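(* Let $N\ge3$ and assume that $\{w_{i,j}\mid w\in W,\ i,j\in\mathbb{N}\}$ is a Riesz basis of $H^\circ$. Then there exist constants $L_m$ ($m\in\mathbb{N}$) such that, for any $p\in\mathbb{N}^*$, $m\in\mathbb{N}$ and $z\in H^\circ$: $$\|(1-E_m)z\|_2^2\le L_m\,p^{-1}\|z\|_2^2+L_m\,p\,\|[\chi_1,z]\|_2^2.$$
   Context: Let $C^*_u(\mathbb{F}O_N)$ be the universal unital $C^*$-algebra generated by self-adjoint $u_{i,j}$, $1\le i,j\le N$, with $u=(u_{i,j})$ unitary, coproduct $\Delta(u_{i,j})=\sum_k u_{i,k}\otimes u_{k,j}$ and Haar state $h$ (a trace). $M=\mathcal{L}(\mathbb{F}O_N)$ is the von Neumann algebra generated in the GNS representation of $h$, on $H\supset M$, with $(x\mid y)=h(x^*y)$ and norm $\|\cdot\|_2$. Put $\chi_1=\sum_iu_{i,i}$, $A=\chi_1''\cap M$, and let $H^\circ$ be the orthogonal of $A$ in $H$. $[\chi_1,z]=\chi_1z-z\chi_1$ for $z\in H$ (left and right actions of $M$ on $H$). Put $H_1=\mathbb{C}^N$ with canonical basis $(e_i)$, $t=\sum_i e_i\otimes e_i:\mathbb{C}\to H_1\otimes H_1$; $H_n\subset H_1^{\otimes n}$ is the subspace of vectors $\zeta$ with $(\mathrm{id}^{\otimes i}\otimes t^*\otimes\mathrm{id}^{\otimes(n-i-2)})\zeta=0$ for $0\le i\le n-2$, with orthogonal projection $P_n$. $X\in B(H_n)$ is identified with $P_nXP_n\in B(H_1^{\otimes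 n})$ and $u_n(X)=\sum_{I,J}X_{J,I}\,u_{i_1,j_1}\cdots u_{i_n,j_n}\in M$. $B(H_n)^{\circ\circ}$ is the set of $X\in B(H_n)$ with $(\mathrm{Tr}_1\otimes\mathrm{id})(X)=0=(\mathrm{id}\otimes\mathrm{Tr}_1)(X)$ (trace of $B(H_1)$ on the first, resp. last, leg). The rotation $\rho(X)=(P_n\otimes t^* )(\mathrm{id}_1\otimes X\otimes\mathrm{id}_1)(t\otimes P_n)$ restricts to a finite order unitary on $B(H_n)^{\circ\circ}$. For $k\ge1$, $W_k$ is the image under $u_k$ of an orthogonal basis of $B(H_k)^{\circ\circ}$ consisting of eigenvectors of $\rho$, normalized so that $\|u_k(X)\|_2=1$; $W=\bigcup_{k\ge1}W_k$. For $w=u_k(X)\in W_k$ and $i,j\in\mathbb{N}$, $w_{i,j}=u_{i+k+j}\big(P_{i+k+j}(\mathrm{id}_i\otimes X\otimes\mathrm{id}_j)P_{i+k+j}\big)\in H^\circ$. $E_m\in B(H^\circ)$ is the (non-orthogonal) bounded idempotent determined by $E_m(w_{i,j})=w_{i,j}$ if $i\ge m$ and $j\ge m$, and $E_m(w_{i,j})=0$ otherwise. (A Riesz basis of a Hilbert space is the image of an orthonormal basis of a Hilbert space under a bounded isomorphism with bounded inverse.) *)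

theory Defs
  imports "HOL-Analysis.Analysis" "HOL-Library.Poly_Mapping"
begin

section \<open>Complex Hilbert spaces and unital C*-algebras\<close>

class scaleC =
  fixes scaleC :: "complex \<Rightarrow> 'a \<Rightarrow> 'a" (infixr "*\<^sub>C" 75)

class complex_vector = real_vector + scaleC +
  assumes scaleC_add_right: "a *\<^sub>C (x + y) = a *\<^sub>C x + a *\<^sub>C y"
    and scaleC_add_left: "(a + b) *\<^sub>C x = a *\<^sub>C x + b *\<^sub>C x"
    and scaleC_scaleC: "a *\<^sub>C (b *\<^sub>C x) = (a * b) *\<^sub>C x"
    and scaleR_scaleC: "r *\<^sub>R x = complex_of_real r *\<^sub>C x"

text \<open>Inner products are linear in the second variable.\<close>

class chilbert = complex_vector + banach +
  fixes cinner :: "'a \<Rightarrow> 'a \<Rightarrow> complex"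
  assumes cinner_commute: "cinner x y = cnj (cinner y x)"
    and cinner_add_right: "cinner x (y + z) = cinner x y + cinner x z"
    and cinner_scaleC_right: "cinner x (a *\<^sub>C y) = a * cinner x y"
    and norm_cinner: "complex_of_real ((norm x)\<^sup>2) = cinner x x"

class cstar_algebra = complex_vector + real_normed_algebra_1 + banach +
  fixes star :: "'a \<Rightarrow> 'a"
  assumes scaleC_mult_left: "(a *\<^sub>C x) * y = a *\<^sub>C (x * y)"
    and scaleC_mult_right: "x * (a *\<^sub>C y) = a *\<^sub>C (x * y)"
    and norm_scaleC: "norm (a *\<^sub>C x) = cmod a * norm x"
    and star_star: "star (star x) = x"
    and star_add: "star (x + y) = star x + star y"
    and star_scaleC: "star (a *\<^sub>C x) = cnj a *\<^sub>C star x"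
    and star_mult: "star (x * y) = star y * star x"
    and cstar_identity: "norm (star x * x) = (norm x)\<^sup>2"

definition clinear :: "('a::complex_vector \<Rightarrow> 'b::complex_vector) \<Rightarrow> bool" where
  "clinear f \<longleftrightarrow> (\<forall>x y. f (x + y) = f x + f y) \<and> (\<forall>a x. f (a *\<^sub>C x) = a *\<^sub>C f x)"

definition cfunctional :: "('a::complex_vector \<Rightarrow> complex) \<Rightarrow> bool" where
  "cfunctional f \<longleftrightarrow> (\<forall>x y. f (x + y) = f x + f y) \<and> (\<forall>a x. f (a *\<^sub>C x) = a * f x)"

definition bounded_clinear ::
  "('a::{complex_vector, real_normed_vector} \<Rightarrow> 'b::{complex_vector, real_normed_vector}) \<Rightarrow> bool"
  where "bounded_clinear f \<longleftrightarrow> clinear f \<and> (\<exists>C. \<forall>x. norm (f x) \<le> C * norm x)"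

definition star_hom :: "('a::cstar_algebra \<Rightarrow> 'b::cstar_algebra) \<Rightarrow> bool" where
  "star_hom f \<longleftrightarrow> clinear f \<and> f 1 = 1 \<and> (\<forall>x y. f (x * y) = f x * f y)
     \<and> (\<forall>x. f (star x) = star (f x))"

definition state :: "('a::cstar_algebra \<Rightarrow> complex) \<Rightarrow> bool" where
  "state h \<longleftrightarrow> cfunctional h \<and> h 1 = 1 \<and> (\<forall>x. h (star x * x) \<in> \<real> \<and> 0 \<le> Re (h (star x * x)))"

text \<open>A unital C*-algebra \<open>'b\<close> is a C*-tensor product of \<open>'a\<close> with itself if it is a completion
  of the algebraic tensor product for some C*-norm. The injectivity of the algebraic tensor
  product into \<open>'b\<close> is expressed by the fourth clause. Elementary tensors are
  stable under complex scalars, so their real span is their complex span.\<close>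

definition cstar_tensor_square :: "('a::cstar_algebra \<Rightarrow> 'a \<Rightarrow> 'b::cstar_algebra) \<Rightarrow> bool" where
  "cstar_tensor_square tens \<longleftrightarrow>
     (\<forall>a. clinear (tens a)) \<and> (\<forall>b. clinear (\<lambda>a. tens a b)) \<and>
     (\<forall>a b c d. tens a b * tens c d = tens (a * c) (b * d)) \<and>
     (\<forall>F b. finite F \<and> (\<forall>c. (\<Sum>a\<in>F. c a *\<^sub>C a) = 0 \<longrightarrow> (\<forall>a\<in>F. c a = 0))
        \<and> (\<Sum>a\<in>F. tens a (b a)) = 0 \<longrightarrow> (\<forall>a\<in>F. b a = 0)) \<and>
     (\<forall>a b. star (tens a b) = tens (star a) (star b)) \<and>
     tens 1 1 = 1 \<and>
     closure (span {tens a b | a b. True}) = UNIV"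

section \<open>The universal C*-algebra of the free orthogonal quantum group\<close>

text \<open>Elements of the free unital *-algebra on self-adjoint generators \<open>x\<^sub>i\<^sub>j\<close> are finitely
  supported functions on words in the index pairs.\<close>

type_synonym 'n ncpoly = "('n \<times> 'n) list \<Rightarrow>\<^sub>0 complex"

definition nc_mult :: "'n ncpoly \<Rightarrow> 'n ncpoly \<Rightarrow> 'n ncpoly" where
  "nc_mult f g = (\<Sum>v\<in>Poly_Mapping.keys f. \<Sum>w\<in>Poly_Mapping.keys g.
     Poly_Mapping.single (v @ w) (Poly_Mapping.lookup f v * Poly_Mapping.lookup g w))"

definition nc_star :: "'n ncpoly \<Rightarrow> 'n ncpoly" where
  "nc_star f = (\<Sum>v\<in>Poly_Mapping.keys f.
     Poly_Mapping.single (rev v) (cnj (Poly_Mapping.lookup f v)))"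

definition nc_scale :: "complex \<Rightarrow> 'n ncpoly \<Rightarrow> 'n ncpoly" where
  "nc_scale c f = Poly_Mapping.map (\<lambda>x. c * x) f"

definition nc_eval :: "('n \<Rightarrow> 'n \<Rightarrow> 'a::cstar_algebra) \<Rightarrow> 'n ncpoly \<Rightarrow> 'a" where
  "nc_eval u f = (\<Sum>w\<in>Poly_Mapping.keys f.
     Poly_Mapping.lookup f w *\<^sub>C prod_list (map (\<lambda>(i, j). u i j) w))"

text \<open>The relations \<open>uu\<^sup>* = 1 = u\<^sup>*u\<close> for a matrix with self-adjoint entries.\<close>

definition FO_relations :: "('n::finite) ncpoly set" where
  "FO_relations =
     {(\<Sum>k\<in>UNIV. Poly_Mapping.single [(i, k), (j, k)] 1) - Poly_Mapping.single [] (of_bool (i = j))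
        | i j. True} \<union>
     {(\<Sum>k\<in>UNIV. Poly_Mapping.single [(k, i), (k, j)] 1) - Poly_Mapping.single [] (of_bool (i = j))
        | i j. True}"

definition cstar_seminorm :: "('n ncpoly \<Rightarrow> real) \<Rightarrow> bool" where
  "cstar_seminorm p \<longleftrightarrow> (\<forall>f g. p (f + g) \<le> p f + p g) \<and> (\<forall>c f. p (nc_scale c f) = cmod c * p f)
     \<and> (\<forall>f g. p (nc_mult f g) \<le> p f * p g) \<and> (\<forall>f. p (nc_mult (nc_star f) f) = (p f)\<^sup>2)"

text \<open>The pair \<open>('a, u)\<close> is the universal unital C*-algebra on self-adjoint generators
  \<open>u i j\<close> forming a unitary matrix: \<open>'a\<close> is generated by the \<open>u i j\<close>, and its norm dominates every
  C*-seminorm on the free *-algebra which vanishes on the relations. C*-seminorms are exactly the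
  norms induced by *-homomorphisms to C*-algebras, so this is the universal property quantified
  over all unital C*-algebras, without quantifying over types.\<close>

definition universal_FO :: "('n::finite \<Rightarrow> 'n \<Rightarrow> 'a::cstar_algebra) \<Rightarrow> bool" where
  "universal_FO u \<longleftrightarrow>
     (\<forall>i j. star (u i j) = u i j) \<and>
     (\<forall>i j. (\<Sum>k\<in>UNIV. u i k * star (u j k)) = of_bool (i = j)) \<and>
     (\<forall>i j. (\<Sum>k\<in>UNIV. star (u k i) * u k j) = of_bool (i = j)) \<and>
     closure (range (nc_eval u)) = UNIV \<and>
     (\<forall>p. cstar_seminorm p \<and> (\<forall>r\<in>FO_relations. p r = 0) \<longrightarrow> (\<forall>f. p f \<le> norm (nc_eval u f)))"

definition FO_coproduct ::
  "('n::finite \<Rightarrow> 'n \<Rightarrow> 'a::cstar_algebra) \<Rightarrow> ('a \<Rightarrow> 'a \<Rightarrow> 'b::cstar_algebra) \<Rightarrow> ('a \<Rightarrow> 'b) \<Rightarrow> bool"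
  where "FO_coproduct u tens \<Delta> \<longleftrightarrow>
     star_hom \<Delta> \<and> (\<forall>i j. \<Delta> (u i j) = (\<Sum>k\<in>UNIV. tens (u i k) (u k j)))"

text \<open>In the next definition \<open>S\<close> and \<open>T\<close> are the slice maps \<open>h \<otimes> id\<close> and \<open>id \<otimes> h\<close>.\<close>

definition haar_state ::
  "('a::cstar_algebra \<Rightarrow> 'a \<Rightarrow> 'b::cstar_algebra) \<Rightarrow> ('a \<Rightarrow> 'b) \<Rightarrow> ('a \<Rightarrow> complex) \<Rightarrow> bool"
  where "haar_state tens \<Delta> h \<longleftrightarrow> state h \<and>
     (\<exists>S. bounded_clinear S \<and> (\<forall>a b. S (tens a b) = h a *\<^sub>C b) \<and> (\<forall>a. S (\<Delta> a) = h a *\<^sub>C 1)) \<and>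
     (\<exists>T. bounded_clinear T \<and> (\<forall>a b. T (tens a b) = h b *\<^sub>C a) \<and> (\<forall>a. T (\<Delta> a) = h a *\<^sub>C 1))"

section \<open>The GNS representation and von Neumann algebras\<close>

text \<open>The GNS triple of \<open>h\<close> on \<open>'h\<close>, which is unique up to unitary equivalence.\<close>

definition gns_triple ::
  "('a::cstar_algebra \<Rightarrow> complex) \<Rightarrow> ('a \<Rightarrow> 'h \<Rightarrow> 'h::chilbert) \<Rightarrow> 'h \<Rightarrow> bool" where
  "gns_triple h \<pi> \<Omega> \<longleftrightarrow>
     (\<forall>a. bounded_clinear (\<pi> a)) \<and>
     (\<forall>a b x. \<pi> (a + b) x = \<pi> a x + \<pi> b x) \<and> (\<forall>c a x. \<pi> (c *\<^sub>C a) x = c *\<^sub>C \<pi> a x) \<and>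
     \<pi> 1 = id \<and> (\<forall>a b. \<pi> (a * b) = \<pi> a \<circ> \<pi> b) \<and>
     (\<forall>a x y. cinner (\<pi> (star a) x) y = cinner x (\<pi> a y)) \<and>
     closure (range (\<lambda>a. \<pi> a \<Omega>)) = UNIV \<and>
     (\<forall>a. cinner \<Omega> (\<pi> a \<Omega>) = h a)"

definition commutant :: "('h::chilbert \<Rightarrow> 'h) set \<Rightarrow> ('h \<Rightarrow> 'h) set" where
  "commutant S = {T. bounded_clinear T \<and> (\<forall>s\<in>S. T \<circ> s = s \<circ> T)}"

definition vN_M :: "('a::cstar_algebra \<Rightarrow> 'h \<Rightarrow> 'h::chilbert) \<Rightarrow> ('h \<Rightarrow> 'h) set" where
  "vN_M \<pi> = commutant (commutant (range \<pi>))"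

text \<open>\<open>M\<close> is contained in \<open>H\<close> via \<open>x \<mapsto> x \<Omega>\<close>. The right action of \<open>x \<in> M\<close> on \<open>H\<close> is the continuous
  extension of right multiplication by \<open>x\<close> on \<open>M\<close>.\<close>

definition right_action ::
  "('a::cstar_algebra \<Rightarrow> 'h \<Rightarrow> 'h::chilbert) \<Rightarrow> 'h \<Rightarrow> ('h \<Rightarrow> 'h) \<Rightarrow> 'h \<Rightarrow> 'h" where
  "right_action \<pi> \<Omega> x =
     (THE R. bounded_clinear R \<and> (\<forall>y\<in>vN_M \<pi>. R (y \<Omega>) = (y \<circ> x) \<Omega>))"

definition commutator ::
  "('a::cstar_algebra \<Rightarrow> 'h \<Rightarrow> 'h::chilbert) \<Rightarrow> 'h \<Rightarrow> ('h \<Rightarrow> 'h) \<Rightarrow> 'h \<Rightarrow> 'h" where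
  "commutator \<pi> \<Omega> x z = x z - right_action \<pi> \<Omega> x z"

definition chi1 :: "('n::finite \<Rightarrow> 'n \<Rightarrow> 'a::cstar_algebra) \<Rightarrow> 'a" where
  "chi1 u = (\<Sum>i\<in>UNIV. u i i)"

definition masa_A ::
  "('n::finite \<Rightarrow> 'n \<Rightarrow> 'a::cstar_algebra) \<Rightarrow> ('a \<Rightarrow> 'h \<Rightarrow> 'h::chilbert) \<Rightarrow> ('h \<Rightarrow> 'h) set" where
  "masa_A u \<pi> = commutant (commutant {\<pi> (chi1 u)}) \<inter> vN_M \<pi>"

definition Hcirc ::
  "('n::finite \<Rightarrow> 'n \<Rightarrow> 'a::cstar_algebra) \<Rightarrow> ('a \<Rightarrow> 'h \<Rightarrow> 'h::chilbert) \<Rightarrow> 'h \<Rightarrow> 'h set" where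
  "Hcirc u \<pi> \<Omega> = {z. \<forall>a\<in>masa_A u \<pi>. cinner (a \<Omega>) z = 0}"

section \<open>Tensor powers of \<open>H\<^sub>1\<close>\<close>

text \<open>The canonical basis of the \<open>n\<close>-th tensor power of \<open>H\<^sub>1\<close> is indexed by the words of length \<open>n\<close>.
  Vectors and operators are given by coordinates and matrices vanishing outside the relevant
  words; the row index of a matrix comes first.\<close>

type_synonym 'n tvec = "'n list \<Rightarrow> complex"
type_synonym 'n tmat = "'n list \<Rightarrow> 'n list \<Rightarrow> complex"

definition words :: "nat \<Rightarrow> 'n list set" where
  "words n = {I. length I = n}"

definition tvecs :: "nat \<Rightarrow> 'n tvec set" where
  "tvecs n = {\<zeta>. \<forall>I. I \<notin> words n \<longrightarrow> \<zeta> I = 0}"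

definition tmats :: "nat \<Rightarrow> nat \<Rightarrow> 'n tmat set" where
  "tmats m n = {X. \<forall>I J. I \<notin> words m \<or> J \<notin> words n \<longrightarrow> X I J = 0}"

definition mapp :: "nat \<Rightarrow> 'n tmat \<Rightarrow> 'n tvec \<Rightarrow> 'n tvec" where
  "mapp n X \<zeta> = (\<lambda>I. \<Sum>J\<in>words n. X I J * \<zeta> J)"

text \<open>Product of matrices, \<open>n\<close> being the number of intermediate legs.\<close>

definition mcomp :: "nat \<Rightarrow> 'n tmat \<Rightarrow> 'n tmat \<Rightarrow> 'n tmat" where
  "mcomp n X Y = (\<lambda>I J. \<Sum>K\<in>words n. X I K * Y K J)"

definition madj :: "'n tmat \<Rightarrow> 'n tmat" where
  "madj X = (\<lambda>I J. cnj (X J I))"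

text \<open>\<open>mtens m n X Y\<close> is \<open>X \<otimes> Y\<close>, where \<open>X\<close> has \<open>m\<close> output legs and \<open>n\<close> input legs.\<close>

definition mtens :: "nat \<Rightarrow> nat \<Rightarrow> 'n tmat \<Rightarrow> 'n tmat \<Rightarrow> 'n tmat" where
  "mtens m n X Y = (\<lambda>I J. X (take m I) (take n J) * Y (drop m I) (drop n J))"

definition idm :: "nat \<Rightarrow> 'n tmat" where
  "idm n = (\<lambda>I J. of_bool (I = J \<and> length I = n))"

definition tmat :: "'n tmat" where
  "tmat = (\<lambda>I J. of_bool ((\<exists>k. I = [k, k]) \<and> J = []))"

definition Hn :: "nat \<Rightarrow> ('n::finite) tvec set" where
  "Hn n = {\<zeta> \<in> tvecs n. \<forall>i. i + 2 \<le> n \<longrightarrow>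
     mapp n (mtens i i (idm i) (mtens 0 2 (madj tmat) (idm (n - i - 2)))) \<zeta> = (\<lambda>_. 0)}"

definition proj :: "nat \<Rightarrow> ('n::finite) tmat" where
  "proj n = (THE P. P \<in> tmats n n \<and> madj P = P \<and> mcomp n P P = P
     \<and> {\<zeta> \<in> tvecs n. mapp n P \<zeta> = \<zeta>} = Hn n)"

definition BHn :: "nat \<Rightarrow> ('n::finite) tmat set" where
  "BHn n = {X \<in> tmats n n. mcomp n (proj n) (mcomp n X (proj n)) = X}"

text \<open>Only used for \<open>n \<ge> 1\<close>.\<close>

definition BHoo :: "nat \<Rightarrow> ('n::finite) tmat set" where
  "BHoo n = {X \<in> BHn n. (\<forall>I J. (\<Sum>k\<in>UNIV. X (k # I) (k # J)) = 0)
     \<and> (\<forall>I J. (\<Sum>k\<in>UNIV. X (I @ [k]) (J @ [k])) = 0)}"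

definition rotation :: "nat \<Rightarrow> ('n::finite) tmat \<Rightarrow> 'n tmat" where
  "rotation n X =
     mcomp (n + 2) (mtens n n (proj n) (madj tmat))
       (mcomp (n + 2) (mtens 1 1 (idm 1) (mtens n n X (idm 1))) (mtens 2 0 tmat (proj n)))"

definition hs_inner :: "nat \<Rightarrow> 'n tmat \<Rightarrow> 'n tmat \<Rightarrow> complex" where
  "hs_inner n X Y = (\<Sum>I\<in>words n. \<Sum>J\<in>words n. cnj (X I J) * Y I J)"

definition u_elt :: "('n::finite \<Rightarrow> 'n \<Rightarrow> 'a::cstar_algebra) \<Rightarrow> nat \<Rightarrow> 'n tmat \<Rightarrow> 'a" where
  "u_elt u n X = (\<Sum>I\<in>words n. \<Sum>J\<in>words n. X J I *\<^sub>C prod_list (map2 u I J))"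

section \<open>The vectors \<open>w\<^sub>i\<^sub>j\<close> and the idempotents \<open>E\<^sub>m\<close>\<close>

text \<open>\<open>B k\<close>, for \<open>k \<ge> 1\<close>, is the chosen basis of \<open>BHoo k\<close>, orthogonal for the Hilbert-Schmidt inner
  product, whose image under \<open>u\<^sub>k\<close> is \<open>W\<^sub>k\<close>.\<close>

definition W_bases ::
  "('n::finite \<Rightarrow> 'n \<Rightarrow> 'a::cstar_algebra) \<Rightarrow> ('a \<Rightarrow> 'h \<Rightarrow> 'h::chilbert) \<Rightarrow> 'h
     \<Rightarrow> (nat \<Rightarrow> 'n tmat set) \<Rightarrow> bool" where
  "W_bases u \<pi> \<Omega> B \<longleftrightarrow> (\<forall>k\<ge>1.
     finite (B k) \<and> B k \<subseteq> BHoo k \<and>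
     (\<forall>X\<in>B k. \<forall>Y\<in>B k. X \<noteq> Y \<longrightarrow> hs_inner k X Y = 0) \<and>
     (\<forall>X\<in>BHoo k. \<exists>c. X = (\<lambda>I J. \<Sum>Y\<in>B k. c Y * Y I J)) \<and>
     (\<forall>X\<in>B k. \<exists>\<mu>. rotation k X = (\<lambda>I J. \<mu> * X I J)) \<and>
     (\<forall>X\<in>B k. norm (\<pi> (u_elt u k X) \<Omega>) = 1))"

text \<open>The index \<open>(k, X, i, j)\<close> stands for \<open>(w, i, j)\<close> with \<open>w = u\<^sub>k(X)\<close>; this is a bijective
  relabelling since the maps \<open>u\<^sub>k\<close> are injective on \<open>B(H\<^sub>k)\<close> with linearly independent ranges.\<close>

definition W_index :: "(nat \<Rightarrow> 'n tmat set) \<Rightarrow> (nat \<times> 'n tmat \<times> nat \<times> nat) set" where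
  "W_index B = {(k, X, i, j). 1 \<le> k \<and> X \<in> B k}"

definition wvec ::
  "('n::finite \<Rightarrow> 'n \<Rightarrow> 'a::cstar_algebra) \<Rightarrow> ('a \<Rightarrow> 'h \<Rightarrow> 'h::chilbert) \<Rightarrow> 'h
     \<Rightarrow> nat \<times> 'n tmat \<times> nat \<times> nat \<Rightarrow> 'h" where
  "wvec u \<pi> \<Omega> = (\<lambda>(k, X, i, j). \<pi> (u_elt u (i + k + j)
     (mcomp (i + k + j) (proj (i + k + j))
       (mcomp (i + k + j) (mtens i i (idm i) (mtens k k X (idm j))) (proj (i + k + j))))) \<Omega>)"

definition orthonormal_basis :: "'i set \<Rightarrow> ('i \<Rightarrow> 'k::chilbert) \<Rightarrow> bool" where
  "orthonormal_basis I e \<longleftrightarrow>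
     (\<forall>i\<in>I. \<forall>j\<in>I. cinner (e i) (e j) = of_bool (i = j)) \<and>
     closure (span {c *\<^sub>C e i | c i. i \<in> I}) = UNIV"

text \<open>The family \<open>f\<close>, indexed by \<open>I\<close>, is a Riesz basis of the closed subspace \<open>V\<close>: the image of an
  orthonormal basis of the Hilbert space \<open>'k\<close> under a bounded isomorphism onto \<open>V\<close>.\<close>

definition riesz_basis ::
  "'k::chilbert itself \<Rightarrow> 'i set \<Rightarrow> ('i \<Rightarrow> 'h::chilbert) \<Rightarrow> 'h set \<Rightarrow> bool" where
  "riesz_basis _ I f V \<longleftrightarrow> (\<exists>(e :: 'i \<Rightarrow> 'k) T.
     orthonormal_basis I e \<and> bounded_clinear T \<and> inj T \<and> range T = V \<and>
     (\<exists>C. \<forall>v\<in>V. norm (inv T v) \<le> C * norm v) \<and> (\<forall>i\<in>I. T (e i) = f i))"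

text \<open>\<open>E\<close> is the idempotent \<open>E\<^sub>m\<close>. Only its restriction to \<open>V = H\<^sup>\<circ>\<close> is relevant; it is determined
  by these conditions as soon as the \<open>w\<^sub>i\<^sub>j\<close> span a dense subspace of \<open>V\<close>.\<close>

definition is_E ::
  "'h::chilbert set \<Rightarrow> (nat \<Rightarrow> 'n tmat set) \<Rightarrow> (nat \<times> 'n tmat \<times> nat \<times> nat \<Rightarrow> 'h) \<Rightarrow> nat
     \<Rightarrow> ('h \<Rightarrow> 'h) \<Rightarrow> bool" where
  "is_E V B w m E \<longleftrightarrow>
     (\<forall>z\<in>V. E z \<in> V) \<and>
     (\<forall>y\<in>V. \<forall>z\<in>V. E (y + z) = E y + E z) \<and> (\<forall>c. \<forall>z\<in>V. E (c *\<^sub>C z) = c *\<^sub>C E z) \<and>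
     (\<exists>C. \<forall>z\<in>V. norm (E z) \<le> C * norm z) \<and>
     (\<forall>z\<in>V. E (E z) = E z) \<and>
     (\<forall>(k, X, i, j)\<in>W_index B.
        E (w (k, X, i, j)) = (if m \<le> i \<and> m \<le> j then w (k, X, i, j) else 0))"

end

theory Submission
  imports Defs
begin

text \<open>The operator \<open>z \<mapsto> [\<chi>\<^sub>1, z]\<close> respects the decomposition of \<open>H\<^sup>\<circ>\<close> into the blocks spanned by
  the \<open>w\<^sub>i\<^sub>j\<close> with \<open>w = u\<^sub>k(X)\<close> fixed, and the Riesz basis makes norms comparable with
  \<open>\<ell>\<^sup>2\<close> norms of coefficients. So everything reduces to one block, provided that the constants do
  not depend on the block.

  In a block, left multiplication by \<open>\<chi>\<^sub>1\<close> acts by the formula of lemma \<open>left_multiplication\<close>: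
  with \<open>n = i + k + j\<close>,
  \<open>\<chi>\<^sub>1 w\<^sub>i\<^sub>j = w\<^sub>i\<^sub>+\<^sub>1\<^sub>,\<^sub>j + (1 - a\<^sub>i\<^sub>j) w\<^sub>i\<^sub>-\<^sub>1\<^sub>,\<^sub>j + b\<^sub>i\<^sub>j w\<^sub>i\<^sub>,\<^sub>j\<^sub>-\<^sub>1 - c\<^sub>i\<^sub>j w\<^sub>i\<^sub>+\<^sub>1\<^sub>,\<^sub>j\<^sub>-\<^sub>2\<close>.
  It comes from the Jones-Wenzl recursion for \<open>P\<^sub>n\<close>: contractions that meet \<open>X\<close> in its interior or
  meet a projection vanish, and the few remaining ones produce \<open>X\<close> or a rotated copy of \<open>X\<close>. As \<open>X\<close> is
  an eigenvector of the rotation, the result stays in the block. Right multiplication is obtained by reversing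
  all words and the order of multiplication, which exchanges \<open>i\<close> and \<open>j\<close>. The coefficients are
  quotients of quantum dimensions and decay like \<open>(25/169)\<^sup>i\<close>, uniformly in \<open>j\<close>, in \<open>k\<close>, in
  \<open>N \<ge> 3\<close> and in the eigenvalue.

  So up to exponentially small terms the commutator is \<open>S + S\<^sup>*\<close> in the first variable minus
  \<open>S + S\<^sup>*\<close> in the second, \<open>S\<close> being the unilateral shift. The correction terms can be removed on
  the left: in the basis \<open>x\<^sub>n\<^sub>j = U\<^sub>n(\<chi>\<^sub>1) w\<^sub>0\<^sub>j\<close>, with \<open>U\<^sub>n\<close> the Chebyshev polynomials, the left
  action is exactly \<open>S + S\<^sup>*\<close>, and the right action, which commutes with it, is independent of \<open>n\<close>.
  Both changes of basis have coefficients with exponential off-diagonal decay, by lemma \<open>lag_decay\<close>,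
  and only involve smaller indices. For the free left action, pairing the commutator with a
  bounded antisymmetric multiplier in the first variable, lemma \<open>row_bound\<close>, bounds the rows of \<open>z\<close>
  near the boundary \<open>i = 0\<close> by \<open>\<parallel>z\<parallel> \<parallel>[\<chi>\<^sub>1, z]\<parallel>\<close>, hence by
  \<open>p\<^sup>-\<^sup>1 \<parallel>z\<parallel>\<^sup>2 + p \<parallel>[\<chi>\<^sub>1, z]\<parallel>\<^sup>2\<close>. The growth of that bound in the row number is slower than
  the decay of the change of basis, so the estimate can be carried back to the rows of \<open>z\<close> in the
  \<open>w\<^sub>i\<^sub>j\<close> (lemma \<open>strip_bound\<close>). The same argument with left and right
  exchanged gives the columns, and \<open>1 - E\<^sub>m\<close> is the restriction to the rows and columns of index less than
  \<open>m\<close>.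

  The right action exists because the Haar state is a trace. This is
  deduced from invariance: the matrices \<open>(h(u\<^sub>I\<^sub>J))\<close> are the orthogonal projections onto the fixed vectors of
  the tensor powers of \<open>u\<close>, and the orthogonality relations of \<open>u\<close> make the spaces of fixed vectors
  invariant under cyclic rotation of the legs.\<close>

section \<open>Recursions with exponentially decaying coefficients\<close>

text \<open>Without the source \<open>s\<close>, the recursion is solved by the pure shift \<open>f n i = [n = i]\<close>. The defect
  \<open>d n i = f (n+1) i - f n (i-1)\<close> satisfies the transport equation \<open>d n i = d (n-1) (i+1) + s n i\<close>. If the
  source is small for large \<open>i\<close>, then so is the defect, and summing the defects along
  the diagonals bounds \<open>f\<close>.\<close>
lemma lag_decay:
  fixes f s :: "nat \<Rightarrow> nat \<Rightarrow> 'j \<Rightarrow> complex" and B :: "'j \<Rightarrow> real"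
  defines "t \<equiv> 19/20" and "u \<equiv> 20/19" and "r \<equiv> 25/169"
  assumes B: "\<And>j. B j \<ge> 0"
    and f0: "\<And>j. cmod (f 0 0 j) \<le> B j" "\<And>i j. f 0 (Suc i) j = 0"
    and rec: "\<And>n i j. f (Suc n) i j = (if i = 0 then 0 else f n (i - 1) j) + f n (Suc i) j
                - (if n = 0 then 0 else f (n - 1) i j) + s n i j"
    and src: "\<And>n i j. (\<And>m i j. m \<le> n \<Longrightarrow> cmod (f m i j) \<le> 13 * B j * t ^ m * u ^ i) \<Longrightarrow>
                cmod (s n i j) \<le> 13 * (u * (100/169)) * r ^ i * B j * t ^ n * u ^ i"
  shows "cmod (f n i j) \<le> 13 * B j * t ^ n * u ^ i"
proof -
  \<comment> \<open>The defect is bounded by \<open>\<kappa> r\<^sup>i\<close> relative to the weights, and \<open>C\<close> accumulates these bounds.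
    The value of \<open>\<kappa>\<close> fits between the two requirements
    \<open>\<kappa> r u\<^sup>2 + 13 u \<cdot> 100/169 \<le> \<kappa>\<close> and \<open>1 + \<kappa> u / (1 - r) \<le> 13\<close>.\<close>
  define \<kappa> :: real where "\<kappa> = 97/10"
  define C :: "nat \<Rightarrow> real" where "C i = 1 + \<kappa> * u * (\<Sum>s\<le>i. r ^ s)" for i
  have tu: "t * u = 1" and u0: "u > 0" and t0: "t > 0" and r0: "r > 0" and r1: "r < 1" and k0: "\<kappa> > 0"
    by (simp_all add: t_def u_def r_def \<kappa>_def)
  have Cle: "C i \<le> 13" for i
  proof -
    have "(\<Sum>s\<le>i. r ^ s) = (1 - r ^ Suc i) / (1 - r)"
      using sum_gp0[of r i] r1 by auto
    also have "\<dots> \<le> 1 / (1 - r)"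
      using r0 r1 by (intro divide_right_mono) auto
    finally have "C i \<le> 1 + \<kappa> * u * (1 / (1 - r))"
      unfolding C_def using k0 u0 by (intro add_left_mono mult_left_mono) auto
    also have "\<dots> \<le> 13" by (simp add: \<kappa>_def u_def r_def)
    finally show ?thesis .
  qed
  have C1: "C i \<ge> 1" for i
    unfolding C_def using k0 u0 r0 by (simp add: sum_nonneg)
  have CSuc: "C (Suc i) = C i + \<kappa> * u * r ^ Suc i" for i
    by (simp add: C_def algebra_simps)
  have C0: "C 0 \<ge> \<kappa> * u" by (simp add: C_def)
  define sh where "sh n i j = (if i = 0 then 0 else f n (i - 1) j)" for n i j
  have main: "(\<forall>m\<le>n. \<forall>i j. cmod (f m i j) \<le> C i * B j * t ^ m * u ^ i) \<and>
      (n > 0 \<longrightarrow> (\<forall>i j. cmod (f n i j - sh (n - 1) i j) \<le> \<kappa> * r ^ i * B j * t ^ (n - 1) * u ^ i))" for n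
  proof (induction n)
    case 0
    have "cmod (f 0 i j) \<le> C i * B j * u ^ i" for i j
    proof (cases i)
      case 0
      have "1 * B j \<le> C 0 * B j" using B[of j] C1 by (intro mult_right_mono) auto
      then show ?thesis using f0(1)[of j] 0 by simp
    next
      case (Suc i')
      then show ?thesis using f0(2) C1[of i] B[of j] u0 by simp
    qed
    then show ?case by simp
  next
    case (Suc n)
    have IH: "cmod (f m i j) \<le> C i * B j * t ^ m * u ^ i" if "m \<le> n" for m i j
      using Suc that by blast
    have "cmod (f m i j) \<le> 13 * B j * t ^ m * u ^ i" if "m \<le> n" for m i j
    proof -
      have "C i * (B j * t ^ m * u ^ i) \<le> 13 * (B j * t ^ m * u ^ i)"
        using Cle B[of j] t0 u0 by (intro mult_right_mono) auto
      then show ?thesis using IH[OF that, of i j] by (simp add: mult.assoc)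
    qed
    then have S: "cmod (s n i j) \<le> 13 * (u * (100/169)) * r ^ i * B j * t ^ n * u ^ i" for i j
      using src by blast
    have D: "cmod (f (Suc n) i j - sh n i j) \<le> \<kappa> * r ^ i * B j * t ^ n * u ^ i" for i j
    proof -
      define W where "W = r ^ i * B j * t ^ n * u ^ i"
      have W: "W \<ge> 0" using r0 B t0 u0 by (simp add: W_def)
      have eq: "f (Suc n) i j - sh n i j = (f n (Suc i) j - (if n = 0 then 0 else f (n - 1) i j)) + s n i j"
        unfolding rec sh_def by (simp add: algebra_simps)
      have "cmod (f n (Suc i) j - (if n = 0 then 0 else f (n - 1) i j)) \<le> \<kappa> * (r * u^2) * W"
      proof (cases n)
        case 0
        then show ?thesis using f0(2) k0 r0 W by simp
      next
        case (Suc n')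
        have "cmod (f n (Suc i) j - sh (n - 1) (Suc i) j) \<le> \<kappa> * r ^ Suc i * B j * t ^ (n - 1) * u ^ Suc i"
          using Suc.IH Suc by blast
        also have "\<dots> = \<kappa> * r * r ^ i * B j * (t ^ n' * (t * u)) * u * u ^ i"
          using Suc tu by (simp)
        also have "\<dots> = \<kappa> * (r * u^2) * W"
          using Suc by (simp add: W_def power2_eq_square)
        finally show ?thesis using Suc by (simp add: sh_def)
      qed
      then have "cmod (f (Suc n) i j - sh n i j) \<le> \<kappa> * (r * u^2) * W + 13 * (u * (100/169)) * W"
        unfolding eq using S[of i j] by (intro order_trans[OF norm_triangle_ineq] add_mono) (auto simp: W_def mult.assoc)
      also have "\<dots> = (\<kappa> * (r * u^2) + 13 * (u * (100/169))) * W" by (simp add: algebra_simps)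
      also have "\<dots> \<le> \<kappa> * W"
        using W by (intro mult_right_mono) (auto simp: \<kappa>_def r_def u_def power2_eq_square)
      finally show ?thesis by (simp add: W_def mult.assoc)
    qed
    have F: "cmod (f (Suc n) i j) \<le> C i * B j * t ^ Suc n * u ^ i" for i j
    proof -
      have "cmod (f (Suc n) i j) \<le> cmod (sh n i j) + cmod (f (Suc n) i j - sh n i j)"
        using norm_triangle_ineq[of "sh n i j" "f (Suc n) i j - sh n i j"] by simp
      also have "\<dots> \<le> cmod (sh n i j) + \<kappa> * r ^ i * B j * t ^ n * u ^ i" using D by simp
      also have "\<dots> \<le> C i * B j * t ^ Suc n * u ^ i"
      proof (cases i)
        case 0
        have "\<kappa> * B j * t ^ n = (\<kappa> * u) * B j * (t ^ Suc n)" using tu by (simp add: mult.commute)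
        also have "\<dots> \<le> C 0 * B j * t ^ Suc n"
          using C0 B[of j] t0 by (intro mult_right_mono) auto
        finally show ?thesis using 0 by (simp add: sh_def)
      next
        case (Suc i')
        have "cmod (sh n i j) \<le> C i' * B j * t ^ n * u ^ i'" using IH[of n i' j] Suc by (simp add: sh_def)
        also have "\<dots> = C i' * B j * t ^ Suc n * u ^ i" using Suc tu by (simp add: mult.commute)
        finally have 1: "cmod (sh n i j) \<le> C i' * B j * t ^ Suc n * u ^ i" .
        have 2: "\<kappa> * r ^ i * B j * t ^ n * u ^ i = \<kappa> * u * r ^ i * B j * t ^ Suc n * u ^ i"
          using tu by (simp add: mult.commute)
        show ?thesis using 1 unfolding 2 unfolding Suc CSuc by (simp only: distrib_right)
      qed
      finally show ?thesis .
    qed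
    show ?case using IH F D by (auto simp: le_Suc_eq)
  qed
  have "cmod (f n i j) \<le> C i * (B j * t ^ n * u ^ i)" using main[of n] by (auto simp: mult.assoc)
  also have "\<dots> \<le> 13 * (B j * t ^ n * u ^ i)"
    using Cle B[of j] t0 u0 by (intro mult_right_mono) auto
  finally show ?thesis by (simp add: mult.assoc)
qed

section \<open>A multiplier estimate for commutators\<close>

lemma square_add_le_weighted:
  fixes A D k :: real
  assumes "k > 0"
  shows "(A + D)^2 \<le> (1 + 1/k) * A^2 + (1 + k) * D^2"
proof -
  have "0 \<le> (A - k * D)^2 / k" using assms by simp
  also have "\<dots> = (1/k) * A^2 + k * D^2 - 2 * A * D"
    using assms by (simp add: field_simps power2_eq_square)
  finally show ?thesis by (simp add: power2_eq_square algebra_simps)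
qed

text \<open>Differences in steps of two suffice to control each term because both parities have an
  initial term. The factor \<open>m + 1\<close> is kept linear by using, in each step, \<open>square_add_le_weighted\<close>
  with weight \<open>m - 1\<close>.\<close>
lemma two_step_telescope:
  fixes y :: "nat \<Rightarrow> complex"
  shows "(cmod (y m))^2 \<le> (real m + 1) *
    ((cmod (y 0))^2 + (cmod (y 1))^2 + (\<Sum>i<m-1. (cmod (y i - y (i + 2)))^2))"
proof (induction m rule: less_induct)
  case (less m)
  let ?E = "\<lambda>m. (cmod (y 0))^2 + (cmod (y 1))^2 + (\<Sum>i<m-1. (cmod (y i - y (i + 2)))^2)"
  consider "m = 0" | "m = 1" | m' where "m = Suc (Suc m')"
    by (metis One_nat_def not0_implies_Suc)
  then show ?case
  proof cases
    case 3
    define k where "k = real m' + 1"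
    define D where "D = cmod (y m' - y (m' + 2))"
    have k: "k > 0" by (simp add: k_def)
    have mono: "?E m' \<le> ?E (Suc m')"
      by (cases m') auto
    have E: "?E m = ?E (Suc m') + D^2" using 3 by (simp add: D_def)
    have E0: "?E (Suc m') \<ge> 0" by (intro add_nonneg_nonneg sum_nonneg) auto
    have IH: "(cmod (y m'))^2 \<le> k * ?E (Suc m')"
      using less[of m'] 3 mono k unfolding k_def by (smt (verit) mult_left_mono less_SucI lessI)
    have le: "cmod (y m) \<le> cmod (y m') + D"
      using 3 norm_triangle_ineq4[of "y m'" "y m' - y m"] by (simp add: D_def)
    have "(cmod (y m))^2 \<le> (cmod (y m') + D)^2" using le by (intro power_mono) auto
    also have "\<dots> \<le> (1 + 1/k) * (cmod (y m'))^2 + (1 + k) * D^2"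
      using k by (rule square_add_le_weighted)
    also have "\<dots> \<le> (1 + 1/k) * (k * ?E (Suc m')) + (1 + k) * D^2"
      using IH k by (intro add_mono mult_left_mono) auto
    also have "\<dots> = (1 + k) * ?E m" using k unfolding E by (simp add: field_simps)
    also have "\<dots> \<le> (real m + 1) * ?E m"
      using E0 unfolding E by (intro mult_right_mono) (auto simp: k_def 3)
    finally show ?thesis .
  qed (auto simp: algebra_simps)
qed

text \<open>Let \<open>P\<close> be the Gram matrix of the rows of \<open>\<zeta>\<close>, and \<open>Q\<close> the matrix of the right action in these
  rows. The left-hand side pairs the commutator with the multiplier
  \<open>\<zeta> \<mapsto> (f\<^sub>i\<^sub>-\<^sub>1 \<zeta>\<^sub>i\<^sub>-\<^sub>1 - f\<^sub>i \<zeta>\<^sub>i\<^sub>+\<^sub>1)\<^sub>i\<close>. Antisymmetry of the multiplier eliminates \<open>Q\<close>, and the free left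
  action contributes only discrete derivatives of \<open>f\<close>.\<close>
lemma multiplier_identity:
  fixes P Q :: "nat \<Rightarrow> nat \<Rightarrow> real" and f :: "nat \<Rightarrow> real"
  assumes "\<And>i k. k \<ge> M \<Longrightarrow> P i k = 0" "\<And>i k. P i k = P k i" "\<And>i k. Q i k = Q k i"
    and "\<And>i k. k \<ge> M \<Longrightarrow> Q i k = 0"
  shows "(\<Sum>i<Suc M. (if i = 0 then 0 else f (i-1) * (P (i-1) (i-1) + P (i-1) (Suc i) - Q (i-1) i))
        - f i * ((if i = 0 then 0 else P (Suc i) (i-1)) + P (Suc i) (Suc i) - Q (Suc i) i))
     = (\<Sum>i<M. (f i - (if i = 0 then 0 else f (i-1))) * P i i) - (\<Sum>i<M. (f (Suc i) - f i) * P i (i+2))"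
proof -
  have 1: "(\<Sum>i<Suc M. (if i = 0 then 0 else f (i-1) * (P (i-1) (i-1) + P (i-1) (Suc i) - Q (i-1) i)))
     = (\<Sum>i<M. f i * (P i i + P i (i+2) - Q i (Suc i)))"
    by (subst sum.lessThan_Suc_shift) simp
  have 2: "(\<Sum>i<Suc M. f i * ((if i = 0 then 0 else P (Suc i) (i-1)) + P (Suc i) (Suc i) - Q (Suc i) i))
     = (\<Sum>i<Suc M. f i * (if i = 0 then 0 else P (Suc i) (i-1))) + (\<Sum>i<M. f i * P (Suc i) (Suc i))
       - (\<Sum>i<M. f i * Q i (Suc i))"
    using assms(1)[of "Suc M" "Suc M"] assms(4)[of M "Suc M"] assms(3)
    by (simp add: algebra_simps sum.distrib sum_subtractf)
  have 3: "(\<Sum>i<Suc M. f i * (if i = 0 then 0 else P (Suc i) (i-1))) = (\<Sum>i<M. f (Suc i) * P i (i+2))"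
    by (subst sum.lessThan_Suc_shift) (simp add: assms(2)[of "Suc (Suc _)"])
  have 4: "(\<Sum>i<M. f i * P (Suc i) (Suc i)) = (\<Sum>i<M. (if i = 0 then 0 else f (i-1)) * P i i)"
  proof -
    have "(\<Sum>i<M. f i * P (Suc i) (Suc i)) = (\<Sum>i<Suc M. (if i = 0 then 0 else f (i-1)) * P i i)"
      unfolding sum.lessThan_Suc_shift[where n = M] by simp
    then show ?thesis using assms(1) by simp
  qed
  show ?thesis
    unfolding sum_subtractf 1 2 3 4
    by (simp add: algebra_simps sum.distrib sum_subtractf)
qed

text \<open>A form of the Schur test that keeps the column sums as weights.\<close>
lemma schur_weighted:
  fixes K :: "'a \<Rightarrow> 'b \<Rightarrow> real" and x :: "'a \<Rightarrow> real"
  assumes K: "\<And>p q. K p q \<ge> 0"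
    and row: "\<And>q. q \<in> Q \<Longrightarrow> (\<Sum>p\<in>P. K p q) \<le> A"
  shows "(\<Sum>q\<in>Q. (\<Sum>p\<in>P. K p q * x p)^2) \<le> A * (\<Sum>p\<in>P. (\<Sum>q\<in>Q. K p q) * (x p)^2)"
proof -
  have 1: "(\<Sum>p\<in>P. K p q * x p)^2 \<le> A * (\<Sum>p\<in>P. K p q * (x p)^2)" if "q \<in> Q" for q
  proof -
    have "(\<Sum>p\<in>P. K p q * x p) = (\<Sum>p\<in>P. sqrt (K p q) * (sqrt (K p q) * x p))"
      using K by (simp flip: mult.assoc)
    also have "\<dots>^2 \<le> (\<Sum>p\<in>P. (sqrt (K p q))^2) * (\<Sum>p\<in>P. (sqrt (K p q) * x p)^2)"
      by (rule Cauchy_Schwarz_ineq_sum)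
    also have "\<dots> = (\<Sum>p\<in>P. K p q) * (\<Sum>p\<in>P. K p q * (x p)^2)"
      using K by (simp add: power_mult_distrib)
    also have "\<dots> \<le> A * (\<Sum>p\<in>P. K p q * (x p)^2)"
      using row[OF that] K by (intro mult_right_mono sum_nonneg) auto
    finally show ?thesis .
  qed
  have "(\<Sum>q\<in>Q. (\<Sum>p\<in>P. K p q * x p)^2) \<le> (\<Sum>q\<in>Q. A * (\<Sum>p\<in>P. K p q * (x p)^2))"
    using 1 by (rule sum_mono)
  also have "\<dots> = A * (\<Sum>p\<in>P. (\<Sum>q\<in>Q. K p q) * (x p)^2)"
    by (simp add: sum_distrib_left[symmetric] sum_distrib_right sum.swap[of _ Q P])
  finally show ?thesis .
qed

lemma sum_geometric_le:
  fixes t :: real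
  assumes "0 \<le> t" "t < 1" "finite A" "inj_on f A"
  shows "(\<Sum>x\<in>A. t ^ f x) \<le> 1 / (1 - t)"
proof -
  have "(\<Sum>x\<in>A. t ^ f x) = (\<Sum>l\<in>f ` A. t ^ l)"
    using assms by (simp add: sum.reindex)
  also have "\<dots> \<le> suminf (\<lambda>l. t ^ l)"
    using assms by (intro sum_le_suminf) (auto intro: summable_geometric)
  also have "\<dots> = 1 / (1 - t)" using assms by (simp add: suminf_geometric)
  finally show ?thesis .
qed

lemma two_Re_le_weighted:
  fixes x y :: complex
  assumes "p > 0"
  shows "2 * Re (cnj x * y) \<le> (cmod x)^2 / p + p * (cmod y)^2"
proof -
  have "Re (cnj x * y) \<le> cmod x * cmod y"
    by (metis complex_Re_le_cmod complex_mod_cnj norm_mult)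
  moreover have "0 \<le> (cmod x - p * cmod y)^2 / p" using assms by simp
  moreover have "(cmod x - p * cmod y)^2 / p = (cmod x)^2 / p + p * (cmod y)^2 - 2 * (cmod x * cmod y)"
    using assms by (simp add: field_simps power2_eq_square)
  ultimately show ?thesis by linarith
qed

text \<open>Here \<open>\<zeta>\<close> are coordinates in which the left action is free and the right action
  is a Jacobi matrix in \<open>j\<close>, and \<open>\<eta>\<close> are those of the commutator. The weight \<open>g\<close> symmetrizes the
  Jacobi matrix, and \<open>\<delta>\<close> is chosen less than one but larger than the decay rate \<open>19/20\<close> of
  the change of basis.

  With \<open>f' = \<delta>\<^sup>i\<close>, the multiplier identity becomes, after completing squares, a
  sum of the \<open>\<parallel>y\<^sub>i - y\<^sub>i\<^sub>+\<^sub>2\<parallel>\<^sup>2\<close> and of the two initial rows, where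
  \<open>y\<^sub>i = \<delta>\<^sup>i\<^sup>/\<^sup>2 \<zeta>\<^sub>i\<close>; these control all rows. The other side is bounded by Cauchy-Schwarz, as \<open>f\<close> is
  bounded by \<open>1 / (1 - \<delta>) \<le> 34\<close>, which leads to the constant \<open>4 \<cdot> 34\<^sup>2 = 4624\<close>.\<close>
lemma row_bound:
  fixes \<zeta> \<eta> :: "nat \<Rightarrow> nat \<Rightarrow> complex" and g a :: "nat \<Rightarrow> real"
  defines "\<delta> \<equiv> (197/200)^2"
  assumes g: "\<And>j. g j \<ge> 1/2" "\<And>j. g j \<le> 1" "\<And>j. g (Suc j) = (1 - a (Suc j)) * g j"
    and supp: "\<And>i j. i \<ge> M \<or> j \<ge> M \<Longrightarrow> \<zeta> i j = 0"
    and \<eta>: "\<And>i j. \<eta> i j = (if i = 0 then 0 else \<zeta> (i-1) j) + \<zeta> (Suc i) j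
        - ((if j = 0 then 0 else \<zeta> i (j-1)) + (1 - complex_of_real (a (Suc j))) * \<zeta> i (Suc j))"
    and p: "p > 0"
  shows "(\<Sum>j<M. (cmod (\<zeta> m j))^2) \<le> 2 * (real m + 1) * (1/\<delta>) ^ m *
     (4624 / p * (\<Sum>i<M. \<Sum>j<M. (cmod (\<zeta> i j))^2) + p * (\<Sum>i<Suc M. \<Sum>j<Suc M. (cmod (\<eta> i j))^2))"
proof -
  define d :: real where "d = 197/200"
  have \<delta>: "\<delta> = d^2" "\<delta> > 0" "\<delta> < 1" "d > 0" by (simp_all add: \<delta>_def d_def power2_eq_square)
  define f where "f i = (\<Sum>s\<le>i. \<delta> ^ s)" for i
  define R where "R k j = (if j = 0 then 0 else \<zeta> k (j-1)) + (1 - complex_of_real (a (Suc j))) * \<zeta> k (Suc j)" for k j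
  define P where "P i k = (\<Sum>j<Suc M. g j * Re (cnj (\<zeta> i j) * \<zeta> k j))" for i k
  define Q where "Q i k = (\<Sum>j<Suc M. g j * Re (cnj (\<zeta> i j) * R k j))" for i k
  \<comment> \<open>\<open>K\<close> is the multiplier applied to \<open>\<zeta>\<close>, and \<open>X\<close> its pairing with the commutator.\<close>
  define K where "K i j = (if i = 0 then 0 else f (i-1) * \<zeta> (i-1) j) - f i * \<zeta> (Suc i) j" for i j
  define X where "X = (\<Sum>i<Suc M. \<Sum>j<Suc M. g j * Re (cnj (K i j) * \<eta> i j))"
  have f0: "f i \<ge> 0" for i using \<delta> by (simp add: f_def sum_nonneg)
  have f34: "f i \<le> 34" for i
  proof -
    have "f i = (1 - \<delta> ^ Suc i) / (1 - \<delta>)" unfolding f_def using sum_gp0[of \<delta> i] \<delta> by auto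
    also have "\<dots> \<le> 1 / (1 - \<delta>)" using \<delta> by (intro divide_right_mono) auto
    also have "\<dots> \<le> 34" by (simp add: \<delta>_def power2_eq_square)
    finally show ?thesis .
  qed
  have Psym: "P i k = P k i" for i k
    unfolding P_def by (intro sum.cong) (auto simp: algebra_simps)
  have Qalt: "Q i k = (\<Sum>j<M. g (Suc j) * (Re (cnj (\<zeta> i (Suc j)) * \<zeta> k j) + Re (cnj (\<zeta> i j) * \<zeta> k (Suc j))))" for i k
  proof -
    have "Q i k = (\<Sum>j<Suc M. (if j = 0 then 0 else g j * Re (cnj (\<zeta> i j) * \<zeta> k (j-1))))
        + (\<Sum>j<Suc M. g (Suc j) * Re (cnj (\<zeta> i j) * \<zeta> k (Suc j)))"
      unfolding Q_def R_def sum.distrib[symmetric] by (intro sum.cong) (auto simp: g(3) algebra_simps)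
    also have "(\<Sum>j<Suc M. (if j = 0 then 0 else g j * Re (cnj (\<zeta> i j) * \<zeta> k (j-1))))
       = (\<Sum>j<M. g (Suc j) * Re (cnj (\<zeta> i (Suc j)) * \<zeta> k j))"
      by (subst sum.lessThan_Suc_shift) simp
    finally show ?thesis using supp by (simp add: sum.distrib algebra_simps)
  qed
  have Qsym: "Q i k = Q k i" for i k
    unfolding Qalt by (intro sum.cong) (auto simp: algebra_simps)
  have X1: "X = (\<Sum>i<Suc M. (if i = 0 then 0 else f (i-1) * (P (i-1) (i-1) + P (i-1) (Suc i) - Q (i-1) i))
        - f i * ((if i = 0 then 0 else P (Suc i) (i-1)) + P (Suc i) (Suc i) - Q (Suc i) i))"
    unfolding X_def
  proof (rule sum.cong[OF refl])
    fix i
    show "(\<Sum>j<Suc M. g j * Re (cnj (K i j) * \<eta> i j)) =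
      (if i = 0 then 0 else f (i-1) * (P (i-1) (i-1) + P (i-1) (Suc i) - Q (i-1) i))
        - f i * ((if i = 0 then 0 else P (Suc i) (i-1)) + P (Suc i) (Suc i) - Q (Suc i) i)"
    proof (cases "i = 0")
      case True
      have "g j * Re (cnj (K i j) * \<eta> i j) = - (f i * (g j * Re (cnj (\<zeta> (Suc i) j) * \<zeta> (Suc i) j)))
          + f i * (g j * Re (cnj (\<zeta> (Suc i) j) * R i j))" for j
        unfolding K_def \<eta> R_def[symmetric] using True by (simp add: algebra_simps)
      then show ?thesis using True
        by (simp only: P_def Q_def sum.distrib sum_negf sum_distrib_left[symmetric] if_True) (simp add: algebra_simps)
    next
      case False
      have "g j * Re (cnj (K i j) * \<eta> i j) =
          f (i-1) * (g j * Re (cnj (\<zeta> (i-1) j) * \<zeta> (i-1) j)) + f (i-1) * (g j * Re (cnj (\<zeta> (i-1) j) * \<zeta> (Suc i) j))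
          - f (i-1) * (g j * Re (cnj (\<zeta> (i-1) j) * R i j))
          - f i * (g j * Re (cnj (\<zeta> (Suc i) j) * \<zeta> (i-1) j)) - f i * (g j * Re (cnj (\<zeta> (Suc i) j) * \<zeta> (Suc i) j))
          + f i * (g j * Re (cnj (\<zeta> (Suc i) j) * R i j))" for j
        unfolding K_def \<eta> R_def[symmetric] using False by (simp add: algebra_simps)
      then show ?thesis using False
        by (simp only: P_def Q_def sum.distrib sum_subtractf sum_distrib_left[symmetric] if_False) (simp add: algebra_simps)
    qed
  qed
  have fd: "f i - (if i = 0 then 0 else f (i-1)) = \<delta> ^ i" "f (Suc i) - f i = \<delta> ^ Suc i" for i
    by (cases i; simp add: f_def)+
  have X2: "X = (\<Sum>i<M. \<delta> ^ i * P i i) - (\<Sum>i<M. \<delta> ^ Suc i * P i (i+2))"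
    unfolding X1
    by (subst multiplier_identity[of M P Q f])
       (auto simp: fd Psym Qsym intro!: Psym Qsym simp: P_def Qalt supp)
  define y where "y j i = complex_of_real (d ^ i) * \<zeta> i j" for j i
  have cd: "(cmod (complex_of_real (d ^ i)))^2 = \<delta> ^ i" for i
    by (simp only: norm_of_real \<delta>(1) power2_abs power_mult[symmetric] mult.commute)
  \<comment> \<open>Since \<open>(y\<^sub>j i - y\<^sub>j (i+2))\<^sup>2\<close> has diagonal terms with weights \<open>\<delta>\<^sup>i\<close> and \<open>\<delta>\<^sup>i\<^sup>+\<^sup>2\<close>, the sum
    over \<open>i\<close> of the terms of \<open>2 X\<close> telescopes up to the contributions of the rows \<open>0\<close> and \<open>1\<close>.\<close>
  define E where "E j = (cmod (y j 0))^2 + (cmod (y j 1))^2 + (\<Sum>i<M. (cmod (y j i - y j (i + 2)))^2)" for j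
  have X3: "2 * X = (\<Sum>j<Suc M. g j * E j)"
  proof -
    have "2 * X = (\<Sum>j<Suc M. g j * (\<Sum>i<M. 2 * \<delta> ^ i * (cmod (\<zeta> i j))^2 - 2 * \<delta> ^ Suc i * Re (cnj (\<zeta> i j) * \<zeta> (i+2) j)))"
      unfolding X2 P_def cmod_power2 sum_distrib_left sum_subtractf[symmetric] right_diff_distrib
      by (subst sum.swap) (simp add: algebra_simps power2_eq_square)
    also have "\<dots> = (\<Sum>j<Suc M. g j * E j)"
    proof (intro sum.cong refl arg_cong2[where f = times])
      fix j
      have "2 * \<delta> ^ i * (cmod (\<zeta> i j))^2 - 2 * \<delta> ^ Suc i * Re (cnj (\<zeta> i j) * \<zeta> (i+2) j)
        = (cmod (y j i - y j (i+2)))^2 + ((cmod (y j i))^2 - (cmod (y j (i+2)))^2)" for i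
      proof -
        have 1: "(cmod (x - z))^2 = (cmod x)^2 + (cmod z)^2 - 2 * Re (cnj x * z)" for x z
          unfolding cmod_power2 by (simp add: power2_eq_square algebra_simps)
        have 2: "(cmod (y j i))^2 = \<delta> ^ i * (cmod (\<zeta> i j))^2" for i
          unfolding y_def norm_mult power_mult_distrib cd ..
        have 3: "Re (cnj (y j i) * y j (i+2)) = \<delta> ^ Suc i * Re (cnj (\<zeta> i j) * \<zeta> (i+2) j)"
        proof -
          have "cnj (y j i) * y j (i+2) = complex_of_real (d ^ i * d ^ (i+2)) * (cnj (\<zeta> i j) * \<zeta> (i+2) j)"
            by (simp add: y_def)
          also have "d ^ i * d ^ (i+2) = \<delta> ^ Suc i" unfolding \<delta>
            by (simp only: power_mult[symmetric] power_add[symmetric]) (simp add: mult_2)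
          finally show ?thesis 
            by (simp only: times_complex.sel(1) Re_complex_of_real Im_complex_of_real mult_zero_left diff_zero)
        qed
        show ?thesis unfolding 1 2 3 by simp
      qed
      then have "(\<Sum>i<M. 2 * \<delta> ^ i * (cmod (\<zeta> i j))^2 - 2 * \<delta> ^ Suc i * Re (cnj (\<zeta> i j) * \<zeta> (i+2) j))
        = (\<Sum>i<M. (cmod (y j i - y j (i+2)))^2) + (\<Sum>i<M. (cmod (y j i))^2 - (cmod (y j (i+2)))^2)"
        by (simp add: sum.distrib)
      also have "(\<Sum>i<M. (cmod (y j i))^2 - (cmod (y j (i+2)))^2)
          = (cmod (y j 0))^2 + (cmod (y j 1))^2 - (cmod (y j M))^2 - (cmod (y j (Suc M)))^2"
        by (induction M) auto
      finally show "(\<Sum>i<M. 2 * \<delta> ^ i * (cmod (\<zeta> i j))^2 - 2 * \<delta> ^ Suc i * Re (cnj (\<zeta> i j) * \<zeta> (i+2) j)) = E j"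
        using supp by (simp add: E_def y_def)
    qed
    finally show ?thesis .
  qed
  have E0: "E j \<ge> 0" for j unfolding E_def by (intro add_nonneg_nonneg sum_nonneg) auto
  have X0: "2 * X \<ge> 0" unfolding X3 using E0 g(1) by (intro sum_nonneg mult_nonneg_nonneg) (auto intro: order_trans[of 0 "1/2"])
  have row: "(\<Sum>j<M. (cmod (\<zeta> m j))^2) \<le> 2 * (real m + 1) * (1/\<delta>) ^ m * (2 * X)"
  proof (cases "m < M")
    case True
    have "(cmod (\<zeta> m j))^2 \<le> 2 * (real m + 1) * (1/\<delta>) ^ m * (g j * E j)" for j
    proof -
      have "\<delta> ^ m * (cmod (\<zeta> m j))^2 = (cmod (y j m))^2"
        unfolding y_def norm_mult power_mult_distrib cd ..
      also have "\<dots> \<le> (real m + 1) * ((cmod (y j 0))^2 + (cmod (y j 1))^2 + (\<Sum>i<m-1. (cmod (y j i - y j (i + 2)))^2))"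
        by (rule two_step_telescope)
      also have "\<dots> \<le> (real m + 1) * E j"
        unfolding E_def using True by (intro mult_left_mono add_left_mono sum_mono2) auto
      also have "\<dots> \<le> (real m + 1) * (2 * (g j * E j))"
      proof -
        have "1/2 * E j \<le> g j * E j" using g(1) E0 by (intro mult_right_mono) auto
        then show ?thesis by (intro mult_left_mono) auto
      qed
      finally have "\<delta> ^ m * (cmod (\<zeta> m j))^2 \<le> (real m + 1) * (2 * (g j * E j))" .
      then show ?thesis using \<delta> by (simp add: power_divide field_simps)
    qed
    then have "(\<Sum>j<M. (cmod (\<zeta> m j))^2) \<le> 2 * (real m + 1) * (1/\<delta>) ^ m * (\<Sum>j<M. g j * E j)"
      unfolding sum_distrib_left by (intro sum_mono) auto
    also have "\<dots> \<le> 2 * (real m + 1) * (1/\<delta>) ^ m * (2 * X)"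
      unfolding X3 using \<delta> E0[of M] g(1)[of M] by (intro mult_left_mono) auto
    finally show ?thesis .
  next
    case False
    then show ?thesis using supp X0 \<delta> by simp
  qed
  have up: "2 * X \<le> 4624 / p * (\<Sum>i<M. \<Sum>j<M. (cmod (\<zeta> i j))^2) + p * (\<Sum>i<Suc M. \<Sum>j<Suc M. (cmod (\<eta> i j))^2)"
  proof -
    have "2 * X = (\<Sum>i<Suc M. \<Sum>j<Suc M. g j * (2 * Re (cnj (K i j) * \<eta> i j)))"
      unfolding X_def sum_distrib_left by (simp add: algebra_simps)
    also have "\<dots> \<le> (\<Sum>i<Suc M. \<Sum>j<Suc M. (cmod (K i j))^2 / p + p * (cmod (\<eta> i j))^2)"
    proof (intro sum_mono)
      fix i j
      have "g j * (2 * Re (cnj (K i j) * \<eta> i j)) \<le> g j * ((cmod (K i j))^2 / p + p * (cmod (\<eta> i j))^2)"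
        using g(1)[of j] two_Re_le_weighted[OF p] by (intro mult_left_mono) auto
      also have "\<dots> \<le> 1 * ((cmod (K i j))^2 / p + p * (cmod (\<eta> i j))^2)"
        using g(2)[of j] p by (intro mult_right_mono) auto
      finally show "g j * (2 * Re (cnj (K i j) * \<eta> i j)) \<le> (cmod (K i j))^2 / p + p * (cmod (\<eta> i j))^2" by simp
    qed
    also have "\<dots> = (\<Sum>i<Suc M. \<Sum>j<Suc M. (cmod (K i j))^2) / p + p * (\<Sum>i<Suc M. \<Sum>j<Suc M. (cmod (\<eta> i j))^2)"
      by (simp only: sum.distrib sum_divide_distrib sum_distrib_left)
    also have "(\<Sum>i<Suc M. \<Sum>j<Suc M. (cmod (K i j))^2) \<le> 4624 * (\<Sum>i<M. \<Sum>j<M. (cmod (\<zeta> i j))^2)"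
    proof -
      define n where "n i = (\<Sum>j<Suc M. (cmod (\<zeta> i j))^2)" for i
      have n0: "n 0 \<ge> 0" unfolding n_def by (intro sum_nonneg) simp
      have "(\<Sum>i<Suc M. \<Sum>j<Suc M. (cmod (K i j))^2) \<le> (\<Sum>i<Suc M. 2312 * (if i = 0 then 0 else n (i-1)) + 2312 * n (Suc i))"
      proof (rule sum_mono)
        fix i
        have b: "(cmod (f k * x))^2 \<le> 1156 * (cmod x)^2" for k and x :: complex
        proof -
          have "(f k)^2 \<le> 34^2" using f34 f0 by (intro power_mono)
          then show ?thesis by (simp add: norm_mult power_mult_distrib mult_right_mono)
        qed
        have c: "(cmod (x - z))^2 \<le> 2 * (cmod x)^2 + 2 * (cmod z)^2" for x z :: complex
        proof -
          have "(cmod (x - z))^2 \<le> (cmod x + cmod z)^2" by (intro power_mono norm_triangle_ineq4) auto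
          also have "\<dots> \<le> 2 * (cmod x)^2 + 2 * (cmod z)^2"
            using square_add_le_weighted[of 1] by simp
          finally show ?thesis .
        qed
        have "(cmod (K i j))^2 \<le> 2312 * (if i = 0 then 0 else (cmod (\<zeta> (i-1) j))^2) + 2312 * (cmod (\<zeta> (Suc i) j))^2" for j
          unfolding K_def using c[of "if i = 0 then 0 else f (i-1) * \<zeta> (i-1) j" "f i * \<zeta> (Suc i) j"]
            b[of i "\<zeta> (Suc i) j"] b[of "i-1" "\<zeta> (i-1) j"] zero_le_power2[of "cmod (\<zeta> (Suc i) j)"]
          by (cases "i = 0") (simp_all, (smt (verit) zero_le_power2)?)
        then have "(\<Sum>j<Suc M. (cmod (K i j))^2) \<le> (\<Sum>j<Suc M. 2312 * (if i = 0 then 0 else (cmod (\<zeta> (i-1) j))^2) + 2312 * (cmod (\<zeta> (Suc i) j))^2)"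
          by (rule sum_mono)
        also have "\<dots> = 2312 * (if i = 0 then 0 else n (i-1)) + 2312 * n (Suc i)"
          by (cases "i = 0"; simp add: n_def sum.distrib sum_distrib_left)
        finally show "(\<Sum>j<Suc M. (cmod (K i j))^2) \<le> 2312 * (if i = 0 then 0 else n (i-1)) + 2312 * n (Suc i)" .
      qed
      also have "\<dots> = 2312 * (\<Sum>i<Suc M. if i = 0 then 0 else n (i-1)) + 2312 * (\<Sum>i<Suc M. n (Suc i))"
        by (simp only: sum.distrib sum_distrib_left)
      also have "(\<Sum>i<Suc M. if i = 0 then 0 else n (i-1)) = (\<Sum>i<M. n i)"
        by (subst sum.lessThan_Suc_shift) simp
      also have "(\<Sum>i<Suc M. n (Suc i)) = (\<Sum>i<Suc (Suc M). n i) - n 0"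
        by (subst (2) sum.lessThan_Suc_shift) simp
      also have "(\<Sum>i<Suc (Suc M). n i) = (\<Sum>i<M. n i)" using supp by (simp add: n_def)
      also have "2312 * (\<Sum>i<M. n i) + 2312 * ((\<Sum>i<M. n i) - n 0) \<le> 4624 * (\<Sum>i<M. n i)"
        using n0 by simp
      also have "(\<Sum>i<M. n i) = (\<Sum>i<M. \<Sum>j<M. (cmod (\<zeta> i j))^2)" using supp by (simp add: n_def)
      finally show ?thesis .
    qed
    finally show ?thesis using p by (simp add: divide_right_mono)
  qed
  have "2 * (real m + 1) * (1/\<delta>) ^ m * (2 * X) \<le> 2 * (real m + 1) * (1/\<delta>) ^ m *
     (4624 / p * (\<Sum>i<M. \<Sum>j<M. (cmod (\<zeta> i j))^2) + p * (\<Sum>i<Suc M. \<Sum>j<Suc M. (cmod (\<eta> i j))^2))"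
    using up \<delta> by (intro mult_left_mono) auto
  then show ?thesis using row by linarith
qed

section \<open>Coordinates in which the left action is free\<close>

interpretation scaleC: vector_space "scaleC :: complex \<Rightarrow> 'a \<Rightarrow> 'a::complex_vector"
  by unfold_locales (auto simp: scaleC_add_right scaleC_add_left scaleC_scaleC scaleR_scaleC[of 1, simplified, symmetric])

text \<open>The bounds on the changes of basis are products of two of these kernels, whose row and column sums
  are at most \<open>1 / (1 - 19/20) = 20\<close>.\<close>
definition lag_kernel :: "nat \<Rightarrow> nat \<Rightarrow> real" where
  "lag_kernel n i = (if i \<le> n then (19/20) ^ (n - i) else 0)"

lemma lag_kernel_nonneg: "lag_kernel n i \<ge> 0" by (simp add: lag_kernel_def)

lemma lag_kernel_eq: assumes "i \<le> n" shows "(19/20::real) ^ n * (20/19) ^ i = lag_kernel n i"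
proof -
  have "(19/20::real) ^ n = (19/20) ^ (n - i) * (19/20) ^ i" using assms by (metis le_add_diff_inverse2 power_add)
  then have "(19/20::real) ^ n * (20/19) ^ i = (19/20) ^ (n - i) * ((19/20) * (20/19)) ^ i"
    by (simp only: power_mult_distrib mult.assoc)
  then show ?thesis using \<open>i \<le> n\<close> by (simp add: lag_kernel_def)
qed

lemma sum_lag_kernel_le: "(\<Sum>i<M. lag_kernel n i) \<le> 20" "(\<Sum>n<M. lag_kernel n i) \<le> 20"
proof -
  have "(\<Sum>i<M. lag_kernel n i) = (\<Sum>i\<in>{i\<in>{..<M}. i \<le> n}. (19/20) ^ (n - i))"
    unfolding lag_kernel_def by (rule sum.inter_filter[symmetric]) simp
  also have "\<dots> \<le> 1 / (1 - 19/20)"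
    by (intro sum_geometric_le) (auto simp: inj_on_def)
  finally show "(\<Sum>i<M. lag_kernel n i) \<le> 20" by simp
  have "(\<Sum>n<M. lag_kernel n i) = (\<Sum>n\<in>{n\<in>{..<M}. i \<le> n}. (19/20) ^ (n - i))"
    unfolding lag_kernel_def by (rule sum.inter_filter[symmetric]) simp
  also have "\<dots> \<le> 1 / (1 - 19/20)"
    by (intro sum_geometric_le) (auto simp: inj_on_def)
  finally show "(\<Sum>n<M. lag_kernel n i) \<le> 20" by simp
qed

text \<open>The coefficients of left multiplication by \<open>\<chi>\<^sub>1\<close> on the \<open>w\<^sub>i\<^sub>j\<close> of one block. The rate \<open>25/169\<close>
  is \<open>(5/13)\<^sup>2\<close>, because the quantum dimensions grow at least by the factor \<open>13/5\<close>.\<close>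
locale half_block_coeffs =
  fixes a :: "nat \<Rightarrow> nat \<Rightarrow> real" and b c :: "nat \<Rightarrow> nat \<Rightarrow> complex"
  assumes a0: "\<And>i j. 0 \<le> a i j"
    and a_le: "\<And>i j. a i j \<le> (25/169) ^ i"
    and b_le: "\<And>i j. cmod (b i j) \<le> 50/169 * (25/169) ^ i"
    and c_le: "\<And>i j. cmod (c i j) \<le> (25/169)^2 * (25/169) ^ i"
begin

text \<open>\<open>w_in_x j0 n i j\<close> is the coefficient of \<open>x\<^sub>i\<^sub>j\<close> in \<open>w\<^sub>n\<^sub>,\<^sub>j\<^sub>0\<close>. The recursion solves the formula for
  \<open>\<chi>\<^sub>1 w\<^sub>n\<^sub>,\<^sub>j\<^sub>0\<close> for \<open>w\<^sub>n\<^sub>+\<^sub>1\<^sub>,\<^sub>j\<^sub>0\<close>; the last term has a larger first index but a smaller second one.\<close>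
fun w_in_x :: "nat \<Rightarrow> nat \<Rightarrow> nat \<Rightarrow> nat \<Rightarrow> complex" where
  "w_in_x j0 0 i j = of_bool (i = 0 \<and> j = j0)"
| "w_in_x j0 (Suc n) i j =
     (if i = 0 then 0 else w_in_x j0 n (i-1) j) + w_in_x j0 n (Suc i) j
     - (if n = 0 then 0 else (1 - complex_of_real (a n j0)) * w_in_x j0 (n-1) i j)
     - (if j0 = 0 then 0 else b n j0 * w_in_x (j0-1) n i j)
     + (if j0 < 2 then 0 else c n j0 * w_in_x (j0-2) (Suc n) i j)"

text \<open>The left action on coefficients with respect to the \<open>w\<^sub>i\<^sub>j\<close>, that is, the transpose of its
  action on the \<open>w\<^sub>i\<^sub>j\<close>.\<close>
definition Lw :: "(nat \<Rightarrow> nat \<Rightarrow> complex) \<Rightarrow> nat \<Rightarrow> nat \<Rightarrow> complex" where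
  "Lw F i j = (if i = 0 then 0 else F (i-1) j) + (1 - complex_of_real (a (Suc i) j)) * F (Suc i) j
     + b i (Suc j) * F i (Suc j) - (if i = 0 then 0 else c (i-1) (j+2) * F (i-1) (j+2))"

text \<open>\<open>x_in_w j0 n i j\<close> is the coefficient of \<open>w\<^sub>i\<^sub>j\<close> in \<open>x\<^sub>n\<^sub>,\<^sub>j\<^sub>0 = U\<^sub>n(\<chi>\<^sub>1) w\<^sub>0\<^sub>,\<^sub>j\<^sub>0\<close>.\<close>
fun x_in_w :: "nat \<Rightarrow> nat \<Rightarrow> nat \<Rightarrow> nat \<Rightarrow> complex" where
  "x_in_w j0 0 i j = of_bool (i = 0 \<and> j = j0)"
| "x_in_w j0 (Suc n) i j = Lw (x_in_w j0 n) i j - (if n = 0 then 0 else x_in_w j0 (n-1) i j)"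

declare w_in_x.simps [simp del] x_in_w.simps [simp del]

lemma w_in_x_support: "\<not> (i \<le> n \<and> j \<le> j0) \<Longrightarrow> w_in_x j0 n i j = 0"
proof (induction j0 n i j rule: w_in_x.induct)
  case (1 j0 i j)
  then show ?case by (auto simp: w_in_x.simps(1))
next
  case (2 j0 n i j)
  have h: "i \<noteq> 0 \<Longrightarrow> w_in_x j0 n (i-1) j = 0" "w_in_x j0 n (Suc i) j = 0"
      "n \<noteq> 0 \<Longrightarrow> w_in_x j0 (n-1) i j = 0" "j0 \<noteq> 0 \<Longrightarrow> w_in_x (j0-1) n i j = 0"
      "\<not> j0 < 2 \<Longrightarrow> w_in_x (j0-2) (Suc n) i j = 0"
    by ((rule "2.IH"(1) "2.IH"(2) "2.IH"(3) "2.IH"(4) "2.IH"(5); (assumption)?); use "2.prems" in linarith)+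
  have "(if i = 0 then 0 else w_in_x j0 n (i-1) j) = 0"
    "(if n = 0 then 0 else (1 - complex_of_real (a n j0)) * w_in_x j0 (n-1) i j) = 0"
    "(if j0 = 0 then 0 else b n j0 * w_in_x (j0-1) n i j) = 0"
    "(if j0 < 2 then 0 else c n j0 * w_in_x (j0-2) (Suc n) i j) = 0"
    using h(1,3,4,5) by auto
  then show ?case unfolding w_in_x.simps(2)[of j0 n i j] using h(2) by simp
qed

lemma x_in_w_support: "\<not> (i \<le> n \<and> j \<le> j0) \<Longrightarrow> x_in_w j0 n i j = 0"
proof (induction n arbitrary: i j rule: less_induct)
  case (less n)
  show ?case
  proof (cases n)
    case 0
    then show ?thesis using less by (auto simp: x_in_w.simps(1))
  next
    case (Suc m)
    then have *: "x_in_w j0 k i j = 0" if "k \<le> m" "\<not> (i \<le> k \<and> j \<le> j0)" for k i j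
      using less.IH that by auto
    have "i \<noteq> 0 \<Longrightarrow> x_in_w j0 m (i-1) j = 0" "x_in_w j0 m (Suc i) j = 0" "x_in_w j0 m i (Suc j) = 0"
      "i \<noteq> 0 \<Longrightarrow> x_in_w j0 m (i-1) (j+2) = 0" "m \<noteq> 0 \<Longrightarrow> x_in_w j0 (m-1) i j = 0"
      using less.prems Suc by (intro *; linarith)+
    then show ?thesis using Suc unfolding Suc x_in_w.simps(2) Lw_def
      by (cases "i = 0"; cases "m = 0"; simp)
  qed
qed

lemma x_in_w_diag: "x_in_w j0 n n j0 = 1"
  by (induction n) (auto simp: x_in_w.simps Lw_def x_in_w_support)

text \<open>The deviation of \<open>Lw\<close> from the free action is a source term in the sense of \<open>lag_decay\<close>: its
  three terms carry the factors \<open>a\<close>, \<open>b\<close> and \<open>c\<close>, and the shifts in the indices cost powers of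
  \<open>20/19\<close> that these factors outweigh.\<close>
lemma x_in_w_decay:
  "cmod (x_in_w j0 n i j) \<le> 13 * ((19/20) ^ j0 * (20/19) ^ j) * (19/20) ^ n * (20/19) ^ i"
proof (rule lag_decay[where f = "\<lambda>n i j. x_in_w j0 n i j" and
     s = "\<lambda>n i j. - complex_of_real (a (Suc i) j) * x_in_w j0 n (Suc i) j + b i (Suc j) * x_in_w j0 n i (Suc j)
        - (if i = 0 then 0 else c (i-1) (j+2) * x_in_w j0 n (i-1) (j+2))"])
  fix n i j
  define t u r :: real where "t = 19/20" and "u = 20/19" and "r = 25/169"
  have pos: "t > 0" "u > 0" "r > 0" by (simp_all add: t_def u_def r_def)
  define B where "B j = t ^ j0 * u ^ j" for j
  assume IH: "\<And>m i j. m \<le> n \<Longrightarrow> cmod (x_in_w j0 m i j) \<le> 13 * ((19/20) ^ j0 * (20/19) ^ j) * (19/20) ^ m * (20/19) ^ i"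
  then have IH: "cmod (x_in_w j0 n i j) \<le> 13 * B j * t ^ n * u ^ i" for i j
    by (simp add: B_def t_def u_def)
  define W where "W = 13 * r ^ i * B j * t ^ n * u ^ i"
  have 1: "cmod (- complex_of_real (a (Suc i) j) * x_in_w j0 n (Suc i) j) \<le> r * u * W"
  proof -
    have "cmod (- complex_of_real (a (Suc i) j) * x_in_w j0 n (Suc i) j) \<le> r ^ Suc i * (13 * B j * t ^ n * u ^ Suc i)"
      unfolding norm_mult norm_minus_cancel norm_of_real using a0[of "Suc i" j] a_le[of "Suc i" j] IH[of "Suc i" j] pos
      by (intro mult_mono) (auto simp: r_def)
    then show ?thesis by (simp add: W_def algebra_simps)
  qed
  have 2: "cmod (b i (Suc j) * x_in_w j0 n i (Suc j)) \<le> 50/169 * u * W"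
  proof -
    have "cmod (b i (Suc j) * x_in_w j0 n i (Suc j)) \<le> (50/169 * r ^ i) * (13 * B (Suc j) * t ^ n * u ^ i)"
      unfolding norm_mult using b_le[of i "Suc j"] IH[of i "Suc j"] pos
      by (intro mult_mono) (auto simp: r_def)
    then show ?thesis by (simp add: W_def B_def algebra_simps)
  qed
  have 3: "cmod (if i = 0 then 0 else c (i-1) (j+2) * x_in_w j0 n (i-1) (j+2)) \<le> r * u * W"
  proof (cases i)
    case 0
    then show ?thesis using pos by (simp add: W_def B_def)
  next
    case (Suc i')
    have "cmod (c i' (j+2) * x_in_w j0 n i' (j+2)) \<le> (r^2 * r ^ i') * (13 * B (j+2) * t ^ n * u ^ i')"
      unfolding norm_mult using c_le[of i' "j+2"] IH[of i' "j+2"] pos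
      by (intro mult_mono) (auto simp: r_def)
    then show ?thesis using Suc by (simp add: W_def B_def power2_eq_square algebra_simps)
  qed
  have "cmod (- complex_of_real (a (Suc i) j) * x_in_w j0 n (Suc i) j + b i (Suc j) * x_in_w j0 n i (Suc j)
        - (if i = 0 then 0 else c (i-1) (j+2) * x_in_w j0 n (i-1) (j+2))) \<le> r * u * W + 50/169 * u * W + r * u * W"
    using 1 2 3 by (intro order_trans[OF norm_triangle_ineq4] order_trans[OF add_mono[OF norm_triangle_ineq order_refl]] add_mono)
  also have "\<dots> = 13 * (u * (100/169)) * r ^ i * B j * t ^ n * u ^ i"
    by (simp add: W_def r_def field_simps)
  finally show "cmod (- complex_of_real (a (Suc i) j) * x_in_w j0 n (Suc i) j + b i (Suc j) * x_in_w j0 n i (Suc j)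
        - (if i = 0 then 0 else c (i-1) (j+2) * x_in_w j0 n (i-1) (j+2)))
     \<le> 13 * (20/19 * (100/169)) * (25/169) ^ i * ((19/20) ^ j0 * (20/19) ^ j) * (19/20) ^ n * (20/19) ^ i"
    by (simp add: B_def t_def u_def r_def)
next
  fix j show "cmod (x_in_w j0 0 0 j) \<le> (19/20) ^ j0 * (20/19) ^ j"
    by (simp add: power_mult_distrib[symmetric] x_in_w.simps)
qed (auto simp: x_in_w.simps Lw_def algebra_simps)

text \<open>The terms of the recursion with second index less than \<open>j0\<close> are part of the source,
  so the bound is proved by induction on \<open>j0\<close>. The factors \<open>a n j0\<close>, \<open>b n j0\<close>, \<open>c n j0\<close> now decay in
  \<open>n\<close>; this gives decay in \<open>i\<close> since only \<open>i \<le> n\<close> contributes.\<close>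
lemma w_in_x_decay:
  "cmod (w_in_x j0 n i j) \<le> 13 * ((19/20) ^ j0 * (20/19) ^ j) * (19/20) ^ n * (20/19) ^ i"
proof (induction j0 arbitrary: n i j rule: less_induct)
  case (less j0)
  show ?case
  proof (rule lag_decay[where f = "\<lambda>n i j. w_in_x j0 n i j" and
     s = "\<lambda>n i j. (if n = 0 then 0 else complex_of_real (a n j0) * w_in_x j0 (n-1) i j)
       - (if j0 = 0 then 0 else b n j0 * w_in_x (j0-1) n i j)
       + (if j0 < 2 then 0 else c n j0 * w_in_x (j0-2) (Suc n) i j)"])
    fix n i j
    define t u r :: real where "t = 19/20" and "u = 20/19" and "r = 25/169"
    have pos: "t > 0" "u > 0" "r > 0" "r < 1" "t * u = 1" by (simp_all add: t_def u_def r_def)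
    define B where "B j = t ^ j0 * u ^ j" for j
    define W where "W = 13 * r ^ i * B j * t ^ n * u ^ i"
    have W0: "W \<ge> 0" using pos by (simp add: W_def B_def)
    assume IH: "\<And>m i j. m \<le> n \<Longrightarrow> cmod (w_in_x j0 m i j) \<le> 13 * ((19/20) ^ j0 * (20/19) ^ j) * (19/20) ^ m * (20/19) ^ i"
    have 1: "cmod (if n = 0 then 0 else complex_of_real (a n j0) * w_in_x j0 (n-1) i j) \<le> r * u * W"
    proof (cases "n = 0 \<or> w_in_x j0 (n-1) i j = 0")
      case True
      then show ?thesis using W0 pos by auto
    next
      case False
      then obtain n' where n: "n = Suc n'" by (cases n) auto
      with False have "i \<le> n'" using w_in_x_support[of i n' j j0] by auto
      then have "r ^ n \<le> r ^ Suc i" using pos n by (intro power_decreasing) auto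
      then have an: "a n j0 \<le> r ^ Suc i" using a_le[of n j0] unfolding r_def by linarith
      have "cmod (complex_of_real (a n j0) * w_in_x j0 n' i j) \<le> r ^ Suc i * (13 * B j * t ^ n' * u ^ i)"
        unfolding norm_mult norm_of_real using a0[of n j0] an IH[of n' i j] pos n
        by (intro mult_mono) (auto simp: B_def t_def u_def)
      also have "t ^ n' = t ^ n * u" using n pos by (simp add: mult.commute)
      finally show ?thesis using n by (simp add: W_def algebra_simps)
    qed
    have 2: "cmod (if j0 = 0 then 0 else b n j0 * w_in_x (j0-1) n i j) \<le> 50/169 * u * W"
    proof (cases "j0 = 0 \<or> w_in_x (j0-1) n i j = 0")
      case True
      then show ?thesis using W0 pos by auto
    next
      case False
      then obtain k where k: "j0 = Suc k" by (cases j0) auto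
      with False have "i \<le> n" using w_in_x_support[of i n j k] by auto
      then have "r ^ n \<le> r ^ i" using pos by (intro power_decreasing) auto
      then have bn: "cmod (b n j0) \<le> 50/169 * r ^ i" using b_le[of n j0] unfolding r_def by linarith
      have "cmod (b n j0 * w_in_x k n i j) \<le> (50/169 * r ^ i) * (13 * (t ^ k * u ^ j) * t ^ n * u ^ i)"
        unfolding norm_mult using bn less[of k n i j] pos k
        by (intro mult_mono) (auto simp: t_def u_def)
      also have "t ^ k = t ^ j0 * u" using k pos by (simp add: mult.commute)
      finally show ?thesis using k by (simp add: W_def B_def algebra_simps)
    qed
    have 3: "cmod (if j0 < 2 then 0 else c n j0 * w_in_x (j0-2) (Suc n) i j) \<le> r * u * W"
    proof (cases "j0 < 2 \<or> w_in_x (j0-2) (Suc n) i j = 0")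
      case True
      then show ?thesis using W0 pos by auto
    next
      case False
      define k where "k = j0 - 2"
      have k: "j0 = Suc (Suc k)" using False by (auto simp: k_def)
      with False have "i \<le> Suc n" using w_in_x_support[of i "Suc n" j k] by auto
      then have "r^2 * r ^ n \<le> r * r ^ i" using pos
        unfolding power_add[symmetric] power_Suc[symmetric] by (intro power_decreasing) auto
      then have cn: "cmod (c n j0) \<le> r * r ^ i" using c_le[of n j0] unfolding r_def by linarith
      have "cmod (c n j0 * w_in_x k (Suc n) i j) \<le> (r * r ^ i) * (13 * (t ^ k * u ^ j) * t ^ Suc n * u ^ i)"
        unfolding norm_mult using cn less[of k "Suc n" i j] pos k
        by (intro mult_mono) (auto simp: t_def u_def)
      also have "t ^ k * u ^ j = t ^ j0 * u * u * u ^ j" using k pos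
        by (simp add: algebra_simps) (simp flip: mult.assoc)
      also have "13 * (t ^ j0 * u * u * u ^ j) * t ^ Suc n * u ^ i = 13 * t ^ j0 * (t * u) * u * u ^ j * t ^ n * u ^ i"
        by (simp add: algebra_simps)
      finally show ?thesis using k pos by (simp add: W_def B_def algebra_simps)
    qed
    have "cmod ((if n = 0 then 0 else complex_of_real (a n j0) * w_in_x j0 (n-1) i j)
       - (if j0 = 0 then 0 else b n j0 * w_in_x (j0-1) n i j)
       + (if j0 < 2 then 0 else c n j0 * w_in_x (j0-2) (Suc n) i j)) \<le> r * u * W + 50/169 * u * W + r * u * W"
      using 1 2 3 by (intro order_trans[OF norm_triangle_ineq] order_trans[OF add_mono[OF norm_triangle_ineq4 order_refl]] add_mono)
    also have "\<dots> = 13 * (u * (100/169)) * r ^ i * B j * t ^ n * u ^ i"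
      by (simp add: W_def r_def field_simps)
    finally show "cmod ((if n = 0 then 0 else complex_of_real (a n j0) * w_in_x j0 (n-1) i j)
       - (if j0 = 0 then 0 else b n j0 * w_in_x (j0-1) n i j)
       + (if j0 < 2 then 0 else c n j0 * w_in_x (j0-2) (Suc n) i j))
     \<le> 13 * (20/19 * (100/169)) * (25/169) ^ i * ((19/20) ^ j0 * (20/19) ^ j) * (19/20) ^ n * (20/19) ^ i"
      by (simp add: B_def t_def u_def r_def)
  next
    fix j show "cmod (w_in_x j0 0 0 j) \<le> (19/20) ^ j0 * (20/19) ^ j"
      by (simp add: power_mult_distrib[symmetric] w_in_x.simps)
  next
    fix n i j
    show "w_in_x j0 (Suc n) i j = (if i = 0 then 0 else w_in_x j0 n (i - 1) j) + w_in_x j0 n (Suc i) j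
        - (if n = 0 then 0 else w_in_x j0 (n - 1) i j)
        + ((if n = 0 then 0 else complex_of_real (a n j0) * w_in_x j0 (n-1) i j)
           - (if j0 = 0 then 0 else b n j0 * w_in_x (j0-1) n i j)
           + (if j0 < 2 then 0 else c n j0 * w_in_x (j0-2) (Suc n) i j))"
      unfolding w_in_x.simps(2)[of j0 n i j] left_diff_distrib by simp
  next
    fix j show "0 \<le> (19/20 :: real) ^ j0 * (20/19) ^ j" by simp
  next
    fix i j show "w_in_x j0 0 (Suc i) j = 0" by (simp add: w_in_x.simps(1))
  qed
qed

lemma x_in_w_lag_kernel: "cmod (x_in_w j0 n i j) \<le> 13 * (lag_kernel n i * lag_kernel j0 j)"
proof (cases "i \<le> n \<and> j \<le> j0")
  case True
  then have eq: "lag_kernel n i = (19/20) ^ n * (20/19) ^ i" "lag_kernel j0 j = (19/20) ^ j0 * (20/19) ^ j"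
    by (simp_all only: lag_kernel_eq)
  show ?thesis using x_in_w_decay[of j0 n i j] unfolding eq by (simp only: ac_simps)
qed (simp_all add: x_in_w_support lag_kernel_nonneg)

lemma w_in_x_lag_kernel: "cmod (w_in_x j0 n i j) \<le> 13 * (lag_kernel n i * lag_kernel j0 j)"
proof (cases "i \<le> n \<and> j \<le> j0")
  case True
  then have eq: "lag_kernel n i = (19/20) ^ n * (20/19) ^ i" "lag_kernel j0 j = (19/20) ^ j0 * (20/19) ^ j"
    by (simp_all only: lag_kernel_eq)
  show ?thesis using w_in_x_decay[of j0 n i j] unfolding eq by (simp only: ac_simps)
qed (simp_all add: w_in_x_support lag_kernel_nonneg)

end

lemma sum_shift_up:
  fixes G :: "nat \<Rightarrow> 'b::ab_group_add"
  assumes "\<And>i. Suc i \<ge> M \<Longrightarrow> G i = 0"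
  shows "(\<Sum>i<M. G i) = (\<Sum>i<M. if i = 0 then 0 else G (i-1))"
proof (cases M)
  case (Suc M')
  have "(\<Sum>i<M. if i = 0 then 0 else G (i-1)) = (\<Sum>i<M'. G i)"
    unfolding Suc by (subst sum.lessThan_Suc_shift) simp
  then show ?thesis using Suc assms by simp
qed simp

lemma sum_shift_down:
  fixes G :: "nat \<Rightarrow> 'b::ab_group_add"
  assumes "\<And>i. i \<ge> M \<Longrightarrow> G i = 0"
  shows "(\<Sum>i<M. if i = 0 then 0 else G i) = (\<Sum>i<M. G (Suc i))"
proof (cases M)
  case (Suc M')
  have "(\<Sum>i<M. if i = 0 then 0 else G i) = (\<Sum>i<M'. G (Suc i))"
    unfolding Suc by (subst sum.lessThan_Suc_shift) simp
  then show ?thesis using Suc assms by simp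
qed simp

lemma sum_shift_down2:
  fixes G :: "nat \<Rightarrow> 'b::ab_group_add"
  assumes "\<And>i. i \<ge> M \<Longrightarrow> G i = 0"
  shows "(\<Sum>i<M. if i < 2 then 0 else G i) = (\<Sum>i<M. G (i + 2))"
proof -
  have "(\<Sum>i<M. if i < 2 then 0 else G i) = (\<Sum>i<M. if i = 0 then 0 else (if i = 1 then 0 else G i))"
    by (intro sum.cong) auto
  also have "\<dots> = (\<Sum>i<M. if i = 0 then 0 else G (Suc i))"
    using assms by (subst sum_shift_down) auto
  also have "\<dots> = (\<Sum>i<M. G (i + 2))"
    using assms by (subst sum_shift_down) auto
  finally show ?thesis .
qed

definition box_sum :: "(nat \<Rightarrow> nat \<Rightarrow> 'b::complex_vector) \<Rightarrow> nat \<Rightarrow> (nat \<Rightarrow> nat \<Rightarrow> complex) \<Rightarrow> 'b" where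
  "box_sum v M F = (\<Sum>i<M. \<Sum>j<M. F i j *\<^sub>C v i j)"

lemma box_sum_add: "box_sum v M (\<lambda>i j. F i j + G i j) = box_sum v M F + box_sum v M G"
  by (simp add: box_sum_def scaleC_add_left sum.distrib)

lemma box_sum_diff: "box_sum v M (\<lambda>i j. F i j - G i j) = box_sum v M F - box_sum v M G"
  by (simp add: box_sum_def scaleC.scale_left_diff_distrib sum_subtractf)

lemma box_sum_scale: "box_sum v M (\<lambda>i j. k * F i j) = k *\<^sub>C box_sum v M F"
  by (simp add: box_sum_def scaleC.scale_sum_right scaleC_scaleC)

lemma box_sum_if: "box_sum v M (\<lambda>i j. if P then 0 else F i j) = (if P then 0 else box_sum v M F)"
  by (simp add: box_sum_def)

lemma box_sum_single: "n < M \<Longrightarrow> k < M \<Longrightarrow> box_sum v M (\<lambda>i j. of_bool (i = n \<and> j = k)) = v n k"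
proof -
  assume *: "n < M" "k < M"
  have "box_sum v M (\<lambda>i j. of_bool (i = n \<and> j = k)) = (\<Sum>i<M. if i = n then v n k else 0)"
    unfolding box_sum_def
  proof (intro sum.cong refl)
    fix i
    have "(\<Sum>j<M. of_bool (i = n \<and> j = k) *\<^sub>C v i j) = (\<Sum>j<M. if j = k then (if i = n then v n k else 0) else 0)"
      by (intro sum.cong) auto
    then show "(\<Sum>j<M. of_bool (i = n \<and> j = k) *\<^sub>C v i j) = (if i = n then v n k else 0)"
      using * by (simp add: sum.delta)
  qed
  then show ?thesis using * by (simp add: sum.delta)
qed

text \<open>Re-expansion of a finite combination of the family \<open>v\<close>, each member of which is a
  combination of the family \<open>v'\<close>.\<close>
lemma box_sum_expand:
  assumes z: "\<And>i j. i \<ge> M \<or> j \<ge> M \<Longrightarrow> z i j = 0" and "M \<le> P"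
    and v: "\<And>n k. n < M \<Longrightarrow> k < M \<Longrightarrow> v n k = box_sum v' P (K k n)"
  shows "box_sum v P z = box_sum v' P (\<lambda>i j. \<Sum>n<M. \<Sum>k<M. z n k * K k n i j)"
proof -
  have "box_sum v P z = (\<Sum>i<M. \<Sum>j<M. z i j *\<^sub>C v i j)"
    unfolding box_sum_def using z \<open>M \<le> P\<close>
    by (intro sum.mono_neutral_cong_right) (auto intro!: sum.mono_neutral_cong_right sum.neutral)
  also have "\<dots> = (\<Sum>n<M. \<Sum>k<M. box_sum v' P (\<lambda>i j. z n k * K k n i j))"
    by (intro sum.cong refl) (simp add: v box_sum_scale)
  also have "\<dots> = box_sum v' P (\<lambda>i j. \<Sum>n<M. \<Sum>k<M. z n k * K k n i j)"
    unfolding box_sum_def scaleC.scale_sum_left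
    by (simp add: sum.swap[of _ "{..<P}" "{..<M}"])
  finally show ?thesis .
qed

text \<open>By the Schur test, both changes of basis are bounded on \<open>\<ell>\<^sup>2\<close>, with \<open>5200 = 13 \<cdot> 20 \<cdot> 20\<close>.\<close>
lemma expansion_energy_le:
  assumes K: "\<And>n k i j. cmod (K k n i j) \<le> 13 * (lag_kernel n i * lag_kernel k j)"
  shows "(\<Sum>i<M. \<Sum>j<M. (cmod (\<Sum>n<M. \<Sum>k<M. z n k * K k n i j))^2)
    \<le> 5200^2 * (\<Sum>n<M. \<Sum>k<M. (cmod (z n k))^2)"
proof -
  let ?P = "{..<M} \<times> {..<M}"
  let ?k = "\<lambda>(n,k) (i,j). 13 * (lag_kernel n i * lag_kernel k j)"
  have prod: "(\<Sum>p\<in>?P. 13 * (f (fst p) * g (snd p))) = 13 * ((\<Sum>n<M. f n) * (\<Sum>k<M. g k))" for f g :: "nat \<Rightarrow> real"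
  proof -
    have "(\<Sum>n<M. f n) * (\<Sum>k<M. g k) = (\<Sum>p\<in>?P. f (fst p) * g (snd p))"
      by (simp add: sum_product sum.cartesian_product case_prod_beta)
    then show ?thesis by (simp only: sum_distrib_left)
  qed
  have le: "13 * ((\<Sum>n<M. f n) * (\<Sum>k<M. g k)) \<le> 5200"
    if "(\<Sum>n<M. f n) \<le> 20" "(\<Sum>k<M. g k) \<le> 20" "\<And>n. f n \<ge> 0" "\<And>n. g n \<ge> 0" for f g :: "nat \<Rightarrow> real"
  proof -
    have "(\<Sum>n<M. f n) * (\<Sum>k<M. g k) \<le> 20 * 20"
      using that by (intro mult_mono) (auto intro: sum_nonneg)
    then show ?thesis by simp
  qed
  have row: "(\<Sum>p\<in>?P. ?k p q) \<le> 5200" for q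
  proof -
    obtain i j where q: "q = (i, j)" by (cases q)
    show ?thesis using prod[of "\<lambda>n. lag_kernel n i" "\<lambda>k. lag_kernel k j"] le[of "\<lambda>n. lag_kernel n i" "\<lambda>k. lag_kernel k j"]
      by (simp add: q case_prod_beta sum_lag_kernel_le lag_kernel_nonneg)
  qed
  have col: "(\<Sum>q\<in>?P. ?k p q) \<le> 5200" for p
  proof -
    obtain n k where p: "p = (n, k)" by (cases p)
    show ?thesis using prod[of "lag_kernel n" "lag_kernel k"] le[of "lag_kernel n" "lag_kernel k"]
      by (simp add: p case_prod_beta sum_lag_kernel_le lag_kernel_nonneg)
  qed
  have k0: "?k p q \<ge> 0" for p q by (cases p; cases q) (simp add: lag_kernel_nonneg)
  have "(\<Sum>i<M. \<Sum>j<M. (cmod (\<Sum>n<M. \<Sum>k<M. z n k * K k n i j))^2)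
     = (\<Sum>q\<in>?P. (cmod (\<Sum>n<M. \<Sum>k<M. z n k * K k n (fst q) (snd q)))^2)"
    by (simp add: sum.cartesian_product case_prod_beta)
  also have "\<dots> \<le> (\<Sum>q\<in>?P. (\<Sum>p\<in>?P. ?k p q * cmod (z (fst p) (snd p)))^2)"
  proof (intro sum_mono power_mono)
    fix q
    have "cmod (\<Sum>n<M. \<Sum>k<M. z n k * K k n (fst q) (snd q)) = cmod (\<Sum>p\<in>?P. z (fst p) (snd p) * K (snd p) (fst p) (fst q) (snd q))"
      by (simp add: sum.cartesian_product case_prod_beta)
    also have "\<dots> \<le> (\<Sum>p\<in>?P. cmod (z (fst p) (snd p) * K (snd p) (fst p) (fst q) (snd q)))"
      by (rule norm_sum)
    also have "\<dots> \<le> (\<Sum>p\<in>?P. ?k p q * cmod (z (fst p) (snd p)))"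
    proof (rule sum_mono)
      fix p
      have "cmod (K (snd p) (fst p) (fst q) (snd q)) \<le> ?k p q" using K by (simp add: case_prod_beta)
      then show "cmod (z (fst p) (snd p) * K (snd p) (fst p) (fst q) (snd q)) \<le> ?k p q * cmod (z (fst p) (snd p))"
        unfolding norm_mult by (subst mult.commute) (intro mult_right_mono, auto)
    qed
    finally show "cmod (\<Sum>n<M. \<Sum>k<M. z n k * K k n (fst q) (snd q)) \<le> (\<Sum>p\<in>?P. ?k p q * cmod (z (fst p) (snd p)))" .
  qed simp
  also have "\<dots> \<le> 5200 * (\<Sum>p\<in>?P. (\<Sum>q\<in>?P. ?k p q) * (cmod (z (fst p) (snd p)))^2)"
    using k0 row by (rule schur_weighted)
  also have "\<dots> \<le> 5200 * (\<Sum>p\<in>?P. 5200 * (cmod (z (fst p) (snd p)))^2)"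
    using col by (intro mult_left_mono sum_mono mult_right_mono) auto
  also have "\<dots> = 5200^2 * (\<Sum>n<M. \<Sum>k<M. (cmod (z n k))^2)"
    by (simp add: sum.cartesian_product case_prod_beta sum_distrib_left)
  finally show ?thesis .
qed

text \<open>A block seen from the left. About the right action \<open>R\<close> one needs only that it commutes with
  \<open>L\<close> and acts on the boundary row \<open>w\<^sub>0\<^sub>j\<close> by a Jacobi matrix: in row \<open>0\<close> the terms with
  coefficients \<open>b\<close> and \<open>c\<close> of the right action are absent.\<close>
locale half_block = half_block_coeffs a b c
  for a :: "nat \<Rightarrow> nat \<Rightarrow> real" and b c :: "nat \<Rightarrow> nat \<Rightarrow> complex" +
  fixes w :: "nat \<Rightarrow> nat \<Rightarrow> 'b::complex_vector" and L R :: "'b \<Rightarrow> 'b"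
  assumes L_add: "\<And>x y. L (x + y) = L x + L y" and L_scale: "\<And>k x. L (k *\<^sub>C x) = k *\<^sub>C L x"
    and R_add: "\<And>x y. R (x + y) = R x + R y" and R_scale: "\<And>k x. R (k *\<^sub>C x) = k *\<^sub>C R x"
    and LR: "\<And>x. L (R x) = R (L x)"
    and L_w: "\<And>i j. L (w i j) = w (Suc i) j + (if i = 0 then 0 else (1 - complex_of_real (a i j)) *\<^sub>C w (i-1) j)
       + (if j = 0 then 0 else b i j *\<^sub>C w i (j-1)) - (if j < 2 then 0 else c i j *\<^sub>C w (Suc i) (j-2))"
    and R_w0: "\<And>j. R (w 0 j) = w 0 (Suc j) + (if j = 0 then 0 else (1 - complex_of_real (a j 0)) *\<^sub>C w 0 (j-1))"
    and indep: "\<And>M F i j. box_sum w M F = 0 \<Longrightarrow> i < M \<Longrightarrow> j < M \<Longrightarrow> F i j = 0"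
begin

sublocale L: additive L by unfold_locales (rule L_add)
sublocale R: additive R by unfold_locales (rule R_add)

text \<open>The vectors \<open>U\<^sub>n(L) w\<^sub>0\<^sub>j\<close> with \<open>U\<^sub>n\<close> the Chebyshev polynomials of the second kind, normalized by
  \<open>t U\<^sub>n(t) = U\<^sub>n\<^sub>+\<^sub>1(t) + U\<^sub>n\<^sub>-\<^sub>1(t)\<close>.\<close>
fun x :: "nat \<Rightarrow> nat \<Rightarrow> 'b" where
  "x 0 j = w 0 j"
| "x (Suc 0) j = L (w 0 j)"
| "x (Suc (Suc n)) j = L (x (Suc n) j) - x n j"

lemma L_x: "L (x n j) = x (Suc n) j + (if n = 0 then 0 else x (n-1) j)"
  by (cases n) auto

text \<open>As \<open>R\<close> commutes with polynomials in \<open>L\<close>, its action on row \<open>n\<close> is a copy of that on row \<open>0\<close>.\<close>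
lemma R_x: "R (x n j) = x n (Suc j) + (if j = 0 then 0 else (1 - complex_of_real (a j 0)) *\<^sub>C x n (j-1))"
proof (induction n rule: less_induct)
  case (less n)
  consider "n = 0" | "n = 1" | m where "n = Suc (Suc m)"
    by (metis One_nat_def not0_implies_Suc)
  then show ?case
  proof cases
    case 2
    then show ?thesis by (simp add: LR[symmetric] R_w0 L_add L_scale L.zero)
  next
    case (3 m)
    then show ?thesis using less[of m] less[of "Suc m"]
      by (auto simp: R.diff LR[symmetric] L_add L_scale L.zero scaleC.scale_right_diff_distrib)
  qed (simp add: R_w0)
qed

lemma L_box_w:
  assumes F: "\<And>i j. Suc i \<ge> M \<or> j \<ge> M \<Longrightarrow> F i j = 0"
  shows "L (box_sum w M F) = box_sum w M (Lw F)"
proof -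
  have "L (box_sum w M F) = (\<Sum>i<M. \<Sum>j<M. F i j *\<^sub>C w (Suc i) j
     + (if i = 0 then 0 else (F i j * (1 - complex_of_real (a i j))) *\<^sub>C w (i-1) j)
     + (if j = 0 then 0 else (F i j * b i j) *\<^sub>C w i (j-1))
     - (if j < 2 then 0 else (F i j * c i j) *\<^sub>C w (Suc i) (j-2)))"
    unfolding box_sum_def L.sum L_scale L_w
    by (intro sum.cong refl) (auto simp: scaleC_add_right scaleC.scale_right_diff_distrib scaleC_scaleC)
  also have "\<dots> = (\<Sum>i<M. \<Sum>j<M. F i j *\<^sub>C w (Suc i) j)
     + (\<Sum>i<M. if i = 0 then 0 else \<Sum>j<M. (F i j * (1 - complex_of_real (a i j))) *\<^sub>C w (i-1) j)
     + (\<Sum>i<M. \<Sum>j<M. if j = 0 then 0 else (F i j * b i j) *\<^sub>C w i (j-1))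
     - (\<Sum>i<M. \<Sum>j<M. if j < 2 then 0 else (F i j * c i j) *\<^sub>C w (Suc i) (j-2))"
    unfolding sum.distrib sum_subtractf
    by (intro arg_cong2[where f = "(-)"] arg_cong2[where f = "(+)"] sum.cong refl) (auto)
  also have "(\<Sum>i<M. \<Sum>j<M. F i j *\<^sub>C w (Suc i) j) = (\<Sum>i<M. \<Sum>j<M. (if i = 0 then 0 else F (i-1) j) *\<^sub>C w i j)"
    using F by (subst sum_shift_up) (auto intro!: sum.cong)
  also have "(\<Sum>i<M. if i = 0 then 0 else \<Sum>j<M. (F i j * (1 - complex_of_real (a i j))) *\<^sub>C w (i-1) j)
     = (\<Sum>i<M. \<Sum>j<M. ((1 - complex_of_real (a (Suc i) j)) * F (Suc i) j) *\<^sub>C w i j)"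
    using F by (subst sum_shift_down) (auto intro!: sum.cong simp: mult.commute)
  also have "(\<Sum>i<M. \<Sum>j<M. if j = 0 then 0 else (F i j * b i j) *\<^sub>C w i (j-1))
     = (\<Sum>i<M. \<Sum>j<M. (b i (Suc j) * F i (Suc j)) *\<^sub>C w i j)"
    using F by (subst sum_shift_down) (auto intro!: sum.cong simp: mult.commute)
  also have "(\<Sum>i<M. \<Sum>j<M. if j < 2 then 0 else (F i j * c i j) *\<^sub>C w (Suc i) (j-2))
     = (\<Sum>i<M. \<Sum>j<M. (F i (j+2) * c i (j+2)) *\<^sub>C w (Suc i) j)"
    using F by (subst sum_shift_down2) (auto intro!: sum.cong)
  also have "\<dots> = (\<Sum>i<M. \<Sum>j<M. (if i = 0 then 0 else c (i-1) (j+2) * F (i-1) (j+2)) *\<^sub>C w i j)"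
    using F by (subst sum_shift_up) (auto intro!: sum.cong simp: mult.commute)
  also have "(\<Sum>i<M. \<Sum>j<M. (if i = 0 then 0 else F (i-1) j) *\<^sub>C w i j)
      + (\<Sum>i<M. \<Sum>j<M. ((1 - complex_of_real (a (Suc i) j)) * F (Suc i) j) *\<^sub>C w i j)
      + (\<Sum>i<M. \<Sum>j<M. (b i (Suc j) * F i (Suc j)) *\<^sub>C w i j)
      - (\<Sum>i<M. \<Sum>j<M. (if i = 0 then 0 else c (i-1) (j+2) * F (i-1) (j+2)) *\<^sub>C w i j)
     = box_sum w M (Lw F)"
    unfolding box_sum_def Lw_def
    by (simp only: scaleC_add_left scaleC.scale_left_diff_distrib sum.distrib sum_subtractf)
  finally show ?thesis .
qed

lemma L_box_x:
  assumes F: "\<And>i j. Suc i \<ge> M \<Longrightarrow> F i j = 0"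
  shows "L (box_sum x M F) = box_sum x M (\<lambda>i j. (if i = 0 then 0 else F (i-1) j) + F (Suc i) j)"
proof -
  have "L (box_sum x M F) = (\<Sum>i<M. \<Sum>j<M. F i j *\<^sub>C x (Suc i) j)
      + (\<Sum>i<M. if i = 0 then 0 else \<Sum>j<M. F i j *\<^sub>C x (i-1) j)"
    unfolding box_sum_def L.sum L_scale L_x scaleC_add_right sum.distrib
    by (intro arg_cong2[where f = "(+)"] sum.cong refl) auto
  also have "(\<Sum>i<M. \<Sum>j<M. F i j *\<^sub>C x (Suc i) j) = (\<Sum>i<M. \<Sum>j<M. (if i = 0 then 0 else F (i-1) j) *\<^sub>C x i j)"
    using F by (subst sum_shift_up) (auto intro!: sum.cong)
  also have "(\<Sum>i<M. if i = 0 then 0 else \<Sum>j<M. F i j *\<^sub>C x (i-1) j) = (\<Sum>i<M. \<Sum>j<M. F (Suc i) j *\<^sub>C x i j)"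
    using F by (subst sum_shift_down) (auto intro!: sum.cong)
  finally show ?thesis by (simp only: box_sum_add[symmetric] box_sum_def[symmetric])
qed

lemma R_box_x:
  assumes F: "\<And>i j. Suc j \<ge> M \<Longrightarrow> F i j = 0"
  shows "R (box_sum x M F) = box_sum x M (\<lambda>i j. (if j = 0 then 0 else F i (j-1)) + (1 - complex_of_real (a (Suc j) 0)) * F i (Suc j))"
proof -
  have "R (box_sum x M F) = (\<Sum>i<M. \<Sum>j<M. F i j *\<^sub>C x i (Suc j))
      + (\<Sum>i<M. \<Sum>j<M. if j = 0 then 0 else (F i j * (1 - complex_of_real (a j 0))) *\<^sub>C x i (j-1))"
    unfolding box_sum_def R.sum R_scale R_x scaleC_add_right sum.distrib
    by (intro arg_cong2[where f = "(+)"] sum.cong refl) (auto simp: scaleC_scaleC)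
  also have "(\<Sum>i<M. \<Sum>j<M. F i j *\<^sub>C x i (Suc j)) = (\<Sum>i<M. \<Sum>j<M. (if j = 0 then 0 else F i (j-1)) *\<^sub>C x i j)"
    using F by (subst sum_shift_up) (auto intro!: sum.cong)
  also have "(\<Sum>i<M. \<Sum>j<M. if j = 0 then 0 else (F i j * (1 - complex_of_real (a j 0))) *\<^sub>C x i (j-1))
     = (\<Sum>i<M. \<Sum>j<M. ((1 - complex_of_real (a (Suc j) 0)) * F i (Suc j)) *\<^sub>C x i j)"
    using F by (subst sum_shift_down) (auto intro!: sum.cong simp: mult.commute)
  finally show ?thesis by (simp only: box_sum_add[symmetric] box_sum_def[symmetric])
qed

lemma x_expand: "n < M \<Longrightarrow> k < M \<Longrightarrow> x n k = box_sum w M (x_in_w k n)"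
proof (induction n rule: less_induct)
  case (less n)
  consider "n = 0" | m where "n = Suc m" by (cases n) auto
  then show ?case
  proof cases
    case 1
    then show ?thesis using less.prems box_sum_single[of 0 M k w] by (simp add: x_in_w.simps(1))
  next
    case (2 m)
    have "x n k = L (x m k) - (if m = 0 then 0 else x (m-1) k)" using L_x[of m k] 2 by simp
    also have "L (x m k) = box_sum w M (Lw (x_in_w k m))"
      using less 2 by (subst L_box_w[symmetric]) (auto simp: x_in_w_support)
    also have "(if m = 0 then 0 else x (m-1) k) = box_sum w M (\<lambda>i j. if m = 0 then 0 else x_in_w k (m-1) i j)"
      using less 2 by (auto simp: box_sum_if)
    finally show ?thesis unfolding 2 by (simp add: x_in_w.simps(2) box_sum_diff[symmetric])
  qed
qed

lemma w_expand: "n < M \<Longrightarrow> k < M \<Longrightarrow> w n k = box_sum x M (w_in_x k n)"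
proof (induction k arbitrary: n rule: less_induct)
  case (less k)
  note IHk = less.IH
  show ?case using less.prems
  proof (induction n rule: less_induct)
    case (less n)
    consider "n = 0" | m where "n = Suc m" by (cases n) auto
    then show ?case
    proof cases
      case 1
      then show ?thesis using less.prems box_sum_single[of 0 M k x] by (simp add: w_in_x.simps(1))
    next
      case (2 m)
      have "w n k = L (w m k) - (if m = 0 then 0 else (1 - complex_of_real (a m k)) *\<^sub>C w (m-1) k)
         - (if k = 0 then 0 else b m k *\<^sub>C w m (k-1)) + (if k < 2 then 0 else c m k *\<^sub>C w (Suc m) (k-2))"
        using L_w[of m k] 2 by simp
      also have "w m k = box_sum x M (w_in_x k m)" using less 2 by auto
      also have "L (box_sum x M (w_in_x k m)) = box_sum x M (\<lambda>i j. (if i = 0 then 0 else w_in_x k m (i-1) j) + w_in_x k m (Suc i) j)"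
        using less.prems 2 by (subst L_box_x) (auto simp: w_in_x_support)
      also have "(if m = 0 then 0 else (1 - complex_of_real (a m k)) *\<^sub>C w (m-1) k)
         = box_sum x M (\<lambda>i j. if m = 0 then 0 else (1 - complex_of_real (a m k)) * w_in_x k (m-1) i j)"
        using less 2 by (simp only: box_sum_if box_sum_scale, (auto)?)
      also have "(if k = 0 then 0 else b m k *\<^sub>C w m (k-1))
         = box_sum x M (\<lambda>i j. if k = 0 then 0 else b m k * w_in_x (k-1) m i j)"
        using IHk[of "k-1" m] less.prems 2 by (simp only: box_sum_if box_sum_scale, (auto)?)
      also have "(if k < 2 then 0 else c m k *\<^sub>C w (Suc m) (k-2))
         = box_sum x M (\<lambda>i j. if k < 2 then 0 else c m k * w_in_x (k-2) (Suc m) i j)"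
        using IHk[of "k-2" "Suc m"] less.prems 2 by (simp only: box_sum_if box_sum_scale, (auto)?)
      finally have "w n k = box_sum x M (\<lambda>i j. w_in_x k (Suc m) i j)"
        unfolding w_in_x.simps(2)[of k m] by (simp only: box_sum_diff box_sum_add)
      then show ?thesis using 2 by simp
    qed
  qed
qed

text \<open>The transition matrix from \<open>x\<close> to \<open>w\<close> is unitriangular for the order by \<open>i + j\<close>, so the
  coefficient at an index of maximal weight in the support survives in the coordinates with respect
  to \<open>w\<close>.\<close>
lemma x_indep:
  assumes "box_sum x M F = 0" "i < M" "j < M"
  shows "F i j = 0"
proof (rule ccontr)
  assume "F i j \<noteq> 0"
  define S where "S = {(n, k). n < M \<and> k < M \<and> F n k \<noteq> 0}"
  have "finite S" unfolding S_def by (rule finite_subset[of _ "{..<M} \<times> {..<M}"]) auto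
  moreover have "S \<noteq> {}" using assms \<open>F i j \<noteq> 0\<close> by (auto simp: S_def)
  ultimately have "Max ((\<lambda>q. fst q + snd q) ` S) \<in> (\<lambda>q. fst q + snd q) ` S" by (intro Max_in) auto
  then obtain p where p: "p \<in> S" "\<And>q. q \<in> S \<Longrightarrow> fst q + snd q \<le> fst p + snd p"
    using Max_ge[of "(\<lambda>q. fst q + snd q) ` S"] \<open>finite S\<close> by fastforce
  obtain n k where nk: "p = (n, k)" by (cases p)
  define F' where "F' i j = (if i < M \<and> j < M then F i j else 0)" for i j
  have "box_sum x M F' = 0" using assms(1) unfolding box_sum_def F'_def by simp
  moreover have "box_sum x M F' = box_sum w M (\<lambda>i j. \<Sum>n<M. \<Sum>k<M. F' n k * x_in_w k n i j)"
    by (rule box_sum_expand) (auto simp: F'_def x_expand)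
  ultimately have "(\<Sum>n'<M. \<Sum>k'<M. F' n' k' * x_in_w k' n' n k) = 0"
    using indep[of M _ n k] p nk by (auto simp: S_def)
  moreover have "(\<Sum>n'<M. \<Sum>k'<M. F' n' k' * x_in_w k' n' n k) = (\<Sum>n'<M. \<Sum>k'<M. F n k * of_bool (n' = n \<and> k' = k))"
  proof (intro sum.cong refl)
    fix n' k' assume "n' \<in> {..<M}" "k' \<in> {..<M}"
    show "F' n' k' * x_in_w k' n' n k = F n k * of_bool (n' = n \<and> k' = k)"
    proof (cases "F' n' k' = 0 \<or> x_in_w k' n' n k = 0")
      case True
      then show ?thesis using p nk by (auto simp: S_def F'_def x_in_w_diag)
    next
      case False
      then have "(n', k') \<in> S" by (auto simp: S_def F'_def split: if_splits)
      then have "n' + k' \<le> n + k" using p(2) nk by fastforce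
      moreover have "n \<le> n'" "k \<le> k'" using False x_in_w_support by blast+
      ultimately have "n' = n" "k' = k" by auto
      then show ?thesis using p nk by (auto simp: S_def F'_def x_in_w_diag)
    qed
  qed
  moreover have "(\<Sum>n'<M. \<Sum>k'<M. F n k * of_bool (n' = n \<and> k' = k)) = F n k"
  proof -
    have "(\<Sum>n'<M. \<Sum>k'<M. F n k * of_bool (n' = n \<and> k' = k)) = (\<Sum>n'<M. if n' = n then (\<Sum>k'<M. if k' = k then F n k else 0) else 0)"
      by (intro sum.cong refl) (auto intro!: sum.cong)
    then show ?thesis using p nk by (simp add: S_def sum.delta)
  qed
  ultimately show False using p nk by (auto simp: S_def)
qed

text \<open>The weights that symmetrize the right action on row \<open>0\<close>. They stay above \<open>1/2\<close> because
  \<open>\<Sum>\<^sub>s a\<^sub>s\<^sub>0 \<le> (25/169) / (1 - 25/169) < 1/2\<close>.\<close>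
lemma a_weights:
  obtains g :: "nat \<Rightarrow> real" where "\<And>j. g j \<ge> 1/2" "\<And>j. g j \<le> 1" "\<And>j. g (Suc j) = (1 - a (Suc j) 0) * g j"
proof -
  define g where "g j = (\<Prod>s<j. 1 - a (Suc s) 0)" for j
  have a1: "a (Suc s) 0 \<le> (25/169) ^ Suc s" for s by (rule a_le)
  have a01: "a (Suc s) 0 \<le> 1" for s
  proof -
    have "(25/169::real) ^ Suc s \<le> 1" by (rule power_le_one) auto
    then show ?thesis using a1[of s] by linarith
  qed
  have low: "g j \<ge> 1 - (\<Sum>s<j. a (Suc s) 0)" and g01: "0 \<le> g j \<and> g j \<le> 1" for j
  proof -
    show "0 \<le> g j \<and> g j \<le> 1"
      unfolding g_def using a0 a01 by (auto intro!: prod_nonneg prod_le_1)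
    show "g j \<ge> 1 - (\<Sum>s<j. a (Suc s) 0)"
    proof (induction j)
      case (Suc j)
      have "a (Suc j) 0 * g j \<le> a (Suc j) 0 * 1"
        unfolding g_def using a0 a01 by (intro mult_left_mono prod_le_1) auto
      then show ?case using Suc by (simp add: g_def algebra_simps)
    qed (simp add: g_def)
  qed
  have half: "(\<Sum>s<j. a (Suc s) 0) \<le> 1/2" for j
  proof -
    have "(\<Sum>s<j. a (Suc s) 0) \<le> (\<Sum>s<j. (25/169) ^ Suc s)" using a1 by (rule sum_mono)
    also have "\<dots> = 25/169 * (\<Sum>s<j. (25/169) ^ id s)" by (simp add: sum_distrib_left)
    also have "\<dots> \<le> 25/169 * (1 / (1 - 25/169))"
      by (intro mult_left_mono sum_geometric_le) auto
    finally show ?thesis by simp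
  qed
  have "g j \<ge> 1/2" for j using low[of j] half[of j] by linarith
  then show thesis using g01 by (intro that[of g]) (auto simp: g_def)
qed

end

section \<open>The strip estimate in one block\<close>

text \<open>The factors are those of the proof of \<open>strip_bound\<close>: \<open>1352000 = 5200 \<cdot> 260\<close> comes from the Schur
  test for the transition from \<open>x\<close> to \<open>w\<close>, \<open>(20/19)\<^sup>m (38809/809)\<^sup>2\<close> from \<open>sum_weighted_lag_le\<close>, and the
  last factors from \<open>row_bound\<close> and from the transition from \<open>w\<close> to \<open>x\<close>.\<close>
definition strip_const :: "nat \<Rightarrow> real" where
  "strip_const m = real m * (1352000 * (20/19) ^ m * (38809/809)^2 * 2 * (4624 * 5200^2))"

lemma strip_const_nonneg: "strip_const m \<ge> 0" by (simp add: strip_const_def)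

text \<open>The series converges because \<open>q = (19/20) / (197/200)\<^sup>2 = 38000/38809\<close> is less than one, and its
  sum is \<open>\<Sum>\<^sub>n (n + 1) q\<^sup>n = (1 - q)\<^sup>-\<^sup>2\<close>.\<close>
lemma sum_weighted_lag_le:
  "(\<Sum>n<M. lag_kernel n i * ((real n + 1) * (1/(197/200)^2) ^ n)) \<le> (20/19) ^ i * (38809/809)^2"
proof -
  define q :: real where "q = 38000/38809"
  have q: "q = 19/20 * (1/(197/200)^2)" by (simp add: q_def power2_eq_square)
  have "(\<Sum>n<M. lag_kernel n i * ((real n + 1) * (1/(197/200)^2) ^ n)) \<le> (\<Sum>n<M. (20/19) ^ i * (real (Suc n) * q ^ n))"
  proof (rule sum_mono)
    fix n
    have "lag_kernel n i \<le> (19/20) ^ n * (20/19) ^ i"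
      by (cases "i \<le> n") (simp_all only: lag_kernel_eq, simp_all add: lag_kernel_def)
    then have "lag_kernel n i * ((real n + 1) * (1/(197/200)^2) ^ n) \<le> ((19/20) ^ n * (20/19) ^ i) * ((real n + 1) * (1/(197/200)^2) ^ n)"
      by (intro mult_right_mono) auto
    also have "\<dots> = (20/19) ^ i * (real (Suc n) * q ^ n)"
      unfolding q power_mult_distrib by (simp only: of_nat_Suc ac_simps)
    finally show "lag_kernel n i * ((real n + 1) * (1/(197/200)^2) ^ n) \<le> (20/19) ^ i * (real (Suc n) * q ^ n)" .
  qed
  also have "\<dots> = (20/19) ^ i * (\<Sum>n<M. real (Suc n) * q ^ n)" by (simp only: sum_distrib_left)
  also have "\<dots> \<le> (20/19) ^ i * (38809/809)^2"
  proof -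
    have s: "(\<lambda>n. real (Suc n) * q ^ n) sums (1 / (1 - q)^2)"
      using geometric_deriv_sums[of q] by (simp add: q_def)
    have "(\<Sum>n<M. real (Suc n) * q ^ n) \<le> suminf (\<lambda>n. real (Suc n) * q ^ n)"
      using s by (intro sum_le_suminf) (auto simp: sums_iff q_def)
    also have "\<dots> = (38809/809)^2" using s by (simp add: sums_iff q_def power2_eq_square)
    finally show ?thesis by (intro mult_left_mono) auto
  qed
  finally show ?thesis .
qed

context half_block
begin

text \<open>In the coordinates \<open>\<zeta>\<close> with respect to \<open>x\<close>, each row satisfies \<open>row_bound\<close>. The row \<open>i\<close> of \<open>z\<close>
  is a combination of the rows \<open>n \<ge> i\<close> of \<open>\<zeta>\<close> with coefficients of size \<open>(19/20)\<^sup>n\<^sup>-\<^sup>i\<close>, which beat the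
  growth of the row bounds. The box of size \<open>M + 2\<close> leaves room for the action of \<open>L\<close> and \<open>R\<close>.\<close>
lemma strip_bound:
  assumes z: "\<And>i j. i \<ge> M \<or> j \<ge> M \<Longrightarrow> z i j = 0"
    and y: "\<And>i j. i \<ge> Suc M \<or> j \<ge> Suc M \<Longrightarrow> y i j = 0"
    and T: "box_sum w (M + 2) y = L (box_sum w (M + 2) z) - R (box_sum w (M + 2) z)"
    and p: "p > 0"
  shows "(\<Sum>i<m. \<Sum>j<M. (cmod (z i j))^2) \<le> strip_const m *
    (1/p * (\<Sum>i<M. \<Sum>j<M. (cmod (z i j))^2) + p * (\<Sum>i<Suc M. \<Sum>j<Suc M. (cmod (y i j))^2))"
proof -
  let ?P = "M + 2"
  obtain g where g: "\<And>j. g j \<ge> 1/2" "\<And>j. g j \<le> 1" "\<And>j. g (Suc j) = (1 - a (Suc j) 0) * g j"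
    using a_weights by blast
  define \<zeta> where "\<zeta> i j = (\<Sum>n<M. \<Sum>k<M. z n k * w_in_x k n i j)" for i j
  define \<eta> where "\<eta> i j = (if i = 0 then 0 else \<zeta> (i-1) j) + \<zeta> (Suc i) j
        - ((if j = 0 then 0 else \<zeta> i (j-1)) + (1 - complex_of_real (a (Suc j) 0)) * \<zeta> i (Suc j))" for i j
  define V where "V i j = (\<Sum>n<Suc M. \<Sum>k<Suc M. y n k * w_in_x k n i j)" for i j
  define nz where "nz = (\<Sum>i<M. \<Sum>j<M. (cmod (z i j))^2)"
  define ny where "ny = (\<Sum>i<Suc M. \<Sum>j<Suc M. (cmod (y i j))^2)"
  have \<zeta>0: "\<zeta> i j = 0" if "i \<ge> M \<or> j \<ge> M" for i j
    unfolding \<zeta>_def using that by (intro sum.neutral ballI) (auto simp: w_in_x_support)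
  have zx: "box_sum w ?P z = box_sum x ?P \<zeta>"
    unfolding \<zeta>_def[abs_def] using z by (intro box_sum_expand) (auto intro: w_expand)
  have yx: "box_sum w ?P y = box_sum x ?P V"
    unfolding V_def[abs_def] using y by (intro box_sum_expand) (auto intro: w_expand)
  have "box_sum x ?P (\<lambda>i j. \<eta> i j - V i j) = 0"
  proof -
    have "L (box_sum x ?P \<zeta>) = box_sum x ?P (\<lambda>i j. (if i = 0 then 0 else \<zeta> (i-1) j) + \<zeta> (Suc i) j)"
      by (rule L_box_x) (auto simp: \<zeta>0)
    moreover have "R (box_sum x ?P \<zeta>) = box_sum x ?P (\<lambda>i j. (if j = 0 then 0 else \<zeta> i (j-1)) + (1 - complex_of_real (a (Suc j) 0)) * \<zeta> i (Suc j))"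
      by (rule R_box_x) (auto simp: \<zeta>0)
    ultimately have "box_sum x ?P \<eta> = L (box_sum w ?P z) - R (box_sum w ?P z)"
      unfolding zx by (simp only: \<eta>_def[abs_def] box_sum_diff)
    then show ?thesis using T yx by (simp only: box_sum_diff diff_self)
  qed
  then have \<eta>V: "\<eta> i j = V i j" if "i < Suc M" "j < Suc M" for i j
    using x_indep[of ?P "\<lambda>i j. \<eta> i j - V i j" i j] that by simp
  have n\<zeta>: "(\<Sum>i<M. \<Sum>j<M. (cmod (\<zeta> i j))^2) \<le> 5200^2 * nz"
    unfolding \<zeta>_def nz_def by (rule expansion_energy_le) (rule w_in_x_lag_kernel)
  have "(\<Sum>i<Suc M. \<Sum>j<Suc M. (cmod (\<eta> i j))^2) = (\<Sum>i<Suc M. \<Sum>j<Suc M. (cmod (V i j))^2)"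
    using \<eta>V by (intro sum.cong refl) auto
  also have "\<dots> \<le> 5200^2 * ny"
    unfolding V_def ny_def by (rule expansion_energy_le) (rule w_in_x_lag_kernel)
  finally have n\<eta>: "(\<Sum>i<Suc M. \<Sum>j<Suc M. (cmod (\<eta> i j))^2) \<le> 5200^2 * ny" .
  define E where "E = 4624 * 5200^2 * (1/p * nz + p * ny)"
  have nz0: "nz \<ge> 0" "ny \<ge> 0" unfolding nz_def ny_def by (intro sum_nonneg; simp)+
  have E0: "E \<ge> 0" unfolding E_def using nz0 p by (intro mult_nonneg_nonneg add_nonneg_nonneg) auto
  have row: "(\<Sum>k<M. (cmod (\<zeta> n k))^2) \<le> 2 * ((real n + 1) * (1/(197/200)^2) ^ n) * E" for n
  proof -
    have "(\<Sum>k<M. (cmod (\<zeta> n k))^2) \<le> 2 * (real n + 1) * (1/(197/200)^2) ^ n *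
       (4624 / p * (\<Sum>i<M. \<Sum>j<M. (cmod (\<zeta> i j))^2) + p * (\<Sum>i<Suc M. \<Sum>j<Suc M. (cmod (\<eta> i j))^2))"
      by (rule row_bound[where g = g and a = "\<lambda>j. a j 0"]) (use g \<zeta>0 p \<eta>_def in auto)
    also have "\<dots> \<le> 2 * (real n + 1) * (1/(197/200)^2) ^ n * E"
    proof (rule mult_left_mono)
      have "4624 / p * (\<Sum>i<M. \<Sum>j<M. (cmod (\<zeta> i j))^2) \<le> 4624 / p * (5200^2 * nz)"
        using n\<zeta> p by (intro mult_left_mono) auto
      moreover have "p * (\<Sum>i<Suc M. \<Sum>j<Suc M. (cmod (\<eta> i j))^2) \<le> 4624 * (p * (5200^2 * ny))"
      proof -
        have "p * (\<Sum>i<Suc M. \<Sum>j<Suc M. (cmod (\<eta> i j))^2) \<le> p * (5200^2 * ny)"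
          using n\<eta> p by (intro mult_left_mono) auto
        moreover have "0 \<le> p * (5200^2 * ny)" using nz0 p by simp
        ultimately show ?thesis by linarith
      qed
      ultimately show "4624 / p * (\<Sum>i<M. \<Sum>j<M. (cmod (\<zeta> i j))^2) + p * (\<Sum>i<Suc M. \<Sum>j<Suc M. (cmod (\<eta> i j))^2) \<le> E"
        unfolding E_def by (simp add: algebra_simps)
    qed auto
    finally show ?thesis by (simp only: ac_simps)
  qed
  have zw: "z i j = (\<Sum>n<M. \<Sum>k<M. \<zeta> n k * x_in_w k n i j)" if "i < M" "j < M" for i j
  proof -
    have "box_sum x ?P \<zeta> = box_sum w ?P (\<lambda>i j. \<Sum>n<M. \<Sum>k<M. \<zeta> n k * x_in_w k n i j)"
      using \<zeta>0 by (intro box_sum_expand) (auto intro: x_expand)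
    then have "box_sum w ?P (\<lambda>i j. z i j - (\<Sum>n<M. \<Sum>k<M. \<zeta> n k * x_in_w k n i j)) = 0"
      by (simp only: box_sum_diff zx diff_self)
    from indep[OF this, of i j] that show ?thesis by simp
  qed
  have strip_row: "(\<Sum>j<M. (cmod (z i j))^2) \<le> 1352000 * (20/19) ^ m * (38809/809)^2 * 2 * E" if "i < m" for i
  proof (cases "i < M")
    case True
    let ?Q = "{..<M} \<times> {..<M}"
    let ?k = "\<lambda>(n,k) j. 13 * (lag_kernel n i * lag_kernel k j)"
    have kA: "(\<Sum>p\<in>?Q. ?k p j) \<le> 5200" for j
    proof -
      have "(\<Sum>p\<in>?Q. ?k p j) = 13 * ((\<Sum>n<M. lag_kernel n i) * (\<Sum>k<M. lag_kernel k j))"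
      proof -
        have "(\<Sum>n<M. lag_kernel n i) * (\<Sum>k<M. lag_kernel k j) = (\<Sum>p\<in>?Q. lag_kernel (fst p) i * lag_kernel (snd p) j)"
          by (simp add: sum_product sum.cartesian_product case_prod_beta)
        then show ?thesis by (simp add: sum_distrib_left case_prod_beta)
      qed
      moreover have "(\<Sum>n<M. lag_kernel n i) * (\<Sum>k<M. lag_kernel k j) \<le> 20 * 20"
        using sum_lag_kernel_le by (intro mult_mono) (auto intro: sum_nonneg lag_kernel_nonneg)
      ultimately show ?thesis by simp
    qed
    have kB: "(\<Sum>j<M. ?k p j) \<le> 260 * lag_kernel (fst p) i" for p
    proof -
      obtain n k where pk: "p = (n, k)" by (cases p)
      have "(\<Sum>j<M. ?k p j) = (13 * lag_kernel n i) * (\<Sum>j<M. lag_kernel k j)"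
        by (simp add: pk sum_distrib_left mult.assoc)
      also have "\<dots> \<le> (13 * lag_kernel n i) * 20"
        using sum_lag_kernel_le lag_kernel_nonneg by (intro mult_left_mono) auto
      finally show ?thesis by (simp add: pk)
    qed
    have "(\<Sum>j<M. (cmod (z i j))^2) \<le> (\<Sum>j<M. (\<Sum>p\<in>?Q. ?k p j * cmod (\<zeta> (fst p) (snd p)))^2)"
    proof (intro sum_mono power_mono)
      fix j assume "j \<in> {..<M}"
      then have "cmod (z i j) = cmod (\<Sum>p\<in>?Q. \<zeta> (fst p) (snd p) * x_in_w (snd p) (fst p) i j)"
        using zw[OF True, of j] by (simp add: sum.cartesian_product case_prod_beta)
      also have "\<dots> \<le> (\<Sum>p\<in>?Q. cmod (\<zeta> (fst p) (snd p) * x_in_w (snd p) (fst p) i j))"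
        by (rule norm_sum)
      also have "\<dots> \<le> (\<Sum>p\<in>?Q. ?k p j * cmod (\<zeta> (fst p) (snd p)))"
      proof (rule sum_mono)
        fix p
        have "cmod (x_in_w (snd p) (fst p) i j) \<le> ?k p j" using x_in_w_lag_kernel by (simp add: case_prod_beta)
        then show "cmod (\<zeta> (fst p) (snd p) * x_in_w (snd p) (fst p) i j) \<le> ?k p j * cmod (\<zeta> (fst p) (snd p))"
          unfolding norm_mult by (subst mult.commute) (intro mult_right_mono, auto)
      qed
      finally show "cmod (z i j) \<le> (\<Sum>p\<in>?Q. ?k p j * cmod (\<zeta> (fst p) (snd p)))" .
    qed simp
    also have "\<dots> \<le> 5200 * (\<Sum>p\<in>?Q. (\<Sum>j<M. ?k p j) * (cmod (\<zeta> (fst p) (snd p)))^2)"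
      using kA by (intro schur_weighted) (auto simp: lag_kernel_nonneg)
    also have "\<dots> \<le> 5200 * (\<Sum>p\<in>?Q. (260 * lag_kernel (fst p) i) * (cmod (\<zeta> (fst p) (snd p)))^2)"
      using kB by (intro mult_left_mono sum_mono mult_right_mono) auto
    also have "\<dots> = 1352000 * (\<Sum>n<M. lag_kernel n i * (\<Sum>k<M. (cmod (\<zeta> n k))^2))"
      by (simp add: sum.cartesian_product case_prod_beta sum_distrib_left mult.assoc)
    also have "\<dots> \<le> 1352000 * (\<Sum>n<M. lag_kernel n i * (2 * ((real n + 1) * (1/(197/200)^2) ^ n) * E))"
      using row lag_kernel_nonneg by (intro mult_left_mono sum_mono) auto
    also have "(\<Sum>n<M. lag_kernel n i * (2 * ((real n + 1) * (1/(197/200)^2) ^ n) * E))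
       = 2 * E * (\<Sum>n<M. lag_kernel n i * ((real n + 1) * (1/(197/200)^2) ^ n))"
      unfolding sum_distrib_left by (intro sum.cong refl) (simp only: ac_simps)
    also have "1352000 * (2 * E * (\<Sum>n<M. lag_kernel n i * ((real n + 1) * (1/(197/200)^2) ^ n)))
       \<le> 1352000 * (2 * E * ((20/19) ^ m * (38809/809)^2))"
    proof (intro mult_left_mono)
      have "(20/19::real) ^ i \<le> (20/19) ^ m" using that by (intro power_increasing) auto
      then have "(20/19::real) ^ i * (38809/809)^2 \<le> (20/19) ^ m * (38809/809)^2"
        by (rule mult_right_mono) simp
      then show "(\<Sum>n<M. lag_kernel n i * ((real n + 1) * (1/(197/200)^2) ^ n)) \<le> (20/19) ^ m * (38809/809)^2"
        using sum_weighted_lag_le[of i M] by (rule order_trans[rotated])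
    qed (use E0 in auto)
    finally show ?thesis by (simp only: ac_simps)
  next
    case False
    then show ?thesis using z E0 by simp
  qed
  have "(\<Sum>i<m. \<Sum>j<M. (cmod (z i j))^2) \<le> (\<Sum>i<m. 1352000 * (20/19) ^ m * (38809/809)^2 * 2 * E)"
    by (rule sum_mono) (use strip_row in auto)
  also have "\<dots> = strip_const m * (1/p * nz + p * ny)"
    by (simp only: strip_const_def E_def sum_constant card_lessThan ac_simps)
  finally show ?thesis unfolding nz_def ny_def .
qed

end

section \<open>Matrices between tensor powers\<close>

lemma finite_words [simp]: "finite (words n :: 'n::finite list set)"
  unfolding words_def using finite_lists_length_eq[OF finite_class.finite_UNIV, of n] by simp

lemma words_0: "words 0 = {[]}" by (auto simp: words_def)

lemma sum_words_add: "(\<Sum>I\<in>words (m + n). f I) = (\<Sum>I\<in>words m. \<Sum>J\<in>words n. f (I @ J :: 'n::finite list))"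
proof -
  have "(\<Sum>I\<in>words (m + n). f I) = (\<Sum>p\<in>words m \<times> words n. f (fst p @ snd p))"
    by (rule sum.reindex_bij_witness[of _ "\<lambda>p. fst p @ snd p" "\<lambda>I. (take m I, drop m I)"])
       (auto simp: words_def)
  then show ?thesis by (simp add: sum.cartesian_product case_prod_beta)
qed

lemma sum_words_1: "(\<Sum>I\<in>words (Suc 0). f I) = (\<Sum>x\<in>UNIV. f [x :: 'n::finite])"
  by (rule sum.reindex_bij_witness[of _ "\<lambda>x. [x]" hd]) (auto simp: words_def length_Suc_conv)

lemma sum_words_Suc: "(\<Sum>I\<in>words (Suc n). f I) = (\<Sum>x\<in>UNIV. \<Sum>I\<in>words n. f (x # I :: 'n::finite list))"
  using sum_words_add[of f 1 n] by (simp add: sum_words_1)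

lemma sum_words_Suc_right: "(\<Sum>I\<in>words (Suc n). f I) = (\<Sum>I\<in>words n. \<Sum>x\<in>UNIV. f (I @ [x :: 'n::finite]))"
  using sum_words_add[of f n 1] by (simp add: sum_words_1)

lemma tmatsI: "(\<And>I J. I \<notin> words m \<or> J \<notin> words n \<Longrightarrow> X I J = 0) \<Longrightarrow> X \<in> tmats m n"
  by (auto simp: tmats_def)

lemma tmatsD: "X \<in> tmats m n \<Longrightarrow> length I \<noteq> m \<or> length J \<noteq> n \<Longrightarrow> X I J = 0"
  by (auto simp: tmats_def words_def)

lemma tmats_eqI:
  assumes "X \<in> tmats m n" "Y \<in> tmats m n" "\<And>I J. length I = m \<Longrightarrow> length J = n \<Longrightarrow> X I J = Y I J"
  shows "X = Y"
proof (intro ext)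
  fix I J show "X I J = Y I J"
    using assms tmatsD[of X m n I J] tmatsD[of Y m n I J] by (cases "length I = m \<and> length J = n") auto
qed

lemma mcomp_assoc: "mcomp p (mcomp n X Y) Z = mcomp n X (mcomp p Y (Z :: 'n::finite tmat))"
  unfolding mcomp_def sum_distrib_left sum_distrib_right
  by (subst sum.swap) (simp add: mult.assoc)

lemma mcomp_tmats: "X \<in> tmats m n \<Longrightarrow> Y \<in> tmats n' p \<Longrightarrow> mcomp k X Y \<in> tmats m p"
  unfolding mcomp_def by (intro tmatsI sum.neutral) (auto simp: words_def dest: tmatsD)

lemma idm_tmats: "idm n \<in> tmats n n"
  by (auto simp: tmats_def idm_def words_def)

lemma mcomp_idm_left:
  assumes "X \<in> tmats n p" shows "mcomp n (idm n) X = (X :: 'n::finite tmat)"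
proof (intro ext)
  fix I J
  have "mcomp n (idm n) X I J = (\<Sum>K\<in>words n. if K = I then X I J else 0)"
    unfolding mcomp_def idm_def by (intro sum.cong) (auto simp: words_def)
  then show "mcomp n (idm n) X I J = X I J"
    using assms by (auto simp: tmats_def)
qed

lemma mcomp_idm_right:
  assumes "X \<in> tmats p n" shows "mcomp n X (idm n) = (X :: 'n::finite tmat)"
proof (intro ext)
  fix I J
  have "mcomp n X (idm n) I J = (\<Sum>K\<in>words n. if K = J then X I J else 0)"
    unfolding mcomp_def idm_def by (intro sum.cong) (auto simp: words_def)
  then show "mcomp n X (idm n) I J = X I J"
    using assms by (auto simp: tmats_def)
qed

lemma mcomp_diff_left: "mcomp n (\<lambda>I J. X I J - Y I J) Z = (\<lambda>I J. mcomp n X Z I J - mcomp n Y Z I J)"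
  by (simp add: mcomp_def left_diff_distrib sum_subtractf)
lemma mcomp_diff_right: "mcomp n Z (\<lambda>I J. X I J - Y I J) = (\<lambda>I J. mcomp n Z X I J - mcomp n Z Y I J)"
  by (simp add: mcomp_def right_diff_distrib sum_subtractf)
lemma mcomp_scale_left: "mcomp n (\<lambda>I J. c * X I J) Z = (\<lambda>I J. c * mcomp n X Z I J)"
  by (simp add: mcomp_def sum_distrib_left mult.assoc)
lemma mcomp_scale_right: "mcomp n Z (\<lambda>I J. c * X I J) = (\<lambda>I J. c * mcomp n Z X I J)"
  by (simp add: mcomp_def sum_distrib_left mult.left_commute)
lemma mcomp_sum_left: "mcomp n (\<lambda>I J. \<Sum>l\<in>S. X l I J) Z = (\<lambda>I J. \<Sum>l\<in>S. mcomp n (X l) Z I J)"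
  unfolding mcomp_def sum_distrib_right by (subst sum.swap) simp
lemma mcomp_sum_right: "mcomp n Z (\<lambda>I J. \<Sum>l\<in>S. X l I J) = (\<lambda>I J. \<Sum>l\<in>S. mcomp n Z (X l) I J)"
  unfolding mcomp_def sum_distrib_left by (subst sum.swap) simp
lemma mcomp_zero_left: "mcomp n (\<lambda>I J. 0) Z = (\<lambda>I J. 0)" by (simp add: mcomp_def)
lemma mcomp_zero_right: "mcomp n Z (\<lambda>I J. 0) = (\<lambda>I J. 0)" by (simp add: mcomp_def)

lemma madj_mcomp: "madj (mcomp n X Y) = mcomp n (madj Y) (madj X)"
  by (intro ext) (simp add: madj_def mcomp_def mult.commute)
lemma madj_madj [simp]: "madj (madj X) = X" by (simp add: madj_def)
lemma madj_tmats: "X \<in> tmats m n \<Longrightarrow> madj X \<in> tmats n m" by (auto simp: tmats_def madj_def)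
lemma madj_idm [simp]: "madj (idm n) = idm n" by (auto simp: madj_def idm_def intro!: ext)
lemma madj_mtens: "madj (mtens m n X Y) = mtens n m (madj X) (madj Y)"
  by (simp add: madj_def mtens_def)

lemma mtens_tmats: "A \<in> tmats m n \<Longrightarrow> B \<in> tmats m' n' \<Longrightarrow> mtens m n A B \<in> tmats (m + m') (n + n')"
proof (rule tmatsI)
  fix I J :: "'a list"
  assume A: "A \<in> tmats m n" and B: "B \<in> tmats m' n'" and *: "I \<notin> words (m + m') \<or> J \<notin> words (n + n')"
  show "mtens m n A B I J = 0"
  proof (cases "length (take m I) = m \<and> length (take n J) = n")
    case True
    then have "length (drop m I) \<noteq> m' \<or> length (drop n J) \<noteq> n'" using * by (auto simp: words_def)
    then have "B (drop m I) (drop n J) = 0" using tmatsD[OF B] by blast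
    then show ?thesis by (simp add: mtens_def)
  next
    case False
    then have "A (take m I) (take n J) = 0" using tmatsD[OF A] by blast
    then show ?thesis by (simp add: mtens_def)
  qed
qed

lemma mtens_interchange:
  "mcomp (n + n') (mtens m n A B) (mtens n p C D) = mtens m p (mcomp n A C) (mcomp n' B (D :: 'n::finite tmat))"
proof (intro ext)
  fix I J
  show "mcomp (n + n') (mtens m n A B) (mtens n p C D) I J = mtens m p (mcomp n A C) (mcomp n' B D) I J"
    unfolding mcomp_def mtens_def sum_words_add sum_product
    by (intro sum.cong refl) (auto simp: words_def)
qed

lemma mtens_assoc:
  "mtens (m1 + m2) (n1 + n2) (mtens m1 n1 A B) C = mtens m1 n1 A (mtens m2 n2 B C)"
  unfolding mtens_def by (intro ext) (simp add: drop_take drop_drop add.commute)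

lemma mtens_idm: "mtens m m (idm m) (idm n) = idm (m + n)"
proof (intro ext)
  fix I J :: "'a list"
  have "I = J \<longleftrightarrow> take m I = take m J \<and> drop m I = drop m J" by (metis append_take_drop_id)
  moreover have "length I = m + n \<longleftrightarrow> length (take m I) = m \<and> length (drop m I) = n" by auto
  ultimately show "mtens m m (idm m) (idm n) I J = idm (m + n) I J"
    unfolding mtens_def idm_def by simp
qed

lemma mtens_idm_add: "mtens (m + n) (m + n) (idm (m + n)) Z = mtens m m (idm m) (mtens n n (idm n) Z)"
  by (simp only: mtens_idm[symmetric] mtens_assoc)

text \<open>\<open>emb i p q j M\<close> is \<open>id\<^sub>i \<otimes> M \<otimes> id\<^sub>j\<close>, where \<open>M\<close> has \<open>p\<close> output legs and \<open>q\<close> input legs.\<close>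
definition emb :: "nat \<Rightarrow> nat \<Rightarrow> nat \<Rightarrow> nat \<Rightarrow> 'n tmat \<Rightarrow> 'n tmat" where
  "emb i p q j M = mtens i i (idm i) (mtens p q M (idm j))"

lemma emb_tmats: "M \<in> tmats p q \<Longrightarrow> emb i p q j M \<in> tmats (i + p + j) (i + q + j)"
  unfolding emb_def add.assoc by (intro mtens_tmats idm_tmats)

lemma emb_comp:
  "mcomp (i + q + j) (emb i p q j M) (emb i q r j M') = emb i p r j (mcomp q M (M' :: 'n::finite tmat))"
  unfolding emb_def add.assoc
  by (simp add: mtens_interchange mcomp_idm_left[OF idm_tmats])

lemma emb_emb:
  "emb i (i' + p + j') (i' + q + j') j (emb i' p q j' M) = emb (i + i') p q (j' + j) M"
proof -
  have "mtens (i' + (p + j')) (i' + (q + j')) (mtens i' i' (idm i') (mtens p q M (idm j'))) (idm j)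
     = mtens i' i' (idm i') (mtens p q M (idm (j' + j)))"
    unfolding mtens_assoc mtens_idm ..
  then show ?thesis unfolding emb_def add.assoc by (simp only: mtens_idm_add)
qed

lemma emb_idm: "emb i p p j (idm p) = idm (i + p + j)"
  by (simp add: emb_def mtens_idm add.assoc)

lemma emb_00:
  assumes "M \<in> tmats p q" shows "emb 0 p q 0 M = M"
proof (intro ext)
  fix I J
  show "emb 0 p q 0 M I J = M I J"
    unfolding emb_def mtens_def idm_def using tmatsD[OF assms, of I J]
    by (cases "length I \<le> p"; cases "length J \<le> q") auto
qed

lemma madj_emb: "madj (emb i p q j M) = emb i q p j (madj M)"
  by (simp add: emb_def madj_mtens)

lemma emb_diff: "emb i p q j (\<lambda>I J. X I J - Y I J) = (\<lambda>I J. emb i p q j X I J - emb i p q j Y I J)"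
  by (simp add: emb_def mtens_def algebra_simps)
lemma emb_scale: "emb i p q j (\<lambda>I J. c * X I J) = (\<lambda>I J. c * emb i p q j X I J)"
  by (simp add: emb_def mtens_def algebra_simps)
lemma emb_sum: "emb i p q j (\<lambda>I J. \<Sum>l\<in>S. X l I J) = (\<lambda>I J. \<Sum>l\<in>S. emb i p q j (X l) I J)"
  by (simp add: emb_def mtens_def sum_distrib_left sum_distrib_right)
lemma emb_zero: "emb i p q j (\<lambda>I J. 0) = (\<lambda>I J. 0)"
  by (simp add: emb_def mtens_def)

text \<open>Operators on disjoint groups of legs commute.\<close>
lemma emb_commute:
  fixes M M' :: "'n::finite tmat"
  assumes M: "M \<in> tmats p q" and M': "M' \<in> tmats p' q'"
  shows "mcomp (i + q + (s + p' + j)) (emb i p q (s + p' + j) M) (emb (i + q + s) p' q' j M')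
     = mcomp (i + p + (s + q' + j)) (emb (i + p + s) p' q' j M') (emb i p q (s + q' + j) M)"
proof -
  have 1: "emb (i + (r + s)) p' q' j M' = mtens i i (idm i) (mtens r r (idm r) (emb s p' q' j M'))" for r
    unfolding emb_def by (simp only: mtens_idm_add)
  have 2: "emb s p' q' j M' \<in> tmats (s + p' + j) (s + q' + j)" using M' by (rule emb_tmats)
  have "mcomp (i + q + (s + p' + j)) (emb i p q (s + p' + j) M) (emb (i + q + s) p' q' j M')
     = mtens i i (idm i) (mtens p q M (emb s p' q' j M'))"
    unfolding add.assoc[of i] 1 emb_def[of i]
    unfolding mtens_interchange mcomp_idm_left[OF idm_tmats] mcomp_idm_right[OF M] mcomp_idm_left[OF 2] ..
  moreover have "mcomp (i + p + (s + q' + j)) (emb (i + p + s) p' q' j M') (emb i p q (s + q' + j) M)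
     = mtens i i (idm i) (mtens p q M (emb s p' q' j M'))"
    unfolding add.assoc[of i] 1 emb_def[of i]
    unfolding mtens_interchange mcomp_idm_left[OF idm_tmats] mcomp_idm_left[OF M] mcomp_idm_right[OF 2] ..
  ultimately show ?thesis by simp
qed

lemma tmat_tmats: "tmat \<in> tmats 2 0"
  by (auto simp: tmats_def tmat_def words_def)

abbreviation tcap :: "'n tmat" where "tcap \<equiv> madj tmat"

lemma tcap_tmats: "tcap \<in> tmats 0 2"
  by (rule madj_tmats[OF tmat_tmats])

section \<open>Cups and caps\<close>

text \<open>\<open>cap a r\<close> contracts two neighbouring legs that have \<open>a\<close> legs on their left and \<open>r\<close> legs on their
  right, and \<open>cup a r\<close> inserts the invariant vector \<open>t\<close> at that place.\<close>
abbreviation cap :: "nat \<Rightarrow> nat \<Rightarrow> 'n tmat" where "cap a r \<equiv> emb a 0 2 r tcap"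
abbreviation cup :: "nat \<Rightarrow> nat \<Rightarrow> 'n tmat" where "cup a r \<equiv> emb a 2 0 r tmat"

lemma cap_tmats: "cap a r \<in> tmats (a + r) (Suc (Suc (a + r)))"
  using emb_tmats[OF tcap_tmats, of a r] by simp
lemma cup_tmats: "cup a r \<in> tmats (Suc (Suc (a + r))) (a + r)"
  using emb_tmats[OF tmat_tmats, of a r] by simp
lemma madj_cap [simp]: "madj (cap a r) = cup a r" by (simp add: madj_emb)
lemma madj_cup [simp]: "madj (cup a r) = cap a r" by (simp add: madj_emb)

lemma sum_words_2: "(\<Sum>I\<in>words 2. f I) = (\<Sum>x\<in>UNIV. \<Sum>y\<in>UNIV. f [x, y :: 'n::finite])"
  unfolding numeral_2_eq_2 by (simp add: sum_words_Suc words_0)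

lemma sum_idm_left:
  assumes "length I = m"
  shows "(\<Sum>K\<in>words m. idm m I K * f K) = f (I :: 'n::finite list)"
proof -
  have "(\<Sum>K\<in>words m. idm m I K * f K) = (\<Sum>K\<in>words m. if K = I then f K else 0)"
    using assms by (intro sum.cong) (auto simp: idm_def)
  moreover have "I \<in> words m" using assms by (simp add: words_def)
  ultimately show ?thesis by simp
qed

lemma cap_apply:
  fixes X :: "'n::finite tmat"
  assumes "length I = a + r"
  shows "mcomp (Suc (Suc (a + r))) (cap a r) X I J = (\<Sum>x\<in>UNIV. X (take a I @ x # x # drop a I) J)"
proof -
  have "Suc (Suc (a + r)) = a + (2 + r)" by simp
  then have "mcomp (Suc (Suc (a + r))) (cap a r) X I J
     = (\<Sum>K1\<in>words a. \<Sum>K2\<in>words 2. \<Sum>K3\<in>words r. cap a r I (K1 @ K2 @ K3) * X (K1 @ K2 @ K3) J)"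
    unfolding mcomp_def by (simp only: sum_words_add)
  also have "\<dots> = (\<Sum>K1\<in>words a. idm a (take a I) K1 * (\<Sum>K2\<in>words 2. tcap [] K2 *
       (\<Sum>K3\<in>words r. idm r (drop a I) K3 * X (K1 @ K2 @ K3) J)))"
    unfolding sum_distrib_left
    by (intro sum.cong refl) (auto simp: emb_def mtens_def words_def)
  also have "\<dots> = (\<Sum>K2\<in>words 2. tcap [] K2 * X (take a I @ K2 @ drop a I) J)"
    using assms by (simp add: sum_idm_left)
  also have "\<dots> = (\<Sum>x\<in>UNIV. \<Sum>y\<in>UNIV. if y = x then X (take a I @ x # x # drop a I) J else 0)"
    unfolding sum_words_2 by (intro sum.cong refl) (auto simp: madj_def tmat_def)
  finally show ?thesis by simp
qed

lemma cup_apply: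
  fixes X :: "'n::finite tmat"
  assumes "length J = a + r"
  shows "mcomp (Suc (Suc (a + r))) X (cup a r) I J = (\<Sum>x\<in>UNIV. X I (take a J @ x # x # drop a J))"
proof -
  have e: "mcomp (Suc (Suc (a + r))) X (cup a r) = madj (mcomp (Suc (Suc (a + r))) (cap a r) (madj X))"
    by (simp only: madj_mcomp madj_madj madj_cap)
  have "mcomp (Suc (Suc (a + r))) X (cup a r) I J = cnj (mcomp (Suc (Suc (a + r))) (cap a r) (madj X) J I)"
    unfolding e madj_def[of "mcomp (Suc (Suc (a + r))) (cap a r) (madj X)"] ..
  also have "\<dots> = cnj (\<Sum>x\<in>UNIV. madj X (take a J @ x # x # drop a J) I)"
    by (simp only: cap_apply[OF assms])
  finally show ?thesis by (simp add: madj_def)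
qed

lemma lsh_comp: "mcomp (Suc q) (emb (Suc 0) p q 0 A) (emb (Suc 0) q r 0 B) = emb (Suc 0) p r 0 (mcomp q A (B :: 'n::finite tmat))"
  using emb_comp[of 1 q 0 p A r B] by simp

lemma lsh_tmats: "A \<in> tmats p q \<Longrightarrow> emb (Suc 0) p q 0 A \<in> tmats (Suc p) (Suc q)"
  using emb_tmats[of A p q 1 0] by simp

lemma lsh_cap: "emb (Suc 0) (a + r) (Suc (Suc (a + r))) 0 (cap a r) = cap (Suc a) r"
  using emb_emb[of 1 a 0 r 2 0 tcap] by simp

lemma lsh_lsh: "emb (Suc 0) (Suc p) (Suc q) 0 (emb (Suc 0) p q 0 A) = emb (Suc (Suc 0)) p q 0 A"
  using emb_emb[of 1 1 p 0 q 0 A] by (simp add: numeral_2_eq_2)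

lemma cap_slide:
  assumes "W \<in> tmats r s"
  shows "mcomp (Suc (Suc r)) (cap 0 r) (emb (Suc (Suc 0)) r s 0 W) = mcomp s W (cap 0 s :: 'n::finite tmat)"
  using emb_commute[OF tcap_tmats assms, of 0 0 0] by (simp add: emb_00[OF assms])

lemma lsh_apply:
  fixes A :: "'n::finite tmat"
  shows "mcomp (Suc n) (emb (Suc 0) p n 0 A) X (x # I) J = (\<Sum>K\<in>words n. A (take p I) K * of_bool (drop p I = []) * X (x # K) J)"
proof -
  have "mcomp (Suc n) (emb (Suc 0) p n 0 A) X (x # I) J = (\<Sum>y\<in>UNIV. \<Sum>K\<in>words n. emb (Suc 0) p n 0 A (x # I) (y # K) * X (y # K) J)"
    unfolding mcomp_def sum_words_Suc ..
  also have "\<dots> = (\<Sum>y\<in>UNIV. if y = x then (\<Sum>K\<in>words n. A (take p I) K * of_bool (drop p I = []) * X (x # K) J) else 0)"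
    by (intro sum.cong refl) (auto simp: emb_def mtens_def idm_def words_def intro!: sum.cong)
  finally show ?thesis by simp
qed

lemma zigzag: "mcomp (Suc (Suc (Suc n))) (cap 0 (Suc n)) (cup (Suc 0) n) = (idm (Suc n) :: 'n::finite tmat)"
proof (rule tmats_eqI[where m = "Suc n" and n = "Suc n"])
  show "mcomp (Suc (Suc (Suc n))) (cap 0 (Suc n)) (cup (Suc 0) n) \<in> tmats (Suc n) (Suc n :: nat)"
    using mcomp_tmats[OF cap_tmats[of 0 "Suc n"] cup_tmats[of "Suc 0" n]] by simp
  fix I J :: "'n list" assume I: "length I = Suc n" and J: "length J = Suc n"
  obtain a I' where I': "I = a # I'" using I by (cases I) auto
  obtain b J' where J': "J = b # J'" using J by (cases J) auto
  have "mcomp (Suc (Suc (Suc n))) (cap 0 (Suc n)) (cup (Suc 0) n) I J = (\<Sum>x\<in>UNIV. cup (Suc 0) n (x # x # I) J)"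
    using cap_apply[of I 0 "Suc n" "cup (Suc 0) n" J] I by simp
  also have "\<dots> = (\<Sum>x\<in>UNIV. if x = b then of_bool (x = a \<and> I' = J') else 0)"
    using I J by (intro sum.cong refl) (auto simp: emb_def mtens_def idm_def tmat_def I' J')
  also have "\<dots> = idm (Suc n) I J" using I by (auto simp: idm_def I' J')
  finally show "mcomp (Suc (Suc (Suc n))) (cap 0 (Suc n)) (cup (Suc 0) n) I J = idm (Suc n) I J" .
qed (rule idm_tmats)

text \<open>The partial trace over the first leg.\<close>
definition ptr :: "'n::finite tmat \<Rightarrow> 'n tmat" where
  "ptr M = (\<lambda>I J. \<Sum>x\<in>UNIV. M (x # I) (x # J))"

lemma cap_lsh_cup:
  fixes M :: "'n::finite tmat"
  assumes M: "M \<in> tmats (Suc n) (Suc n)"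
  shows "mcomp (Suc (Suc n)) (cap 0 n) (mcomp (Suc (Suc n)) (emb (Suc 0) (Suc n) (Suc n) 0 M) (cup 0 n)) = ptr M"
proof (rule tmats_eqI[where m = n and n = n])
  have S: "emb (Suc 0) (Suc n) (Suc n) 0 M \<in> tmats (Suc (Suc n)) (Suc (Suc n))" using M by (rule lsh_tmats)
  show "mcomp (Suc (Suc n)) (cap 0 n) (mcomp (Suc (Suc n)) (emb (Suc 0) (Suc n) (Suc n) 0 M) (cup 0 n)) \<in> tmats n n"
    using mcomp_tmats[OF cap_tmats[of 0 n] mcomp_tmats[OF S cup_tmats[of 0 n]]] by simp
  show "ptr M \<in> tmats n n"
    unfolding ptr_def by (intro tmatsI sum.neutral) (auto simp: words_def tmatsD[OF M])
  fix I J :: "'n list" assume I: "length I = n" and J: "length J = n"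
  have "mcomp (Suc (Suc n)) (cap 0 n) (mcomp (Suc (Suc n)) (emb (Suc 0) (Suc n) (Suc n) 0 M) (cup 0 n)) I J
     = (\<Sum>x\<in>UNIV. \<Sum>y\<in>UNIV. emb (Suc 0) (Suc n) (Suc n) 0 M (x # x # I) (y # y # J))"
    using cap_apply[of I 0 n _ J] cup_apply[of J 0 n] I J by simp
  also have "\<dots> = (\<Sum>x\<in>UNIV. \<Sum>y\<in>UNIV. if y = x then M (x # I) (x # J) else 0)"
    using I J by (intro sum.cong refl) (auto simp: emb_def mtens_def idm_def)
  finally show "mcomp (Suc (Suc n)) (cap 0 n) (mcomp (Suc (Suc n)) (emb (Suc 0) (Suc n) (Suc n) 0 M) (cup 0 n)) I J = ptr M I J"
    by (simp add: ptr_def)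
qed

lemma ptr_lsh:
  fixes A :: "'n::finite tmat"
  assumes "A \<in> tmats n n"
  shows "ptr (emb (Suc 0) n n 0 A) = (\<lambda>I J. of_nat CARD('n) * A I J)"
proof (intro ext)
  fix I J :: "'n list"
  have "emb (Suc 0) n n 0 A (x # I) (x # J) = A I J" for x
    using tmatsD[OF assms, of I J]
    by (cases "length I \<le> n"; cases "length J \<le> n") (auto simp: emb_def mtens_def idm_def)
  then show "ptr (emb (Suc 0) n n 0 A) I J = of_nat CARD('n) * A I J" by (simp add: ptr_def)
qed

lemma ptr_cup_cap: 
  fixes A B :: "'n::finite tmat"
  assumes A: "A \<in> tmats (Suc n) (Suc n)" and B: "B \<in> tmats (Suc n) (Suc n)"
  shows "ptr (mcomp n (mcomp (Suc (Suc n)) (emb (Suc 0) (Suc n) (Suc n) 0 A) (cup 0 n)) (mcomp (Suc (Suc n)) (cap 0 n) (emb (Suc 0) (Suc n) (Suc n) 0 B)))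
    = mcomp (Suc n) A B"
proof (rule tmats_eqI[where m = "Suc n" and n = "Suc n"])
  let ?X = "mcomp (Suc (Suc n)) (emb (Suc 0) (Suc n) (Suc n) 0 A) (cup 0 n)"
  let ?Y = "mcomp (Suc (Suc n)) (cap 0 n) (emb (Suc 0) (Suc n) (Suc n) 0 B)"
  have XY: "mcomp n ?X ?Y \<in> tmats (Suc (Suc n)) (Suc (Suc n))"
    by (intro mcomp_tmats[where n = "n" and n' = "n"] mcomp_tmats[OF lsh_tmats[OF A] cup_tmats[of 0 n, simplified]] 
        mcomp_tmats[OF cap_tmats[of 0 n, simplified] lsh_tmats[OF B]])
  show "ptr (mcomp n ?X ?Y) \<in> tmats (Suc n) (Suc n)"
    unfolding ptr_def by (intro tmatsI sum.neutral) (auto simp: words_def tmatsD[OF XY])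
  show "mcomp (Suc n) A B \<in> tmats (Suc n) (Suc n)" using A B by (rule mcomp_tmats)
  fix I J :: "'n list" assume I: "length I = Suc n" and J: "length J = Suc n"
  have X: "?X (x # I) K = A I (x # K)" if "length K = n" for x K
  proof -
    have "?X (x # I) K = (\<Sum>y\<in>UNIV. emb (Suc 0) (Suc n) (Suc n) 0 A (x # I) (y # y # K))"
      using cup_apply[of K 0 n] that by simp
    also have "\<dots> = (\<Sum>y\<in>UNIV. if y = x then A I (x # K) else 0)"
      using I that by (intro sum.cong refl) (auto simp: emb_def mtens_def idm_def)
    finally show ?thesis by simp
  qed
  have Y: "?Y K (x # J) = B (x # K) J" if "length K = n" for x K
  proof -
    have "?Y K (x # J) = (\<Sum>y\<in>UNIV. emb (Suc 0) (Suc n) (Suc n) 0 B (y # y # K) (x # J))"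
      using cap_apply[of K 0 n] that by simp
    also have "\<dots> = (\<Sum>y\<in>UNIV. if y = x then B (x # K) J else 0)"
      using J that by (intro sum.cong refl) (auto simp: emb_def mtens_def idm_def)
    finally show ?thesis by simp
  qed
  have "ptr (mcomp n ?X ?Y) I J = (\<Sum>x\<in>UNIV. \<Sum>K\<in>words n. ?X (x # I) K * ?Y K (x # J))"
    by (simp add: ptr_def mcomp_def[of n])
  also have "\<dots> = (\<Sum>x\<in>UNIV. \<Sum>K\<in>words n. A I (x # K) * B (x # K) J)"
    by (intro sum.cong refl) (auto simp: X Y words_def)
  also have "\<dots> = mcomp (Suc n) A B I J" by (simp add: mcomp_def sum_words_Suc)
  finally show "ptr (mcomp n ?X ?Y) I J = mcomp (Suc n) A B I J" .
qed

text \<open>\<open>qnum N (n + 1)\<close> is the dimension of \<open>H\<^sub>n\<close>. The shift by one makes \<open>qnum N 0 = 0\<close> the right boundary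
  value in formulas with an empty group of legs.\<close>
fun qnum :: "real \<Rightarrow> nat \<Rightarrow> real" where
  "qnum N 0 = 0"
| "qnum N (Suc 0) = 1"
| "qnum N (Suc (Suc n)) = N * qnum N (Suc n) - qnum N n"

lemma qnum_growth: "N \<ge> 3 \<Longrightarrow> qnum N (Suc n) \<ge> 13/5 * qnum N n \<and> qnum N (Suc n) > 0 \<and> qnum N n \<ge> 0"
proof (induction n)
  case (Suc n)
  have "3 * qnum N (Suc n) \<le> N * qnum N (Suc n)" using Suc by (intro mult_right_mono) auto
  moreover have "qnum N (Suc n) \<ge> 13/5 * qnum N n" "qnum N (Suc n) > 0" using Suc by auto
  ultimately show ?case unfolding qnum.simps(3) by (intro conjI; linarith)
qed simp

section \<open>The projections onto \<open>H\<^sub>n\<close>\<close>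

text \<open>The Jones-Wenzl recursion
  \<open>P\<^sub>n\<^sub>+\<^sub>2 = 1 \<otimes> P\<^sub>n\<^sub>+\<^sub>1 - (d\<^sub>n / d\<^sub>n\<^sub>+\<^sub>1) (1 \<otimes> P\<^sub>n\<^sub>+\<^sub>1) t t\<^sup>* (1 \<otimes> P\<^sub>n\<^sub>+\<^sub>1)\<close> for the projection onto \<open>H\<^sub>n\<^sub>+\<^sub>2\<close>, the
  contraction \<open>t t\<^sup>*\<close> acting on the first two legs.\<close>
fun wenzl :: "nat \<Rightarrow> 'n::finite tmat" where
  "wenzl 0 = idm 0"
| "wenzl (Suc 0) = idm (Suc 0)"
| "wenzl (Suc (Suc n)) = (\<lambda>I J. emb (Suc 0) (Suc n) (Suc n) 0 (wenzl (Suc n)) I J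
     - complex_of_real (qnum (real CARD('n)) (Suc n) / qnum (real CARD('n)) (Suc (Suc n))) *
       mcomp n (mcomp (Suc (Suc n)) (emb (Suc 0) (Suc n) (Suc n) 0 (wenzl (Suc n))) (cup 0 n))
               (mcomp (Suc (Suc n)) (cap 0 n) (emb (Suc 0) (Suc n) (Suc n) 0 (wenzl (Suc n)))) I J)"

declare wenzl.simps(3) [simp del]

locale large_dim =
  fixes ty :: "'n::finite itself" and N :: real
  assumes card_N: "real CARD('n) = N" and dim3: "3 \<le> N"
begin

abbreviation D :: "nat \<Rightarrow> real" where "D \<equiv> qnum N"

lemma D_pos: "D (Suc n) > 0" using qnum_growth[of N n] dim3 by simp
lemma D_nonneg: "D n \<ge> 0" using qnum_growth[of N n] dim3 by simp
lemma D_growth: "13/5 * D n \<le> D (Suc n)" using qnum_growth[of N n] dim3 by simp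

abbreviation P :: "nat \<Rightarrow> 'n tmat" where "P \<equiv> wenzl"

text \<open>\<open>S n = 1 \<otimes> P\<^sub>n\<close>, and \<open>V\<close> and \<open>V'\<close> are its contractions from above and below, so that the
  correction in the recursion for \<open>P\<close> is a multiple of \<open>V' n \<circ> V n\<close>.\<close>
definition S :: "nat \<Rightarrow> 'n tmat" where "S n = emb (Suc 0) n n 0 (P n)"
definition V :: "nat \<Rightarrow> 'n tmat" where "V n = mcomp (Suc (Suc n)) (cap 0 n) (S (Suc n))"
definition V' :: "nat \<Rightarrow> 'n tmat" where "V' n = mcomp (Suc (Suc n)) (S (Suc n)) (cup 0 n)"

lemma P_SS: "P (Suc (Suc n)) = (\<lambda>I J. S (Suc n) I J - complex_of_real (D (Suc n) / D (Suc (Suc n))) * mcomp n (V' n) (V n) I J)"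
  by (simp add: wenzl.simps(3) S_def V_def V'_def card_N)

definition is_projection :: "nat \<Rightarrow> bool" where
  "is_projection n \<longleftrightarrow> P n \<in> tmats n n \<and> madj (P n) = P n \<and> mcomp n (P n) (P n) = P n"

text \<open>The partial trace of \<open>P\<^sub>n\<^sub>+\<^sub>1\<close> is a multiple of \<open>P\<^sub>n\<close>, and this multiple is what makes the
  correction term \<open>V' V\<close> a multiple of a projection. So idempotence and the
  partial trace formula have to be proved together.\<close>
lemma wenzl_step:
  assumes b0: "is_projection n" and b1: "is_projection (Suc n)"
    and ab: "mcomp (Suc n) (P (Suc n)) (S n) = P (Suc n)"
    and tr: "ptr (P (Suc n)) = (\<lambda>I J. complex_of_real (D (Suc (Suc n)) / D (Suc n)) * P n I J)"
  shows "is_projection (Suc (Suc n))"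
    and "mcomp (Suc (Suc n)) (P (Suc (Suc n))) (S (Suc n)) = P (Suc (Suc n))"
    and "ptr (P (Suc (Suc n))) = (\<lambda>I J. complex_of_real (D (Suc (Suc (Suc n))) / D (Suc (Suc n))) * P (Suc n) I J)"
    and "mcomp (Suc (Suc n)) (cap 0 n) (P (Suc (Suc n))) = (\<lambda>I J. 0)"
    and "madj (V n) = V' n" and "V n \<in> tmats n (Suc (Suc n))"
    and "mcomp (Suc (Suc n)) (S (Suc n)) (P (Suc (Suc n))) = P (Suc (Suc n))"
    and "mcomp (Suc (Suc n)) (V n) (cup 0 n) = (\<lambda>I J. complex_of_real (D (Suc (Suc n)) / D (Suc n)) * P n I J)"
proof -
  let ?m = "Suc (Suc n)"
  let ?S = "S (Suc n)"
  define c where "c = complex_of_real (D (Suc n) / D ?m)"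
  define ci where "ci = complex_of_real (D ?m / D (Suc n))"
  have cci: "c * ci = 1" using D_pos[of n] D_pos[of "Suc n"] unfolding c_def ci_def of_real_mult[symmetric] by simp
  have P1: "P (Suc n) \<in> tmats (Suc n) (Suc n)" "madj (P (Suc n)) = P (Suc n)" "mcomp (Suc n) (P (Suc n)) (P (Suc n)) = P (Suc n)"
    and P0: "P n \<in> tmats n n" "madj (P n) = P n" "mcomp n (P n) (P n) = P n"
    using b0 b1 by (auto simp: is_projection_def)
  have St: "?S \<in> tmats ?m ?m" unfolding S_def using P1(1) by (rule lsh_tmats)
  have Sadj: "madj ?S = ?S" by (simp add: S_def madj_emb P1)
  have SS: "mcomp ?m ?S ?S = ?S" by (simp add: S_def lsh_comp P1)
  have Vt: "V n \<in> tmats n ?m" unfolding V_def by (rule mcomp_tmats[OF cap_tmats[of 0 n, simplified] St])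
  have V't: "V' n \<in> tmats ?m n" unfolding V'_def by (rule mcomp_tmats[OF St cup_tmats[of 0 n, simplified]])
  have Vadj: "madj (V n) = V' n" by (simp add: V_def V'_def madj_mcomp Sadj)
  have VS: "mcomp ?m (V n) ?S = V n" by (simp add: V_def mcomp_assoc SS)
  have SV': "mcomp ?m ?S (V' n) = V' n" by (simp add: V'_def mcomp_assoc[symmetric] SS)
  have Vcup: "mcomp ?m (V n) (cup 0 n) = (\<lambda>I J. ci * P n I J)"
    unfolding V_def mcomp_assoc ci_def tr[symmetric] using cap_lsh_cup[OF P1(1)] by (simp add: S_def)
  have VV': "mcomp ?m (V n) (V' n) = (\<lambda>I J. ci * P n I J)"
    unfolding V'_def mcomp_assoc[symmetric] VS by (rule Vcup)
  have SnP: "mcomp (Suc n) (S n) (P (Suc n)) = P (Suc n)"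
  proof -
    have "madj (mcomp (Suc n) (P (Suc n)) (S n)) = madj (P (Suc n))" by (simp only: ab)
    moreover have "madj (S n) = S n" by (simp add: S_def madj_emb P0)
    ultimately show ?thesis by (simp add: madj_mcomp P1)
  qed
  have PnV: "mcomp n (P n) (V n) = V n"
  proof -
    have "mcomp n (P n) (V n) = mcomp ?m (mcomp n (P n) (cap 0 n)) ?S" by (simp add: V_def mcomp_assoc)
    also have "mcomp n (P n) (cap 0 n) = mcomp ?m (cap 0 n) (emb (Suc (Suc 0)) n n 0 (P n))"
      by (rule cap_slide[OF P0(1), symmetric])
    also have "mcomp ?m (mcomp ?m (cap 0 n) (emb (Suc (Suc 0)) n n 0 (P n))) ?S
        = mcomp ?m (cap 0 n) (mcomp ?m (emb (Suc 0) (Suc n) (Suc n) 0 (S n)) ?S)"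
      using lsh_lsh[of n n "P n"] by (simp add: mcomp_assoc S_def numeral_2_eq_2)
    also have "mcomp ?m (emb (Suc 0) (Suc n) (Suc n) 0 (S n)) ?S = ?S"
      unfolding S_def[of "Suc n"] lsh_comp SnP ..
    finally show ?thesis by (simp add: V_def)
  qed
  define T where "T = mcomp n (V' n) (V n)"
  have Tt: "T \<in> tmats ?m ?m" unfolding T_def using V't Vt by (rule mcomp_tmats)
  have Tadj: "madj T = T" by (simp add: T_def madj_mcomp Vadj[symmetric])
  have ST: "mcomp ?m ?S T = T" by (simp add: T_def mcomp_assoc[symmetric] SV')
  have TS: "mcomp ?m T ?S = T" by (simp add: T_def mcomp_assoc VS)
  have TT: "mcomp ?m T T = (\<lambda>I J. ci * T I J)"
  proof -
    have "mcomp ?m T T = mcomp n (V' n) (mcomp n (mcomp ?m (V n) (V' n)) (V n))"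
      by (simp add: T_def mcomp_assoc)
    also have "\<dots> = (\<lambda>I J. ci * T I J)"
      unfolding VV' mcomp_scale_left mcomp_scale_right PnV by (simp add: T_def)
    finally show ?thesis .
  qed
  have PS: "P ?m = (\<lambda>I J. ?S I J - c * T I J)" by (simp add: P_SS c_def T_def)
  have Pt: "P ?m \<in> tmats ?m ?m" unfolding PS using St Tt by (auto simp: tmats_def)
  have real_c: "cnj c = c" by (simp add: c_def)
  have Padj: "madj (P ?m) = P ?m"
  proof -
    have "madj (P ?m) = (\<lambda>I J. madj ?S I J - c * madj T I J)" by (simp add: PS madj_def real_c)
    then show ?thesis by (simp only: Sadj Tadj PS)
  qed
  show SP: "mcomp ?m ?S (P ?m) = P ?m"
    by (simp add: PS mcomp_diff_right mcomp_scale_right SS ST)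
  show PSab: "mcomp ?m (P ?m) ?S = P ?m"
    by (simp add: PS mcomp_diff_left mcomp_scale_left SS TS)
  have TP: "mcomp ?m T (P ?m) = (\<lambda>I J. 0)"
    unfolding PS mcomp_diff_right mcomp_scale_right TS TT using cci by (simp add: mult.assoc[symmetric])
  have PP: "mcomp ?m (P ?m) (P ?m) = P ?m"
  proof -
    have "mcomp ?m (P ?m) (P ?m) = mcomp ?m (\<lambda>I J. ?S I J - c * T I J) (P ?m)" by (simp only: PS[symmetric])
    then show ?thesis by (simp add: mcomp_diff_left mcomp_scale_left SP TP)
  qed
  show "is_projection ?m" using Pt Padj PP by (simp add: is_projection_def)
  have ptrS: "ptr ?S = (\<lambda>I J. of_nat CARD('n) * P (Suc n) I J)" unfolding S_def by (rule ptr_lsh[OF P1(1)])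
  have ptrT: "ptr T = P (Suc n)"
    unfolding T_def V'_def V_def S_def using ptr_cup_cap[OF P1(1) P1(1)] by (simp add: P1)
  have card: "of_nat CARD('n) = complex_of_real N" using card_N by (metis of_real_of_nat_eq)
  have N: "of_nat CARD('n) - c = complex_of_real (D (Suc ?m) / D ?m)"
    using D_pos[of "Suc n"] unfolding c_def card of_real_diff[symmetric] by (simp add: diff_divide_distrib)
  have "ptr (P ?m) = (\<lambda>I J. ptr ?S I J - c * ptr T I J)"
    by (simp add: PS ptr_def sum_subtractf sum_distrib_left)
  also have "\<dots> = (\<lambda>I J. (of_nat CARD('n) - c) * P (Suc n) I J)" by (simp add: ptrS ptrT left_diff_distrib)
  finally show "ptr (P ?m) = (\<lambda>I J. complex_of_real (D (Suc ?m) / D ?m) * P (Suc n) I J)" unfolding N .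
  have capT: "mcomp ?m (cap 0 n) T = (\<lambda>I J. ci * V n I J)"
  proof -
    have "mcomp ?m (cap 0 n) T = mcomp n (mcomp ?m (cap 0 n) (V' n)) (V n)" by (simp add: T_def mcomp_assoc)
    also have "mcomp ?m (cap 0 n) (V' n) = mcomp ?m (V n) (cup 0 n)" by (simp add: V'_def V_def mcomp_assoc)
    finally show ?thesis by (simp add: Vcup mcomp_scale_left PnV)
  qed
  have "mcomp ?m (cap 0 n) (P ?m) = (\<lambda>I J. mcomp ?m (cap 0 n) ?S I J - c * (ci * V n I J))"
    unfolding PS mcomp_diff_right mcomp_scale_right capT ..
  then show "mcomp ?m (cap 0 n) (P ?m) = (\<lambda>I J. 0)"
    using cci by (simp add: V_def mult.assoc[symmetric])
  show "madj (V n) = V' n" by (rule Vadj)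
  show "V n \<in> tmats n ?m" by (rule Vt)
  show "mcomp ?m (V n) (cup 0 n) = (\<lambda>I J. complex_of_real (D ?m / D (Suc n)) * P n I J)"
    using Vcup by (simp add: ci_def)
qed

lemma wenzl_all: "is_projection n \<and> is_projection (Suc n) \<and> mcomp (Suc n) (P (Suc n)) (S n) = P (Suc n)
   \<and> ptr (P (Suc n)) = (\<lambda>I J. complex_of_real (D (Suc (Suc n)) / D (Suc n)) * P n I J)"
proof (induction n)
  case 0
  have b: "is_projection 0" "is_projection (Suc 0)" by (auto simp: is_projection_def idm_tmats mcomp_idm_left[OF idm_tmats])
  have e: "idm (Suc 0) = emb (Suc 0) 0 0 0 (idm 0 :: 'n tmat)" by (simp add: emb_idm)
  have "ptr (idm (Suc 0) :: 'n tmat) = (\<lambda>I J. of_nat CARD('n) * idm 0 I J)"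
    unfolding e by (rule ptr_lsh[OF idm_tmats])
  moreover have "of_nat CARD('n) = complex_of_real N" using card_N by (metis of_real_of_nat_eq)
  ultimately show ?case using b by (simp add: S_def emb_idm mcomp_idm_left[OF idm_tmats])
next
  case (Suc n)
  then show ?case using wenzl_step[of n] by blast
qed

lemmas wenzl_facts = wenzl_step[OF wenzl_all[THEN conjunct1] wenzl_all[THEN conjunct2, THEN conjunct1]
   wenzl_all[THEN conjunct2, THEN conjunct2, THEN conjunct1] wenzl_all[THEN conjunct2, THEN conjunct2, THEN conjunct2]]

lemma P_tmats: "P n \<in> tmats n n" and P_adj: "madj (P n) = P n" and P_idem: "mcomp n (P n) (P n) = P n"
  using wenzl_all[of n] by (auto simp: is_projection_def)

lemma P_absorb: "mcomp (Suc n) (P (Suc n)) (S n) = P (Suc n)" using wenzl_all by blast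

lemma S_tmats: "S n \<in> tmats (Suc n) (Suc n)" unfolding S_def by (rule lsh_tmats[OF P_tmats])

lemma cap_P: "mcomp (Suc (Suc (a + r))) (cap a r) (P (Suc (Suc (a + r)))) = (\<lambda>I J. 0)"
proof (induction a arbitrary: r)
  case 0
  then show ?case using wenzl_facts(4)[of r] by simp
next
  case (Suc a)
  let ?m = "Suc (Suc (a + r))"
  have "mcomp (Suc ?m) (cap (Suc a) r) (P (Suc ?m)) = mcomp (Suc ?m) (mcomp (Suc ?m) (cap (Suc a) r) (S ?m)) (P (Suc ?m))"
    using wenzl_facts(7)[of "Suc (a + r)"] by (simp add: mcomp_assoc)
  also have "mcomp (Suc ?m) (cap (Suc a) r) (S ?m) = emb (Suc 0) (a + r) ?m 0 (mcomp ?m (cap a r) (P ?m))"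
    unfolding S_def lsh_cap[symmetric] by (rule lsh_comp)
  also have "\<dots> = (\<lambda>I J. 0)" unfolding Suc.IH by (rule emb_zero)
  finally show ?case by (simp add: mcomp_zero_left)
qed

lemma P_cup: "mcomp (Suc (Suc (a + r))) (P (Suc (Suc (a + r)))) (cup a r) = (\<lambda>I J. 0)"
proof -
  have "madj (mcomp (Suc (Suc (a + r))) (P (Suc (Suc (a + r)))) (cup a r)) = (\<lambda>I J. 0)"
    by (simp add: madj_mcomp P_adj cap_P)
  then have "madj (madj (mcomp (Suc (Suc (a + r))) (P (Suc (Suc (a + r)))) (cup a r))) = madj (\<lambda>I J. 0)" by simp
  then show ?thesis by (simp only: madj_madj) (simp add: madj_def)
qed

lemma P_fixes:
  assumes "M \<in> tmats n p"
    and "\<And>a r. n = Suc (Suc (a + r)) \<Longrightarrow> mcomp n (cap a r) M = (\<lambda>I J. 0)"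
  shows "mcomp n (P n) M = M"
  using assms
proof (induction n arbitrary: M rule: less_induct)
  case (less n)
  consider "n = 0" | "n = Suc 0" | k where "n = Suc (Suc k)" by (metis not0_implies_Suc)
  then show ?case
  proof cases
    case (3 k)
    have M: "M \<in> tmats (Suc (Suc k)) p" using less.prems 3 by simp
    have slice: "mcomp (Suc k) (P (Suc k)) (\<lambda>I J. M (x # I) J) = (\<lambda>I J. M (x # I) J)" for x
    proof (rule less.IH)
      show "Suc k < n" using 3 by simp
      show t: "(\<lambda>I J. M (x # I) J) \<in> tmats (Suc k) p"
        by (intro tmatsI) (auto simp: words_def tmatsD[OF M])
      fix a r assume k: "Suc k = Suc (Suc (a + r))"
      show "mcomp (Suc k) (cap a r) (\<lambda>I J. M (x # I) J) = (\<lambda>I J. 0)"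
      proof (intro ext)
        fix I J
        have t': "mcomp (Suc k) (cap a r) (\<lambda>I J. M (x # I) J) \<in> tmats (a + r) p"
          using mcomp_tmats[OF cap_tmats t] k by simp
        show "mcomp (Suc k) (cap a r) (\<lambda>I J. M (x # I) J) I J = 0"
        proof (cases "length I = a + r")
          case True
          have "mcomp (Suc k) (cap a r) (\<lambda>I J. M (x # I) J) I J = mcomp (Suc (Suc (Suc a + r))) (cap (Suc a) r) M (x # I) J"
            using True k cap_apply[of I a r "\<lambda>I J. M (x # I) J" J] cap_apply[of "x # I" "Suc a" r M J] by simp
          also have "\<dots> = 0" using less.prems(2)[of "Suc a" r] 3 k by simp
          finally show ?thesis .
        next
          case False
          then show ?thesis using tmatsD[OF t'] by blast
        qed
      qed
    qed
    have SM: "mcomp (Suc (Suc k)) (S (Suc k)) M = M"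
    proof (rule tmats_eqI[OF mcomp_tmats[OF S_tmats M] M])
      fix I J :: "'n list" assume I: "length I = Suc (Suc k)"
      then obtain x I' where I': "I = x # I'" "length I' = Suc k" by (cases I) auto
      show "mcomp (Suc (Suc k)) (S (Suc k)) M I J = M I J"
        using fun_cong[OF fun_cong[OF slice[of x], of I'], of J] I'
        unfolding S_def I'(1) lsh_apply by (simp add: mcomp_def)
    qed
    have VM: "mcomp (Suc (Suc k)) (V k) M = (\<lambda>I J. 0)"
      unfolding V_def mcomp_assoc SM using less.prems(2)[of 0 k] 3 by simp
    show ?thesis
      unfolding 3 P_SS mcomp_diff_left mcomp_scale_left mcomp_assoc SM VM mcomp_zero_right by simp
  qed (use less.prems mcomp_idm_left in auto)
qed

definition vecm :: "'n tvec \<Rightarrow> 'n tmat" where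
  "vecm \<zeta> = (\<lambda>I J. if J = [] then \<zeta> I else 0)"

lemma mcomp_vecm: "mcomp n X (vecm \<zeta>) = vecm (mapp n X \<zeta>)"
  by (auto simp: mcomp_def vecm_def mapp_def intro!: ext)

lemma vecm_inject: "vecm \<zeta> = vecm \<xi> \<longleftrightarrow> \<zeta> = \<xi>"
  by (metis vecm_def ext)

lemma cap_eq: "mtens i i (idm i) (mtens 0 2 (madj tmat) (idm (n - i - 2))) = cap i (n - i - 2)"
  by (simp add: emb_def)

text \<open>A vector annihilated by all contractions is fixed by \<open>P n\<close>, as each correction term of
  the recursion starts with a contraction. Conversely all contractions annihilate \<open>P n\<close>.\<close>
lemma Hn_iff: "\<zeta> \<in> Hn n \<longleftrightarrow> \<zeta> \<in> tvecs n \<and> mapp n (P n) \<zeta> = (\<zeta> :: 'n tvec)"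
proof
  assume H: "\<zeta> \<in> Hn n"
  then have t: "\<zeta> \<in> tvecs n" and k: "\<And>i. i + 2 \<le> n \<Longrightarrow> mapp n (cap i (n - i - 2)) \<zeta> = (\<lambda>_. 0)"
    unfolding Hn_def cap_eq by blast+
  have "mcomp n (P n) (vecm \<zeta>) = vecm \<zeta>"
  proof (rule P_fixes)
    show "vecm \<zeta> \<in> tmats n 0" using t by (auto simp: tmats_def vecm_def tvecs_def words_def)
    fix a r assume n: "n = Suc (Suc (a + r))"
    show "mcomp n (cap a r) (vecm \<zeta>) = (\<lambda>I J. 0)"
      using k[of a] n by (simp add: mcomp_vecm) (simp add: vecm_def)
  qed
  then show "\<zeta> \<in> tvecs n \<and> mapp n (P n) \<zeta> = \<zeta>" using t by (simp add: mcomp_vecm vecm_inject)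
next
  assume H: "\<zeta> \<in> tvecs n \<and> mapp n (P n) \<zeta> = \<zeta>"
  have "mapp n (cap i (n - i - 2)) \<zeta> = (\<lambda>_. 0)" if i: "i + 2 \<le> n" for i
  proof -
    obtain r where n: "n = Suc (Suc (i + r))" using i by (metis add_2_eq_Suc' add.assoc add.commute le_Suc_ex)
    have "vecm (mapp n (cap i r) \<zeta>) = mcomp n (cap i r) (mcomp n (P n) (vecm \<zeta>))"
      using H by (simp add: mcomp_vecm)
    also have "\<dots> = (\<lambda>I J. 0)" using cap_P[of i r] n by (simp add: mcomp_assoc[symmetric] mcomp_zero_left)
    also have "\<dots> = vecm (\<lambda>_. 0)" by (auto simp: vecm_def)
    finally show ?thesis using n by (simp add: vecm_inject)
  qed
  then show "\<zeta> \<in> Hn n" using H unfolding Hn_def cap_eq by blast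
qed

lemma proj_eq: "proj n = P n"
  unfolding proj_def
proof (rule the_equality)
  have "{\<zeta> \<in> tvecs n. mapp n (P n) \<zeta> = \<zeta>} = Hn n" using Hn_iff by blast
  then show "P n \<in> tmats n n \<and> madj (P n) = P n \<and> mcomp n (P n) (P n) = P n \<and> {\<zeta> \<in> tvecs n. mapp n (P n) \<zeta> = \<zeta>} = Hn n"
    by (simp add: P_tmats P_adj P_idem)
next
  fix Q :: "'n tmat"
  assume "Q \<in> tmats n n \<and> madj Q = Q \<and> mcomp n Q Q = Q \<and> {\<zeta> \<in> tvecs n. mapp n Q \<zeta> = \<zeta>} = Hn n"
  then have Q: "Q \<in> tmats n n" "madj Q = Q" "mcomp n Q Q = Q" "\<And>\<zeta>. \<zeta> \<in> Hn n \<longleftrightarrow> \<zeta> \<in> tvecs n \<and> mapp n Q \<zeta> = \<zeta>" by blast+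
  have col: "mapp n X (\<lambda>I. Y I J) = (\<lambda>I. mcomp n X Y I J)" for X Y :: "'n tmat" and J by (simp add: mapp_def mcomp_def)
  have tv: "(\<lambda>I. X I J) \<in> tvecs n" if "X \<in> tmats n n" for X :: "'n tmat" and J using that by (auto simp: tmats_def tvecs_def)
  have "mcomp n Q (P n) = P n"
  proof (intro ext)
    fix I J
    have "(\<lambda>I. P n I J) \<in> Hn n" unfolding Hn_iff using tv[OF P_tmats] by (simp add: col P_idem)
    then have "mapp n Q (\<lambda>I. P n I J) = (\<lambda>I. P n I J)" using Q(4) by blast
    then show "mcomp n Q (P n) I J = P n I J" by (simp add: col fun_eq_iff)
  qed
  moreover have "mcomp n (P n) Q = Q"
  proof (intro ext)
    fix I J
    have "(\<lambda>I. Q I J) \<in> Hn n" unfolding Q(4) using tv[OF Q(1)] by (simp add: col Q(3))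
    then have "mapp n (P n) (\<lambda>I. Q I J) = (\<lambda>I. Q I J)" using Hn_iff by blast
    then show "mcomp n (P n) Q I J = Q I J" by (simp add: col fun_eq_iff)
  qed
  moreover have "madj (mcomp n (P n) Q) = mcomp n Q (P n)" by (simp add: madj_mcomp Q P_adj)
  ultimately show "Q = P n" using Q(2) by simp
qed

text \<open>Iterating the recursion inside \<open>V n\<close> moves the contraction to the right one leg at a time.
  Up to \<open>P n\<close> on the output side, the projection below the contraction then disappears.\<close>
lemma V_expand:
  "V n = mcomp n (P n) (\<lambda>I J. \<Sum>l\<le>n. ((-1)^l * complex_of_real (D (Suc n - l) / D (Suc n))) * cap l (n - l) I J)"
proof (induction n)
  case 0
  have "V 0 = cap 0 0"
    unfolding V_def S_def using mcomp_idm_right[OF cap_tmats[of 0 0, simplified]] by (simp add: emb_idm)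
  then show ?case by (simp add: mcomp_idm_left[OF cap_tmats[of 0 0, simplified]])
next
  case (Suc n)
  let ?m = "Suc (Suc n)"
  define c where "c = complex_of_real (D (Suc n) / D ?m)"
  define k where "k l = (-1)^l * complex_of_real (D (Suc n - l) / D (Suc n))" for l
  define E :: "'n tmat" where "E = (\<lambda>I J. \<Sum>l\<le>n. k l * cap l (n - l) I J)"
  have IH: "V n = mcomp n (P n) E" using Suc by (simp add: E_def k_def)
  have emb1E: "emb (Suc 0) n ?m 0 E = (\<lambda>I J. \<Sum>l\<le>n. k l * cap (Suc l) (n - l) I J)"
  proof -
    have "emb (Suc 0) n ?m 0 (cap l (n - l) :: 'n tmat) = cap (Suc l) (n - l)" if "l \<le> n" for l
      using lsh_cap[of l "n - l"] that by simp
    then show ?thesis unfolding E_def emb_sum emb_scale by (intro ext sum.cong) auto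
  qed
  have emb1V: "emb (Suc 0) n ?m 0 (V n) = mcomp (Suc n) (S n) (emb (Suc 0) n ?m 0 E)"
    unfolding IH S_def lsh_comp ..
  define U where "U = mcomp n (cup 0 n) (V n)"
  have Ut: "emb (Suc 0) ?m ?m 0 U = mcomp (Suc n) (cup (Suc 0) n) (emb (Suc 0) n ?m 0 (V n))"
  proof -
    have "emb (Suc 0) ?m n 0 (cup 0 n) = (cup (Suc 0) n :: 'n tmat)"
      using emb_emb[of "Suc 0" 0 2 n 0 0 tmat] by simp
    then show ?thesis unfolding U_def lsh_comp[symmetric] by simp
  qed
  have "P ?m = (\<lambda>I J. S (Suc n) I J - c * mcomp ?m (S (Suc n)) U I J)"
    unfolding P_SS c_def U_def V'_def mcomp_assoc ..
  then have "S ?m = (\<lambda>I J. emb (Suc 0) ?m ?m 0 (S (Suc n)) I J - c * mcomp (Suc ?m) (emb (Suc 0) ?m ?m 0 (S (Suc n))) (emb (Suc 0) ?m ?m 0 U) I J)"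
    unfolding S_def[of ?m] by (simp only: emb_diff emb_scale lsh_comp)
  moreover have "emb (Suc 0) ?m ?m 0 (S (Suc n)) = emb (Suc (Suc 0)) (Suc n) (Suc n) 0 (P (Suc n))"
    unfolding S_def using lsh_lsh[of "Suc n" "Suc n" "P (Suc n)"] by simp
  ultimately have "V (Suc n) = (\<lambda>I J. mcomp (Suc n) (P (Suc n)) (cap 0 (Suc n)) I J
      - c * mcomp (Suc ?m) (mcomp (Suc n) (P (Suc n)) (cap 0 (Suc n))) (emb (Suc 0) ?m ?m 0 U) I J)"
    unfolding V_def using cap_slide[OF P_tmats[of "Suc n"]]
    by (simp only: mcomp_diff_right mcomp_scale_right mcomp_assoc[symmetric])
  also have "mcomp (Suc ?m) (mcomp (Suc n) (P (Suc n)) (cap 0 (Suc n))) (emb (Suc 0) ?m ?m 0 U)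
      = mcomp (Suc n) (P (Suc n)) (mcomp (Suc n) (mcomp (Suc ?m) (cap 0 (Suc n)) (cup (Suc 0) n)) (emb (Suc 0) n ?m 0 (V n)))"
    unfolding Ut by (simp only: mcomp_assoc)
  also have "\<dots> = mcomp (Suc n) (P (Suc n)) (emb (Suc 0) n ?m 0 (V n))"
    unfolding zigzag mcomp_idm_left[OF lsh_tmats[OF wenzl_facts(6)]] ..
  also have "\<dots> = mcomp (Suc n) (P (Suc n)) (emb (Suc 0) n ?m 0 E)"
    unfolding emb1V mcomp_assoc[symmetric] P_absorb ..
  also have "(\<lambda>I J. mcomp (Suc n) (P (Suc n)) (cap 0 (Suc n)) I J - c * mcomp (Suc n) (P (Suc n)) (emb (Suc 0) n ?m 0 E) I J)
     = mcomp (Suc n) (P (Suc n)) (\<lambda>I J. cap 0 (Suc n) I J - c * emb (Suc 0) n ?m 0 E I J)"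
    unfolding mcomp_diff_right mcomp_scale_right ..
  also have "(\<lambda>I J. cap 0 (Suc n) I J - c * emb (Suc 0) n ?m 0 E I J)
     = (\<lambda>I J. \<Sum>l\<le>Suc n. ((-1)^l * complex_of_real (D (Suc (Suc n) - l) / D (Suc (Suc n)))) * cap l (Suc n - l) I J)"
  proof (intro ext)
    fix I J :: "'n list"
    have ck: "c * (k l * z) = (-1)^l * complex_of_real (D (Suc n - l) / D ?m) * z" for l z
      using D_pos[of n] by (simp add: c_def k_def)
    show "cap 0 (Suc n) I J - c * emb (Suc 0) n ?m 0 E I J
       = (\<Sum>l\<le>Suc n. ((-1)^l * complex_of_real (D (Suc (Suc n) - l) / D (Suc (Suc n)))) * cap l (Suc n - l) I J)"
      unfolding emb1E sum_distrib_left ck sum.atMost_Suc_shift[where n = n]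
      using D_pos[of "Suc n"] by (simp add: sum_negf)
  qed
  finally show ?case .
qed

end

section \<open>The rotation and bent matrices\<close>

text \<open>The rotation without the projection \<open>P\<^sub>n\<close>, which acts as the identity on the matrices considered
  below: the first input leg becomes the first output leg and the last output leg the last input leg.\<close>
definition rot :: "nat \<Rightarrow> 'n::finite tmat \<Rightarrow> 'n tmat" where
  "rot k X = (\<lambda>I J. if length I = k \<and> length J = k then X (tl I @ [last J]) (hd I # butlast J) else 0)"

definition rot_inv :: "nat \<Rightarrow> 'n::finite tmat \<Rightarrow> 'n tmat" where
  "rot_inv k X = (\<lambda>I J. if length I = k \<and> length J = k then X (hd J # butlast I) (tl J @ [last I]) else 0)"

lemma emb1_apply:
  assumes "length J = n" "length I = p"
  shows "emb (Suc 0) p n 0 A (x # I) (y # J) = (if x = y then A I J else 0)"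
  using assms by (auto simp: emb_def mtens_def idm_def)

lemma emb_right1_apply:
  assumes "length J = n" "length I = p"
  shows "emb 0 p n (Suc 0) A (I @ [x]) (J @ [y]) = (if x = y then A I J else 0)"
  using assms by (auto simp: emb_def mtens_def idm_def)

text \<open>The first output leg of \<open>X\<close> bent to the input side, and the last one.\<close>

definition bend_left :: "nat \<Rightarrow> 'n::finite tmat \<Rightarrow> 'n tmat" where
  "bend_left k X = mcomp (Suc (Suc k)) (cap 0 k) (emb (Suc 0) (Suc k) (Suc k) 0 X)"

definition bend_right :: "nat \<Rightarrow> 'n::finite tmat \<Rightarrow> 'n tmat" where
  "bend_right k X = mcomp (Suc (Suc k)) (cap k 0) (emb 0 (Suc k) (Suc k) (Suc 0) X)"

text \<open>The properties of elements of \<open>B(H\<^sub>k\<^sub>+\<^sub>1)\<^sup>\<circ>\<^sup>\<circ>\<close> needed in diagrammatic computations: neighbouring legs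
  on the same side cannot be contracted, and neither can the first or last output leg with
  the input leg opposite to it.\<close>
locale traceless =
  fixes k :: nat and X :: "'n::finite tmat"
  assumes X: "X \<in> tmats (Suc k) (Suc k)"
    and cap_X: "\<And>a r. k = Suc (a + r) \<Longrightarrow> mcomp (Suc k) (cap a r) X = (\<lambda>I J. 0)"
    and X_cup: "\<And>a r. k = Suc (a + r) \<Longrightarrow> mcomp (Suc k) X (cup a r) = (\<lambda>I J. 0)"
    and tr_first: "\<And>I J. (\<Sum>x\<in>UNIV. X (x # I) (x # J)) = 0"
    and tr_last: "\<And>I J. (\<Sum>x\<in>UNIV. X (I @ [x]) (J @ [x])) = 0"
begin

abbreviation "L \<equiv> bend_left k X"
abbreviation "R \<equiv> bend_right k X"

lemma L_tmats: "L \<in> tmats k (Suc (Suc k))"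
  unfolding bend_left_def by (rule mcomp_tmats[OF cap_tmats[of 0 k, simplified] lsh_tmats[OF X]])

lemma R_tmats: "R \<in> tmats k (Suc (Suc k))"
  unfolding bend_right_def
  by (rule mcomp_tmats[OF cap_tmats[of k 0, simplified] emb_tmats[OF X, of 0 "Suc 0", simplified]])

lemma L_apply:
  assumes "length I = k" "length J = Suc k"
  shows "L I (h # J) = X (h # I) J"
proof -
  have "L I (h # J) = (\<Sum>x\<in>UNIV. emb (Suc 0) (Suc k) (Suc k) 0 X (x # x # I) (h # J))"
    unfolding bend_left_def using cap_apply[of I 0 k _ "h # J"] assms by simp
  also have "\<dots> = (\<Sum>x\<in>UNIV. if x = h then X (x # I) J else 0)"
    using assms by (simp only: emb1_apply length_Cons)
  finally show ?thesis by simp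
qed

lemma R_apply:
  assumes "length I = k" "length J = Suc k"
  shows "R I (J @ [h]) = X (I @ [h]) J"
proof -
  have "R I (J @ [h]) = (\<Sum>x\<in>UNIV. emb 0 (Suc k) (Suc k) (Suc 0) X ((I @ [x]) @ [x]) (J @ [h]))"
    unfolding bend_right_def using cap_apply[of I k 0 _ "J @ [h]"] assms by simp
  also have "\<dots> = (\<Sum>x\<in>UNIV. if x = h then X (I @ [x]) J else 0)"
    using assms by (subst emb_right1_apply) auto
  finally show ?thesis by simp
qed

lemma rot_tmats: "rot (Suc k) X \<in> tmats (Suc k) (Suc k)" "rot_inv (Suc k) X \<in> tmats (Suc k) (Suc k)"
  by (auto simp: tmats_def words_def rot_def rot_inv_def)

text \<open>Straightening the bent leg gives back \<open>X\<close> on one side and a rotated \<open>X\<close> on the other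
  side.\<close>
lemma L_snake: "mcomp (Suc (Suc (Suc k))) (emb (Suc 0) k (Suc (Suc k)) 0 L) (cup 0 (Suc k)) = X"
proof (rule tmats_eqI[OF _ X])
  show "mcomp (Suc (Suc (Suc k))) (emb (Suc 0) k (Suc (Suc k)) 0 L) (cup 0 (Suc k)) \<in> tmats (Suc k) (Suc k)"
    by (rule mcomp_tmats[OF lsh_tmats[OF L_tmats] cup_tmats[of 0 "Suc k", simplified]])
  fix I J :: "'n list" assume I: "length I = Suc k" and J: "length J = Suc k"
  obtain h I' where I': "I = h # I'" "length I' = k" using I by (cases I) auto
  have "mcomp (Suc (Suc (Suc k))) (emb (Suc 0) k (Suc (Suc k)) 0 L) (cup 0 (Suc k)) I J
      = (\<Sum>x\<in>UNIV. emb (Suc 0) k (Suc (Suc k)) 0 L (h # I') (x # x # J))"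
    using cup_apply[of J 0 "Suc k" _ I] J I' by simp
  also have "\<dots> = (\<Sum>x\<in>UNIV. if x = h then L I' (h # J) else 0)"
    using I' J by (intro sum.cong refl) (auto simp: emb1_apply)
  finally show "mcomp (Suc (Suc (Suc k))) (emb (Suc 0) k (Suc (Suc k)) 0 L) (cup 0 (Suc k)) I J = X I J"
    using I' J by (simp add: L_apply)
qed

text \<open>The contraction of the bent leg with its neighbour is the partial trace of \<open>X\<close>; the other
  contractions are contractions of input legs of \<open>X\<close>.\<close>
lemma L_cup:
  assumes "b \<le> k"
  shows "mcomp (Suc (Suc k)) L (cup b (k - b)) = (\<lambda>I J. 0)"
proof -
  have t: "mcomp (Suc (Suc k)) L (cup b (k - b)) \<in> tmats k k"
    using mcomp_tmats[OF L_tmats cup_tmats[of b "k - b"]] assms by simp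
  show ?thesis
  proof (rule tmats_eqI[OF t])
    show "(\<lambda>I J. 0) \<in> tmats k k" by (auto simp: tmats_def)
    fix I J :: "'n list" assume I: "length I = k" and J: "length J = k"
    have e: "mcomp (Suc (Suc k)) L (cup b (k - b)) I J = (\<Sum>x\<in>UNIV. L I (take b J @ x # x # drop b J))"
      using cup_apply[of J b "k - b" L I] assms J by simp
    show "mcomp (Suc (Suc k)) L (cup b (k - b)) I J = 0"
    proof (cases b)
      case 0
      then show ?thesis unfolding e using I J by (simp add: L_apply tr_first)
    next
      case (Suc c)
      then obtain h J' where J': "J = h # J'" "k = Suc (length J')" using J assms by (cases J) auto
      then have k: "k = Suc (c + (length J' - c))" using Suc assms by auto
      have "(\<Sum>x\<in>UNIV. L I (take b J @ x # x # drop b J)) = (\<Sum>x\<in>UNIV. X (h # I) (take c J' @ x # x # drop c J'))"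
      proof (intro sum.cong refl)
        fix x
        have "L I (h # (take c J' @ x # x # drop c J')) = X (h # I) (take c J' @ x # x # drop c J')"
          by (rule L_apply) (use I J' k in auto)
        then show "L I (take b J @ x # x # drop b J) = X (h # I) (take c J' @ x # x # drop c J')"
          using Suc J'(1) by simp
      qed
      also have "\<dots> = mcomp (Suc (Suc (c + (length J' - c)))) X (cup c (length J' - c)) (h # I) J'"
        using J' Suc assms by (subst cup_apply) auto
      also have "\<dots> = 0" using X_cup[OF k] k by metis
      finally show ?thesis unfolding e .
    qed
  qed
qed

lemma L_rot: "mcomp (Suc (Suc (Suc k))) (emb 0 k (Suc (Suc k)) (Suc 0) L) (cup (Suc k) 0) = rot_inv (Suc k) X"
proof (rule tmats_eqI[OF _ rot_tmats(2)])
  show "mcomp (Suc (Suc (Suc k))) (emb 0 k (Suc (Suc k)) (Suc 0) L) (cup (Suc k) 0) \<in> tmats (Suc k) (Suc k)"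
    using mcomp_tmats[OF emb_tmats[OF L_tmats, of 0 "Suc 0"] cup_tmats[of "Suc k" 0]] by simp
  fix I J :: "'n list" assume I: "length I = Suc k" and J: "length J = Suc k"
  obtain g I' where I': "I = I' @ [g]" "length I' = k" using I by (cases I rule: rev_cases) auto
  obtain h J' where J': "J = h # J'" "length J' = k" using J by (cases J) auto
  have "mcomp (Suc (Suc (Suc k))) (emb 0 k (Suc (Suc k)) (Suc 0) L) (cup (Suc k) 0) I J
      = (\<Sum>x\<in>UNIV. emb 0 k (Suc (Suc k)) (Suc 0) L (I' @ [g]) ((J @ [x]) @ [x]))"
    using cup_apply[of J "Suc k" 0 _ I] J I' by simp
  also have "\<dots> = (\<Sum>x\<in>UNIV. if x = g then L I' (h # (J' @ [g])) else 0)"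
    using I' J J' by (intro sum.cong refl, subst emb_right1_apply) auto
  finally show "mcomp (Suc (Suc (Suc k))) (emb 0 k (Suc (Suc k)) (Suc 0) L) (cup (Suc k) 0) I J = rot_inv (Suc k) X I J"
    using I' J' by (simp add: L_apply rot_inv_def)
qed

lemma R_rot: "mcomp (Suc (Suc (Suc k))) (emb (Suc 0) k (Suc (Suc k)) 0 R) (cup 0 (Suc k)) = rot (Suc k) X"
proof (rule tmats_eqI[OF _ rot_tmats(1)])
  show "mcomp (Suc (Suc (Suc k))) (emb (Suc 0) k (Suc (Suc k)) 0 R) (cup 0 (Suc k)) \<in> tmats (Suc k) (Suc k)"
    by (rule mcomp_tmats[OF lsh_tmats[OF R_tmats] cup_tmats[of 0 "Suc k", simplified]])
  fix I J :: "'n list" assume I: "length I = Suc k" and J: "length J = Suc k"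
  obtain h I' where I': "I = h # I'" "length I' = k" using I by (cases I) auto
  obtain g J' where J': "J = J' @ [g]" "length J' = k" using J by (cases J rule: rev_cases) auto
  have "mcomp (Suc (Suc (Suc k))) (emb (Suc 0) k (Suc (Suc k)) 0 R) (cup 0 (Suc k)) I J
      = (\<Sum>x\<in>UNIV. emb (Suc 0) k (Suc (Suc k)) 0 R (h # I') (x # x # J))"
    using cup_apply[of J 0 "Suc k" _ I] J I' by simp
  also have "\<dots> = (\<Sum>x\<in>UNIV. if x = h then R I' ((h # J') @ [g]) else 0)"
    using I' J J' by (intro sum.cong refl) (auto simp: emb1_apply)
  also have "\<dots> = X (I' @ [g]) (h # J')" using I' J' by (subst R_apply) auto
  finally show "mcomp (Suc (Suc (Suc k))) (emb (Suc 0) k (Suc (Suc k)) 0 R) (cup 0 (Suc k)) I J = rot (Suc k) X I J"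
    using I' J' by (simp add: rot_def)
qed

lemma R_cup:
  assumes "b \<le> k"
  shows "mcomp (Suc (Suc k)) R (cup b (k - b)) = (\<lambda>I J. 0)"
proof -
  have t: "mcomp (Suc (Suc k)) R (cup b (k - b)) \<in> tmats k k"
    using mcomp_tmats[OF R_tmats cup_tmats[of b "k - b"]] assms by simp
  show ?thesis
  proof (rule tmats_eqI[OF t])
    show "(\<lambda>I J. 0) \<in> tmats k k" by (auto simp: tmats_def)
    fix I J :: "'n list" assume I: "length I = k" and J: "length J = k"
    have e: "mcomp (Suc (Suc k)) R (cup b (k - b)) I J = (\<Sum>x\<in>UNIV. R I (take b J @ x # x # drop b J))"
      using cup_apply[of J b "k - b" R I] assms J by simp
    show "mcomp (Suc (Suc k)) R (cup b (k - b)) I J = 0"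
    proof (cases "b = k")
      case True
      have "(\<Sum>x\<in>UNIV. R I (take b J @ x # x # drop b J)) = (\<Sum>x\<in>UNIV. R I ((J @ [x]) @ [x]))"
        using True J by simp
      also have "\<dots> = (\<Sum>x\<in>UNIV. X (I @ [x]) (J @ [x]))"
        using I J by (intro sum.cong refl R_apply) auto
      finally show ?thesis unfolding e by (simp add: tr_last)
    next
      case False
      then obtain g J' where J': "J = J' @ [g]" "k = Suc (length J')" using J assms by (cases J rule: rev_cases) auto
      then have k: "k = Suc (b + (length J' - b))" using False assms by auto
      have "(\<Sum>x\<in>UNIV. R I (take b J @ x # x # drop b J)) = (\<Sum>x\<in>UNIV. R I ((take b J' @ x # x # drop b J') @ [g]))"
        using J' False assms by simp
      also have "\<dots> = (\<Sum>x\<in>UNIV. X (I @ [g]) (take b J' @ x # x # drop b J'))"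
        using I J' False assms by (intro sum.cong refl R_apply) auto
      also have "\<dots> = mcomp (Suc (Suc (b + (length J' - b)))) X (cup b (length J' - b)) (I @ [g]) J'"
        using J' k by (subst cup_apply) auto
      also have "\<dots> = 0" using X_cup[OF k] k by metis
      finally show ?thesis unfolding e .
    qed
  qed
qed

lemma R_snake: "mcomp (Suc (Suc (Suc k))) (emb 0 k (Suc (Suc k)) (Suc 0) R) (cup (Suc k) 0) = X"
proof (rule tmats_eqI[OF _ X])
  show "mcomp (Suc (Suc (Suc k))) (emb 0 k (Suc (Suc k)) (Suc 0) R) (cup (Suc k) 0) \<in> tmats (Suc k) (Suc k)"
    using mcomp_tmats[OF emb_tmats[OF R_tmats, of 0 "Suc 0"] cup_tmats[of "Suc k" 0]] by simp
  fix I J :: "'n list" assume I: "length I = Suc k" and J: "length J = Suc k"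
  obtain g I' where I': "I = I' @ [g]" "length I' = k" using I by (cases I rule: rev_cases) auto
  have "mcomp (Suc (Suc (Suc k))) (emb 0 k (Suc (Suc k)) (Suc 0) R) (cup (Suc k) 0) I J
      = (\<Sum>x\<in>UNIV. emb 0 k (Suc (Suc k)) (Suc 0) R (I' @ [g]) ((J @ [x]) @ [x]))"
    using cup_apply[of J "Suc k" 0 _ I] J I' by simp
  also have "\<dots> = (\<Sum>x\<in>UNIV. if x = g then R I' (J @ [g]) else 0)"
    using I' J by (intro sum.cong refl, subst emb_right1_apply) auto
  finally show "mcomp (Suc (Suc (Suc k))) (emb 0 k (Suc (Suc k)) (Suc 0) R) (cup (Suc k) 0) I J = X I J"
    using I' J by (simp add: R_apply)
qed

end

text \<open>Products of the bent matrices, placed among identity legs, with a cup in any position.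
  In the remaining positions the cup slides to the output side.\<close>

lemma emb_bent_cup:
  fixes i j b k :: nat and B X\<^sub>l X\<^sub>r :: "'n::finite tmat"
  defines "m \<equiv> i + k + j"
  defines "Z \<equiv> mcomp (Suc (Suc m)) (emb i k (Suc (Suc k)) j B) (cup b (m - b))"
  assumes b: "b \<le> m" and B: "B \<in> tmats k (Suc (Suc k))"
    and left: "mcomp (Suc (Suc (Suc k))) (emb (Suc 0) k (Suc (Suc k)) 0 B) (cup 0 (Suc k)) = X\<^sub>l"
    and right: "mcomp (Suc (Suc (Suc k))) (emb 0 k (Suc (Suc k)) (Suc 0) B) (cup (Suc k) 0) = X\<^sub>r"
    and inner: "\<And>b. b \<le> k \<Longrightarrow> mcomp (Suc (Suc k)) B (cup b (k - b)) = (\<lambda>I J. 0)"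
  shows "i = Suc b \<Longrightarrow> Z = emb b (Suc k) (Suc k) j X\<^sub>l"
    and "j = Suc j' \<Longrightarrow> b = i + Suc k \<Longrightarrow> Z = emb i (Suc k) (Suc k) j' X\<^sub>r"
    and "i \<le> b \<Longrightarrow> b \<le> i + k \<Longrightarrow> Z = (\<lambda>I J. 0)"
    and "b + 2 \<le> i \<or> i + Suc (Suc k) \<le> b \<Longrightarrow> \<exists>a r Z'. Z = mcomp (a + r) (cup a r) Z' \<and> m = Suc (Suc (a + r))"
proof -
  show "Z = emb b (Suc k) (Suc k) j X\<^sub>l" if "i = Suc b"
  proof -
    have "emb i k (Suc (Suc k)) j B = emb b (Suc k) (Suc (Suc (Suc k))) j (emb (Suc 0) k (Suc (Suc k)) 0 B)"
      using emb_emb[of b "Suc 0" k 0 "Suc (Suc k)" j B] that by simp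
    moreover have "(cup b (m - b) :: 'n tmat) = emb b (Suc (Suc (Suc k))) (Suc k) j (cup 0 (Suc k))"
      using emb_emb[of b 0 2 "Suc k" 0 j "tmat :: 'n tmat"] that by (simp add: m_def)
    moreover have "Suc (Suc m) = b + Suc (Suc (Suc k)) + j" using that by (simp add: m_def)
    ultimately show ?thesis unfolding Z_def by (simp only: emb_comp left)
  qed
  show "Z = emb i (Suc k) (Suc k) j' X\<^sub>r" if "j = Suc j'" "b = i + Suc k"
  proof -
    have "emb i k (Suc (Suc k)) j B = emb i (Suc k) (Suc (Suc (Suc k))) j' (emb 0 k (Suc (Suc k)) (Suc 0) B)"
      using emb_emb[of i 0 k "Suc 0" "Suc (Suc k)" j' B] that by simp
    moreover have "(cup b (m - b) :: 'n tmat) = emb i (Suc (Suc (Suc k))) (Suc k) j' (cup (Suc k) 0)"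
      using emb_emb[of i "Suc k" 2 0 0 j' "tmat :: 'n tmat"] that by (simp add: m_def)
    moreover have "Suc (Suc m) = i + Suc (Suc (Suc k)) + j'" using that by (simp add: m_def)
    ultimately show ?thesis unfolding Z_def by (simp only: emb_comp right)
  qed
  show "Z = (\<lambda>I J. 0)" if "i \<le> b" "b \<le> i + k"
  proof -
    have "(cup b (m - b) :: 'n tmat) = emb i (Suc (Suc k)) k j (cup (b - i) (k - (b - i)))"
      using emb_emb[of i "b - i" 2 "k - (b - i)" 0 j "tmat :: 'n tmat"] that by (simp add: m_def add.commute[of i k])
    moreover have "Suc (Suc m) = i + Suc (Suc k) + j" by (simp add: m_def)
    moreover have "b - i \<le> k" using that by simp
    ultimately show ?thesis unfolding Z_def by (simp only: emb_comp inner emb_zero)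
  qed
  show "\<exists>a r Z'. Z = mcomp (a + r) (cup a r) Z' \<and> m = Suc (Suc (a + r))" if "b + 2 \<le> i \<or> i + Suc (Suc k) \<le> b"
    using that
  proof
    assume "b + 2 \<le> i"
    then obtain s where s: "i = b + 2 + s" using le_Suc_ex by blast
    have "Z = mcomp (b + (s + k + j)) (cup b (s + k + j)) (emb (b + s) k (Suc (Suc k)) j B)"
      unfolding Z_def m_def s using emb_commute[OF tmat_tmats B, of b s j] by (simp add: add.assoc)
    moreover have "m = Suc (Suc (b + (s + k + j)))" by (simp add: m_def s)
    ultimately show ?thesis by blast
  next
    assume "i + Suc (Suc k) \<le> b"
    then obtain s where s: "b = i + Suc (Suc k) + s" using le_Suc_ex by blast
    then have "j = s + 2 + (j - (s + 2))" using b by (simp add: m_def)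
    then obtain r where r: "j = s + 2 + r" by blast
    have "Z = mcomp ((i + k + s) + r) (cup (i + k + s) r) (emb i k (Suc (Suc k)) (s + r) B)"
      unfolding Z_def m_def s r using emb_commute[OF B tmat_tmats, of i s r] by (simp add: add.assoc)
    moreover have "m = Suc (Suc ((i + k + s) + r))" by (simp add: m_def r)
    ultimately show ?thesis by blast
  qed
qed

section \<open>Left multiplication by the fundamental character\<close>

declare qnum.simps(3) [simp del]

text \<open>The multiplication is a parameter because left and right
  multiplication by \<open>\<chi>\<^sub>1\<close> are treated together: the second case is the first one for the opposite
  multiplication, for which the same relations hold.\<close>
locale FO_mul = large_dim ty N for ty :: "'n::finite itself" and N :: real +
  fixes mul :: "'a::cstar_algebra \<Rightarrow> 'a \<Rightarrow> 'a" and u :: "'n \<Rightarrow> 'n \<Rightarrow> 'a"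
  assumes mul_add_left: "\<And>x y z. mul (x + y) z = mul x z + mul y z"
    and mul_add_right: "\<And>x y z. mul x (y + z) = mul x y + mul x z"
    and mul_scale_left: "\<And>c x y. mul (c *\<^sub>C x) y = c *\<^sub>C mul x y"
    and mul_scale_right: "\<And>c x y. mul x (c *\<^sub>C y) = c *\<^sub>C mul x y"
    and mul_assoc: "\<And>x y z. mul (mul x y) z = mul x (mul y z)"
    and mul_one: "\<And>x. mul 1 x = x" "\<And>x. mul x 1 = x"
    and row_rel: "\<And>i j. (\<Sum>k\<in>UNIV. mul (u i k) (u j k)) = of_bool (i = j)"
    and col_rel: "\<And>i j. (\<Sum>k\<in>UNIV. mul (u k i) (u k j)) = of_bool (i = j)"
begin

lemma mul_sum_left: "mul (\<Sum>i\<in>A. f i) y = (\<Sum>i\<in>A. mul (f i) y)"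
proof -
  interpret additive "\<lambda>x. mul x y" by unfold_locales (rule mul_add_left)
  show ?thesis by (rule sum)
qed

lemma mul_sum_right: "mul y (\<Sum>i\<in>A. f i) = (\<Sum>i\<in>A. mul y (f i))"
proof -
  interpret additive "mul y" by unfold_locales (rule mul_add_right)
  show ?thesis by (rule sum)
qed

definition uw :: "'n list \<Rightarrow> 'n list \<Rightarrow> 'a" where
  "uw I J = foldr mul (map2 u I J) 1"

lemma uw_simps [simp]: "uw [] [] = 1" "uw (a # I) (b # J) = mul (u a b) (uw I J)"
  by (simp_all add: uw_def)

lemma uw_append: "length I = length J \<Longrightarrow> uw (I @ I') (J @ J') = mul (uw I J) (uw I' J')"
  by (induction I J rule: list_induct2) (simp_all add: mul_one mul_assoc)

text \<open>The map \<open>u\<^sub>n\<close> on all matrices, without the projection.\<close>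
definition U :: "nat \<Rightarrow> 'n tmat \<Rightarrow> 'a" where
  "U n X = (\<Sum>I\<in>words n. \<Sum>J\<in>words n. X J I *\<^sub>C uw I J)"

lemma U_diff: "U n (\<lambda>I J. X I J - Y I J) = U n X - U n Y"
  by (simp add: U_def scaleC.scale_left_diff_distrib sum_subtractf)
lemma U_scale: "U n (\<lambda>I J. c * X I J) = c *\<^sub>C U n X"
  by (simp add: U_def scaleC.scale_sum_right scaleC_scaleC)
lemma U_sum: "U n (\<lambda>I J. \<Sum>l\<in>A. X l I J) = (\<Sum>l\<in>A. U n (X l))"
  unfolding U_def scaleC.scale_sum_left by (simp add: sum.swap[of _ "words n" A])
lemma U_zero: "U n (\<lambda>I J. 0) = 0" by (simp add: U_def)

text \<open>\<open>A\<close> intertwines the tensor powers \<open>m\<close> and \<open>n\<close> of the matrix \<open>u\<close>.\<close>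
definition intertwines :: "nat \<Rightarrow> nat \<Rightarrow> 'n tmat \<Rightarrow> bool" where
  "intertwines m n A \<longleftrightarrow> (\<forall>I\<in>words m. \<forall>J\<in>words n.
     (\<Sum>K\<in>words n. A I K *\<^sub>C uw K J) = (\<Sum>K\<in>words m. A K J *\<^sub>C uw I K))"

text \<open>The coefficient map behaves like a trace with respect to intertwiners. This moves
  projections and contractions from one side of a matrix to the other.\<close>
lemma U_swap:
  assumes "intertwines m n A"
  shows "U m (mcomp n A Z) = U n (mcomp m Z A)"
proof -
  have "U m (mcomp n A Z) = (\<Sum>I\<in>words m. \<Sum>J\<in>words m. \<Sum>K\<in>words n. (A J K * Z K I) *\<^sub>C uw I J)"
    by (simp add: U_def mcomp_def scaleC.scale_sum_left)
  also have "\<dots> = (\<Sum>I\<in>words m. \<Sum>K\<in>words n. Z K I *\<^sub>C (\<Sum>J\<in>words m. A J K *\<^sub>C uw I J))"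
    by (simp add: scaleC.scale_sum_right scaleC_scaleC mult.commute sum.swap[of _ "words m" "words n"])
  also have "\<dots> = (\<Sum>I\<in>words m. \<Sum>K\<in>words n. Z K I *\<^sub>C (\<Sum>J\<in>words n. A I J *\<^sub>C uw J K))"
    using assms unfolding intertwines_def by (intro sum.cong refl) simp
  also have "\<dots> = (\<Sum>I\<in>words m. \<Sum>K\<in>words n. \<Sum>J\<in>words n. (Z K I * A I J) *\<^sub>C uw J K)"
    by (simp add: scaleC.scale_sum_right scaleC_scaleC)
  also have "\<dots> = (\<Sum>I\<in>words m. \<Sum>J\<in>words n. \<Sum>K\<in>words n. (Z K I * A I J) *\<^sub>C uw J K)"
    by (intro sum.cong refl sum.swap)
  also have "\<dots> = (\<Sum>J\<in>words n. \<Sum>I\<in>words m. \<Sum>K\<in>words n. (Z K I * A I J) *\<^sub>C uw J K)"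
    by (rule sum.swap)
  also have "\<dots> = (\<Sum>J\<in>words n. \<Sum>K\<in>words n. \<Sum>I\<in>words m. (Z K I * A I J) *\<^sub>C uw J K)"
    by (intro sum.cong refl sum.swap)
  also have "\<dots> = U n (mcomp m Z A)"
    by (simp add: U_def mcomp_def scaleC.scale_sum_left)
  finally show ?thesis .
qed

lemma intertwines_idm: "intertwines n n (idm n)"
proof -
  have 1: "(\<Sum>K\<in>words n. idm n I K *\<^sub>C uw K J) = uw I J" if "I \<in> words n" for I J
  proof -
    have "(\<Sum>K\<in>words n. idm n I K *\<^sub>C uw K J) = (\<Sum>K\<in>words n. if K = I then uw K J else 0)"
      using that by (intro sum.cong) (auto simp: idm_def words_def)
    then show ?thesis using that by simp
  qed
  have 2: "(\<Sum>K\<in>words n. idm n K J *\<^sub>C uw I K) = uw I J" if "J \<in> words n" for I J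
  proof -
    have "(\<Sum>K\<in>words n. idm n K J *\<^sub>C uw I K) = (\<Sum>K\<in>words n. if K = J then uw I K else 0)"
      using that by (intro sum.cong) (auto simp: idm_def words_def)
    then show ?thesis using that by simp
  qed
  show ?thesis by (simp add: intertwines_def 1 2)
qed

lemma of_bool_scale: "of_bool b *\<^sub>C (1::'a) = of_bool b" by (cases b) auto

lemma sum_if_diag: "(\<Sum>x\<in>UNIV. \<Sum>y\<in>UNIV. if y = x then f x else 0) = (\<Sum>x\<in>(UNIV :: 'n set). f x :: 'a)"
  by simp

lemma intertwines_tmat: "intertwines 2 0 tmat"
  unfolding intertwines_def
proof (intro ballI)
  fix I J :: "'n list" assume "I \<in> words 2" "J \<in> words 0"
  then obtain a b where I: "I = [a, b]" and J: "J = []"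
    by (auto simp: words_def length_Suc_conv numeral_2_eq_2)
  have "(\<Sum>K\<in>words 2. tmat K J *\<^sub>C uw I K) = (\<Sum>x\<in>UNIV. \<Sum>y\<in>UNIV. if y = x then mul (u a x) (u b x) else 0)"
    unfolding sum_words_2 I J by (intro sum.cong refl) (auto simp: tmat_def mul_one)
  also have "\<dots> = of_bool (a = b)" unfolding sum_if_diag by (rule row_rel)
  finally show "(\<Sum>K\<in>words 0. tmat I K *\<^sub>C uw K J) = (\<Sum>K\<in>words 2. tmat K J *\<^sub>C uw I K)"
    by (auto simp: words_0 I J tmat_def of_bool_scale)
qed

lemma intertwines_tcap: "intertwines 0 2 tcap"
  unfolding intertwines_def
proof (intro ballI)
  fix I J :: "'n list" assume "I \<in> words 0" "J \<in> words 2"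
  then obtain a b where J: "J = [a, b]" and I: "I = []"
    by (auto simp: words_def length_Suc_conv numeral_2_eq_2)
  have "(\<Sum>K\<in>words 2. tcap I K *\<^sub>C uw K J) = (\<Sum>x\<in>UNIV. \<Sum>y\<in>UNIV. if y = x then mul (u x a) (u x b) else 0)"
    unfolding sum_words_2 I J by (intro sum.cong refl) (auto simp: tmat_def madj_def mul_one)
  also have "\<dots> = of_bool (a = b)" unfolding sum_if_diag by (rule col_rel)
  finally show "(\<Sum>K\<in>words 2. tcap I K *\<^sub>C uw K J) = (\<Sum>K\<in>words 0. tcap K J *\<^sub>C uw I K)"
    by (auto simp: words_0 I J tmat_def madj_def of_bool_scale)
qed

lemma intertwines_mtens:
  assumes A: "intertwines m n A" and B: "intertwines m' n' B"
  shows "intertwines (m + m') (n + n') (mtens m n A B)"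
  unfolding intertwines_def
proof (intro ballI)
  fix I J :: "'n list" assume IJ: "I \<in> words (m + m')" "J \<in> words (n + n')"
  define I1 I2 J1 J2 where "I1 = take m I" and "I2 = drop m I" and "J1 = take n J" and "J2 = drop n J"
  then have I: "I = I1 @ I2" "I1 \<in> words m" "I2 \<in> words m'" and J: "J = J1 @ J2" "J1 \<in> words n" "J2 \<in> words n'"
    using IJ by (auto simp: words_def)
  have "(\<Sum>K\<in>words (n + n'). mtens m n A B I K *\<^sub>C uw K J)
     = (\<Sum>K1\<in>words n. \<Sum>K2\<in>words n'. mul (A I1 K1 *\<^sub>C uw K1 J1) (B I2 K2 *\<^sub>C uw K2 J2))"
    unfolding sum_words_add using I J
    by (intro sum.cong refl) (auto simp: mtens_def words_def uw_append mul_scale_left mul_scale_right scaleC_scaleC)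
  also have "\<dots> = mul (\<Sum>K1\<in>words n. A I1 K1 *\<^sub>C uw K1 J1) (\<Sum>K2\<in>words n'. B I2 K2 *\<^sub>C uw K2 J2)"
    unfolding mul_sum_left unfolding mul_sum_right ..
  also have "\<dots> = mul (\<Sum>K1\<in>words m. A K1 J1 *\<^sub>C uw I1 K1) (\<Sum>K2\<in>words m'. B K2 J2 *\<^sub>C uw I2 K2)"
    using A B I J by (simp add: intertwines_def)
  also have "\<dots> = (\<Sum>K1\<in>words m. \<Sum>K2\<in>words m'. mul (A K1 J1 *\<^sub>C uw I1 K1) (B K2 J2 *\<^sub>C uw I2 K2))"
    unfolding mul_sum_left unfolding mul_sum_right ..
  also have "\<dots> = (\<Sum>K\<in>words (m + m'). mtens m n A B K J *\<^sub>C uw I K)"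
    unfolding sum_words_add using I J
    by (intro sum.cong refl) (auto simp: mtens_def words_def uw_append mul_scale_left mul_scale_right scaleC_scaleC)
  finally show "(\<Sum>K\<in>words (n + n'). mtens m n A B I K *\<^sub>C uw K J) = (\<Sum>K\<in>words (m + m'). mtens m n A B K J *\<^sub>C uw I K)" .
qed

lemma intertwines_emb: "intertwines p q M \<Longrightarrow> intertwines (i + p + j) (i + q + j) (emb i p q j M)"
  unfolding emb_def add.assoc by (intro intertwines_mtens intertwines_idm)

lemma intertwines_cap: "intertwines (a + r) (Suc (Suc (a + r))) (cap a r)"
  using intertwines_emb[OF intertwines_tcap, of a r] by simp
lemma intertwines_cup: "intertwines (Suc (Suc (a + r))) (a + r) (cup a r)"
  using intertwines_emb[OF intertwines_tmat, of a r] by simp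

lemma intertwines_comp:
  assumes A: "intertwines m n A" and B: "intertwines n p B"
  shows "intertwines m p (mcomp n A B)"
  unfolding intertwines_def
proof (intro ballI)
  fix I J :: "'n list" assume I: "I \<in> words m" and J: "J \<in> words p"
  have "(\<Sum>K\<in>words p. mcomp n A B I K *\<^sub>C uw K J) = (\<Sum>H\<in>words n. A I H *\<^sub>C (\<Sum>K\<in>words p. B H K *\<^sub>C uw K J))"
    by (simp add: mcomp_def scaleC.scale_sum_left scaleC.scale_sum_right scaleC_scaleC sum.swap[of _ "words p" "words n"])
  also have "\<dots> = (\<Sum>H\<in>words n. A I H *\<^sub>C (\<Sum>K\<in>words n. B K J *\<^sub>C uw H K))"
    using B J by (intro sum.cong refl) (simp add: intertwines_def)
  also have "\<dots> = (\<Sum>K\<in>words n. B K J *\<^sub>C (\<Sum>H\<in>words n. A I H *\<^sub>C uw H K))"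
    unfolding scaleC.scale_sum_right scaleC_scaleC by (subst sum.swap) (simp add: mult.commute)
  also have "\<dots> = (\<Sum>K\<in>words n. B K J *\<^sub>C (\<Sum>H\<in>words m. A H K *\<^sub>C uw I H))"
    using A I by (intro sum.cong refl) (simp add: intertwines_def)
  also have "\<dots> = (\<Sum>K\<in>words m. mcomp n A B K J *\<^sub>C uw I K)"
    unfolding mcomp_def scaleC.scale_sum_left scaleC.scale_sum_right scaleC_scaleC by (subst sum.swap) (simp add: mult.commute)
  finally show "(\<Sum>K\<in>words p. mcomp n A B I K *\<^sub>C uw K J) = (\<Sum>K\<in>words m. mcomp n A B K J *\<^sub>C uw I K)" .
qed

lemma intertwines_diff_scale:
  assumes "intertwines m n A" and "intertwines m n B"
  shows "intertwines m n (\<lambda>I J. A I J - c * B I J)"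
proof -
  have e: "(x - c * y) *\<^sub>C v = x *\<^sub>C v - c *\<^sub>C (y *\<^sub>C v)" for x y and v :: 'a
    by (simp add: scaleC.scale_left_diff_distrib scaleC_scaleC)
  show ?thesis
    using assms unfolding intertwines_def by (simp only: e sum_subtractf scaleC.scale_sum_right[symmetric]) simp
qed

lemma intertwines_P: "intertwines n n (P n)" and intertwines_S: "intertwines (Suc n) (Suc n) (S n)"
proof -
  have lsh: "intertwines (Suc p) (Suc q) (emb (Suc 0) p q 0 A)" if "intertwines p q A" for p q A
    using intertwines_emb[OF that, of "Suc 0" 0] by simp
  show "intertwines n n (P n)"
  proof (induction n rule: less_induct)
    case (less n)
    consider "n = 0" | "n = Suc 0" | k where "n = Suc (Suc k)" by (metis not0_implies_Suc)
    then show ?case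
    proof cases
      case (3 k)
      then have "intertwines (Suc (Suc k)) (Suc (Suc k)) (S (Suc k))"
        unfolding S_def using less by (intro lsh) auto
      then show ?thesis unfolding 3 P_SS V_def V'_def
        using intertwines_cap[of 0 k] intertwines_cup[of 0 k] by (intro intertwines_diff_scale intertwines_comp) auto
    qed (auto simp: intertwines_idm)
  qed
  then show "intertwines (Suc n) (Suc n) (S n)" unfolding S_def by (rule lsh)
qed

lemma intertwines_V: "intertwines n (Suc (Suc n)) (V n)"
  unfolding V_def using intertwines_cap[of 0 n] intertwines_S[of "Suc n"] by (intro intertwines_comp) auto

definition chi :: 'a where "chi = (\<Sum>i\<in>UNIV. u i i)"

lemma chi_U: "mul chi (U n X) = U (Suc n) (emb (Suc 0) n n 0 X)"
proof -
  have "U (Suc n) (emb (Suc 0) n n 0 X) = (\<Sum>a\<in>UNIV. \<Sum>I\<in>words n. \<Sum>b\<in>UNIV. if b = a then (\<Sum>J\<in>words n. X J I *\<^sub>C mul (u a a) (uw I J)) else 0)"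
    unfolding U_def sum_words_Suc
    by (intro sum.cong refl) (auto simp: emb1_apply words_def intro!: sum.cong sum.neutral)
  also have "\<dots> = mul chi (U n X)"
    unfolding chi_def mul_sum_left unfolding U_def mul_sum_right mul_scale_right by simp
  finally show ?thesis ..
qed

lemma V'_expand:
  "V' n = mcomp n (\<lambda>I J. \<Sum>l\<le>n. ((-1)^l * complex_of_real (D (Suc n - l) / D (Suc n))) * cup l (n - l) I J) (P n)"
proof -
  have "madj (\<lambda>I J. \<Sum>l\<le>n. ((-1)^l * complex_of_real (D (Suc n - l) / D (Suc n))) * cap l (n - l) I J)
     = (\<lambda>I J. \<Sum>l\<le>n. ((-1)^l * complex_of_real (D (Suc n - l) / D (Suc n))) * (cup l (n - l) :: 'n tmat) I J)"
    unfolding madj_cap[symmetric] by (simp add: madj_def)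
  moreover have "V' n = madj (V n)" using wenzl_facts(5)[of n] by simp
  ultimately show ?thesis unfolding V_expand[of n] madj_mcomp P_adj by simp
qed

text \<open>An inserted vector \<open>t\<close> on the output side can be moved to the input side, where it meets the projection.\<close>
lemma U_cup_zero: "U (Suc (Suc (a + r))) (mcomp (Suc (Suc (a + r))) (mcomp (a + r) (cup a r) Z) (P (Suc (Suc (a + r))))) = 0"
  unfolding mcomp_assoc U_swap[OF intertwines_cup] by (simp add: P_cup mcomp_zero_right U_zero)

text \<open>By the expansion of \<open>V'\<close>, the vector \<open>t\<close> is inserted at each possible place. It survives only
  directly next to the bent matrix, on the left with the result \<open>X\<^sub>l\<close> and on the right with the
  result \<open>X\<^sub>r\<close>.\<close>
lemma U_bent:
  fixes i j k :: nat and B X\<^sub>l X\<^sub>r :: "'n tmat"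
  assumes m: "m = i + k + j" and B: "B \<in> tmats k (Suc (Suc k))"
    and left: "mcomp (Suc (Suc (Suc k))) (emb (Suc 0) k (Suc (Suc k)) 0 B) (cup 0 (Suc k)) = X\<^sub>l"
    and right: "mcomp (Suc (Suc (Suc k))) (emb 0 k (Suc (Suc k)) (Suc 0) B) (cup (Suc k) 0) = X\<^sub>r"
    and inner: "\<And>b. b \<le> k \<Longrightarrow> mcomp (Suc (Suc k)) B (cup b (k - b)) = (\<lambda>I J. 0)"
  defines "\<kappa> \<equiv> \<lambda>b. (-1)^b * complex_of_real (D (Suc m - b) / D (Suc m))"
  shows "U m (mcomp (Suc (Suc m)) (emb i k (Suc (Suc k)) j B) (V' m))
    = (if i = 0 then 0 else \<kappa> (i-1) *\<^sub>C U m (mcomp m (emb (i-1) (Suc k) (Suc k) j X\<^sub>l) (P m)))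
    + (if j = 0 then 0 else \<kappa> (i + Suc k) *\<^sub>C U m (mcomp m (emb i (Suc k) (Suc k) (j-1) X\<^sub>r) (P m)))"
proof -
  note bent = emb_bent_cup[of _ i k j B X\<^sub>l X\<^sub>r, OF _ B left right inner, folded m]
  define Wl where "Wl = U m (mcomp m (emb (i-1) (Suc k) (Suc k) j X\<^sub>l) (P m))"
  define Wr where "Wr = U m (mcomp m (emb i (Suc k) (Suc k) (j-1) X\<^sub>r) (P m))"
  define Z where "Z b = mcomp (Suc (Suc m)) (emb i k (Suc (Suc k)) j B) (cup b (m - b))" for b
  have "U m (mcomp (Suc (Suc m)) (emb i k (Suc (Suc k)) j B) (V' m))
     = (\<Sum>b\<le>m. \<kappa> b *\<^sub>C U m (mcomp m (Z b) (P m)))"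
    unfolding V'_expand Z_def mcomp_assoc[symmetric] mcomp_sum_right mcomp_sum_left mcomp_scale_right mcomp_scale_left
      U_sum U_scale \<kappa>_def ..
  also have "\<dots> = (\<Sum>b\<le>m. (if b = i - 1 then (if i = 0 then 0 else \<kappa> (i-1) *\<^sub>C Wl) else 0)
       + (if b = i + Suc k then (if j = 0 then 0 else \<kappa> (i + Suc k) *\<^sub>C Wr) else 0))"
  proof (rule sum.cong[OF refl])
    fix b assume "b \<in> {..m}"
    then have b: "b \<le> m" by simp
    consider "i = Suc b" | "b = i + Suc k" | "i \<le> b" "b \<le> i + k" | "b + 2 \<le> i \<or> i + Suc (Suc k) \<le> b"
      by linarith
    then show "\<kappa> b *\<^sub>C U m (mcomp m (Z b) (P m)) = (if b = i - 1 then (if i = 0 then 0 else \<kappa> (i-1) *\<^sub>C Wl) else 0)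
       + (if b = i + Suc k then (if j = 0 then 0 else \<kappa> (i + Suc k) *\<^sub>C Wr) else 0)"
    proof cases
      case 1
      then show ?thesis using bent(1)[OF b _ 1] by (simp add: Z_def Wl_def)
    next
      case 2
      then obtain j' where j: "j = Suc j'" using b m by (cases j) auto
      have "Z b = emb i (Suc k) (Suc k) j' X\<^sub>r" using bent(2)[OF b _ j 2] by (simp add: Z_def)
      moreover have "Suc (i + k) \<noteq> i - Suc 0" by linarith
      ultimately show ?thesis using 2 j by (simp add: Wr_def)
    next
      case 3
      then have "Z b = (\<lambda>I J. 0)" using bent(3)[OF b] by (simp add: Z_def)
      then show ?thesis using 3 by (cases "i = 0") (auto simp: mcomp_zero_left U_zero)
    next
      case 4
      then obtain a r Z' where "Z b = mcomp (a + r) (cup a r) Z'" "m = Suc (Suc (a + r))"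
        using bent(4)[OF b] by (auto simp: Z_def)
      then have "U m (mcomp m (Z b) (P m)) = 0" using U_cup_zero by simp
      then show ?thesis using 4 by auto
    qed
  qed
  also have "\<dots> = (if i = 0 then 0 else \<kappa> (i-1) *\<^sub>C Wl) + (if j = 0 then 0 else \<kappa> (i + Suc k) *\<^sub>C Wr)"
  proof -
    have "i - 1 \<le> m" "j \<noteq> 0 \<Longrightarrow> i + Suc k \<le> m" using m by auto
    then show ?thesis unfolding sum.distrib by (auto simp: sum.delta)
  qed
  finally show ?thesis unfolding Wl_def Wr_def .
qed

lemma cap_V':
  assumes "1 \<le> l" "l \<le> m"
  shows "mcomp (Suc (Suc m)) (cap l (m - l)) (V' m) = (\<lambda>I J. 0)"
proof -
  obtain a r where l: "l = Suc a" and m: "m = Suc (a + r)" and r: "m - l = r"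
    using assms by (cases l) (auto dest: le_Suc_ex)
  have "mcomp (Suc (Suc m)) (cap (Suc a) r) (S (Suc m)) = emb (Suc 0) (a + r) (Suc m) 0 (mcomp (Suc m) (cap a r) (P (Suc m)))"
    unfolding S_def lsh_cap[symmetric] m by (rule lsh_comp)
  also have "\<dots> = (\<lambda>I J. 0)" unfolding m cap_P by (rule emb_zero)
  finally show ?thesis unfolding V'_def mcomp_assoc[symmetric] r unfolding l by (simp only: mcomp_zero_left)
qed

text \<open>The element of the algebra whose vector is \<open>w\<^sub>i\<^sub>j\<close> for \<open>w = u\<^sub>k(X)\<close>. One of the two projections is
  absorbed by the other one, thanks to \<open>U_swap\<close>.\<close>
definition Wel :: "nat \<Rightarrow> 'n tmat \<Rightarrow> nat \<Rightarrow> nat \<Rightarrow> 'a" where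
  "Wel k X i j = U (i + k + j) (mcomp (i + k + j) (emb i k k j X) (P (i + k + j)))"

text \<open>Multiplying by \<open>\<chi>\<^sub>1\<close> adds an identity leg on the left, and the recursion compares
  \<open>1 \<otimes> P\<^sub>n\<close> with \<open>P\<^sub>n\<^sub>+\<^sub>1\<close>. In the correction term \<open>V\<close> is moved to the other side and
  expanded into contractions.\<close>
lemma chi_Wel:
  assumes X: "X \<in> tmats k k" and n: "i + k + j = Suc m"
  shows "mul chi (Wel k X i j) = Wel k X (Suc i) j
    + (\<Sum>l\<le>m. ((-1)^l * complex_of_real (D (Suc m - l) / D (Suc (Suc m)))) *\<^sub>C
        U m (mcomp (Suc (Suc m)) (mcomp (Suc (Suc m)) (cap l (m - l)) (emb (Suc i) k k j X)) (V' m)))"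
proof -
  let ?n = "Suc m" and ?N = "Suc (Suc m)"
  define Y where "Y = emb (Suc i) k k j X"
  define c where "c = complex_of_real (D ?n / D ?N)"
  have Y: "emb (Suc 0) ?n ?n 0 (emb i k k j X) = Y"
    unfolding Y_def using emb_emb[of "Suc 0" i k j k 0 X] n by simp
  have "mul chi (Wel k X i j) = U ?N (mcomp ?N Y (S ?n))"
    unfolding Wel_def n chi_U lsh_comp[symmetric] Y S_def ..
  moreover have "Wel k X (Suc i) j = U ?N (mcomp ?N Y (S ?n)) - c *\<^sub>C U ?N (mcomp m (mcomp ?N Y (V' m)) (V m))"
  proof -
    have "Suc i + k + j = ?N" using n by simp
    then show ?thesis
      unfolding Wel_def Y_def[symmetric] by (simp only: P_SS mcomp_diff_right mcomp_scale_right U_diff U_scale c_def mcomp_assoc)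
  qed
  moreover have "U ?N (mcomp m (mcomp ?N Y (V' m)) (V m)) = U m (mcomp ?N (V m) (mcomp ?N Y (V' m)))"
    by (rule U_swap[OF intertwines_V, symmetric])
  moreover have "c *\<^sub>C U m (mcomp ?N (V m) (mcomp ?N Y (V' m)))
      = (\<Sum>l\<le>m. ((-1)^l * complex_of_real (D (Suc m - l) / D ?N)) *\<^sub>C
        U m (mcomp ?N (mcomp ?N (cap l (m - l)) Y) (V' m)))"
  proof -
    have V'P: "mcomp m (V' m) (P m) = V' m"
      unfolding V'_expand mcomp_assoc P_idem ..
    have "U m (mcomp ?N (V m) (mcomp ?N Y (V' m))) =
       (\<Sum>l\<le>m. ((-1)^l * complex_of_real (D (Suc m - l) / D ?n)) *\<^sub>C U m (mcomp m (P m) (mcomp ?N (cap l (m - l)) (mcomp ?N Y (V' m)))))"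
      unfolding V_expand[of m] mcomp_assoc mcomp_sum_left mcomp_sum_right mcomp_scale_left mcomp_scale_right U_sum U_scale ..
    also have "\<dots> = (\<Sum>l\<le>m. ((-1)^l * complex_of_real (D (Suc m - l) / D ?n)) *\<^sub>C U m (mcomp ?N (mcomp ?N (cap l (m - l)) Y) (V' m)))"
      unfolding U_swap[OF intertwines_P] mcomp_assoc V'P ..
    finally have E: "U m (mcomp ?N (V m) (mcomp ?N Y (V' m))) = (\<Sum>l\<le>m. ((-1)^l * complex_of_real (D (Suc m - l) / D ?n)) *\<^sub>C U m (mcomp ?N (mcomp ?N (cap l (m - l)) Y) (V' m)))" .
    have "c * ((-1)^l * complex_of_real (y / D ?n)) = (-1)^l * complex_of_real (y / D ?N)" for l y
      using D_pos[of m] by (simp add: c_def)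
    then show ?thesis unfolding E scaleC.scale_sum_right scaleC_scaleC by (simp only:)
  qed
  ultimately show ?thesis unfolding Y_def by simp
qed

context
  fixes k :: nat and X :: "'n tmat" and \<mu> \<mu>' :: complex
  assumes X: "traceless k X"
    and rot_X: "rot (Suc k) X = (\<lambda>I J. \<mu> * X I J)"
    and rot_inv_X: "rot_inv (Suc k) X = (\<lambda>I J. \<mu>' * X I J)"
begin

interpretation traceless k X by (rule X)

text \<open>The contraction \<open>cap l\<close> meets two identity legs on the left of \<open>X\<close>, the first leg of \<open>X\<close>, two legs
  of \<open>X\<close>, the last leg of \<open>X\<close>, or two legs on the right of \<open>X\<close>. In the first and last case it slides
  through to \<open>V'\<close>, which it annihilates unless \<open>l = 0\<close>; in the second and fourth case it bends a
  leg of \<open>X\<close>.\<close>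
lemma residual_terms:
  assumes m: "m = i + k + j" and l: "l \<le> m"
  defines "RL \<equiv> U m (mcomp (Suc (Suc m)) (emb i k (Suc (Suc k)) j (bend_left k X)) (V' m))"
    and "RR \<equiv> U m (mcomp (Suc (Suc m)) (emb (Suc i) k (Suc (Suc k)) (j-1) (bend_right k X)) (V' m))"
  shows "U m (mcomp (Suc (Suc m)) (mcomp (Suc (Suc m)) (cap l (m - l)) (emb (Suc i) (Suc k) (Suc k) j X)) (V' m))
    = (if l = 0 then (if i = 0 then 0 else complex_of_real (D (Suc (Suc m)) / D (Suc m)) *\<^sub>C Wel (Suc k) X (i-1) j) else 0)
      + (if l = i then RL else 0) + (if l = i + Suc k then (if j = 0 then 0 else RR) else 0)"
proof -
  let ?N = "Suc (Suc m)"
  let ?Z = "mcomp ?N (cap l (m - l)) (emb (Suc i) (Suc k) (Suc k) j X) :: 'n tmat"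
  have N: "?N = Suc i + Suc k + j" using m by simp
  consider (a) "l < i" | (b) "l = i" | (c) "i < l" "l < i + Suc k" | (d) "l = i + Suc k" | (e) "i + Suc k < l" by linarith
  then show ?thesis
  proof cases
    case a
    then obtain s where s: "Suc i = l + 2 + s" by (metis add_2_eq_Suc' add_Suc le_Suc_ex less_eq_Suc_le)
    have "?Z = mcomp m (emb (l + s) (Suc k) (Suc k) j X) (cap l (m - l))"
      using emb_commute[OF tcap_tmats X, of l s j] m s
      by (simp add: add.assoc numeral_2_eq_2)
    then have e: "mcomp ?N ?Z (V' m) = mcomp m (emb (l + s) (Suc k) (Suc k) j X) (mcomp ?N (cap l (m - l)) (V' m))"
      by (simp only: mcomp_assoc)
    show ?thesis
    proof (cases l)
      case 0
      have "mcomp ?N (cap 0 m) (V' m) = mcomp ?N (V m) (cup 0 m)" by (simp add: V_def V'_def mcomp_assoc)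
      also have "\<dots> = (\<lambda>I J. complex_of_real (D ?N / D (Suc m)) * P m I J)" by (rule wenzl_facts(8))
      finally have cv: "mcomp ?N (cap 0 m) (V' m) = (\<lambda>I J. complex_of_real (D ?N / D (Suc m)) * P m I J)" .
      have "U m (mcomp ?N ?Z (V' m)) = complex_of_real (D ?N / D (Suc m)) *\<^sub>C U m (mcomp m (emb s (Suc k) (Suc k) j X) (P m))"
        unfolding e unfolding 0 diff_zero cv mcomp_scale_right U_scale add_0 ..
      moreover have "s = i - 1" "i - 1 + Suc k + j = m" using s 0 a m by auto
      ultimately show ?thesis using a 0 by (simp add: Wel_def)
    next
      case (Suc l')
      then have "mcomp ?N (cap l (m - l)) (V' m) = (\<lambda>I J. 0)" using l by (intro cap_V') auto
      then show ?thesis unfolding e using Suc a by (simp add: mcomp_zero_right U_zero)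
    qed
  next
    case b
    have "?Z = emb i k (Suc (Suc k)) j (bend_left k X)"
    proof -
      have "(cap l (m - l) :: 'n tmat) = emb i k (Suc (Suc k)) j (cap 0 k)"
        using emb_emb[of i 0 0 k 2 j "tcap :: 'n tmat"] b m by simp
      moreover have "emb (Suc i) (Suc k) (Suc k) j X = emb i (Suc (Suc k)) (Suc (Suc k)) j (emb (Suc 0) (Suc k) (Suc k) 0 X)"
        using emb_emb[of i "Suc 0" "Suc k" 0 "Suc k" j X] by simp
      moreover have "?N = i + Suc (Suc k) + j" using m by simp
      ultimately show ?thesis by (simp only: emb_comp bend_left_def)
    qed
    then show ?thesis using b by (cases "i = 0") (simp_all add: RL_def)
  next
    case c
    define r where "r = i + k - l"
    have k: "k = Suc ((l - Suc i) + r)" using c by (auto simp: r_def)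
    have "?Z = emb (Suc i) (l - Suc i + r) (Suc k) j (mcomp (Suc k) (cap (l - Suc i) r) X)"
    proof -
      have "(cap l (m - l) :: 'n tmat) = emb (Suc i) (l - Suc i + r) (Suc k) j (cap (l - Suc i) r)"
        using emb_emb[of "Suc i" "l - Suc i" 0 r 2 j "tcap :: 'n tmat"] c m by (simp add: r_def)
      then show ?thesis unfolding N by (simp only: emb_comp)
    qed
    also have "\<dots> = (\<lambda>I J. 0)" unfolding cap_X[OF k] by (rule emb_zero)
    finally show ?thesis using c by (simp add: mcomp_zero_left U_zero)
  next
    case d
    then obtain j' where j: "j = Suc j'" using l m by (cases j) auto
    have "?Z = emb (Suc i) k (Suc (Suc k)) j' (bend_right k X)"
    proof -
      have "(cap l (m - l) :: 'n tmat) = emb (Suc i) k (Suc (Suc k)) j' (cap k 0)"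
        using emb_emb[of "Suc i" k 0 0 2 j' "tcap :: 'n tmat"] d m j by simp
      moreover have "emb (Suc i) (Suc k) (Suc k) j X = emb (Suc i) (Suc (Suc k)) (Suc (Suc k)) j' (emb 0 (Suc k) (Suc k) (Suc 0) X)"
        using emb_emb[of "Suc i" 0 "Suc k" "Suc 0" "Suc k" j' X] j by simp
      moreover have "?N = Suc i + Suc (Suc k) + j'" using m j by simp
      ultimately show ?thesis by (simp only: emb_comp bend_right_def)
    qed
    then show ?thesis using d j by (simp add: RR_def)
  next
    case e
    then obtain s where s: "l = Suc i + Suc k + s" by (metis add_Suc le_Suc_ex less_eq_Suc_le)
    define r where "r = m - l"
    have j: "j = s + (2 + r)" using s l m by (simp add: r_def)
    have "?Z = mcomp m (emb (Suc i) (Suc k) (Suc k) (s + r) X) (cap l (m - l))"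
      using emb_commute[OF X tcap_tmats, of "Suc i" s r] s j m by (simp add: add.assoc numeral_2_eq_2)
    moreover have "mcomp ?N (cap l (m - l)) (V' m) = (\<lambda>I J. 0)" using l s by (intro cap_V') auto
    ultimately have "mcomp ?N ?Z (V' m) = (\<lambda>I J. 0)" by (simp only: mcomp_assoc mcomp_zero_right)
    then show ?thesis using e by (simp add: U_zero)
  qed
qed

text \<open>The bent matrices contribute \<open>w\<^sub>i\<^sub>-\<^sub>1\<^sub>,\<^sub>j\<close> and \<open>w\<^sub>i\<^sub>+\<^sub>1\<^sub>,\<^sub>j\<^sub>-\<^sub>2\<close> when they are straightened back to \<open>X\<close>,
  and \<open>w\<^sub>i\<^sub>,\<^sub>j\<^sub>-\<^sub>1\<close> when they are straightened to a rotation of \<open>X\<close>; both bends give the latter, one with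
  \<open>\<mu>\<close> and the other with \<open>\<mu>'\<close>.\<close>
lemma left_multiplication:
  defines "K \<equiv> Suc k"
  defines "den \<equiv> \<lambda>i j. D (Suc (i + K + j)) * D (i + K + j)"
  shows "mul chi (Wel K X i j) = Wel K X (Suc i) j
    + (if i = 0 then 0 else (1 - complex_of_real (D (K + j) * D (Suc (K + j)) / den i j)) *\<^sub>C Wel K X (i-1) j)
    + (if j = 0 then 0 else ((-1)^K * (\<mu> + \<mu>') * complex_of_real (D j * D (K + j) / den i j)) *\<^sub>C Wel K X i (j-1))
    - (if j < 2 then 0 else complex_of_real (D j * D (j-1) / den i j) *\<^sub>C Wel K X (Suc i) (j-2))"
proof -
  define m where "m = i + k + j"
  define co where "co l = (-1)^l * complex_of_real (D (Suc m - l) / D (Suc (Suc m)))" for l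
  define \<kappa> where "\<kappa> b = (-1)^b * complex_of_real (D (Suc m - b) / D (Suc m))" for b
  define RL where "RL = U m (mcomp (Suc (Suc m)) (emb i k (Suc (Suc k)) j (bend_left k X)) (V' m))"
  define RR where "RR = U m (mcomp (Suc (Suc m)) (emb (Suc i) k (Suc (Suc k)) (j-1) (bend_right k X)) (V' m))"
  have den: "den i j = D (Suc (Suc m)) * D (Suc m)" by (simp add: den_def K_def m_def)
  have pos: "D (Suc m) > 0" "D (Suc (Suc m)) > 0" by (rule D_pos)+
  have "mul chi (Wel K X i j) = Wel K X (Suc i) j + (\<Sum>l\<le>m. co l *\<^sub>C
      ((if l = 0 then (if i = 0 then 0 else complex_of_real (D (Suc (Suc m)) / D (Suc m)) *\<^sub>C Wel K X (i-1) j) else 0)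
      + (if l = i then RL else 0) + (if l = i + Suc k then (if j = 0 then 0 else RR) else 0)))"
    unfolding K_def co_def RL_def RR_def
    using chi_Wel[OF X, of i j m] residual_terms[OF m_def, of _]
    by (simp add: m_def)
  also have "(\<Sum>l\<le>m. co l *\<^sub>C
      ((if l = 0 then (if i = 0 then 0 else complex_of_real (D (Suc (Suc m)) / D (Suc m)) *\<^sub>C Wel K X (i-1) j) else 0)
      + (if l = i then RL else 0) + (if l = i + Suc k then (if j = 0 then 0 else RR) else 0)))
     = (\<Sum>l\<le>m. if l = 0 then (if i = 0 then 0 else Wel K X (i-1) j) else 0)
      + (\<Sum>l\<le>m. if l = i then co i *\<^sub>C RL else 0)
      + (\<Sum>l\<le>m. if l = i + Suc k then (if j = 0 then 0 else co (i + Suc k) *\<^sub>C RR) else 0)"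
  proof -
    have "co 0 * complex_of_real (D (Suc (Suc m)) / D (Suc m)) = 1" using pos by (simp add: co_def)
    then show ?thesis unfolding sum.distrib[symmetric]
      by (intro sum.cong refl) (auto simp: scaleC_add_right scaleC_scaleC scaleC.scale_zero_right simp del: of_real_divide)
  qed
  also have "\<dots> = (if i = 0 then 0 else Wel K X (i-1) j) + co i *\<^sub>C RL + (if j = 0 then 0 else co (i + Suc k) *\<^sub>C RR)"
    by (auto simp: sum.delta m_def)
  also have "RL = (if i = 0 then 0 else \<kappa> (i-1) *\<^sub>C Wel K X (i-1) j) + (if j = 0 then 0 else (\<kappa> (i + Suc k) * \<mu>') *\<^sub>C Wel K X i (j-1))"
  proof -
    have "RL = (if i = 0 then 0 else \<kappa> (i-1) *\<^sub>C U m (mcomp m (emb (i-1) (Suc k) (Suc k) j X) (P m)))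
      + (if j = 0 then 0 else \<kappa> (i + Suc k) *\<^sub>C U m (mcomp m (emb i (Suc k) (Suc k) (j-1) (rot_inv (Suc k) X)) (P m)))"
      unfolding RL_def \<kappa>_def by (rule U_bent[OF m_def L_tmats L_snake L_rot L_cup])
    moreover have "U m (mcomp m (emb (i-1) (Suc k) (Suc k) j X) (P m)) = Wel K X (i-1) j" if "i \<noteq> 0"
    proof -
      have "i - 1 + Suc k + j = m" using that by (simp add: m_def)
      then show ?thesis unfolding Wel_def K_def by simp
    qed
    moreover have "U m (mcomp m (emb i (Suc k) (Suc k) (j-1) (rot_inv (Suc k) X)) (P m)) = \<mu>' *\<^sub>C Wel K X i (j-1)" if "j \<noteq> 0"
    proof -
      have "i + Suc k + (j - 1) = m" using that by (simp add: m_def)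
      then show ?thesis unfolding Wel_def K_def rot_inv_X emb_scale mcomp_scale_left U_scale by simp
    qed
    ultimately show ?thesis by (auto simp: scaleC_scaleC)
  qed
  also have "(if j = 0 then 0 else co (i + Suc k) *\<^sub>C RR) = (if j = 0 then 0 else (co (i + Suc k) * \<kappa> i * \<mu>) *\<^sub>C Wel K X i (j-1))
      + (if j < 2 then 0 else (co (i + Suc k) * \<kappa> (Suc i + Suc k)) *\<^sub>C Wel K X (Suc i) (j-2))"
  proof (cases j)
    case (Suc j')
    have m': "m = Suc i + k + j'" using Suc by (simp add: m_def)
    have "RR = \<kappa> i *\<^sub>C U m (mcomp m (emb i (Suc k) (Suc k) j' (rot (Suc k) X)) (P m))
      + (if j' = 0 then 0 else \<kappa> (Suc i + Suc k) *\<^sub>C U m (mcomp m (emb (Suc i) (Suc k) (Suc k) (j'-1) X) (P m)))"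
      using U_bent[OF m' R_tmats R_rot R_snake R_cup] Suc unfolding RR_def \<kappa>_def by simp
    moreover have "U m (mcomp m (emb i (Suc k) (Suc k) j' (rot (Suc k) X)) (P m)) = \<mu> *\<^sub>C Wel K X i j'"
    proof -
      have "i + Suc k + j' = m" by (simp add: m')
      then show ?thesis unfolding Wel_def K_def rot_X emb_scale mcomp_scale_left U_scale by simp
    qed
    moreover have "U m (mcomp m (emb (Suc i) (Suc k) (Suc k) (j'-1) X) (P m)) = Wel K X (Suc i) (j'-1)" if "j' \<noteq> 0"
    proof -
      have "Suc i + Suc k + (j' - 1) = m" using that by (simp add: m')
      then show ?thesis unfolding Wel_def K_def by simp
    qed
    ultimately show ?thesis using Suc by (cases j') (auto simp: scaleC_add_right scaleC_scaleC numeral_2_eq_2)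
  qed simp
  finally have main: "mul chi (Wel K X i j) = Wel K X (Suc i) j
    + ((if i = 0 then 0 else Wel K X (i-1) j)
      + co i *\<^sub>C ((if i = 0 then 0 else \<kappa> (i-1) *\<^sub>C Wel K X (i-1) j) + (if j = 0 then 0 else (\<kappa> (i + Suc k) * \<mu>') *\<^sub>C Wel K X i (j-1)))
      + ((if j = 0 then 0 else (co (i + Suc k) * \<kappa> i * \<mu>) *\<^sub>C Wel K X i (j-1))
      + (if j < 2 then 0 else (co (i + Suc k) * \<kappa> (Suc i + Suc k)) *\<^sub>C Wel K X (Suc i) (j-2))))" .
  \<comment> \<open>It remains to multiply out the coefficients \<open>co\<close> of the contraction and \<open>\<kappa>\<close> of the inserted vector.\<close>
  have c1: "co i * \<kappa> (i-1) = - complex_of_real (D (K + j) * D (Suc (K + j)) / den i j)" if i: "i \<noteq> 0"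
  proof -
    obtain i' where i': "i = Suc i'" using i by (cases i) auto
    have "Suc m - i = K + j" "Suc m - (i - 1) = Suc (K + j)" using i' by (auto simp: m_def K_def)
    then have "co i * \<kappa> (i-1) = (-1)^i * (-1)^(i-1) * complex_of_real ((D (K + j) / D (Suc (Suc m))) * (D (Suc (K + j)) / D (Suc m)))"
      unfolding co_def \<kappa>_def by simp
    also have "(-1)^i * (-1)^(i-1) = (-1::complex)" by (simp add: i' power_mult_distrib[symmetric])
    finally show ?thesis by (simp add: den)
  qed
  have c2: "co i * (\<kappa> (i + Suc k) * \<mu>') + co (i + Suc k) * \<kappa> i * \<mu> = (-1)^K * (\<mu> + \<mu>') * complex_of_real (D j * D (K + j) / den i j)"
  proof -
    have e: "Suc m - i = K + j" "Suc m - (i + Suc k) = j" by (auto simp: m_def K_def)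
    have s: "(-1::complex)^i * (-1)^(i + Suc k) = (-1)^K"
      by (simp add: power_add power_mult_distrib[symmetric] K_def flip: mult.assoc)
    have "co i * (\<kappa> (i + Suc k) * \<mu>') + co (i + Suc k) * \<kappa> i * \<mu>
      = ((-1)^i * (-1)^(i + Suc k)) * (\<mu> + \<mu>') * (complex_of_real (D (K + j) / D (Suc (Suc m))) * complex_of_real (D j / D (Suc m)))"
      unfolding co_def \<kappa>_def e
    proof -
      have gen: "(s*R1)*((q*R2)*x') + (q*R3)*(s*R4)*x = (s*q)*(x+x')*(R1*R2)" if "R3*R4 = R1*R2"
        for s q R1 R2 R3 R4 x x' :: complex
      proof -
        have "(q*R3)*(s*R4)*x = (s*q)*x*(R3*R4)" by (simp only: ac_simps)
        then show ?thesis by (simp add: that algebra_simps)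
      qed
      show "(-1)^i * complex_of_real (D (K + j) / D (Suc (Suc m))) * ((-1)^(i + Suc k) * complex_of_real (D j / D (Suc m)) * \<mu>')
          + (-1)^(i + Suc k) * complex_of_real (D j / D (Suc (Suc m))) * ((-1)^i * complex_of_real (D (K + j) / D (Suc m))) * \<mu>
        = (-1)^i * (-1)^(i + Suc k) * (\<mu> + \<mu>') * (complex_of_real (D (K + j) / D (Suc (Suc m))) * complex_of_real (D j / D (Suc m)))"
        by (rule gen) simp
    qed
    then show ?thesis unfolding s by (simp add: den mult.commute)
  qed
  have c3: "co (i + Suc k) * \<kappa> (Suc i + Suc k) = - complex_of_real (D j * D (j-1) / den i j)" if "\<not> j < 2"
  proof -
    have e: "Suc m - (i + Suc k) = j" "Suc m - (Suc i + Suc k) = j - 1" using that by (auto simp: m_def)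
    have "(-1::complex)^p * (-1)^Suc p = -1" for p
      by (simp add: power_mult_distrib[symmetric])
    from this[of "i + Suc k"] have s: "(-1::complex)^(i + Suc k) * (-1)^(Suc i + Suc k) = -1"
      by (simp only: add_Suc)
    have "co (i + Suc k) * \<kappa> (Suc i + Suc k) = ((-1)^(i + Suc k) * (-1)^(Suc i + Suc k)) * (complex_of_real (D j / D (Suc (Suc m))) * complex_of_real (D (j-1) / D (Suc m)))"
      unfolding co_def \<kappa>_def e by (simp only: ac_simps)
    then show ?thesis unfolding s by (simp add: den)
  qed
  have t1: "(if i = 0 then 0 else Wel K X (i-1) j) + co i *\<^sub>C (if i = 0 then 0 else \<kappa> (i-1) *\<^sub>C Wel K X (i-1) j)
    = (if i = 0 then 0 else (1 - complex_of_real (D (K + j) * D (Suc (K + j)) / den i j)) *\<^sub>C Wel K X (i-1) j)"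
    using c1 by (auto simp: scaleC_scaleC scaleC.scale_left_diff_distrib simp del: of_real_divide of_real_mult)
  have t2: "co i *\<^sub>C (if j = 0 then 0 else (\<kappa> (i + Suc k) * \<mu>') *\<^sub>C Wel K X i (j-1)) + (if j = 0 then 0 else (co (i + Suc k) * \<kappa> i * \<mu>) *\<^sub>C Wel K X i (j-1))
    = (if j = 0 then 0 else ((-1)^K * (\<mu> + \<mu>') * complex_of_real (D j * D (K + j) / den i j)) *\<^sub>C Wel K X i (j-1))"
    using c2 by (auto simp: scaleC_scaleC scaleC_add_left[symmetric] simp del: of_real_divide of_real_mult)
  have t3: "(if j < 2 then 0 else (co (i + Suc k) * \<kappa> (Suc i + Suc k)) *\<^sub>C Wel K X (Suc i) (j-2))
    = - (if j < 2 then 0 else complex_of_real (D j * D (j-1) / den i j) *\<^sub>C Wel K X (Suc i) (j-2))"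
    using c3 by (auto simp del: of_real_divide of_real_mult)
  have "x + ((p + (q + q')) + (r + - s)) = x + (p + q) + (q' + r) - s" for x p q q' r s :: 'a
    by (simp add: algebra_simps)
  then show ?thesis unfolding main scaleC_add_right t3 t1[symmetric] t2[symmetric] .
qed

end

end

section \<open>Mirror symmetry and eigenvalues of the rotation\<close>

text \<open>Reading all words backwards exchanges the two ends of the row of legs.\<close>
definition mirror :: "'n tmat \<Rightarrow> 'n tmat" where "mirror X = (\<lambda>I J. X (rev I) (rev J))"

lemma mirror_mirror [simp]: "mirror (mirror X) = X" by (simp add: mirror_def)
lemma mirror_tmats: "X \<in> tmats m n \<Longrightarrow> mirror X \<in> tmats m n" by (auto simp: tmats_def mirror_def words_def)
lemma mirror_madj: "mirror (madj X) = madj (mirror X)" by (simp add: mirror_def madj_def)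
lemma mirror_zero: "mirror (\<lambda>I J. 0) = (\<lambda>I J. 0)" by (simp add: mirror_def)
lemma mirror_scale: "mirror (\<lambda>I J. c * X I J) = (\<lambda>I J. c * mirror X I J)" by (simp add: mirror_def)

lemma sum_words_rev: "(\<Sum>I\<in>words n. f (rev I)) = (\<Sum>I\<in>words n. f (I :: 'n::finite list))"
  by (rule sum.reindex_bij_witness[of _ rev rev]) (auto simp: words_def)

lemma mirror_mcomp: "mirror (mcomp n X Y) = mcomp n (mirror X) (mirror (Y :: 'n::finite tmat))"
  unfolding mirror_def mcomp_def by (intro ext sum_words_rev[of "\<lambda>K. X (rev _) K * Y K (rev _)", symmetric])

lemma emb_apply:
  assumes "length A = i" "length A' = i" "length B = p" "length B' = q" "length C = j" "length C' = j"
  shows "emb i p q j M (A @ B @ C) (A' @ B' @ C') = of_bool (A = A') * (M B B' * of_bool (C = C'))"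
  using assms by (simp add: emb_def mtens_def idm_def)

lemma mirror_emb:
  fixes M :: "'n tmat"
  assumes "M \<in> tmats p q" shows "mirror (emb i p q j M) = emb j p q i (mirror M)"
proof (rule tmats_eqI)
  show "mirror (emb i p q j M) \<in> tmats (j + p + i) (j + q + i)"
    using mirror_tmats[OF emb_tmats[OF assms, of i j]] by (simp add: ac_simps)
  show "emb j p q i (mirror M) \<in> tmats (j + p + i) (j + q + i)" by (rule emb_tmats[OF mirror_tmats[OF assms]])
  fix I J :: "'n list" assume I: "length I = j + p + i" and J: "length J = j + q + i"
  define A B C A' B' C' where "A = take j I" and "B = take p (drop j I)" and "C = drop p (drop j I)"
    and "A' = take j J" and "B' = take q (drop j J)" and "C' = drop q (drop j J)"
  note d = this
  have IJ: "I = A @ B @ C" "J = A' @ B' @ C'" unfolding d by (metis append_take_drop_id)+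
  have l: "length A = j" "length B = p" "length C = i" "length A' = j" "length B' = q" "length C' = i"
    using I J unfolding d by auto
  have "mirror (emb i p q j M) I J = of_bool (rev C = rev C') * (M (rev B) (rev B') * of_bool (rev A = rev A'))"
    unfolding mirror_def IJ rev_append append_assoc using l by (intro emb_apply) auto
  moreover have "emb j p q i (mirror M) I J = of_bool (A = A') * (mirror M B B' * of_bool (C = C'))"
    unfolding IJ using l by (intro emb_apply) auto
  ultimately show "mirror (emb i p q j M) I J = emb j p q i (mirror M) I J" by (simp add: mirror_def)
qed

lemma mirror_tmat: "mirror tmat = tmat"
  by (intro ext) (auto simp: mirror_def tmat_def rev_singleton_conv split: list.splits)

lemma mirror_cap: "mirror (cap a r) = cap r a"
  using mirror_emb[OF tcap_tmats, of a r] by (simp add: mirror_madj mirror_tmat)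

lemma mirror_cup: "mirror (cup a r) = cup r a"
  using mirror_emb[OF tmat_tmats, of a r] by (simp add: mirror_tmat)

lemma rot_inv_rot: "X \<in> tmats (Suc k) (Suc k) \<Longrightarrow> rot_inv (Suc k) (rot (Suc k) X) = X"
proof (rule tmats_eqI[where m = "Suc k" and n = "Suc k"])
  assume X: "X \<in> tmats (Suc k) (Suc k)"
  show "rot_inv (Suc k) (rot (Suc k) X) \<in> tmats (Suc k) (Suc k)" by (auto simp: tmats_def words_def rot_inv_def)
  show "X \<in> tmats (Suc k) (Suc k)" by (rule X)
  fix I J :: "'a list" assume I: "length I = Suc k" and J: "length J = Suc k"
  then have "I \<noteq> []" "J \<noteq> []" by auto
  then show "rot_inv (Suc k) (rot (Suc k) X) I J = X I J"
    using I J by (simp add: rot_def rot_inv_def)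
qed

lemma rot_mirror: "rot (Suc k) (mirror X) = mirror (rot_inv (Suc k) X)" and rot_inv_mirror: "rot_inv (Suc k) (mirror X) = mirror (rot (Suc k) X)"
proof -
  have "rot (Suc k) (mirror X) I J = mirror (rot_inv (Suc k) X) I J \<and> rot_inv (Suc k) (mirror X) I J = mirror (rot (Suc k) X) I J" for I J
  proof (cases "length I = Suc k \<and> length J = Suc k")
    case True
    then have "I \<noteq> []" "J \<noteq> []" by auto
    then have e: "hd (rev I) = last I" "hd (rev J) = last J" "last (rev I) = hd I" "last (rev J) = hd J"
      "butlast (rev I) = rev (tl I)" "butlast (rev J) = rev (tl J)" "tl (rev I) = rev (butlast I)" "tl (rev J) = rev (butlast J)"
      by (auto simp: hd_rev last_rev butlast_rev) (metis butlast_rev rev_rev_ident)+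
    show ?thesis using True by (simp add: rot_def rot_inv_def mirror_def e)
  qed (auto simp: rot_def rot_inv_def mirror_def)
  then show "rot (Suc k) (mirror X) = mirror (rot_inv (Suc k) X)" "rot_inv (Suc k) (mirror X) = mirror (rot (Suc k) X)" by auto
qed

lemma rot_norm:
  fixes X :: "'n::finite tmat"
  shows "(\<Sum>I\<in>words (Suc k). \<Sum>J\<in>words (Suc k). (cmod (rot (Suc k) X I J))^2)
   = (\<Sum>I\<in>words (Suc k). \<Sum>J\<in>words (Suc k). (cmod (X I J))^2)"
proof -
  let ?W = "words (Suc k) \<times> words (Suc k) :: ('n list \<times> 'n list) set"
  have "(\<Sum>p\<in>?W. (cmod (rot (Suc k) X (fst p) (snd p)))^2) = (\<Sum>p\<in>?W. (cmod (X (fst p) (snd p)))^2)"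
  proof (rule sum.reindex_bij_witness[of _ "\<lambda>(I, J). (hd J # butlast I, tl J @ [last I])" "\<lambda>(I, J). (tl I @ [last J], hd I # butlast J)"])
    fix p assume p: "p \<in> ?W"
    obtain I J where IJ: "p = (I, J)" by (cases p)
    have l: "length I = Suc k" "length J = Suc k" using p IJ by (auto simp: words_def)
    then have ne: "I \<noteq> []" "J \<noteq> []" by auto
    show "(case (case p of (I, J) \<Rightarrow> (tl I @ [last J], hd I # butlast J)) of (I, J) \<Rightarrow> (hd J # butlast I, tl J @ [last I])) = p"
      using IJ l ne by simp
    show "(case p of (I, J) \<Rightarrow> (tl I @ [last J], hd I # butlast J)) \<in> ?W" using IJ l by (simp add: words_def)
    show "(case (case p of (I, J) \<Rightarrow> (hd J # butlast I, tl J @ [last I])) of (I, J) \<Rightarrow> (tl I @ [last J], hd I # butlast J)) = p"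
      using IJ l ne by simp
    show "(case p of (I, J) \<Rightarrow> (hd J # butlast I, tl J @ [last I])) \<in> ?W" using IJ l by (simp add: words_def)
    show "(cmod (X (fst (case p of (I, J) \<Rightarrow> (tl I @ [last J], hd I # butlast J))) (snd (case p of (I, J) \<Rightarrow> (tl I @ [last J], hd I # butlast J)))))\<^sup>2
       = (cmod (rot (Suc k) X (fst p) (snd p)))\<^sup>2" using IJ l by (simp add: rot_def)
  qed
  then show ?thesis by (simp add: sum.cartesian_product case_prod_beta)
qed

text \<open>The rotation permutes the matrix entries, hence is isometric for the Hilbert-Schmidt norm.\<close>
lemma rot_eigenvalue:
  fixes X :: "'n::finite tmat"
  assumes X: "X \<in> tmats (Suc k) (Suc k)" and ne: "X \<noteq> (\<lambda>I J. 0)" and e: "rot (Suc k) X = (\<lambda>I J. \<mu> * X I J)"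
  shows "cmod \<mu> = 1" and "rot_inv (Suc k) X = (\<lambda>I J. inverse \<mu> * X I J)"
proof -
  let ?s = "\<Sum>I\<in>words (Suc k). \<Sum>J\<in>words (Suc k). (cmod (X I J))^2"
  obtain I J where IJ: "X I J \<noteq> 0" using ne by (auto simp: fun_eq_iff)
  then have "length I = Suc k" "length J = Suc k" using tmatsD[OF X] by blast+
  then have w: "I \<in> words (Suc k)" "J \<in> words (Suc k)" by (auto simp: words_def)
  have "0 < (cmod (X I J))^2" using IJ by simp
  also have "\<dots> \<le> (\<Sum>J\<in>words (Suc k). (cmod (X I J))^2)" using w by (intro member_le_sum) auto
  also have "\<dots> \<le> ?s" using w by (intro member_le_sum[of I]) (auto intro: sum_nonneg)
  finally have s: "?s > 0" .
  have "(cmod \<mu>)^2 * ?s = ?s"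
    using rot_norm[of k X] unfolding e by (simp add: norm_mult power_mult_distrib sum_distrib_left)
  then have "(cmod \<mu>)^2 = 1" using s by simp
  then show m: "cmod \<mu> = 1" by (metis norm_ge_zero power2_eq_1_iff zero_le_one not_numeral_le_zero norm_not_less_zero neg_less_0_iff_less zero_less_one)
  have "rot_inv (Suc k) (\<lambda>I J. \<mu> * X I J) = X" using rot_inv_rot[OF X] unfolding e .
  moreover have "rot_inv (Suc k) (\<lambda>I J. \<mu> * X I J) = (\<lambda>I J. \<mu> * rot_inv (Suc k) X I J)"
    by (intro ext) (simp add: rot_inv_def)
  ultimately have "(\<lambda>I J. \<mu> * rot_inv (Suc k) X I J) = X" by simp
  then have "\<mu> * rot_inv (Suc k) X I J = X I J" for I J by (rule fun_cong[OF fun_cong])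
  moreover have "\<mu> \<noteq> 0" using m by auto
  ultimately have "rot_inv (Suc k) X I J = inverse \<mu> * X I J" for I J by (simp add: field_simps)
  then show "rot_inv (Suc k) X = (\<lambda>I J. inverse \<mu> * X I J)" by auto
qed

context large_dim
begin

lemma mirror_P: "mirror (P n) = P n"
proof -
  have 1: "mcomp n (P n) (mirror (P n)) = mirror (P n)"
  proof (rule P_fixes[OF mirror_tmats[OF P_tmats]])
    fix a r assume n: "n = Suc (Suc (a + r))"
    have "mcomp n (cap a r) (mirror (P n)) = mirror (mcomp n (cap r a) (P n))"
      by (simp add: mirror_mcomp mirror_cap)
    also have "\<dots> = (\<lambda>I J. 0)" using cap_P[of r a] n by (simp add: mirror_zero add.commute)
    finally show "mcomp n (cap a r) (mirror (P n)) = (\<lambda>I J. 0)" .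
  qed
  have "mirror (mcomp n (P n) (mirror (P n))) = P n" unfolding 1 by simp
  then have "mcomp n (mirror (P n)) (P n) = P n" by (simp add: mirror_mcomp)
  moreover have "madj (mcomp n (P n) (mirror (P n))) = mcomp n (mirror (P n)) (P n)"
    by (simp add: madj_mcomp mirror_madj[symmetric] P_adj)
  ultimately show ?thesis unfolding 1 by (simp add: mirror_madj[symmetric] P_adj)
qed

lemma BHoo_traceless:
  assumes "X \<in> BHoo (Suc k)" shows "traceless k (X :: 'n tmat)"
proof
  have t: "X \<in> tmats (Suc k) (Suc k)" and e: "mcomp (Suc k) (P (Suc k)) (mcomp (Suc k) X (P (Suc k))) = X"
    and tr1: "\<And>I J. (\<Sum>x\<in>UNIV. X (x # I) (x # J)) = 0" and tr2: "\<And>I J. (\<Sum>x\<in>UNIV. X (I @ [x]) (J @ [x])) = 0"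
    using assms by (auto simp: BHoo_def BHn_def proj_eq)
  show "X \<in> tmats (Suc k) (Suc k)" by (rule t)
  show "\<And>I J. (\<Sum>x\<in>UNIV. X (x # I) (x # J)) = 0" by (rule tr1)
  show "\<And>I J. (\<Sum>x\<in>UNIV. X (I @ [x]) (J @ [x])) = 0" by (rule tr2)
  fix a r assume k: "k = Suc (a + r)"
  have "mcomp (Suc k) (cap a r) X = mcomp (Suc k) (mcomp (Suc k) (cap a r) (P (Suc k))) (mcomp (Suc k) X (P (Suc k)))"
    by (subst (1) e[symmetric]) (simp only: mcomp_assoc)
  then show "mcomp (Suc k) (cap a r) X = (\<lambda>I J. 0)" using cap_P[of a r] k by (simp add: mcomp_zero_left)
  have "mcomp (Suc k) X (cup a r) = mcomp (Suc k) (P (Suc k)) (mcomp (Suc k) X (mcomp (Suc k) (P (Suc k)) (cup a r)))"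
    by (subst (1) e[symmetric]) (simp only: mcomp_assoc)
  then show "mcomp (Suc k) X (cup a r) = (\<lambda>I J. 0)" using P_cup[of a r] k by (simp add: mcomp_zero_right)
qed

lemma traceless_mirror:
  assumes "traceless k (X :: 'n tmat)" shows "traceless k (mirror X)"
proof -
  interpret traceless k X by fact
  show ?thesis
  proof
    show "mirror X \<in> tmats (Suc k) (Suc k)" by (rule mirror_tmats[OF X])
    show "\<And>I J. (\<Sum>x\<in>UNIV. mirror X (x # I) (x # J)) = 0" by (simp add: mirror_def tr_last)
    show "\<And>I J. (\<Sum>x\<in>UNIV. mirror X (I @ [x]) (J @ [x])) = 0" by (simp add: mirror_def tr_first)
    fix a r assume k: "k = Suc (a + r)"
    have "mirror (mcomp (Suc k) (cap r a) X) = mcomp (Suc k) (cap a r) (mirror X)" by (simp add: mirror_mcomp mirror_cap)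
    then show "mcomp (Suc k) (cap a r) (mirror X) = (\<lambda>I J. 0)" using cap_X[of r a] k by (simp add: mirror_zero add.commute)
    have "mirror (mcomp (Suc k) X (cup r a)) = mcomp (Suc k) (mirror X) (cup a r)"
      by (simp add: mirror_mcomp mirror_cup)
    then show "mcomp (Suc k) (mirror X) (cup a r) = (\<lambda>I J. 0)" using X_cup[of r a] k by (simp add: mirror_zero add.commute)
  qed
qed

text \<open>The rotation of a matrix that cannot be contracted cannot be contracted either: the
  contractions that involve a rotated leg are partial traces of \<open>X\<close>. So the projection acts as the identity.\<close>
lemma rotation_eq:
  assumes "traceless k (X :: 'n tmat)"
  shows "rotation (Suc k) X = rot (Suc k) X"
proof -
  interpret traceless k X by fact
  let ?K = "Suc k" and ?N = "Suc (Suc (Suc k))" and ?r = "rot (Suc k) X"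
  have left: "mtens ?K ?K (P ?K) tcap = mcomp ?K (P ?K) (cap ?K 0)"
  proof -
    have "mcomp (?K + 0) (mtens ?K ?K (P ?K) (idm 0)) (mtens ?K ?K (idm ?K) tcap) = mtens ?K ?K (P ?K) tcap"
      unfolding mtens_interchange mcomp_idm_right[OF P_tmats] mcomp_idm_left[OF tcap_tmats] ..
    moreover have "mtens ?K ?K (P ?K) (idm 0) = P ?K" 
      using emb_00[OF P_tmats, of ?K] mtens_tmats[OF P_tmats idm_tmats, of ?K 0] by (auto simp: emb_def mtens_def idm_def)
    moreover have "mtens ?K ?K (idm ?K) tcap = (cap ?K 0 :: 'n tmat)"
    proof -
      have "mtens 0 2 tcap (idm 0) = (tcap :: 'n tmat)"
        using emb_00[OF tcap_tmats] by (simp add: emb_def mtens_def idm_def)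
      then show ?thesis by (simp add: emb_def)
    qed
    ultimately show ?thesis by simp
  qed
  have right: "mtens 2 0 tmat (P ?K) = mcomp ?K (cup 0 ?K) (P ?K)"
  proof -
    have "mcomp (0 + ?K) (mtens 2 0 tmat (idm ?K)) (mtens 0 0 (idm 0) (P ?K)) = mtens 2 0 tmat (P ?K)"
      unfolding mtens_interchange mcomp_idm_right[OF tmat_tmats] mcomp_idm_left[OF P_tmats] ..
    moreover have "mtens 0 0 (idm 0) A = A" for A :: "'n tmat" by (simp add: mtens_def idm_def)
    ultimately show ?thesis by (simp add: emb_def)
  qed
  have mid: "mcomp ?N (cap ?K 0) (mcomp ?N (emb (Suc 0) ?K ?K (Suc 0) X) (cup 0 ?K)) = ?r"
  proof -
    have c: "emb (Suc 0) k (Suc ?K) 0 (cap k 0) = (cap ?K 0 :: 'n tmat)"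
      using lsh_cap[of k 0] by simp
    have "emb (Suc 0) k (Suc ?K) 0 (bend_right k X) = mcomp ?N (cap ?K 0) (emb (Suc 0) ?K ?K (Suc 0) X)"
      unfolding bend_right_def lsh_comp[symmetric] c
      using emb_emb[of "Suc 0" 0 ?K "Suc 0" ?K 0 X] by simp
    then show ?thesis using R_rot by (simp add: mcomp_assoc)
  qed
  have cap_r: "mcomp ?K (cap a s) ?r = (\<lambda>I J. 0)" if K: "?K = Suc (Suc (a + s))" for a s
  proof (rule tmats_eqI)
    show "mcomp ?K (cap a s) ?r \<in> tmats (a + s) ?K" using mcomp_tmats[OF cap_tmats[of a s] rot_tmats(1)] by simp
    show "(\<lambda>I J. 0) \<in> tmats (a + s) ?K" by (simp add: tmats_def)
    fix I J :: "'n list" assume I: "length I = a + s" and J: "length J = ?K"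
    have "mcomp ?K (cap a s) ?r I J = (\<Sum>x\<in>UNIV. ?r (take a I @ x # x # drop a I) J)"
      using cap_apply[OF I, of ?r J] K by simp
    also have "\<dots> = 0"
    proof (cases a)
      case 0
      have "(\<Sum>x\<in>UNIV. ?r (take a I @ x # x # drop a I) J) = (\<Sum>x\<in>UNIV. X (x # (I @ [last J])) (x # butlast J))"
        using 0 I J K by (simp add: rot_def)
      then show ?thesis by (simp add: tr_first)
    next
      case (Suc a')
      then obtain h I' where I': "I = h # I'" "length I' = a' + s" using I by (cases I) auto
      have "(\<Sum>x\<in>UNIV. ?r (take a I @ x # x # drop a I) J)
         = (\<Sum>x\<in>UNIV. X (take a' (I' @ [last J]) @ x # x # drop a' (I' @ [last J])) (h # butlast J))"
        using Suc I' J K by (simp add: rot_def)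
      also have "\<dots> = mcomp (Suc (Suc (a' + Suc s))) (cap a' (Suc s)) X (I' @ [last J]) (h # butlast J)"
        using I' by (intro cap_apply[symmetric]) simp
      also have "\<dots> = 0" using cap_X[of a' "Suc s"] K Suc by simp
      finally show ?thesis .
    qed
    finally show "mcomp ?K (cap a s) ?r I J = 0" .
  qed
  have r_cup: "mcomp ?K ?r (cup a s) = (\<lambda>I J. 0)" if K: "?K = Suc (Suc (a + s))" for a s
  proof (rule tmats_eqI)
    show "mcomp ?K ?r (cup a s) \<in> tmats ?K (a + s)" using mcomp_tmats[OF rot_tmats(1) cup_tmats[of a s]] by simp
    show "(\<lambda>I J. 0) \<in> tmats ?K (a + s)" by (simp add: tmats_def)
    fix I J :: "'n list" assume I: "length I = ?K" and J: "length J = a + s"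
    have "mcomp ?K ?r (cup a s) I J = (\<Sum>x\<in>UNIV. ?r I (take a J @ x # x # drop a J))"
      using cup_apply[OF J, of ?r I] K by simp
    also have "\<dots> = 0"
    proof (cases s)
      case 0
      have "(\<Sum>x\<in>UNIV. ?r I (take a J @ x # x # drop a J)) = (\<Sum>x\<in>UNIV. X (tl I @ [x]) ((hd I # J) @ [x]))"
        using 0 I J K by (simp add: rot_def butlast_append)
      then show ?thesis by (simp only: tr_last)
    next
      case (Suc s')
      then obtain g J' where J': "J = J' @ [g]" "length J' = a + s'" using J by (cases J rule: rev_cases) auto
      have "(\<Sum>x\<in>UNIV. ?r I (take a J @ x # x # drop a J))
         = (\<Sum>x\<in>UNIV. X (tl I @ [g]) (take (Suc a) (hd I # J') @ x # x # drop (Suc a) (hd I # J')))"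
        using Suc I J' K by (simp add: rot_def butlast_append)
      also have "\<dots> = mcomp (Suc (Suc (Suc a + s'))) X (cup (Suc a) s') (tl I @ [g]) (hd I # J')"
        using J' by (intro cup_apply[symmetric]) simp
      also have "\<dots> = 0" using X_cup[of "Suc a" s'] K Suc by simp
      finally show ?thesis .
    qed
    finally show "mcomp ?K ?r (cup a s) I J = 0" .
  qed
  have Pr: "mcomp ?K (P ?K) ?r = ?r" by (rule P_fixes[OF rot_tmats(1) cap_r])
  have rP: "mcomp ?K ?r (P ?K) = ?r"
  proof -
    have "mcomp ?K (P ?K) (madj ?r) = madj ?r"
    proof (rule P_fixes[OF madj_tmats[OF rot_tmats(1)]])
      fix a s assume "?K = Suc (Suc (a + s))"
      from r_cup[OF this] have "madj (mcomp ?K ?r (cup a s)) = (\<lambda>I J. 0)" by (simp add: madj_def)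
      then show "mcomp ?K (cap a s) (madj ?r) = (\<lambda>I J. 0)" by (simp add: madj_mcomp)
    qed
    then have "madj (mcomp ?K (P ?K) (madj ?r)) = ?r" by simp
    then show ?thesis by (simp add: madj_mcomp P_adj)
  qed
  have "rotation ?K X = mcomp ?K (P ?K) (mcomp ?K (mcomp ?N (cap ?K 0) (mcomp ?N (emb (Suc 0) ?K ?K (Suc 0) X) (cup 0 ?K))) (P ?K))"
    unfolding rotation_def proj_eq left right emb_def[of 1, symmetric] by (simp add: mcomp_assoc emb_def)
  then show ?thesis unfolding mid rP Pr .
qed

end

section \<open>The two actions on a block\<close>

locale FO_alg =
  fixes u :: "'n::finite \<Rightarrow> 'n \<Rightarrow> 'a::cstar_algebra"
  assumes dim: "3 \<le> CARD('n)"
    and row_u: "\<And>i j. (\<Sum>k\<in>UNIV. u i k * u j k) = of_bool (i = j)"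
    and col_u: "\<And>i j. (\<Sum>k\<in>UNIV. u k i * u k j) = of_bool (i = j)"
begin

sublocale FO_mul "TYPE('n)" "real CARD('n)" times u
  by unfold_locales (use dim in \<open>simp_all add: distrib_left distrib_right scaleC_mult_left scaleC_mult_right mult.assoc row_u col_u\<close>)

sublocale op: FO_mul "TYPE('n)" "real CARD('n)" "\<lambda>x y. y * x" u
proof unfold_locales
  show "(\<Sum>k\<in>UNIV. u j k * u i k) = of_bool (i = j)" for i j using row_u[of j i] by (simp add: eq_commute)
  show "(\<Sum>k\<in>UNIV. u k j * u k i) = of_bool (i = j)" for i j using col_u[of j i] by (simp add: eq_commute)
qed (simp_all add: distrib_left distrib_right scaleC_mult_left scaleC_mult_right mult.assoc)

lemma uw_eq: "uw I J = prod_list (map2 u I J)"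
  by (simp add: uw_def prod_list.eq_foldr)

lemma u_elt_U: "u_elt u n X = U n X"
  by (simp add: u_elt_def U_def uw_eq)

lemma op_uw: "length I = length J \<Longrightarrow> op.uw I J = uw (rev I) (rev J)"
  by (induction I J rule: list_induct2) (simp_all add: uw_append)

lemma op_U: "op.U n X = U n (mirror X)"
proof -
  have "op.U n X = (\<Sum>I\<in>words n. \<Sum>J\<in>words n. X J I *\<^sub>C uw (rev I) (rev J))"
    unfolding op.U_def by (intro sum.cong refl) (simp add: op_uw words_def)
  also have "\<dots> = (\<Sum>I\<in>words n. \<Sum>J\<in>words n. X (rev (rev J)) (rev (rev I)) *\<^sub>C uw (rev I) (rev J))" by simp
  also have "\<dots> = (\<Sum>I\<in>words n. \<Sum>J\<in>words n. X (rev J) (rev (rev I)) *\<^sub>C uw (rev I) J)"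
    by (intro sum.cong refl sum_words_rev[of "\<lambda>J. X (rev J) (rev (rev _)) *\<^sub>C uw (rev _) J"])
  also have "\<dots> = (\<Sum>I\<in>words n. \<Sum>J\<in>words n. X (rev J) (rev I) *\<^sub>C uw I J)"
    by (rule sum_words_rev[of "\<lambda>I. \<Sum>J\<in>words n. X (rev J) (rev I) *\<^sub>C uw I J"])
  finally show ?thesis by (simp add: U_def mirror_def)
qed

lemma chi_eq: "chi = chi1 u" and op_chi_eq: "op.chi = chi1 u"
  by (simp_all add: chi_def op.chi_def chi1_def)

lemma op_Wel: "X \<in> tmats k k \<Longrightarrow> op.Wel k (mirror X) j i = Wel k X i j"
  by (simp add: op.Wel_def Wel_def op_U mirror_mcomp mirror_emb[OF mirror_tmats] mirror_P ac_simps)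

lemma wvec_Wel:
  "wvec u \<pi> \<Omega> (k, X, i, j) = \<pi> (Wel k X i j) \<Omega>"
  unfolding wvec_def Wel_def emb_def[symmetric] u_elt_U proj_eq prod.case U_swap[OF intertwines_P] mcomp_assoc P_idem ..

definition coA :: "nat \<Rightarrow> nat \<Rightarrow> nat \<Rightarrow> real" where
  "coA k i j = D (k + j) * D (Suc (k + j)) / (D (Suc (i + k + j)) * D (i + k + j))"
definition coB :: "nat \<Rightarrow> complex \<Rightarrow> nat \<Rightarrow> nat \<Rightarrow> complex" where
  "coB k \<nu> i j = \<nu> * complex_of_real (D j * D (k + j) / (D (Suc (i + k + j)) * D (i + k + j)))"
definition coC :: "nat \<Rightarrow> nat \<Rightarrow> nat \<Rightarrow> complex" where
  "coC k i j = complex_of_real (D j * D (j-1) / (D (Suc (i + k + j)) * D (i + k + j)))"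

lemma D_ratio: "D n / D (n + i) \<le> (5/13) ^ i" if "n + i > 0"
proof -
  have "(13/5) ^ i * D n \<le> D (n + i)"
  proof (induction i)
    case (Suc i)
    have "(13/5) ^ Suc i * D n = 13/5 * ((13/5) ^ i * D n)" by simp
    also have "\<dots> \<le> 13/5 * D (n + i)" using Suc by (intro mult_left_mono) auto
    also have "\<dots> \<le> D (n + Suc i)" using D_growth[of "n + i"] by simp
    finally show ?case .
  qed simp
  moreover have "D (n + i) > 0" using D_pos[of "n + i - 1"] that by simp
  ultimately have "D n / D (n + i) \<le> 1 / (13/5) ^ i" by (simp add: field_simps)
  then show ?thesis by (simp add: power_divide)
qed

text \<open>Each coefficient is a product of two quotients of quantum dimensions whose indices differ by at
  least \<open>i\<close>, and by at least \<open>i + 2\<close> when the numerator has an index below \<open>j + 1\<close>, since \<open>k \<ge> 1\<close>.\<close>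
lemma coeffs:
  assumes "k \<ge> 1" and \<nu>: "cmod \<nu> \<le> 2"
  shows "half_block_coeffs (coA k) (coB k \<nu>) (coC k)"
proof
  fix i j
  let ?n = "i + k + j"
  have pos: "D ?n > 0" "D (Suc ?n) > 0" using D_pos[of "?n - 1"] D_pos[of ?n] assms by auto
  have sq: "(25/169::real) ^ i = (5/13) ^ i * (5/13) ^ i" by (simp add: power_mult_distrib[symmetric])
  have r: "D (k + j) / D ?n \<le> (5/13) ^ i" "D (Suc (k + j)) / D (Suc ?n) \<le> (5/13) ^ i"
    using D_ratio[of "k + j" i] D_ratio[of "Suc (k + j)" i] assms by (simp_all add: ac_simps)
  have small: "(5/13::real) ^ (Suc (i + k)) \<le> (5/13) ^ (i + 2)" using assms by (intro power_decreasing) auto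
  have rj: "D j / D (Suc ?n) \<le> (5/13) ^ (i + 2)"
  proof -
    have "j + Suc (i + k) = Suc ?n" by simp
    then show ?thesis using order_trans[OF D_ratio[of j "Suc (i + k)"] small] by (simp only:, (simp)?)
  qed
  have rj1: "D (j-1) / D ?n \<le> (5/13) ^ (i + 2)"
  proof (cases j)
    case (Suc j')
    then have "j' + Suc (i + k) = ?n" by simp
    then show ?thesis using order_trans[OF D_ratio[of j' "Suc (i + k)"] small] Suc by (simp only:, (simp)?)
  qed (simp add: divide_nonneg_nonneg)
  have nn: "0 \<le> D a / D b" for a b by (simp add: D_nonneg)
  show "0 \<le> coA k i j" unfolding coA_def using D_nonneg by (intro divide_nonneg_nonneg mult_nonneg_nonneg) auto
  have "coA k i j = (D (k + j) / D ?n) * (D (Suc (k + j)) / D (Suc ?n))" by (simp add: coA_def)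
  also have "\<dots> \<le> (5/13) ^ i * (5/13) ^ i" using r nn by (intro mult_mono) auto
  finally show "coA k i j \<le> (25/169) ^ i" by (simp add: sq)
  have "cmod (coB k \<nu> i j) = cmod \<nu> * ((D j / D (Suc ?n)) * (D (k + j) / D ?n))"
    using D_nonneg pos by (simp add: coB_def norm_mult norm_divide)
  also have "\<dots> \<le> 2 * ((5/13) ^ (i + 2) * (5/13) ^ i)" using r rj nn \<nu> by (intro mult_mono mult_nonneg_nonneg) auto
  also have "\<dots> = 50/169 * (25/169) ^ i" by (simp add: sq power_add power2_eq_square)
  finally show "cmod (coB k \<nu> i j) \<le> 50/169 * (25/169) ^ i" .
  have "cmod (coC k i j) = (D j / D (Suc ?n)) * (D (j-1) / D ?n)"
    using D_nonneg pos by (simp add: coC_def norm_mult norm_divide)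
  also have "\<dots> \<le> (5/13) ^ (i + 2) * (5/13) ^ (i + 2)" using rj rj1 nn by (intro mult_mono) auto
  also have "\<dots> = (25/169)^2 * (25/169) ^ i" by (simp add: sq power_add power2_eq_square)
  finally show "cmod (coC k i j) \<le> (25/169)^2 * (25/169) ^ i" .
qed

text \<open>The mirror image of \<open>X\<close> is an eigenvector with the inverse eigenvalue. As the formulas involve only
  \<open>\<mu> + \<mu>\<^sup>-\<^sup>1\<close>, the right action has the same coefficients as the left one.\<close>
lemma block_formulas:
  assumes k: "k \<ge> 1" and X: "X \<in> BHoo k" and ne: "X \<noteq> (\<lambda>I J. 0)" and rot: "rotation k X = (\<lambda>I J. \<mu> * X I J)"
  defines "\<nu> \<equiv> (-1)^k * (\<mu> + inverse \<mu>)"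
  shows "cmod \<nu> \<le> 2"
    and "chi1 u * Wel k X i j = Wel k X (Suc i) j + (if i = 0 then 0 else (1 - complex_of_real (coA k i j)) *\<^sub>C Wel k X (i-1) j)
       + (if j = 0 then 0 else coB k \<nu> i j *\<^sub>C Wel k X i (j-1)) - (if j < 2 then 0 else coC k i j *\<^sub>C Wel k X (Suc i) (j-2))"
    and "Wel k X i j * chi1 u = Wel k X i (Suc j) + (if j = 0 then 0 else (1 - complex_of_real (coA k j i)) *\<^sub>C Wel k X i (j-1))
       + (if i = 0 then 0 else coB k \<nu> j i *\<^sub>C Wel k X (i-1) j) - (if i < 2 then 0 else coC k j i *\<^sub>C Wel k X (i-2) (Suc j))"
proof -
  obtain k' where k': "k = Suc k'" using k by (cases k) auto
  have tl: "traceless k' X" using X unfolding k' by (rule BHoo_traceless)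
  have tX: "X \<in> tmats (Suc k') (Suc k')" using tl by (simp add: traceless_def)
  have r: "rot (Suc k') X = (\<lambda>I J. \<mu> * X I J)" using rot rotation_eq[OF tl] by (simp add: k')
  note e = rot_eigenvalue[OF tX ne r]
  have "cmod (inverse \<mu>) = 1" using e(1) by (simp add: norm_inverse)
  then have "cmod (\<mu> + inverse \<mu>) \<le> 2" using norm_triangle_ineq[of \<mu> "inverse \<mu>"] e(1) by simp
  then show "cmod \<nu> \<le> 2" by (simp add: \<nu>_def norm_mult norm_power)
  show "chi1 u * Wel k X i j = Wel k X (Suc i) j + (if i = 0 then 0 else (1 - complex_of_real (coA k i j)) *\<^sub>C Wel k X (i-1) j)
       + (if j = 0 then 0 else coB k \<nu> i j *\<^sub>C Wel k X i (j-1)) - (if j < 2 then 0 else coC k i j *\<^sub>C Wel k X (Suc i) (j-2))"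
    using left_multiplication[OF tl r e(2), of i j] unfolding chi_eq coA_def coB_def coC_def \<nu>_def k' .
  have r1: "rot (Suc k') (mirror X) = (\<lambda>I J. inverse \<mu> * mirror X I J)" unfolding rot_mirror e(2) mirror_scale ..
  have r2: "rot_inv (Suc k') (mirror X) = (\<lambda>I J. \<mu> * mirror X I J)" unfolding rot_inv_mirror r mirror_scale ..
  have eq: "i + Suc k' + j = j + Suc k' + i" by simp
  show "Wel k X i j * chi1 u = Wel k X i (Suc j) + (if j = 0 then 0 else (1 - complex_of_real (coA k j i)) *\<^sub>C Wel k X i (j-1))
       + (if i = 0 then 0 else coB k \<nu> j i *\<^sub>C Wel k X (i-1) j) - (if i < 2 then 0 else coC k j i *\<^sub>C Wel k X (i-2) (Suc j))"
    using op.left_multiplication[OF traceless_mirror[OF tl] r1 r2, of j i]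
    unfolding op_chi_eq op_Wel[OF tX] coA_def coB_def coC_def \<nu>_def k' add.commute[of "inverse \<mu>" \<mu>] .
qed

end

lemma box_sum_transpose: "box_sum v M (\<lambda>i j. F j i) = box_sum (\<lambda>i j. v j i) M F"
  unfolding box_sum_def by (rule sum.swap)

lemma (in half_block_coeffs) Lw_support:
  assumes "\<And>i j. i \<ge> M \<or> j \<ge> M \<Longrightarrow> z i j = 0" "i \<ge> Suc M \<or> j \<ge> Suc M"
  shows "Lw z i j = 0"
proof -
  have "i \<noteq> 0 \<Longrightarrow> z (i-1) j = 0" "z (Suc i) j = 0" "z i (Suc j) = 0" "i \<noteq> 0 \<Longrightarrow> z (i-1) (j+2) = 0"
    using assms(2) by (intro assms(1); linarith)+
  then show ?thesis unfolding Lw_def by (cases "i = 0") simp_all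
qed

text \<open>The left and the right action have the same coefficients up to exchanging the indices, so the
  strip estimate applies to the rows and to the columns of the same vector.\<close>
lemma two_sided_strip_bound:
  fixes w :: "nat \<Rightarrow> nat \<Rightarrow> 'b::complex_vector"
  assumes left: "half_block a b c w L R" and right: "half_block a b c (\<lambda>i j. w j i) R L"
    and z: "\<And>i j. i \<ge> M \<or> j \<ge> M \<Longrightarrow> z i j = 0" and p: "p > 0"
  defines "y \<equiv> \<lambda>i j. half_block_coeffs.Lw a b c z i j - half_block_coeffs.Lw a b c (\<lambda>i j. z j i) j i"
  shows "\<And>i j. i \<ge> Suc M \<or> j \<ge> Suc M \<Longrightarrow> y i j = 0"
    and "box_sum w (M + 2) y = L (box_sum w (M + 2) z) - R (box_sum w (M + 2) z)"
    and "(\<Sum>i<M. \<Sum>j<M. if i < m \<or> j < m then (cmod (z i j))^2 else 0) \<le> 2 * strip_const m *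
    (1/p * (\<Sum>i<M. \<Sum>j<M. (cmod (z i j))^2) + p * (\<Sum>i<Suc M. \<Sum>j<Suc M. (cmod (y i j))^2))"
proof -
  interpret l: half_block a b c w L R by (rule left)
  interpret r: half_block a b c "\<lambda>i j. w j i" R L by (rule right)
  let ?zt = "\<lambda>i j. z j i"
  have zt: "\<And>i j. i \<ge> M \<or> j \<ge> M \<Longrightarrow> ?zt i j = 0" using z by auto
  show y0: "\<And>i j. i \<ge> Suc M \<or> j \<ge> Suc M \<Longrightarrow> y i j = 0"
    unfolding y_def using l.Lw_support[of M z] l.Lw_support[of M ?zt] z by (metis diff_self)
  have L: "L (box_sum w (M + 2) z) = box_sum w (M + 2) (l.Lw z)"
    using z by (intro l.L_box_w) auto
  have R: "R (box_sum w (M + 2) z) = box_sum w (M + 2) (\<lambda>i j. l.Lw ?zt j i)"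
  proof -
    have "R (box_sum (\<lambda>i j. w j i) (M + 2) ?zt) = box_sum (\<lambda>i j. w j i) (M + 2) (l.Lw ?zt)"
      using zt by (intro r.L_box_w) auto
    then show ?thesis unfolding box_sum_transpose[of w, symmetric] .
  qed
  show T: "box_sum w (M + 2) y = L (box_sum w (M + 2) z) - R (box_sum w (M + 2) z)"
    unfolding L R y_def by (rule box_sum_diff)
  let ?E = "1/p * (\<Sum>i<M. \<Sum>j<M. (cmod (z i j))^2) + p * (\<Sum>i<Suc M. \<Sum>j<Suc M. (cmod (y i j))^2)"
  have 1: "(\<Sum>i<m. \<Sum>j<M. (cmod (z i j))^2) \<le> strip_const m * ?E"
    by (rule l.strip_bound[OF z y0 T p])
  have T': "box_sum (\<lambda>i j. w j i) (M + 2) (\<lambda>i j. - y j i) = R (box_sum (\<lambda>i j. w j i) (M + 2) ?zt) - L (box_sum (\<lambda>i j. w j i) (M + 2) ?zt)"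
  proof -
    have "box_sum w (M + 2) (\<lambda>i j. - y i j) = - box_sum w (M + 2) y"
      using box_sum_scale[of w "M + 2" "-1" y] by simp
    then show ?thesis unfolding box_sum_transpose[of w, symmetric] T by simp
  qed
  have "(\<Sum>i<m. \<Sum>j<M. (cmod (z j i))^2) \<le> strip_const m *
     (1/p * (\<Sum>i<M. \<Sum>j<M. (cmod (z j i))^2) + p * (\<Sum>i<Suc M. \<Sum>j<Suc M. (cmod (- y j i))^2))"
    by (rule r.strip_bound[OF zt _ T' p]) (use y0 in auto)
  also have "\<dots> = strip_const m * ?E"
    unfolding norm_minus_cancel sum.swap[of "\<lambda>i j. (cmod (z j i))^2"] sum.swap[of "\<lambda>i j. (cmod (y j i))^2"] ..
  finally have 2: "(\<Sum>i<m. \<Sum>j<M. (cmod (z j i))^2) \<le> strip_const m * ?E" .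
  have "(\<Sum>i<M. \<Sum>j<M. if i < m \<or> j < m then (cmod (z i j))^2 else 0)
     \<le> (\<Sum>i<M. \<Sum>j<M. (if i < m then (cmod (z i j))^2 else 0) + (if j < m then (cmod (z i j))^2 else 0))"
    by (intro sum_mono) auto
  also have "\<dots> = (\<Sum>i<M. if i < m then (\<Sum>j<M. (cmod (z i j))^2) else 0) + (\<Sum>j<M. if j < m then (\<Sum>i<M. (cmod (z i j))^2) else 0)"
  proof -
    have "(\<Sum>i<M. \<Sum>j<M. if j < m then (cmod (z i j))^2 else 0) = (\<Sum>j<M. if j < m then (\<Sum>i<M. (cmod (z i j))^2) else 0)"
      by (subst sum.swap) (intro sum.cong refl, auto)
    moreover have "(\<Sum>i<M. \<Sum>j<M. if i < m then (cmod (z i j))^2 else 0) = (\<Sum>i<M. if i < m then (\<Sum>j<M. (cmod (z i j))^2) else 0)"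
      by (intro sum.cong refl) auto
    ultimately show ?thesis by (simp only: sum.distrib)
  qed
  also have "\<dots> \<le> (\<Sum>i<m. \<Sum>j<M. (cmod (z i j))^2) + (\<Sum>i<m. \<Sum>j<M. (cmod (z j i))^2)"
  proof -
    have gen: "(\<Sum>i<M. if i < m then f i else 0) \<le> (\<Sum>i<m. f i)" if "\<And>i. f i \<ge> 0" for f :: "nat \<Rightarrow> real"
    proof -
      have "(\<Sum>i<M. if i < m then f i else 0) = (\<Sum>i\<in>{i\<in>{..<M}. i < m}. f i)" by (rule sum.inter_filter[symmetric]) simp
      also have "\<dots> \<le> (\<Sum>i<m. f i)" using that by (intro sum_mono2) auto
      finally show ?thesis .
    qed
    show ?thesis by (intro add_mono gen sum_nonneg) auto
  qed
  also have "\<dots> \<le> strip_const m * ?E + strip_const m * ?E" using 1 2 by (rule add_mono)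
  finally show "(\<Sum>i<M. \<Sum>j<M. if i < m \<or> j < m then (cmod (z i j))^2 else 0) \<le> 2 * strip_const m * ?E" by simp
qed

section \<open>C*-algebras\<close>

lemma star_zero [simp]: "star (0::'a::cstar_algebra) = 0"
  using star_add[of 0 "0::'a"] by simp

lemma star_scaleR: "star (r *\<^sub>R x) = r *\<^sub>R star (x::'a::cstar_algebra)"
  by (simp add: scaleR_scaleC star_scaleC)
lemma star_one [simp]: "star (1::'a::cstar_algebra) = 1"
  using star_mult[of "star 1" "1::'a"] by (simp add: star_star)
lemma star_sum: "star (\<Sum>i\<in>A. f i) = (\<Sum>i\<in>A. star (f i :: 'a::cstar_algebra))"
  by (induction A rule: infinite_finite_induct) (simp_all add: star_add)
lemma star_power: "star (x ^ n) = star (x::'a::cstar_algebra) ^ n"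
  by (induction n) (simp_all add: star_mult power_commutes)

lemma norm_star [simp]: "norm (star x) = norm (x::'a::cstar_algebra)"
proof -
  have *: "norm y \<le> norm (star y)" for y :: 'a
  proof (cases "y = 0")
    case False
    have "norm y * norm y \<le> norm (star y) * norm y"
      using norm_mult_ineq[of "star y" y] by (simp add: cstar_identity power2_eq_square)
    then show ?thesis using False by simp
  qed simp
  show ?thesis using *[of x] *[of "star x"] by (simp add: star_star)
qed

lemma star_bounded_linear: "bounded_linear (star :: 'a::cstar_algebra \<Rightarrow> 'a)"
  by (rule bounded_linear_intro[of _ 1]) (simp_all add: star_add star_scaleR)

lemma sqrt_coeff_le: "\<bar>(1/2 :: real) gchoose n\<bar> \<le> 1"
proof -
  have "\<bar>\<Prod>i=0..<n. (1/2 :: real) - real i\<bar> \<le> fact n" 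
  proof (induction n)
    case (Suc n)
    have "\<bar>(1/2 :: real) - real n\<bar> \<le> real (Suc n)" by linarith
    then have "\<bar>(1/2 :: real) - real n\<bar> * \<bar>\<Prod>i=0..<n. (1/2 :: real) - real i\<bar> \<le> real (Suc n) * fact n"
      using Suc by (intro mult_mono) auto
    then show ?case by (simp add: abs_mult mult.commute)
  qed simp
  then show ?thesis by (simp add: gbinomial_prod_rev abs_divide)
qed

text \<open>The binomial series provides a self-adjoint square root of \<open>1 - y\<close> when \<open>y\<close> is a
  self-adjoint strict contraction.\<close>
lemma exists_sqrt:
  fixes y :: "'a::cstar_algebra"
  assumes sa: "star y = y" and lt: "norm y < 1"
  shows "\<exists>b. star b = b \<and> b * b = 1 - y"
proof -
  define c where "c n = (-1)^n * ((1/2 :: real) gchoose n)" for n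
  define s where "s n = c n *\<^sub>R y ^ n" for n
  have sm: "summable (\<lambda>n. norm (s n))"
  proof (rule summable_comparison_test'[where g = "\<lambda>n. norm y ^ n" and N = 0])
    show "summable (\<lambda>n. norm y ^ n)" using lt by (simp add: summable_geometric)
    fix n :: nat
    have "norm (s n) = \<bar>(1/2 :: real) gchoose n\<bar> * norm (y ^ n)" by (simp add: s_def c_def abs_mult)
    also have "\<dots> \<le> 1 * norm y ^ n" using sqrt_coeff_le norm_power_ineq by (intro mult_mono) auto
    finally show "norm (norm (s n)) \<le> norm y ^ n" by simp
  qed
  have conv: "(\<Sum>i\<le>n. s i * s (n - i)) = (if n = 0 then 1 else if n = 1 then - y else 0)" for n
  proof -
    have "s i * s (n - i) = ((-1)^n * (((1/2) gchoose i) * ((1/2) gchoose (n - i)))) *\<^sub>R y ^ n" if "i \<le> n" for i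
    proof -
      have "(-1::real)^i * (-1)^(n-i) = (-1)^n" "y ^ i * y ^ (n - i) = y ^ n" using that by (simp_all flip: power_add)
      then show ?thesis by (simp add: s_def c_def mult.commute mult.left_commute)
    qed
    then have "(\<Sum>i\<le>n. s i * s (n - i)) = ((-1)^n * (\<Sum>i=0..n. ((1/2) gchoose i) * ((1/2) gchoose (n - i)))) *\<^sub>R y ^ n"
      by (simp add: sum_distrib_left scaleR_sum_left atMost_atLeast0)
    also have "(\<Sum>i=0..n. ((1/2 :: real) gchoose i) * ((1/2) gchoose (n - i))) = 1 gchoose n"
      using gbinomial_Vandermonde[of "1/2 :: real" "1/2" n] by simp
    also have "(1 :: real) gchoose n = real (1 choose n)"
      using binomial_gbinomial[of 1 n, where 'a = real] by simp
    finally show ?thesis by (cases n) (auto simp: binomial_eq_0)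
  qed
  define b where "b = suminf s"
  have "(\<lambda>n. \<Sum>i\<le>n. s i * s (n - i)) sums (b * b)"
    unfolding b_def by (rule Cauchy_product_sums[OF sm sm])
  moreover have "(\<lambda>n. if n = 0 then 1 else if n = 1 then - y else 0) sums (\<Sum>n\<in>{0,1::nat}. if n = 0 then 1 else if n = 1 then - y else 0)"
    by (rule sums_finite[of "{0,1::nat}"]) auto
  ultimately have bb: "b * b = 1 - y"
    unfolding conv using sums_unique2 by fastforce
  have "star b = suminf (\<lambda>n. star (s n))"
    unfolding b_def using bounded_linear.suminf[OF star_bounded_linear summable_norm_cancel[OF sm]] by simp
  also have "\<dots> = b" unfolding b_def by (simp add: s_def[abs_def] star_scaleR star_power sa)
  finally show ?thesis using bb by blast
qed

text \<open>If \<open>r > \<parallel>a\<parallel>\<close> then \<open>1 - a\<^sup>*a / r\<^sup>2\<close> has a self-adjoint square root, so the state is nonnegative on it.\<close>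
lemma state_bound:
  fixes a :: "'a::cstar_algebra"
  assumes st: "state h"
  shows "Re (h (star a * a)) \<le> (norm a)^2"
proof (rule field_le_epsilon)
  fix e :: real assume e: "e > 0"
  define r where "r = sqrt ((norm a)^2 + e)"
  have r: "r > 0" "r^2 = (norm a)^2 + e" using e by (auto simp: r_def add_nonneg_pos)
  define y where "y = (1/r^2) *\<^sub>R (star a * a)"
  have "norm y = \<bar>1/r^2\<bar> * norm (star a * a)" by (simp only: y_def norm_scaleR)
  also have "\<dots> = (norm a)^2 / r^2" by (simp add: cstar_identity)
  also have "\<dots> < 1"
  proof -
    have "0 < r^2" "(norm a)^2 < r^2" using r(1) zero_less_power[OF r(1), of 2] r(2) e by linarith+
    then show ?thesis by (simp only: divide_less_eq) simp
  qed
  finally have "norm y < 1" .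
  moreover have "star y = y" by (simp add: y_def star_scaleR star_mult star_star)
  ultimately obtain b where b: "star b = b" "b * b = 1 - y" using exists_sqrt by blast
  have add: "h (x + z) = h x + h z" and scale: "h (c *\<^sub>C x) = c * h x" for x z c
    using st by (auto simp: state_def cfunctional_def)
  have "0 \<le> Re (h (star b * b))" using st by (simp add: state_def)
  also have "star b * b = 1 + (-1) *\<^sub>C y" unfolding b using scaleR_scaleC[of "-1" y] b(2) by (simp add: b(1))
  also have "Re (h (1 + (-1) *\<^sub>C y)) = 1 - Re (h y)" unfolding add scale using st by (simp add: state_def)
  also have "h y = complex_of_real (1/r^2) * h (star a * a)" unfolding y_def scaleR_scaleC scale ..
  finally have "Re (h (star a * a)) / r^2 \<le> 1" by simp
  then have "Re (h (star a * a)) \<le> r^2" using zero_less_power[OF r(1), of 2] by (simp only: divide_le_eq) simp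
  then show "Re (h (star a * a)) \<le> (norm a)^2 + e" unfolding r(2) .
qed

section \<open>Hilbert space\<close>

lemma norm_scaleC_chilbert: "norm (c *\<^sub>C x) = cmod c * norm (x::'h::chilbert)"
proof -
  have "complex_of_real ((norm (c *\<^sub>C x))^2) = c * cnj (c * cinner x x)"
    unfolding norm_cinner cinner_scaleC_right using cinner_commute[of "c *\<^sub>C x" x] by (simp add: cinner_scaleC_right)
  also have "\<dots> = complex_of_real ((cmod c * norm x)^2)"
  proof -
    have "cnj (cinner x x) = cinner x x" using cinner_commute[of x x] by simp
    then have "c * cnj (c * cinner x x) = (c * cnj c) * cinner x x" by simp
    also have "\<dots> = complex_of_real ((cmod c)^2) * complex_of_real ((norm x)^2)"
      by (simp only: norm_cinner[symmetric] complex_norm_square[symmetric])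
    finally show ?thesis by (simp add: power_mult_distrib)
  qed
  finally have "(norm (c *\<^sub>C x))^2 = (cmod c * norm x)^2" by (simp only: of_real_eq_iff)
  then show ?thesis by (simp add: power2_eq_iff_nonneg)
qed

lemma cinner_add_left: "cinner (x + y) z = cinner x z + cinner y (z::'h::chilbert)"
  using cinner_commute[of "x + y" z] cinner_commute[of x z] cinner_commute[of y z] by (simp add: cinner_add_right)

lemma cinner_scaleC_left: "cinner (c *\<^sub>C x) y = cnj c * cinner x (y::'h::chilbert)"
  using cinner_commute[of "c *\<^sub>C x" y] cinner_commute[of x y] by (simp add: cinner_scaleC_right)

lemma cinner_sum_right: "cinner x (\<Sum>i\<in>A. f i) = (\<Sum>i\<in>A. cinner (x::'h::chilbert) (f i))"
proof -
  interpret additive "cinner x" by unfold_locales (rule cinner_add_right)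
  show ?thesis by (rule sum)
qed

lemma cinner_sum_left: "cinner (\<Sum>i\<in>A. f i) x = (\<Sum>i\<in>A. cinner (f i) (x::'h::chilbert))"
proof -
  interpret additive "\<lambda>y. cinner y x" by unfold_locales (rule cinner_add_left)
  show ?thesis by (rule sum)
qed

lemma Re_cinner: "Re (cinner x y) = ((norm (x + y))^2 - (norm x)^2 - (norm (y::'h::chilbert))^2) / 2"
proof -
  have "complex_of_real ((norm (x + y))^2) = cinner x x + cinner y y + (cinner x y + cnj (cinner x y))"
    unfolding norm_cinner using cinner_commute[of y x] by (simp add: cinner_add_left cinner_add_right)
  then have "complex_of_real ((norm (x + y))^2) = complex_of_real ((norm x)^2 + (norm y)^2 + 2 * Re (cinner x y))"
    by (simp only: norm_cinner[symmetric] complex_add_cnj of_real_add)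
  then have "(norm (x + y))^2 = (norm x)^2 + (norm y)^2 + 2 * Re (cinner x y)" by (simp only: of_real_eq_iff)
  then show ?thesis by simp
qed

lemma bounded_clinear_bounded_linear: "bounded_clinear f \<Longrightarrow> bounded_linear f"
proof -
  assume f: "bounded_clinear f"
  then obtain C where C: "\<And>x. norm (f x) \<le> C * norm x" by (auto simp: bounded_clinear_def)
  show ?thesis
    by (rule bounded_linear_intro[of _ C])
       (use f C in \<open>auto simp: bounded_clinear_def clinear_def scaleR_scaleC mult.commute\<close>)
qed

lemma scaleC_bounded_linear: "bounded_linear (\<lambda>x. c *\<^sub>C (x::'h::chilbert))"
  by (rule bounded_linear_intro[of _ "cmod c"])
     (simp_all add: scaleC_add_right scaleR_scaleC scaleC_scaleC norm_scaleC_chilbert mult.commute)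

lemma continuous_cinner_right: "continuous_on UNIV (\<lambda>y. cinner x (y::'h::chilbert))"
proof -
  have Im: "Im (cinner x y) = Re (cinner x ((- \<i>) *\<^sub>C y))" for y by (simp only: cinner_scaleC_right) simp
  have "continuous_on UNIV (\<lambda>y. (- \<i>) *\<^sub>C (y::'h))"
    by (rule linear_continuous_on[OF scaleC_bounded_linear])
  then have "continuous_on UNIV (\<lambda>y. Complex (Re (cinner x y)) (Im (cinner x y)))"
    unfolding Im Re_cinner Complex_eq by (intro continuous_intros) auto
  then show ?thesis by simp
qed

section \<open>The trace and the right action\<close>

locale haar_gns = FO_alg u for u :: "'n::finite \<Rightarrow> 'n \<Rightarrow> 'a::cstar_algebra" +
  fixes tens :: "'a \<Rightarrow> 'a \<Rightarrow> 'b::cstar_algebra" and \<Delta> :: "'a \<Rightarrow> 'b"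
    and h :: "'a \<Rightarrow> complex" and \<pi> :: "'a \<Rightarrow> 'h \<Rightarrow> 'h::chilbert" and \<Omega> :: 'h
  assumes sa: "\<And>i j. star (u i j) = u i j"
    and dense: "closure (range (nc_eval u)) = UNIV"
    and tens: "cstar_tensor_square tens"
    and coproduct: "FO_coproduct u tens \<Delta>"
    and haar: "haar_state tens \<Delta> h"
    and gns: "gns_triple h \<pi> \<Omega>"
begin

lemma h_add: "h (x + y) = h x + h y" and h_scale: "h (c *\<^sub>C x) = c * h x" and h_one: "h 1 = 1"
  using haar by (auto simp: haar_state_def state_def cfunctional_def)

lemma h_sum: "h (\<Sum>i\<in>A. f i) = (\<Sum>i\<in>A. h (f i))"
proof -
  interpret additive h by unfold_locales (rule h_add)
  show ?thesis by (rule sum)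
qed

lemma \<pi>_bounded: "bounded_clinear (\<pi> a)" and \<pi>_add: "\<pi> (a + b) x = \<pi> a x + \<pi> b x"
  and \<pi>_scale: "\<pi> (c *\<^sub>C a) x = c *\<^sub>C \<pi> a x" and \<pi>_one: "\<pi> 1 x = x" and \<pi>_mult: "\<pi> (a * b) x = \<pi> a (\<pi> b x)"
  and \<pi>_star: "cinner (\<pi> (star a) x) y = cinner x (\<pi> a y)"
  and \<pi>_dense: "closure (range (\<lambda>a. \<pi> a \<Omega>)) = UNIV" and \<pi>_h: "cinner \<Omega> (\<pi> a \<Omega>) = h a"
  using gns by (auto simp: gns_triple_def)

lemma \<pi>_diff: "\<pi> (a - b) x = \<pi> a x - \<pi> b x"
  using \<pi>_add[of "a - b" b x] by simp

lemma norm_\<pi>_\<Omega>: "(norm (\<pi> a \<Omega>))^2 = Re (h (star a * a))"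
proof -
  have "complex_of_real ((norm (\<pi> a \<Omega>))^2) = h (star a * a)"
    unfolding norm_cinner using \<pi>_star[of "star a" \<Omega> "\<pi> a \<Omega>"] by (simp add: star_star \<pi>_mult[symmetric] \<pi>_h)
  then show ?thesis by (metis Re_complex_of_real)
qed

lemma norm_\<pi>_\<Omega>_le: "norm (\<pi> a \<Omega>) \<le> norm a"
proof (rule power2_le_imp_le)
  show "(norm (\<pi> a \<Omega>))\<^sup>2 \<le> (norm a)\<^sup>2"
    unfolding norm_\<pi>_\<Omega> using haar by (intro state_bound) (simp add: haar_state_def)
qed simp

lemma \<pi>_\<Omega>_bounded_linear: "bounded_linear (\<lambda>a. \<pi> a \<Omega>)"
  by (rule bounded_linear_intro[of _ 1]) (simp_all add: \<pi>_add \<pi>_scale scaleR_scaleC norm_\<pi>_\<Omega>_le)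

lemma h_continuous: "continuous_on UNIV h"
proof -
  have "continuous_on UNIV (\<lambda>a. cinner \<Omega> (\<pi> a \<Omega>))"
    using continuous_on_compose2[OF continuous_cinner_right[of \<Omega>] linear_continuous_on[OF \<pi>_\<Omega>_bounded_linear]] by simp
  then show ?thesis by (simp add: \<pi>_h)
qed

lemma \<Delta>_uw: "I \<in> words n \<Longrightarrow> J \<in> words n \<Longrightarrow> \<Delta> (uw I J) = (\<Sum>K\<in>words n. tens (uw I K) (uw K J))"
proof (induction n arbitrary: I J)
  case 0
  then show ?case using tens coproduct by (simp add: words_0 cstar_tensor_square_def FO_coproduct_def star_hom_def)
next
  case (Suc n)
  obtain a I' b J' where I: "I = a # I'" "I' \<in> words n" and J: "J = b # J'" "J' \<in> words n"
    using Suc.prems by (auto simp: words_def length_Suc_conv)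
  have \<Delta>m: "\<Delta> (x * y) = \<Delta> x * \<Delta> y" for x y using coproduct by (simp add: FO_coproduct_def star_hom_def)
  have tm: "tens x y * tens z w = tens (x * z) (y * w)" for x y z w using tens by (simp add: cstar_tensor_square_def)
  have "\<Delta> (uw I J) = (\<Sum>k\<in>UNIV. tens (u a k) (u k b)) * (\<Sum>K\<in>words n. tens (uw I' K) (uw K J'))"
    using Suc.IH[OF I(2) J(2)] coproduct by (simp add: I J \<Delta>m FO_coproduct_def)
  also have "\<dots> = (\<Sum>k\<in>UNIV. \<Sum>K\<in>words n. tens (u a k * uw I' K) (u k b * uw K J'))"
    by (simp add: sum_product tm)
  finally show ?case by (simp add: sum_words_Suc I J)
qed

definition Q :: "'n list \<Rightarrow> 'n list \<Rightarrow> complex" where "Q I J = h (uw I J)"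

text \<open>Invariance of the Haar state under the two slice maps.\<close>
lemma Q_left: "I \<in> words n \<Longrightarrow> J \<in> words n \<Longrightarrow> (\<Sum>K\<in>words n. Q I K *\<^sub>C uw K J) = Q I J *\<^sub>C 1"
  and Q_right: "I \<in> words n \<Longrightarrow> J \<in> words n \<Longrightarrow> (\<Sum>K\<in>words n. Q K J *\<^sub>C uw I K) = Q I J *\<^sub>C 1"
proof -
  obtain S where S: "bounded_clinear S" "\<And>a b. S (tens a b) = h a *\<^sub>C b" "\<And>a. S (\<Delta> a) = h a *\<^sub>C 1"
    using haar by (auto simp: haar_state_def)
  obtain T where T: "bounded_clinear T" "\<And>a b. T (tens a b) = h b *\<^sub>C a" "\<And>a. T (\<Delta> a) = h a *\<^sub>C 1"
    using haar by (auto simp: haar_state_def)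
  interpret S: bounded_linear S by (rule bounded_clinear_bounded_linear[OF S(1)])
  interpret T: bounded_linear T by (rule bounded_clinear_bounded_linear[OF T(1)])
  assume IJ: "I \<in> words n" "J \<in> words n"
  show "(\<Sum>K\<in>words n. Q I K *\<^sub>C uw K J) = Q I J *\<^sub>C 1"
    using S(3)[of "uw I J"] unfolding \<Delta>_uw[OF IJ] S.sum S(2) Q_def .
  show "(\<Sum>K\<in>words n. Q K J *\<^sub>C uw I K) = Q I J *\<^sub>C 1"
    using T(3)[of "uw I J"] unfolding \<Delta>_uw[OF IJ] T.sum T(2) Q_def .
qed

definition fixed :: "nat \<Rightarrow> ('n list \<Rightarrow> complex) \<Rightarrow> bool" where
  "fixed n \<xi> \<longleftrightarrow> (\<forall>I\<in>words n. (\<Sum>J\<in>words n. \<xi> J *\<^sub>C uw I J) = \<xi> I *\<^sub>C 1)"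

lemma fixed_Q: "fixed n \<xi> \<Longrightarrow> I \<in> words n \<Longrightarrow> (\<Sum>J\<in>words n. \<xi> J * Q I J) = \<xi> I"
proof -
  assume "fixed n \<xi>" "I \<in> words n"
  then have "h (\<Sum>J\<in>words n. \<xi> J *\<^sub>C uw I J) = h (\<xi> I *\<^sub>C 1)" by (simp add: fixed_def)
  then show ?thesis by (simp add: h_sum h_scale h_one Q_def)
qed

lemma uw_unitary: "L \<in> words n \<Longrightarrow> K \<in> words n \<Longrightarrow> (\<Sum>J\<in>words n. uw L J * star (uw K J)) = of_bool (L = K)"
proof (induction n arbitrary: L K)
  case 0
  then show ?case by (simp add: words_0)
next
  case (Suc n)
  obtain a L' b K' where L: "L = a # L'" "L' \<in> words n" and K: "K = b # K'" "K' \<in> words n"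
    using Suc.prems by (auto simp: words_def length_Suc_conv)
  have "(\<Sum>J\<in>words (Suc n). uw L J * star (uw K J)) = (\<Sum>k\<in>UNIV. u a k * (\<Sum>J\<in>words n. uw L' J * star (uw K' J)) * u b k)"
    by (simp add: sum_words_Suc L K star_mult sa sum_distrib_left sum_distrib_right mult.assoc)
  also have "\<dots> = of_bool (L = K)"
    unfolding Suc.IH[OF L(2) K(2)] using row_u[of a b] by (auto simp: L K)
  finally show ?case .
qed

text \<open>Conjugating left invariance and using unitarity shows that the rows of \<open>Q\<close> are, after complex
  conjugation, fixed vectors, hence fixed by \<open>Q\<close>. This gives \<open>cnj (Q J I) = (Q Q\<^sup>*) I J\<close>, which
  is Hermitian. So \<open>Q\<close> is the orthogonal projection onto the fixed vectors.\<close>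
lemma Q_hermitian: "I \<in> words n \<Longrightarrow> J \<in> words n \<Longrightarrow> cnj (Q J I) = Q I J"
proof -
  have fx: "fixed n (\<lambda>K. cnj (Q I K))" if I: "I \<in> words n" for I
    unfolding fixed_def
  proof (intro ballI)
    fix L :: "'n list" assume L: "L \<in> words n"
    have 1: "(\<Sum>K\<in>words n. cnj (Q I K) *\<^sub>C star (uw K J)) = cnj (Q I J) *\<^sub>C 1" if "J \<in> words n" for J
      using arg_cong[OF Q_left[OF I that], of star] by (simp add: star_sum star_scaleC)
    have "(\<Sum>J\<in>words n. cnj (Q I J) *\<^sub>C uw L J) = (\<Sum>J\<in>words n. uw L J * (\<Sum>K\<in>words n. cnj (Q I K) *\<^sub>C star (uw K J)))"
      using 1 by (intro sum.cong refl) (simp add: scaleC_mult_right)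
    also have "\<dots> = (\<Sum>J\<in>words n. \<Sum>K\<in>words n. cnj (Q I K) *\<^sub>C (uw L J * star (uw K J)))"
      by (simp add: sum_distrib_left scaleC_mult_right)
    also have "\<dots> = (\<Sum>K\<in>words n. cnj (Q I K) *\<^sub>C (\<Sum>J\<in>words n. uw L J * star (uw K J)))"
      unfolding scaleC.scale_sum_right by (rule sum.swap)
    also have "\<dots> = (\<Sum>K\<in>words n. if K = L then cnj (Q I L) *\<^sub>C 1 else 0)"
      using L by (intro sum.cong refl) (auto simp: uw_unitary)
    finally show "(\<Sum>J\<in>words n. cnj (Q I J) *\<^sub>C uw L J) = cnj (Q I L) *\<^sub>C 1" using L by simp
  qed
  assume I: "I \<in> words n" and J: "J \<in> words n"
  have a: "(\<Sum>K\<in>words n. cnj (Q J K) * Q I K) = cnj (Q J I)" using fixed_Q[OF fx[OF J] I] .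
  have b: "(\<Sum>K\<in>words n. cnj (Q I K) * Q J K) = cnj (Q I J)" using fixed_Q[OF fx[OF I] J] .
  have "Q I J = cnj (\<Sum>K\<in>words n. cnj (Q I K) * Q J K)" unfolding b by simp
  also have "\<dots> = (\<Sum>K\<in>words n. cnj (Q J K) * Q I K)" by (simp add: mult.commute)
  finally show "cnj (Q J I) = Q I J" using a by simp
qed

lemma fixed_column: "J \<in> words n \<Longrightarrow> fixed n (\<lambda>I. Q I J)"
  by (simp add: fixed_def Q_right)

text \<open>Multiplying the equation of a fixed vector by the entries of \<open>u\<close> and using the orthogonality
  relations moves the first factor to the end. Moving the last factor to the front is the inverse operation.\<close>
lemma fixed_shift:
  assumes "fixed (Suc n) \<xi>"
  shows "fixed (Suc n) (\<lambda>J. \<xi> (last J # butlast J))" and "fixed (Suc n) (\<lambda>J. \<xi> (tl J @ [hd J]))"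
proof -
  have scm: "x * (c *\<^sub>C y) = c *\<^sub>C (x * y)" "(c *\<^sub>C x) * y = c *\<^sub>C (x * y)" for c and x y :: 'a
    by (simp_all add: scaleC_mult_left scaleC_mult_right)
  have 1: "(\<Sum>b\<in>UNIV. \<Sum>J\<in>words n. \<xi> (b # J) *\<^sub>C (u i b * uw I J)) = \<xi> (i # I) *\<^sub>C 1" if "I \<in> words n" for i I
  proof -
    have "i # I \<in> words (Suc n)" using that by (simp add: words_def)
    then have "(\<Sum>J\<in>words (Suc n). \<xi> J *\<^sub>C uw (i # I) J) = \<xi> (i # I) *\<^sub>C 1" using assms by (simp add: fixed_def)
    then show ?thesis by (simp add: sum_words_Suc)
  qed
  show "fixed (Suc n) (\<lambda>J. \<xi> (last J # butlast J))"
    unfolding fixed_def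
  proof (intro ballI)
    fix H :: "'n list" assume "H \<in> words (Suc n)"
    then obtain I l where H: "H = I @ [l]" "I \<in> words n" by (cases H rule: rev_cases) (auto simp: words_def)
    have 2: "(\<Sum>J\<in>words n. \<xi> (a # J) *\<^sub>C uw I J) = (\<Sum>i\<in>UNIV. \<xi> (i # I) *\<^sub>C u i a)" for a
    proof -
      have "(\<Sum>i\<in>UNIV. \<xi> (i # I) *\<^sub>C u i a) = (\<Sum>i\<in>UNIV. u i a * (\<Sum>b\<in>UNIV. \<Sum>J\<in>words n. \<xi> (b # J) *\<^sub>C (u i b * uw I J)))"
        unfolding 1[OF H(2)] by (simp add: scm)
      also have "\<dots> = (\<Sum>i\<in>UNIV. \<Sum>b\<in>UNIV. \<Sum>J\<in>words n. \<xi> (b # J) *\<^sub>C (u i a * u i b * uw I J))"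
        by (simp add: sum_distrib_left scm mult.assoc)
      also have "\<dots> = (\<Sum>b\<in>UNIV. \<Sum>i\<in>UNIV. \<Sum>J\<in>words n. \<xi> (b # J) *\<^sub>C (u i a * u i b * uw I J))"
        by (rule sum.swap)
      also have "\<dots> = (\<Sum>b\<in>UNIV. \<Sum>J\<in>words n. \<Sum>i\<in>UNIV. \<xi> (b # J) *\<^sub>C (u i a * u i b * uw I J))"
        by (intro sum.cong refl sum.swap)
      also have "\<dots> = (\<Sum>b\<in>UNIV. \<Sum>J\<in>words n. \<xi> (b # J) *\<^sub>C ((\<Sum>i\<in>UNIV. u i a * u i b) * uw I J))"
        by (simp add: sum_distrib_right scaleC.scale_sum_right)
      also have "\<dots> = (\<Sum>b\<in>UNIV. if b = a then (\<Sum>J\<in>words n. \<xi> (b # J) *\<^sub>C uw I J) else 0)"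
        unfolding col_u by (intro sum.cong refl) auto
      finally show ?thesis by simp
    qed
    have "(\<Sum>J\<in>words (Suc n). \<xi> (last J # butlast J) *\<^sub>C uw H J) = (\<Sum>J\<in>words n. \<Sum>b\<in>UNIV. \<xi> (b # J) *\<^sub>C (uw I J * u l b))"
      unfolding sum_words_Suc_right using H by (intro sum.cong refl) (auto simp: uw_append words_def)
    also have "\<dots> = (\<Sum>b\<in>UNIV. (\<Sum>J\<in>words n. \<xi> (b # J) *\<^sub>C uw I J) * u l b)"
      by (subst sum.swap) (simp add: sum_distrib_right scm)
    also have "\<dots> = (\<Sum>i\<in>UNIV. \<xi> (i # I) *\<^sub>C (\<Sum>b\<in>UNIV. u i b * u l b))"
      unfolding 2 sum_distrib_right scaleC.scale_sum_right scm by (rule sum.swap)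
    also have "\<dots> = (\<Sum>i\<in>UNIV. if i = l then \<xi> (i # I) *\<^sub>C 1 else 0)"
      unfolding row_u by (intro sum.cong refl) auto
    finally show "(\<Sum>J\<in>words (Suc n). \<xi> (last J # butlast J) *\<^sub>C uw H J) = \<xi> (last H # butlast H) *\<^sub>C 1"
      using H by simp
  qed
  have 1: "(\<Sum>J\<in>words n. \<Sum>b\<in>UNIV. \<xi> (J @ [b]) *\<^sub>C (uw I J * u i b)) = \<xi> (I @ [i]) *\<^sub>C 1" if "I \<in> words n" for i I
  proof -
    have "I @ [i] \<in> words (Suc n)" using that by (simp add: words_def)
    then have "(\<Sum>J\<in>words (Suc n). \<xi> J *\<^sub>C uw (I @ [i]) J) = \<xi> (I @ [i]) *\<^sub>C 1" using assms by (simp add: fixed_def)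
    moreover have "(\<Sum>J\<in>words (Suc n). \<xi> J *\<^sub>C uw (I @ [i]) J) = (\<Sum>J\<in>words n. \<Sum>b\<in>UNIV. \<xi> (J @ [b]) *\<^sub>C (uw I J * u i b))"
      unfolding sum_words_Suc_right using that by (intro sum.cong refl) (auto simp: uw_append words_def)
    ultimately show ?thesis by simp
  qed
  show "fixed (Suc n) (\<lambda>J. \<xi> (tl J @ [hd J]))"
    unfolding fixed_def
  proof (intro ballI)
    fix H :: "'n list" assume "H \<in> words (Suc n)"
    then obtain I l where H: "H = l # I" "I \<in> words n" by (cases H) (auto simp: words_def)
    have 2: "(\<Sum>J\<in>words n. \<xi> (J @ [a]) *\<^sub>C uw I J) = (\<Sum>i\<in>UNIV. \<xi> (I @ [i]) *\<^sub>C u i a)" for a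
    proof -
      have "(\<Sum>i\<in>UNIV. \<xi> (I @ [i]) *\<^sub>C u i a) = (\<Sum>i\<in>UNIV. (\<Sum>J\<in>words n. \<Sum>b\<in>UNIV. \<xi> (J @ [b]) *\<^sub>C (uw I J * u i b)) * u i a)"
        unfolding 1[OF H(2)] by (simp add: scm)
      also have "\<dots> = (\<Sum>i\<in>UNIV. \<Sum>J\<in>words n. \<Sum>b\<in>UNIV. \<xi> (J @ [b]) *\<^sub>C (uw I J * (u i b * u i a)))"
        by (simp add: sum_distrib_right scm mult.assoc)
      also have "\<dots> = (\<Sum>J\<in>words n. \<Sum>i\<in>UNIV. \<Sum>b\<in>UNIV. \<xi> (J @ [b]) *\<^sub>C (uw I J * (u i b * u i a)))"
        by (rule sum.swap)
      also have "\<dots> = (\<Sum>J\<in>words n. \<Sum>b\<in>UNIV. \<Sum>i\<in>UNIV. \<xi> (J @ [b]) *\<^sub>C (uw I J * (u i b * u i a)))"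
        by (intro sum.cong refl sum.swap)
      also have "\<dots> = (\<Sum>J\<in>words n. \<Sum>b\<in>UNIV. \<xi> (J @ [b]) *\<^sub>C (uw I J * (\<Sum>i\<in>UNIV. u i b * u i a)))"
        by (simp add: sum_distrib_left scaleC.scale_sum_right)
      also have "\<dots> = (\<Sum>J\<in>words n. \<Sum>b\<in>UNIV. if b = a then \<xi> (J @ [b]) *\<^sub>C uw I J else 0)"
        unfolding col_u by (intro sum.cong refl) auto
      finally show ?thesis by simp
    qed
    have "(\<Sum>J\<in>words (Suc n). \<xi> (tl J @ [hd J]) *\<^sub>C uw H J) = (\<Sum>b\<in>UNIV. \<Sum>J\<in>words n. \<xi> (J @ [b]) *\<^sub>C (u l b * uw I J))"
      unfolding sum_words_Suc H(1) by simp
    also have "\<dots> = (\<Sum>b\<in>UNIV. u l b * (\<Sum>J\<in>words n. \<xi> (J @ [b]) *\<^sub>C uw I J))"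
      by (simp add: sum_distrib_left scm)
    also have "\<dots> = (\<Sum>i\<in>UNIV. \<xi> (I @ [i]) *\<^sub>C (\<Sum>b\<in>UNIV. u l b * u i b))"
      unfolding 2 sum_distrib_left scaleC.scale_sum_right scm by (rule sum.swap)
    also have "\<dots> = (\<Sum>i\<in>UNIV. if i = l then \<xi> (I @ [i]) *\<^sub>C 1 else 0)"
      unfolding row_u by (intro sum.cong refl) auto
    finally show "(\<Sum>J\<in>words (Suc n). \<xi> (tl J @ [hd J]) *\<^sub>C uw H J) = \<xi> (tl H @ [hd H]) *\<^sub>C 1"
      using H by simp
  qed
qed

end

context haar_gns
begin

text \<open>Let \<open>c\<close> be the cyclic rotation of legs. Since \<open>c\<close> and its inverse preserve the range of the orthogonal
  projection \<open>Q\<close>, they commute with it: the two identities computed below are \<open>Q c Q = c Q\<close> and the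
  adjoint of \<open>Q c\<^sup>-\<^sup>1 Q = c\<^sup>-\<^sup>1 Q\<close>.\<close>
lemma Q_rotate:
  assumes I: "I \<in> words n" and J: "J \<in> words n"
  shows "Q (i # I) (j # J) = Q (I @ [i]) (J @ [j])"
proof -
  let ?I = "I @ [i]" and ?J = "j # J"
  have I': "?I \<in> words (Suc n)" and J': "?J \<in> words (Suc n)" using I J by (auto simp: words_def)
  have "(\<Sum>K\<in>words (Suc n). Q (last K # butlast K) ?J * Q ?I K) = Q (last ?I # butlast ?I) ?J"
    using fixed_Q[OF fixed_shift(1)[OF fixed_column[OF J']] I'] .
  then have 1: "(\<Sum>K\<in>words n. \<Sum>x\<in>UNIV. Q ?I (K @ [x]) * Q (x # K) ?J) = Q (i # I) ?J"
    by (simp add: sum_words_Suc_right mult.commute)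
  have "(\<Sum>K\<in>words (Suc n). Q (tl K @ [hd K]) ?I * Q ?J K) = Q (tl ?J @ [hd ?J]) ?I"
    using fixed_Q[OF fixed_shift(2)[OF fixed_column[OF I']] J'] .
  then have 2: "(\<Sum>x\<in>UNIV. \<Sum>K\<in>words n. Q (K @ [x]) ?I * Q ?J (x # K)) = Q (J @ [j]) ?I"
    by (simp add: sum_words_Suc)
  have w: "K @ [x] \<in> words (Suc n)" "x # K \<in> words (Suc n)" if "K \<in> words n" for K :: "'n list" and x
    using that by (auto simp: words_def)
  have "Q (I @ [i]) (J @ [j]) = cnj (\<Sum>x\<in>UNIV. \<Sum>K\<in>words n. Q (K @ [x]) ?I * Q ?J (x # K))"
    unfolding 2 using Q_hermitian[OF I' w(1)[OF J]] by simp
  also have "\<dots> = (\<Sum>x\<in>UNIV. \<Sum>K\<in>words n. Q ?I (K @ [x]) * Q (x # K) ?J)"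
    unfolding cnj_sum complex_cnj_mult using Q_hermitian[OF I' w(1)] Q_hermitian[OF w(2) J']
    by (intro sum.cong refl) simp
  also have "\<dots> = (\<Sum>K\<in>words n. \<Sum>x\<in>UNIV. Q ?I (K @ [x]) * Q (x # K) ?J)" by (rule sum.swap)
  finally show ?thesis using 1 by simp
qed

lemma trace_uw:
  assumes "length I' = length J'" "length I = length J"
  shows "h (uw I J * uw I' J') = h (uw I' J' * uw I J)"
  using assms
proof (induction I' J' arbitrary: I J rule: list_induct2)
  case (Cons a I' b J')
  have "h (uw I J * uw (a # I') (b # J')) = h (uw (I @ [a]) (J @ [b]) * uw I' J')"
    using Cons.prems by (simp add: uw_append mult.assoc)
  also have "\<dots> = h (uw I' J' * uw (I @ [a]) (J @ [b]))" using Cons.prems by (intro Cons.IH) simp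
  also have "\<dots> = Q ((I' @ I) @ [a]) ((J' @ J) @ [b])"
    using Cons.prems Cons.hyps by (simp add: Q_def uw_append mult.assoc)
  also have "\<dots> = Q (a # I' @ I) (b # J' @ J)"
    using Cons.prems Cons.hyps by (intro Q_rotate[symmetric, of _ "length I' + length I"]) (auto simp: words_def)
  also have "\<dots> = h (uw (a # I') (b # J') * uw I J)"
    using Cons.prems Cons.hyps by (simp add: Q_def uw_append mult.assoc)
  finally show ?case .
qed simp

lemma prod_list_uw: "prod_list (map (\<lambda>(i, j). u i j) w) = uw (map fst w) (map snd w)"
  by (induction w) auto

lemma trace_nc_eval: "h (nc_eval u f * nc_eval u g) = h (nc_eval u g * nc_eval u f)"
proof -
  let ?f = "Poly_Mapping.lookup f" and ?g = "Poly_Mapping.lookup g"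
  let ?u = "\<lambda>w. uw (map fst w) (map snd w)"
  have "h (nc_eval u f * nc_eval u g) = (\<Sum>v\<in>Poly_Mapping.keys f. \<Sum>w\<in>Poly_Mapping.keys g. ?f v * (?g w * h (?u v * ?u w)))"
    by (simp add: nc_eval_def prod_list_uw sum_product h_sum h_scale scaleC_mult_left scaleC_mult_right mult.assoc mult.left_commute)
  also have "\<dots> = (\<Sum>v\<in>Poly_Mapping.keys f. \<Sum>w\<in>Poly_Mapping.keys g. ?g w * (?f v * h (?u w * ?u v)))"
  proof (intro sum.cong refl)
    fix v w
    have "h (?u v * ?u w) = h (?u w * ?u v)" by (rule trace_uw) simp_all
    then show "?f v * (?g w * h (?u v * ?u w)) = ?g w * (?f v * h (?u w * ?u v))"
      by (simp add: mult.left_commute)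
  qed
  also have "\<dots> = (\<Sum>w\<in>Poly_Mapping.keys g. \<Sum>v\<in>Poly_Mapping.keys f. ?g w * (?f v * h (?u w * ?u v)))"
    by (rule sum.swap)
  also have "\<dots> = h (nc_eval u g * nc_eval u f)"
    by (simp add: nc_eval_def prod_list_uw sum_product h_sum h_scale scaleC_mult_left scaleC_mult_right mult.assoc mult.left_commute)
  finally show ?thesis .
qed

lemma trace: "h (a * b) = h (b * a)"
proof -
  have h': "continuous_on UNIV (\<lambda>x. h (f x))" if "continuous_on UNIV f" for f :: "'a \<Rightarrow> 'a"
    using continuous_on_compose2[OF h_continuous that] by simp
  have closed: "closed {x. h (x * y) = h (y * x)}" for y
  proof (rule closed_Collect_eq)
    show "continuous_on UNIV (\<lambda>x. h (x * y))" by (rule h') (intro continuous_intros)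
    show "continuous_on UNIV (\<lambda>x. h (y * x))" by (rule h') (intro continuous_intros)
  qed
  have 1: "h (x * nc_eval u g) = h (nc_eval u g * x)" for x g
  proof -
    have "closure (range (nc_eval u)) \<subseteq> {x. h (x * nc_eval u g) = h (nc_eval u g * x)}"
      by (rule closure_minimal[OF _ closed]) (auto simp: trace_nc_eval)
    then have "x \<in> {x. h (x * nc_eval u g) = h (nc_eval u g * x)}" unfolding dense by (rule subsetD) (rule UNIV_I)
    then show ?thesis by simp
  qed
  have "closure (range (nc_eval u)) \<subseteq> {x. h (x * a) = h (a * x)}"
    by (rule closure_minimal[OF _ closed]) (use 1 in auto)
  then have "b \<in> {x. h (x * a) = h (a * x)}" unfolding dense by (rule subsetD) (rule UNIV_I)
  then show ?thesis by simp
qed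

lemma norm_\<pi>_star: "norm (\<pi> (star a) \<Omega>) = norm (\<pi> a \<Omega>)"
proof -
  have "(norm (\<pi> (star a) \<Omega>))^2 = (norm (\<pi> a \<Omega>))^2"
    unfolding norm_\<pi>_\<Omega> star_star by (rule arg_cong[OF trace])
  then show ?thesis by (simp add: power2_eq_iff_nonneg)
qed

text \<open>As \<open>h\<close> is a trace, right multiplication by \<open>x\<close> is the conjugate of left multiplication by
  its adjoint under the isometric involution \<open>a\<Omega> \<mapsto> a\<^sup>*\<Omega>\<close>. It is therefore bounded and extends to
  the whole Hilbert space.\<close>
lemma exists_right_multiplication:
  "\<exists>R. bounded_clinear R \<and> (\<forall>a. R (\<pi> a \<Omega>) = \<pi> (a * x) \<Omega>) \<and> (\<forall>a z. R (\<pi> a z) = \<pi> a (R z))"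
proof -
  obtain C where C: "\<And>z. norm (\<pi> (star x) z) \<le> C * norm z"
    using \<pi>_bounded[of "star x"] by (auto simp: bounded_clinear_def)
  have bd: "norm (\<pi> (a * x) \<Omega>) \<le> C * norm (\<pi> a \<Omega>)" for a
  proof -
    have "norm (\<pi> (a * x) \<Omega>) = norm (\<pi> (star x) (\<pi> (star a) \<Omega>))"
      using norm_\<pi>_star[of "a * x"] by (simp add: star_mult \<pi>_mult)
    also have "\<dots> \<le> C * norm (\<pi> a \<Omega>)" using C[of "\<pi> (star a) \<Omega>"] by (simp add: norm_\<pi>_star)
    finally show ?thesis .
  qed
  define f where "f y = \<pi> ((SOME a. \<pi> a \<Omega> = y) * x) \<Omega>" for y
  have f: "f (\<pi> a \<Omega>) = \<pi> (a * x) \<Omega>" for a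
  proof -
    define b where "b = (SOME b. \<pi> b \<Omega> = \<pi> a \<Omega>)"
    have "\<pi> b \<Omega> = \<pi> a \<Omega>" unfolding b_def by (rule someI[of _ a]) simp
    then have "\<pi> ((b - a) * x) \<Omega> = 0" using bd[of "b - a"] by (simp add: \<pi>_diff)
    then have "\<pi> (b * x) \<Omega> = \<pi> (a * x) \<Omega>" by (simp add: left_diff_distrib \<pi>_diff)
    then show ?thesis by (simp add: f_def b_def)
  qed
  let ?V = "range (\<lambda>a. \<pi> a \<Omega>)"
  have "(max C 0)-lipschitz_on ?V f"
  proof (rule lipschitz_onI)
    fix y z assume "y \<in> ?V" "z \<in> ?V"
    then obtain a b where ab: "y = \<pi> a \<Omega>" "z = \<pi> b \<Omega>" by auto
    have "dist (f y) (f z) = norm (\<pi> ((a - b) * x) \<Omega>)" by (simp add: ab f dist_norm left_diff_distrib \<pi>_diff)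
    also have "\<dots> \<le> C * dist y z" using bd[of "a - b"] by (simp add: ab dist_norm \<pi>_diff)
    also have "\<dots> \<le> max C 0 * dist y z" by (intro mult_right_mono) auto
    finally show "dist (f y) (f z) \<le> max C 0 * dist y z" .
  qed simp
  then have "uniformly_continuous_on ?V f" by (rule lipschitz_on_uniformly_continuous)
  then obtain R where R: "uniformly_continuous_on (closure ?V) R" "\<And>y. y \<in> ?V \<Longrightarrow> f y = R y"
    by (rule uniformly_continuous_on_extension_on_closure) blast
  have R_cont: "continuous_on UNIV R" using uniformly_continuous_imp_continuous[OF R(1)] \<pi>_dense by simp
  have R_eq: "R (\<pi> a \<Omega>) = \<pi> (a * x) \<Omega>" for a using R(2)[of "\<pi> a \<Omega>"] f[of a] by simp
  have dense_induct: "P z" if "closed {z. P z}" "\<And>a. P (\<pi> a \<Omega>)" for P and z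
  proof -
    have "closure ?V \<subseteq> {z. P z}" by (rule closure_minimal[OF _ that(1)]) (use that(2) in auto)
    then show ?thesis using \<pi>_dense by auto
  qed
  have Rc: "continuous_on UNIV (\<lambda>z. R (k z))" if "continuous_on UNIV k" for k :: "'h \<Rightarrow> 'h"
    using continuous_on_compose2[OF R_cont that] by simp
  have \<pi>c: "continuous_on UNIV (\<lambda>z. \<pi> a (k z))" if "continuous_on UNIV k" for a and k :: "'h \<Rightarrow> 'h"
    by (rule continuous_on_compose2[OF linear_continuous_on[OF bounded_clinear_bounded_linear[OF \<pi>_bounded]] that subset_UNIV])
  have sc: "continuous_on UNIV (\<lambda>z. c *\<^sub>C k z)" if "continuous_on UNIV k" for c and k :: "'h \<Rightarrow> 'h"
    by (rule continuous_on_compose2[OF linear_continuous_on[OF scaleC_bounded_linear] that subset_UNIV])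
  have add1: "R (\<pi> a \<Omega> + z) = R (\<pi> a \<Omega>) + R z" for a z
  proof (rule dense_induct[of "\<lambda>z. R (\<pi> a \<Omega> + z) = R (\<pi> a \<Omega>) + R z"])
    show "closed {z. R (\<pi> a \<Omega> + z) = R (\<pi> a \<Omega>) + R z}"
      by (intro closed_Collect_eq continuous_intros Rc)
    show "R (\<pi> a \<Omega> + \<pi> b \<Omega>) = R (\<pi> a \<Omega>) + R (\<pi> b \<Omega>)" for b
      using R_eq[of "a + b"] by (simp add: R_eq \<pi>_add distrib_right)
  qed
  have add: "R (y + z) = R y + R z" for y z
  proof (rule dense_induct[of "\<lambda>y. R (y + z) = R y + R z"])
    show "closed {y. R (y + z) = R y + R z}" by (intro closed_Collect_eq continuous_intros Rc)
  qed (rule add1)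
  have scale: "R (c *\<^sub>C z) = c *\<^sub>C R z" for c z
  proof (rule dense_induct[of "\<lambda>z. R (c *\<^sub>C z) = c *\<^sub>C R z"])
    show "closed {z. R (c *\<^sub>C z) = c *\<^sub>C R z}" by (intro closed_Collect_eq continuous_intros Rc sc)
    show "R (c *\<^sub>C \<pi> b \<Omega>) = c *\<^sub>C R (\<pi> b \<Omega>)" for b
      using R_eq[of "c *\<^sub>C b"] by (simp add: R_eq \<pi>_scale scaleC_mult_left)
  qed
  have comm: "R (\<pi> a z) = \<pi> a (R z)" for a z
  proof (rule dense_induct[of "\<lambda>z. R (\<pi> a z) = \<pi> a (R z)"])
    show "closed {z. R (\<pi> a z) = \<pi> a (R z)}" by (intro closed_Collect_eq continuous_intros Rc \<pi>c)
    show "R (\<pi> a (\<pi> b \<Omega>)) = \<pi> a (R (\<pi> b \<Omega>))" for b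
      using R_eq[of "a * b"] by (simp add: R_eq \<pi>_mult mult.assoc)
  qed
  have "norm (R z) \<le> C * norm z" for z
  proof (rule dense_induct[of "\<lambda>z. norm (R z) \<le> C * norm z"])
    show "closed {z. norm (R z) \<le> C * norm z}" by (intro closed_Collect_le continuous_intros Rc)
  qed (simp add: R_eq bd)
  then have "bounded_clinear R" using add scale by (auto simp: bounded_clinear_def clinear_def)
  then show ?thesis using R_eq comm by blast
qed

text \<open>The map just constructed commutes with all \<open>\<pi> a\<close>, hence with \<open>M\<close>, so it is the right action.\<close>
lemma right_action_props:
  fixes x
  defines "R \<equiv> right_action \<pi> \<Omega> (\<pi> x)"
  shows "bounded_clinear R" and "R (\<pi> a \<Omega>) = \<pi> (a * x) \<Omega>" and "R (\<pi> a z) = \<pi> a (R z)"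
proof -
  obtain S where S: "bounded_clinear S" "\<And>a. S (\<pi> a \<Omega>) = \<pi> (a * x) \<Omega>" "\<And>a z. S (\<pi> a z) = \<pi> a (S z)"
    using exists_right_multiplication[of x] by auto
  have comm: "S \<in> commutant (range \<pi>)" using S(1,3) by (auto simp: commutant_def fun_eq_iff)
  have SO: "S \<Omega> = \<pi> x \<Omega>" using S(2)[of 1] by (simp add: \<pi>_one)
  have vN: "S (y \<Omega>) = (y \<circ> \<pi> x) \<Omega>" if "y \<in> vN_M \<pi>" for y
  proof -
    have "y \<circ> S = S \<circ> y" using that comm by (auto simp: vN_M_def commutant_def)
    then show ?thesis using SO by (metis comp_apply)
  qed
  have \<pi>_vN: "\<pi> a \<in> vN_M \<pi>" for a using \<pi>_bounded by (auto simp: vN_M_def commutant_def)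
  have "R = S" unfolding R_def right_action_def
  proof (rule the_equality)
    show "bounded_clinear S \<and> (\<forall>y\<in>vN_M \<pi>. S (y \<Omega>) = (y \<circ> \<pi> x) \<Omega>)" using S(1) vN by blast
  next
    fix T assume T: "bounded_clinear T \<and> (\<forall>y\<in>vN_M \<pi>. T (y \<Omega>) = (y \<circ> \<pi> x) \<Omega>)"
    have "closure (range (\<lambda>a. \<pi> a \<Omega>)) \<subseteq> {z. T z = S z}"
    proof (rule closure_minimal)
      show "range (\<lambda>a. \<pi> a \<Omega>) \<subseteq> {z. T z = S z}" using T vN \<pi>_vN by auto
      show "closed {z. T z = S z}"
        using T S(1) by (intro closed_Collect_eq linear_continuous_on bounded_clinear_bounded_linear) auto
    qed
    then show "T = S" unfolding \<pi>_dense by auto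
  qed
  then show "bounded_clinear R" "R (\<pi> a \<Omega>) = \<pi> (a * x) \<Omega>" "R (\<pi> a z) = \<pi> a (R z)" using S by auto
qed

end

section \<open>Riesz bases\<close>

lemma orthonormal_norm:
  fixes e :: "'i \<Rightarrow> 'k::chilbert"
  assumes on: "orthonormal_basis I e" and F: "finite F" "F \<subseteq> I"
  shows "(norm (\<Sum>i\<in>F. c i *\<^sub>C e i))^2 = (\<Sum>i\<in>F. (cmod (c i))^2)"
proof -
  have "complex_of_real ((norm (\<Sum>i\<in>F. c i *\<^sub>C e i))^2) = (\<Sum>i\<in>F. \<Sum>j\<in>F. cnj (c i) * (c j * cinner (e i) (e j)))"
    by (simp only: norm_cinner cinner_sum_left cinner_scaleC_left)
       (simp only: cinner_sum_right cinner_scaleC_right sum_distrib_left)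
  also have "\<dots> = (\<Sum>i\<in>F. \<Sum>j\<in>F. if j = i then cnj (c i) * c i else 0)"
  proof (intro sum.cong refl)
    fix i j assume "i \<in> F" "j \<in> F"
    then have "cinner (e i) (e j) = of_bool (i = j)" using on F(2) unfolding orthonormal_basis_def by blast
    then show "cnj (c i) * (c j * cinner (e i) (e j)) = (if j = i then cnj (c i) * c i else 0)" by simp
  qed
  also have "\<dots> = (\<Sum>i\<in>F. complex_of_real ((cmod (c i))^2))"
    using F(1) by (simp add: complex_norm_square mult.commute del: of_real_power)
  finally show ?thesis unfolding of_real_sum[symmetric] of_real_eq_iff .
qed

lemma span_subset_finite_combinations:
  fixes e :: "'i \<Rightarrow> 'k::chilbert"
  shows "span {c *\<^sub>C e i | c i. i \<in> I} \<subseteq> {\<Sum>i\<in>F. c i *\<^sub>C e i | F c. finite F \<and> F \<subseteq> I}" (is "_ \<subseteq> ?S")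
proof
  fix x assume "x \<in> span {c *\<^sub>C e i | c i. i \<in> I}"
  then show "x \<in> ?S"
  proof (induction rule: span_induct_alt)
    case base
    then show ?case by (rule CollectI, intro exI[of _ "{}"]) auto
  next
    case (step r x y)
    obtain a i where x: "x = a *\<^sub>C e i" "i \<in> I" using step(1) by auto
    obtain F c where y: "y = (\<Sum>i\<in>F. c i *\<^sub>C e i)" "finite F" "F \<subseteq> I" using step(2) by auto
    define d where "d j = (if j \<in> F then c j else 0) + (if j = i then complex_of_real r * a else 0)" for j
    have "(\<Sum>j\<in>insert i F. d j *\<^sub>C e j)
       = (\<Sum>j\<in>insert i F. if j \<in> F then c j *\<^sub>C e j else 0) + (\<Sum>j\<in>insert i F. if j = i then (complex_of_real r * a) *\<^sub>C e j else 0)"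
      unfolding sum.distrib[symmetric] by (intro sum.cong refl) (simp add: d_def scaleC_add_left)
    also have "(\<Sum>j\<in>insert i F. if j \<in> F then c j *\<^sub>C e j else 0) = y"
      unfolding y(1) using y(2) by (intro sum.mono_neutral_cong_right) auto
    also have "(\<Sum>j\<in>insert i F. if j = i then (complex_of_real r * a) *\<^sub>C e j else 0) = r *\<^sub>R x"
      using y(2) by (simp add: x(1) scaleR_scaleC scaleC_scaleC sum.delta del: sum.insert)
    finally have "r *\<^sub>R x + y = (\<Sum>j\<in>insert i F. d j *\<^sub>C e j)" by (simp only: add.commute)
    then show ?case using x(2) y(2,3) by (intro CollectI exI[of _ "insert i F"] exI[of _ d]) auto
  qed
qed

lemma riesz_basis_estimates:
  fixes f :: "'i \<Rightarrow> 'h::chilbert"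
  assumes "riesz_basis TYPE('k::chilbert) I f V"
  obtains A C where "A \<ge> 0" "C \<ge> 0"
    and "\<And>F c. finite F \<Longrightarrow> F \<subseteq> I \<Longrightarrow> (norm (\<Sum>i\<in>F. c i *\<^sub>C f i))^2 \<le> A * (\<Sum>i\<in>F. (cmod (c i))^2)"
    and "\<And>F c. finite F \<Longrightarrow> F \<subseteq> I \<Longrightarrow> (\<Sum>i\<in>F. (cmod (c i))^2) \<le> C * (norm (\<Sum>i\<in>F. c i *\<^sub>C f i))^2"
    and "\<And>x y. x \<in> V \<Longrightarrow> y \<in> V \<Longrightarrow> x + y \<in> V" and "\<And>c x. x \<in> V \<Longrightarrow> c *\<^sub>C x \<in> V" and "\<And>i. i \<in> I \<Longrightarrow> f i \<in> V"
    and "0 \<in> V" and "V \<subseteq> closure {\<Sum>i\<in>F. c i *\<^sub>C f i | F c. finite F \<and> F \<subseteq> I}"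
proof -
  obtain e :: "'i \<Rightarrow> 'k" and T :: "'k \<Rightarrow> 'h" and C where on: "orthonormal_basis I e"
    and T: "bounded_clinear T" "inj T" "range T = V"
    and C: "\<And>v. v \<in> V \<Longrightarrow> norm (inv T v) \<le> C * norm v" and f: "\<And>i. i \<in> I \<Longrightarrow> T (e i) = f i"
    using assms unfolding riesz_basis_def by blast
  interpret T: bounded_linear T by (rule bounded_clinear_bounded_linear[OF T(1)])
  have Tsc: "T (c *\<^sub>C x) = c *\<^sub>C T x" for c x using T(1) by (simp add: bounded_clinear_def clinear_def)
  obtain A where A: "\<And>x. norm (T x) \<le> A * norm x" using T(1) by (auto simp: bounded_clinear_def)
  have Tsum: "T (\<Sum>i\<in>F. c i *\<^sub>C e i) = (\<Sum>i\<in>F. c i *\<^sub>C f i)" if "F \<subseteq> I" for F c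
    unfolding T.sum using that f by (intro sum.cong refl) (auto simp: Tsc)
  show thesis
  proof (rule that[of "A^2" "C^2"])
    fix F c assume F: "finite F" "F \<subseteq> I"
    let ?x = "\<Sum>i\<in>F. c i *\<^sub>C e i"
    have "(norm (T ?x))^2 \<le> (A * norm ?x)^2" using A by (intro power_mono) auto
    then show "(norm (\<Sum>i\<in>F. c i *\<^sub>C f i))^2 \<le> A^2 * (\<Sum>i\<in>F. (cmod (c i))^2)"
      unfolding Tsum[OF F(2)] power_mult_distrib orthonormal_norm[OF on F] .
    have "norm ?x \<le> C * norm (T ?x)" using C[of "T ?x"] T(2,3) by auto
    then have "(norm ?x)^2 \<le> (C * norm (T ?x))^2" by (intro power_mono) auto
    then show "(\<Sum>i\<in>F. (cmod (c i))^2) \<le> C^2 * (norm (\<Sum>i\<in>F. c i *\<^sub>C f i))^2"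
      unfolding Tsum[OF F(2)] power_mult_distrib orthonormal_norm[OF on F] .
  next
    fix x y assume "x \<in> V" "y \<in> V"
    then obtain a b where "x = T a" "y = T b" using T(3) by blast
    then have "x + y = T (a + b)" by (simp add: T.add)
    then show "x + y \<in> V" using T(3) by blast
  next
    fix c x assume "x \<in> V"
    then obtain a where "x = T a" using T(3) by blast
    then have "c *\<^sub>C x = T (c *\<^sub>C a)" by (simp add: Tsc)
    then show "c *\<^sub>C x \<in> V" using T(3) by blast
  next
    fix i assume "i \<in> I" then show "f i \<in> V" using f[of i] T(3) by (metis rangeI)
  next
    show "0 \<in> V" using T.zero T(3) by (metis rangeI)
  next
    let ?S = "{\<Sum>i\<in>F. c i *\<^sub>C e i | F c. finite F \<and> F \<subseteq> I}"
    have "UNIV = closure (span {c *\<^sub>C e i | c i. i \<in> I})" using on by (simp add: orthonormal_basis_def)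
    also have "\<dots> \<subseteq> closure ?S" by (intro closure_mono span_subset_finite_combinations)
    finally have "V \<subseteq> T ` closure ?S" using T(3) by auto
    also have "\<dots> \<subseteq> closure (T ` ?S)"
      by (intro image_closure_subset continuous_on_subset[OF T.continuous_on[OF continuous_on_id] subset_UNIV] closed_closure closure_subset)
    also have "T ` ?S \<subseteq> {\<Sum>i\<in>F. c i *\<^sub>C f i | F c. finite F \<and> F \<subseteq> I}"
    proof safe
      fix F c assume "finite F" "F \<subseteq> I"
      then show "\<exists>F' c'. T (\<Sum>i\<in>F. c i *\<^sub>C e i) = (\<Sum>i\<in>F'. c' i *\<^sub>C f i) \<and> finite F' \<and> F' \<subseteq> I" using Tsum by blast
    qed
    finally show "V \<subseteq> closure {\<Sum>i\<in>F. c i *\<^sub>C f i | F c. finite F \<and> F \<subseteq> I}" using closure_mono by blast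
  qed auto
qed

section \<open>Summing over the blocks\<close>

lemma sum_box_restrict:
  fixes f :: "nat \<Rightarrow> nat \<Rightarrow> real"
  assumes "\<And>i j. i \<ge> M \<or> j \<ge> M \<Longrightarrow> f i j = 0" and "M \<le> K"
  shows "(\<Sum>i<K. \<Sum>j<K. f i j) = (\<Sum>i<M. \<Sum>j<M. f i j)"
proof -
  have "(\<Sum>i<K. \<Sum>j<K. f i j) = (\<Sum>i<M. \<Sum>j<K. f i j)"
    using assms by (intro sum.mono_neutral_right) auto
  also have "\<dots> = (\<Sum>i<M. \<Sum>j<M. f i j)"
    using assms by (intro sum.cong refl sum.mono_neutral_right) auto
  finally show ?thesis .
qed

text \<open>The strip constants do not depend on the block, so the estimates of the blocks can be added.\<close>
lemma block_sum_strip_bound: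
  fixes w :: "'q \<Rightarrow> nat \<Rightarrow> nat \<Rightarrow> 'h::chilbert" and z :: "'q \<Rightarrow> nat \<Rightarrow> nat \<Rightarrow> complex"
  assumes LR: "Modules.additive L" "Modules.additive R"
    and blocks: "\<And>b. b \<in> Bl \<Longrightarrow> \<exists>\<alpha> \<beta> \<gamma>. half_block \<alpha> \<beta> \<gamma> (w b) L R \<and> half_block \<alpha> \<beta> \<gamma> (\<lambda>i j. w b j i) R L"
    and upper: "\<And>K F. (norm (\<Sum>b\<in>Bl. box_sum (w b) K (F b)))^2 \<le> A * (\<Sum>b\<in>Bl. \<Sum>i<K. \<Sum>j<K. (cmod (F b i j))^2)"
    and lower: "\<And>K F. (\<Sum>b\<in>Bl. \<Sum>i<K. \<Sum>j<K. (cmod (F b i j))^2) \<le> C * (norm (\<Sum>b\<in>Bl. box_sum (w b) K (F b)))^2"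
    and A: "A \<ge> 0" and p: "p > 0"
    and z: "\<And>b i j. b \<in> Bl \<Longrightarrow> i \<ge> M \<or> j \<ge> M \<Longrightarrow> z b i j = 0"
  defines "Z \<equiv> \<Sum>b\<in>Bl. box_sum (w b) (M + 2) (z b)"
  shows "(norm (\<Sum>b\<in>Bl. box_sum (w b) (M + 2) (\<lambda>i j. if i < m \<or> j < m then z b i j else 0)))^2
    \<le> A * (2 * strip_const m) * C * (1/p * (norm Z)^2 + p * (norm (L Z - R Z))^2)"
proof -
  obtain \<alpha> \<beta> \<gamma> where hb: "\<And>b. b \<in> Bl \<Longrightarrow> half_block (\<alpha> b) (\<beta> b) (\<gamma> b) (w b) L R"
      "\<And>b. b \<in> Bl \<Longrightarrow> half_block (\<alpha> b) (\<beta> b) (\<gamma> b) (\<lambda>i j. w b j i) R L"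
    using blocks by metis
  define y where "y b = (\<lambda>i j. half_block_coeffs.Lw (\<alpha> b) (\<beta> b) (\<gamma> b) (z b) i j
      - half_block_coeffs.Lw (\<alpha> b) (\<beta> b) (\<gamma> b) (\<lambda>i j. z b j i) j i)" for b
  let ?s = "\<lambda>b i j. if i < m \<or> j < m then z b i j else 0"
  have ts: "\<And>i j. i \<ge> Suc M \<or> j \<ge> Suc M \<Longrightarrow> y b i j = 0"
      "box_sum (w b) (M + 2) (y b) = L (box_sum (w b) (M + 2) (z b)) - R (box_sum (w b) (M + 2) (z b))"
      "(\<Sum>i<M. \<Sum>j<M. if i < m \<or> j < m then (cmod (z b i j))^2 else 0) \<le> 2 * strip_const m *
       (1/p * (\<Sum>i<M. \<Sum>j<M. (cmod (z b i j))^2) + p * (\<Sum>i<Suc M. \<Sum>j<Suc M. (cmod (y b i j))^2))"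
    if b: "b \<in> Bl" for b
    unfolding y_def
    by (rule two_sided_strip_bound[OF hb(1)[OF b] hb(2)[OF b] _ p, where z = "z b" and M = M]; (rule z[OF b])?; assumption)+
  have com: "(\<Sum>b\<in>Bl. box_sum (w b) (M + 2) (y b)) = L Z - R Z"
  proof -
    have "(\<Sum>b\<in>Bl. box_sum (w b) (M + 2) (y b)) = (\<Sum>b\<in>Bl. L (box_sum (w b) (M + 2) (z b)) - R (box_sum (w b) (M + 2) (z b)))"
      by (intro sum.cong refl ts(2))
    then show ?thesis by (simp add: Z_def Modules.additive.sum[OF LR(1)] Modules.additive.sum[OF LR(2)] sum_subtractf)
  qed
  have "(norm (\<Sum>b\<in>Bl. box_sum (w b) (M + 2) (?s b)))^2 \<le> A * (\<Sum>b\<in>Bl. \<Sum>i<M+2. \<Sum>j<M+2. (cmod (?s b i j))^2)"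
    by (rule upper)
  also have "(\<Sum>b\<in>Bl. \<Sum>i<M+2. \<Sum>j<M+2. (cmod (?s b i j))^2) = (\<Sum>b\<in>Bl. \<Sum>i<M. \<Sum>j<M. if i < m \<or> j < m then (cmod (z b i j))^2 else 0)"
  proof (rule sum.cong[OF refl])
    fix b assume "b \<in> Bl"
    then have "(\<Sum>i<M+2. \<Sum>j<M+2. (cmod (?s b i j))^2) = (\<Sum>i<M. \<Sum>j<M. (cmod (?s b i j))^2)"
      using z by (intro sum_box_restrict) auto
    also have "\<dots> = (\<Sum>i<M. \<Sum>j<M. if i < m \<or> j < m then (cmod (z b i j))^2 else 0)"
      by (intro sum.cong refl) auto
    finally show "(\<Sum>i<M+2. \<Sum>j<M+2. (cmod (?s b i j))^2) = (\<Sum>i<M. \<Sum>j<M. if i < m \<or> j < m then (cmod (z b i j))^2 else 0)" .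
  qed
  also have "A * \<dots> \<le> A * (\<Sum>b\<in>Bl. 2 * strip_const m *
      (1/p * (\<Sum>i<M. \<Sum>j<M. (cmod (z b i j))^2) + p * (\<Sum>i<Suc M. \<Sum>j<Suc M. (cmod (y b i j))^2)))"
    using A by (intro mult_left_mono sum_mono ts(3)) auto
  also have "\<dots> = A * (\<Sum>b\<in>Bl. 2 * strip_const m *
      (1/p * (\<Sum>i<M+2. \<Sum>j<M+2. (cmod (z b i j))^2) + p * (\<Sum>i<M+2. \<Sum>j<M+2. (cmod (y b i j))^2)))"
  proof -
    have "(\<Sum>i<M+2. \<Sum>j<M+2. (cmod (z b i j))^2) = (\<Sum>i<M. \<Sum>j<M. (cmod (z b i j))^2)"
      and "(\<Sum>i<M+2. \<Sum>j<M+2. (cmod (y b i j))^2) = (\<Sum>i<Suc M. \<Sum>j<Suc M. (cmod (y b i j))^2)" if "b \<in> Bl" for b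
      using z[OF that] ts(1)[OF that] by (intro sum_box_restrict; simp)+
    then show ?thesis by (intro arg_cong[where f = "\<lambda>x. A * x"] sum.cong[OF refl]) simp
  qed
  also have "\<dots> = A * (2 * strip_const m) * (1/p * (\<Sum>b\<in>Bl. \<Sum>i<M+2. \<Sum>j<M+2. (cmod (z b i j))^2)
      + p * (\<Sum>b\<in>Bl. \<Sum>i<M+2. \<Sum>j<M+2. (cmod (y b i j))^2))"
    by (simp only: sum_distrib_left[symmetric] sum.distrib mult.assoc)
  also have "\<dots> \<le> A * (2 * strip_const m) * (1/p * (C * (norm Z)^2) + p * (C * (norm (L Z - R Z))^2))"
    using A p strip_const_nonneg[of m] lower[where K = "M + 2" and F = z] lower[where K = "M + 2" and F = y]
    unfolding com Z_def[symmetric] by (intro mult_left_mono add_mono) auto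
  also have "\<dots> = A * (2 * strip_const m) * C * (1/p * (norm Z)^2 + p * (norm (L Z - R Z))^2)"
    by (simp add: algebra_simps)
  finally show ?thesis .
qed

section \<open>The estimate on \<open>H\<^sup>\<circ>\<close>\<close>

context haar_gns
begin

lemma block_actions:
  fixes X :: "'n tmat" and k :: nat
  defines "w \<equiv> \<lambda>i j. wvec u \<pi> \<Omega> (k, X, i, j)" and "R \<equiv> right_action \<pi> \<Omega> (\<pi> (chi1 u))"
  assumes k: "k \<ge> 1" and X: "X \<in> BHoo k" and norm1: "norm (\<pi> (u_elt u k X) \<Omega>) = 1"
    and rot: "rotation k X = (\<lambda>I J. \<mu> * X I J)"
    and indep: "\<And>M F i j. box_sum w M F = 0 \<Longrightarrow> i < M \<Longrightarrow> j < M \<Longrightarrow> F i j = 0"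
  shows "\<exists>\<alpha> \<beta> \<gamma>. half_block \<alpha> \<beta> \<gamma> w (\<pi> (chi1 u)) R \<and> half_block \<alpha> \<beta> \<gamma> (\<lambda>i j. w j i) R (\<pi> (chi1 u))"
proof -
  have \<pi>0: "\<pi> 0 \<Omega> = 0" using \<pi>_diff[of 0 0 \<Omega>] by simp
  have ne: "X \<noteq> (\<lambda>I J. 0)"
  proof
    assume "X = (\<lambda>I J. 0)"
    then have "u_elt u k X = 0" by (simp add: u_elt_def)
    then show False using norm1 \<pi>0 by simp
  qed
  let ?\<nu> = "(-1)^k * (\<mu> + inverse \<mu>)"
  note bf = block_formulas[OF k X ne rot]
  note co = coeffs[OF k bf(1)]
  have w: "w i j = \<pi> (Wel k X i j) \<Omega>" for i j by (simp only: w_def wvec_Wel)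
  have \<pi>if: "\<pi> (if P then 0 else c *\<^sub>C y) \<Omega> = (if P then 0 else c *\<^sub>C \<pi> y \<Omega>)" for P c y by (simp add: \<pi>0 \<pi>_scale)
  have L: "\<pi> (chi1 u) (w i j) = w (Suc i) j + (if i = 0 then 0 else (1 - complex_of_real (coA k i j)) *\<^sub>C w (i-1) j)
       + (if j = 0 then 0 else coB k ?\<nu> i j *\<^sub>C w i (j-1)) - (if j < 2 then 0 else coC k i j *\<^sub>C w (Suc i) (j-2))" for i j
    unfolding w \<pi>_mult[symmetric] bf(2) \<pi>_add \<pi>_diff \<pi>if ..
  have R: "R (w i j) = w i (Suc j) + (if j = 0 then 0 else (1 - complex_of_real (coA k j i)) *\<^sub>C w i (j-1))
       + (if i = 0 then 0 else coB k ?\<nu> j i *\<^sub>C w (i-1) j) - (if i < 2 then 0 else coC k j i *\<^sub>C w (i-2) (Suc j))" for i j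
    unfolding w R_def right_action_props(2) bf(3) \<pi>_add \<pi>_diff \<pi>if ..
  have lin: "\<pi> (chi1 u) (x + y) = \<pi> (chi1 u) x + \<pi> (chi1 u) y" "\<pi> (chi1 u) (c *\<^sub>C x) = c *\<^sub>C \<pi> (chi1 u) x"
     "R (x + y) = R x + R y" "R (c *\<^sub>C x) = c *\<^sub>C R x" for c x y
    using \<pi>_bounded[of "chi1 u"] right_action_props(1)[of "chi1 u"] by (auto simp: R_def bounded_clinear_def clinear_def)
  have comm: "R (\<pi> (chi1 u) x) = \<pi> (chi1 u) (R x)" for x unfolding R_def by (rule right_action_props(3))
  have "half_block (coA k) (coB k ?\<nu>) (coC k) w (\<pi> (chi1 u)) R"
    by (intro half_block.intro[OF co] half_block_axioms.intro lin L indep)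
       (simp_all add: comm R)
  moreover have "half_block (coA k) (coB k ?\<nu>) (coC k) (\<lambda>i j. w j i) R (\<pi> (chi1 u))"
  proof (intro half_block.intro[OF co] half_block_axioms.intro lin R comm)
    fix M F i j assume "box_sum (\<lambda>i j. w j i) M F = 0" "i < M" "j < M"
    then show "F i j = 0" using indep[of M "\<lambda>i j. F j i" j i] box_sum_transpose[of w M F] by simp
  qed (simp_all add: L)
  ultimately show ?thesis by blast
qed

end

lemma sum_over_blocks:
  fixes g :: "'k \<times> 'q \<times> nat \<times> nat \<Rightarrow> 's::comm_monoid_add"
  defines "idx \<equiv> \<lambda>Bl (K::nat). {(k, X, i, j). (k, X) \<in> Bl \<and> i < K \<and> j < K}"
  assumes "finite Bl"
  shows "finite (idx Bl K)"
    and "(\<Sum>q\<in>idx Bl K. g q) = (\<Sum>(k, X)\<in>Bl. \<Sum>i<K. \<Sum>j<K. g (k, X, i, j))"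
proof -
  let ?\<phi> = "\<lambda>((k, X), i, j). (k, X, i, j)"
  have eq: "idx Bl K = ?\<phi> ` (Bl \<times> {..<K} \<times> {..<K})" 
  proof (intro equalityI subsetI)
    fix q assume q: "q \<in> idx Bl K"
    obtain k X i j where "q = (k, X, i, j)" by (cases q)
    then show "q \<in> ?\<phi> ` (Bl \<times> {..<K} \<times> {..<K})"
      using q by (intro image_eqI[of _ _ "((k, X), i, j)"]) (auto simp: idx_def)
  qed (auto simp: idx_def)
  show "finite (idx Bl K)" unfolding eq by (intro finite_imageI finite_cartesian_product assms(2)) simp_all
  have inj: "inj_on ?\<phi> (Bl \<times> {..<K} \<times> {..<K})" by (auto simp: inj_on_def)
  show "(\<Sum>q\<in>idx Bl K. g q) = (\<Sum>(k, X)\<in>Bl. \<Sum>i<K. \<Sum>j<K. g (k, X, i, j))"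
    unfolding eq sum.reindex[OF inj] by (simp add: sum.cartesian_product split_def)
qed

text \<open>For a given finite set of indices, the blocks and the box size can be chosen independently of the
  coefficients, so that \<open>z\<close> and \<open>z - E\<^sub>m z\<close> are decomposed alike.\<close>
lemma finite_combination_as_blocks:
  fixes f :: "nat \<times> 'q \<times> nat \<times> nat \<Rightarrow> 'h::complex_vector"
  assumes F: "finite F"
  obtains Bl M where "finite Bl" "Bl = (\<lambda>(k, X, i, j). (k, X)) ` F"
    and "\<And>k X i j. (k, X, i, j) \<in> F \<Longrightarrow> i < M \<and> j < M"
    and "\<And>c K. M \<le> K \<Longrightarrow> (\<Sum>q\<in>F. c q *\<^sub>C f q)
       = (\<Sum>b\<in>Bl. box_sum (\<lambda>i j. f (fst b, snd b, i, j)) K (\<lambda>i j. if (fst b, snd b, i, j) \<in> F then c (fst b, snd b, i, j) else 0))"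
proof -
  define Bl where "Bl = (\<lambda>(k, X, i, j). (k, X)) ` F"
  define M where "M = Suc (\<Sum>(k, X, i, j)\<in>F. i + j)"
  have M: "i < M \<and> j < M" if "(k, X, i, j) \<in> F" for k X i j
    using member_le_sum[OF that, of "\<lambda>(k, X, i, j). i + j"] F by (simp add: M_def)
  have finBl: "finite Bl" using F by (simp add: Bl_def)
  show thesis
  proof (rule that[OF finBl Bl_def M])
    fix c :: "nat \<times> 'q \<times> nat \<times> nat \<Rightarrow> complex" and K assume K: "M \<le> K"
    let ?I = "{(k, X, i, j). (k, X) \<in> Bl \<and> i < K \<and> j < K}"
    have "F \<subseteq> ?I"
    proof
      fix q assume q: "q \<in> F"
      obtain k X i j where eq: "q = (k, X, i, j)" by (cases q)
      have "(k, X) \<in> Bl" unfolding Bl_def using q eq by (intro image_eqI[of _ _ q]) auto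
      moreover have "i < K" "j < K" using M[of k X i j] K q eq by auto
      ultimately show "q \<in> ?I" by (simp add: eq)
    qed
    then have "(\<Sum>q\<in>F. c q *\<^sub>C f q) = (\<Sum>q\<in>?I. (if q \<in> F then c q else 0) *\<^sub>C f q)"
      using sum_over_blocks(1)[OF finBl] by (intro sum.mono_neutral_cong_left) auto
    also have "\<dots> = (\<Sum>(k, X)\<in>Bl. \<Sum>i<K. \<Sum>j<K. (if (k, X, i, j) \<in> F then c (k, X, i, j) else 0) *\<^sub>C f (k, X, i, j))"
      by (rule sum_over_blocks(2)[OF finBl])
    finally show "(\<Sum>q\<in>F. c q *\<^sub>C f q)
       = (\<Sum>b\<in>Bl. box_sum (\<lambda>i j. f (fst b, snd b, i, j)) K (\<lambda>i j. if (fst b, snd b, i, j) \<in> F then c (fst b, snd b, i, j) else 0))"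
      by (simp add: box_sum_def split_def)
  qed assumption
qed

text \<open>The idempotent is linear only on \<open>V\<close>, which is why membership has to be carried along.\<close>
lemma is_E_combination:
  assumes E: "is_E V B w m E" and "finite F" "F \<subseteq> W_index B"
    and V: "\<And>x y. x \<in> V \<Longrightarrow> y \<in> V \<Longrightarrow> x + y \<in> V" "\<And>c x. x \<in> V \<Longrightarrow> c *\<^sub>C x \<in> V" "\<And>q. q \<in> W_index B \<Longrightarrow> w q \<in> V" "0 \<in> V"
  shows "(\<Sum>q\<in>F. c q *\<^sub>C w q) \<in> V"
    and "(\<Sum>q\<in>F. c q *\<^sub>C w q) - E (\<Sum>q\<in>F. c q *\<^sub>C w q)
      = (\<Sum>q\<in>F. (case q of (k, X, i, j) \<Rightarrow> if i < m \<or> j < m then c q else 0) *\<^sub>C w q)"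
proof -
  let ?z = "\<lambda>F. \<Sum>q\<in>F. c q *\<^sub>C w q" and ?s = "\<lambda>q. (case q of (k, X, i, j) \<Rightarrow> if i < m \<or> j < m then c q else 0) *\<^sub>C w q"
  have add: "E (y + z) = E y + E z" if "y \<in> V" "z \<in> V" for y z using E that by (auto simp: is_E_def)
  have scale: "E (a *\<^sub>C z) = a *\<^sub>C E z" if "z \<in> V" for a z using E that by (auto simp: is_E_def)
  have *: "?z F \<in> V \<and> ?z F - E (?z F) = (\<Sum>q\<in>F. ?s q)"
    using assms(2,3)
  proof (induction F rule: finite_induct)
    case empty
    have "E 0 = 0" using scale[OF V(4), of 0] by simp
    then show ?case using V(4) by simp
  next
    case (insert q F)
    have q: "q \<in> W_index B" using insert.prems by auto
    have wq: "w q \<in> V" "c q *\<^sub>C w q \<in> V" using V(2,3) q by auto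
    have Ew: "E (w q) = (case q of (k, X, i, j) \<Rightarrow> if m \<le> i \<and> m \<le> j then w q else 0)"
      using E q by (cases q) (fastforce simp: is_E_def)
    have "c q *\<^sub>C w q - E (c q *\<^sub>C w q) = ?s q"
      unfolding scale[OF wq(1)] Ew by (cases q) auto
    moreover have "?z F \<in> V" "?z F - E (?z F) = (\<Sum>q\<in>F. ?s q)" using insert.IH insert.prems by blast+
    ultimately show ?case using insert.hyps wq(2) V(1) by (simp add: add add_diff_add)
  qed
  show "?z F \<in> V" by (rule conjunct1[OF *])
  show "?z F - E (?z F) = (\<Sum>q\<in>F. ?s q)" by (rule conjunct2[OF *])
qed

lemma (in haar_gns) finite_combination_estimate:
  fixes B :: "nat \<Rightarrow> 'n tmat set" and c :: "nat \<times> 'n tmat \<times> nat \<times> nat \<Rightarrow> complex"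
  defines "w \<equiv> wvec u \<pi> \<Omega>" and "R \<equiv> right_action \<pi> \<Omega> (\<pi> (chi1 u))"
  assumes W: "W_bases u \<pi> \<Omega> B" and A: "A \<ge> 0" and p: "p > 0"
    and upper: "\<And>F c. finite F \<Longrightarrow> F \<subseteq> W_index B \<Longrightarrow> (norm (\<Sum>q\<in>F. c q *\<^sub>C w q))^2 \<le> A * (\<Sum>q\<in>F. (cmod (c q))^2)"
    and lower: "\<And>F c. finite F \<Longrightarrow> F \<subseteq> W_index B \<Longrightarrow> (\<Sum>q\<in>F. (cmod (c q))^2) \<le> C * (norm (\<Sum>q\<in>F. c q *\<^sub>C w q))^2"
    and F: "finite F" "F \<subseteq> W_index B"
  defines "Z \<equiv> \<Sum>q\<in>F. c q *\<^sub>C w q"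
  shows "(norm (\<Sum>q\<in>F. (case q of (k, X, i, j) \<Rightarrow> if i < m \<or> j < m then c q else 0) *\<^sub>C w q))^2
    \<le> A * (2 * strip_const m) * C * (1/p * (norm Z)^2 + p * (norm (\<pi> (chi1 u) Z - R Z))^2)"
proof -
  obtain Bl M where Bl: "finite Bl" "Bl = (\<lambda>(k, X, i, j). (k, X)) ` F"
    and M: "\<And>k X i j. (k, X, i, j) \<in> F \<Longrightarrow> i < M \<and> j < M"
    and blocks: "\<And>c K. M \<le> K \<Longrightarrow> (\<Sum>q\<in>F. c q *\<^sub>C w q)
       = (\<Sum>b\<in>Bl. box_sum (\<lambda>i j. w (fst b, snd b, i, j)) K (\<lambda>i j. if (fst b, snd b, i, j) \<in> F then c (fst b, snd b, i, j) else 0))"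
    by (rule finite_combination_as_blocks[OF F(1), where f = w]) (rule that, assumption+)
  let ?w = "\<lambda>b i j. w (fst b, snd b, i, j)"
  let ?I = "\<lambda>Bl K. {(k, X, i, j). (k, X) \<in> Bl \<and> i < K \<and> j < K}"
  define z where "z b i j = (if (fst b, snd b, i, j) \<in> F then c (fst b, snd b, i, j) else 0)" for b i j
  have Bl_sub: "fst b \<ge> 1 \<and> snd b \<in> B (fst b)" if "b \<in> Bl" for b
    using that F(2) unfolding Bl(2) by (force simp: W_index_def)
  have I_sub: "?I S K \<subseteq> W_index B" if "S \<subseteq> Bl" for S K using that Bl_sub by (fastforce simp: W_index_def)
  have as_I: "(\<Sum>b\<in>S. box_sum (?w b) K (G b)) = (\<Sum>q\<in>?I S K. (case q of (k, X, i, j) \<Rightarrow> G (k, X) i j) *\<^sub>C w q)"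
    and as_I': "(\<Sum>b\<in>S. \<Sum>i<K. \<Sum>j<K. (cmod (G b i j))^2) = (\<Sum>q\<in>?I S K. (cmod (case q of (k, X, i, j) \<Rightarrow> G (k, X) i j))^2)"
    if "S \<subseteq> Bl" for S K G
    unfolding sum_over_blocks(2)[OF finite_subset[OF that Bl(1)]] by (simp_all add: box_sum_def split_def)
  have up: "(norm (\<Sum>b\<in>S. box_sum (?w b) K (G b)))^2 \<le> A * (\<Sum>b\<in>S. \<Sum>i<K. \<Sum>j<K. (cmod (G b i j))^2)"
    and low: "(\<Sum>b\<in>S. \<Sum>i<K. \<Sum>j<K. (cmod (G b i j))^2) \<le> C * (norm (\<Sum>b\<in>S. box_sum (?w b) K (G b)))^2"
    if "S \<subseteq> Bl" for S K G
    unfolding as_I[OF that] as_I'[OF that]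
    by (intro upper lower sum_over_blocks(1) finite_subset[OF that Bl(1)] I_sub that)+
  have hb: "\<exists>\<alpha> \<beta> \<gamma>. half_block \<alpha> \<beta> \<gamma> (?w b) (\<pi> (chi1 u)) R \<and> half_block \<alpha> \<beta> \<gamma> (\<lambda>i j. ?w b j i) R (\<pi> (chi1 u))"
    if b: "b \<in> Bl" for b
  proof -
    have k: "1 \<le> fst b" "snd b \<in> B (fst b)" using Bl_sub[OF b] by auto
    note Wb = W[unfolded W_bases_def, rule_format, OF k(1)]
    have "\<forall>X\<in>B (fst b). \<exists>\<mu>. rotation (fst b) X = (\<lambda>I J. \<mu> * X I J)"
      using Wb by (elim conjE) assumption
    from bspec[OF this k(2)] obtain \<mu> where "snd b \<in> BHoo (fst b)" "norm (\<pi> (u_elt u (fst b) (snd b)) \<Omega>) = 1"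
      "rotation (fst b) (snd b) = (\<lambda>I J. \<mu> * snd b I J)"
      using Wb k(2) by (elim conjE exE) auto
    then show ?thesis unfolding w_def R_def
    proof (rule block_actions[OF k(1)])
      fix N G i j assume 0: "box_sum (\<lambda>i j. wvec u \<pi> \<Omega> (fst b, snd b, i, j)) N G = 0" and ij: "i < N" "j < N"
      have "(\<Sum>i<N. \<Sum>j<N. (cmod (G i j))^2) \<le> 0"
        using low[of "{b}" "\<lambda>_. G" N] b 0 by (simp add: w_def)
      moreover have "(cmod (G i j))^2 \<le> (\<Sum>i<N. \<Sum>j<N. (cmod (G i j))^2)"
        using ij by (intro order_trans[OF member_le_sum[of j "{..<N}"] member_le_sum[of i "{..<N}" "\<lambda>i. \<Sum>j<N. (cmod (G i j))^2"]] sum_nonneg) auto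
      ultimately have "(cmod (G i j))^2 \<le> 0" by linarith
      then show "G i j = 0" by simp
    qed
  qed
  have add: "Modules.additive (\<pi> (chi1 u))" "Modules.additive R"
    using \<pi>_bounded[of "chi1 u"] right_action_props(1)[of "chi1 u"]
    by (auto simp: R_def bounded_clinear_def clinear_def Modules.additive_def)
  have z0: "z b i j = 0" if "i \<ge> M \<or> j \<ge> M" for b i j using M that by (fastforce simp: z_def)
  have Z: "(\<Sum>b\<in>Bl. box_sum (?w b) (M + 2) (z b)) = Z"
    unfolding Z_def blocks[of "M + 2" c, OF le_add1] z_def[abs_def] ..
  have S: "(\<Sum>q\<in>F. (case q of (k, X, i, j) \<Rightarrow> if i < m \<or> j < m then c q else 0) *\<^sub>C w q)
     = (\<Sum>b\<in>Bl. box_sum (?w b) (M + 2) (\<lambda>i j. if i < m \<or> j < m then z b i j else 0))"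
    unfolding blocks[of "M + 2", OF le_add1] z_def by (intro sum.cong refl arg_cong[where f = "box_sum _ _"] ext) auto
  show ?thesis
    unfolding S Z[symmetric]
    by (rule block_sum_strip_bound[OF add hb up[OF order_refl] low[OF order_refl] A p]) (use z0 in auto)
qed

theorem theorem5p9:
  fixes u :: "'n::finite \<Rightarrow> 'n \<Rightarrow> 'a::cstar_algebra"
    and tens :: "'a \<Rightarrow> 'a \<Rightarrow> 'b::cstar_algebra"
    and \<Delta> :: "'a \<Rightarrow> 'b"
    and h :: "'a \<Rightarrow> complex"
    and \<pi> :: "'a \<Rightarrow> 'h \<Rightarrow> 'h::chilbert"
    and \<Omega> :: 'h
    and B :: "nat \<Rightarrow> 'n tmat set"
    and E :: "nat \<Rightarrow> 'h \<Rightarrow> 'h"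
  assumes "CARD('n) \<ge> 3"
    and "universal_FO u"
    and "cstar_tensor_square tens"
    and "FO_coproduct u tens \<Delta>"
    and "haar_state tens \<Delta> h"
    and "gns_triple h \<pi> \<Omega>"
    and "W_bases u \<pi> \<Omega> B"
    and "riesz_basis TYPE('k::chilbert) (W_index B) (wvec u \<pi> \<Omega>) (Hcirc u \<pi> \<Omega>)"
    and "\<And>m. is_E (Hcirc u \<pi> \<Omega>) B (wvec u \<pi> \<Omega>) m (E m)"
  shows "\<exists>L :: nat \<Rightarrow> real. \<forall>p::nat. \<forall>m::nat. \<forall>z\<in>Hcirc u \<pi> \<Omega>. p \<ge> 1 \<longrightarrow>
    (norm (z - E m z))\<^sup>2 \<le> L m * inverse (real p) * (norm z)\<^sup>2
       + L m * real p * (norm (commutator \<pi> \<Omega> (\<pi> (chi1 u)) z))\<^sup>2"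
proof -
  have sa: "star (u i j) = u i j" for i j using assms(2) by (simp add: universal_FO_def)
  interpret haar_gns u tens \<Delta> h \<pi> \<Omega>
  proof
    show "(\<Sum>k\<in>UNIV. u i k * u j k) = of_bool (i = j)" "(\<Sum>k\<in>UNIV. u k i * u k j) = of_bool (i = j)" for i j
      using assms(2) sa by (simp_all add: universal_FO_def)
    show "closure (range (nc_eval u)) = UNIV" using assms(2) by (simp add: universal_FO_def)
  qed (use assms(1,3-6) sa in auto)
  let ?V = "Hcirc u \<pi> \<Omega>" and ?w = "wvec u \<pi> \<Omega>" and ?I = "W_index B"
  let ?R = "right_action \<pi> \<Omega> (\<pi> (chi1 u))"
  obtain A C where A: "A \<ge> 0"
    and up: "\<And>F c. finite F \<Longrightarrow> F \<subseteq> ?I \<Longrightarrow> (norm (\<Sum>i\<in>F. c i *\<^sub>C ?w i))^2 \<le> A * (\<Sum>i\<in>F. (cmod (c i))^2)"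
    and low: "\<And>F c. finite F \<Longrightarrow> F \<subseteq> ?I \<Longrightarrow> (\<Sum>i\<in>F. (cmod (c i))^2) \<le> C * (norm (\<Sum>i\<in>F. c i *\<^sub>C ?w i))^2"
    and V: "\<And>x y. x \<in> ?V \<Longrightarrow> y \<in> ?V \<Longrightarrow> x + y \<in> ?V" "\<And>c x. x \<in> ?V \<Longrightarrow> c *\<^sub>C x \<in> ?V" "\<And>i. i \<in> ?I \<Longrightarrow> ?w i \<in> ?V" "0 \<in> ?V"
    and dense: "?V \<subseteq> closure {\<Sum>i\<in>F. c i *\<^sub>C ?w i | F c. finite F \<and> F \<subseteq> ?I}"
    by (rule riesz_basis_estimates[OF assms(8)]) (rule that, assumption+)
  \<comment> \<open>By continuity of \<open>E m\<close> and of the commutator, the estimate for finite combinations extends to \<open>H\<^sup>\<circ>\<close>.\<close>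
  define L where "L m = A * (2 * strip_const m) * C" for m
  have "(norm (z - E m z))\<^sup>2 \<le> L m * inverse (real p) * (norm z)\<^sup>2 + L m * real p * (norm (commutator \<pi> \<Omega> (\<pi> (chi1 u)) z))\<^sup>2"
    if z: "z \<in> ?V" and p: "p \<ge> 1" for z m and p :: nat
  proof -
    obtain x where x: "\<And>n. x n \<in> {\<Sum>i\<in>F. c i *\<^sub>C ?w i | F c. finite F \<and> F \<subseteq> ?I}" and lim: "x \<longlonglongrightarrow> z"
      using subsetD[OF dense z] unfolding closure_sequential by auto
    have xE: "x n \<in> ?V" 
      "(norm (x n - E m (x n)))^2 \<le> L m * (1/real p * (norm (x n))^2 + real p * (norm (\<pi> (chi1 u) (x n) - ?R (x n)))^2)" for n
    proof -
      obtain F c where F: "finite F" "F \<subseteq> ?I" and xn: "x n = (\<Sum>i\<in>F. c i *\<^sub>C ?w i)" using x[of n] by auto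
      show "x n \<in> ?V" unfolding xn by (rule is_E_combination(1)[OF assms(9) F]) (fact V)+
      have dE: "x n - E m (x n) = (\<Sum>q\<in>F. (case q of (k, X, i, j) \<Rightarrow> if i < m \<or> j < m then c q else 0) *\<^sub>C ?w q)"
        unfolding xn by (rule is_E_combination(2)[OF assms(9) F]) (fact V)+
      show "(norm (x n - E m (x n)))^2 \<le> L m * (1/real p * (norm (x n))^2 + real p * (norm (\<pi> (chi1 u) (x n) - ?R (x n)))^2)"
        unfolding dE L_def unfolding xn
        by (rule finite_combination_estimate[OF assms(7) A _ up low F]) (use p in simp_all)
    qed
    have Elim: "(\<lambda>n. E m (x n)) \<longlonglongrightarrow> E m z"
    proof -
      obtain D' where D': "\<And>y. y \<in> ?V \<Longrightarrow> norm (E m y) \<le> D' * norm y" using assms(9)[of m] unfolding is_E_def by blast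
      have d: "x n - z \<in> ?V" for n using V(1)[OF xE(1)[of n] V(2)[OF z, of "-1"]] by simp
      have "E m (x n) - E m z = E m (x n - z)" for n
      proof -
        have "E m ((x n - z) + z) = E m (x n - z) + E m z" using assms(9)[of m] d z unfolding is_E_def by blast
        then show ?thesis by simp
      qed
      then have bd: "norm (E m (x n) - E m z) \<le> D' * norm (x n - z)" for n using D'[OF d] by simp
      have "(\<lambda>n. x n - z) \<longlonglongrightarrow> 0" using lim by (rule LIM_zero)
      then have "(\<lambda>n. norm (x n - z)) \<longlonglongrightarrow> 0" by (rule tendsto_norm_zero)
      then have "(\<lambda>n. D' * norm (x n - z)) \<longlonglongrightarrow> 0" by (rule tendsto_mult_right_zero)
      moreover have "\<forall>\<^sub>F n in sequentially. norm (E m (x n) - E m z) \<le> D' * norm (x n - z)"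
        by (rule always_eventually[OF allI[OF bd]])
      ultimately have "(\<lambda>n. E m (x n) - E m z) \<longlonglongrightarrow> 0" by (rule Lim_null_comparison[rotated])
      then show ?thesis by (rule LIM_zero_cancel)
    qed
    have blin: "bounded_linear (\<pi> (chi1 u))" "bounded_linear ?R"
      by (intro bounded_clinear_bounded_linear \<pi>_bounded right_action_props(1))+
    have "(norm (z - E m z))^2 \<le> L m * (1/real p * (norm z)^2 + real p * (norm (\<pi> (chi1 u) z - ?R z))^2)"
    proof (rule LIMSEQ_le)
      show "(\<lambda>n. (norm (x n - E m (x n)))^2) \<longlonglongrightarrow> (norm (z - E m z))^2"
        by (intro tendsto_intros lim Elim)
      show "(\<lambda>n. L m * (1/real p * (norm (x n))^2 + real p * (norm (\<pi> (chi1 u) (x n) - ?R (x n)))^2))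
          \<longlonglongrightarrow> L m * (1/real p * (norm z)^2 + real p * (norm (\<pi> (chi1 u) z - ?R z))^2)"
        by (intro tendsto_mult tendsto_add tendsto_power tendsto_norm tendsto_diff tendsto_const lim
            bounded_linear.tendsto[OF blin(1)] bounded_linear.tendsto[OF blin(2)])
    qed (use xE(2) in blast)
    then show ?thesis by (simp add: commutator_def distrib_left inverse_eq_divide mult.assoc)
  qed
  then show ?thesis by blast
qed

end
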